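(* Let $k$ be an algebraically closed field, $\mathcal C$ an essentially small locally finite semisimple tensor category over $k$, and $\chi:U_{\mathcal C}\to\mathbb Z$ a homomorphism. The functor $$R_\chi:\mathcal C\to\mathcal H_\chi,\qquad R_\chi(X)=\bigoplus_n X_n[n],$$ admits a strong monoidal structure and is an exact tensor equivalence.
   Context: Tensor categories are as in Etingof–Gelaki–Nikshych–Ostrik: $k$-linear abelian rigid monoidal categories with $k$-bilinear tensor product, finite-dimensional Hom spaces, every object of finite length, and simple unit $\mathbf 1$ with $\operatorname{End}(\mathbf 1)=k$. $\operatorname{Irr}(\mathcal C)$, the set of simple isomorphism classes, may be infinite. $D^b(\mathcal C)$ has the induced tensor product: $(K\otimes L)^r=\bigoplus_{i+j=r}K^i\otimes L^j$, $d(x\otimes y)=d_Kx\otimes y+(-1)^ix\otimes d_Ly$ for $x\in K^i$, with associator acting degreewise. Shifts: $(K[a])^i=K^{i+a}$, $d_{K[a]}^i=(-1)^ad_K^{i+a}$. $U_{\mathcal C}$ is the universal grading group, with degree map $\deg:\operatorname{Irr}(\mathcal C)\to U_{\mathcal C}$: the universal map to a group satisfying $\deg Z=\deg X\deg Y$ whenever $Z$ is a direct summand of $X\otimes Y$. Given $\chi$, write $\mathcal C=\bigoplus_{n\in\mathbb Z}\mathcal C_n$, where $\mathcal C_n$ is generated (as a full additive subcategory) by the simple objects $X$ with $\chi(\deg X)=n$. Every object has a finite functorial decomposition $X=\bigoplus_nX_n$ with $X_n\in\mathcal C_n$. $\mathcal H_\chi=\operatorname{add}\{X[\chi(\deg X)]:X\in\operatorname{Irr}(\mathcal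 C)\}\subseteq D^b(\mathcal C)$, where $\operatorname{add}(\mathcal S)$ is the full subcategory of direct summands of finite direct sums of objects of $\mathcal S$. It is the heart of the bounded $t$-structure $D^{\le0}=\operatorname{add}\{X[a]:a\ge\chi(\deg X)\}$, $D^{\ge1}=\operatorname{add}\{X[a]:a<\chi(\deg X)\}$ and is closed under the tensor product of $D^b(\mathcal C)$, so it is a tensor category with the inherited tensor product. *)

theory Defs
  imports "HOL-Algebra.Algebra"
begin

(* HOL-Algebra.Polynomials reserves the letter X. *)
no_notation var (\<open>X\<index>\<close>)

section \<open>Linear categories\<close>

text \<open>
  A category carries its objects in \<open>Obj\<close>; the morphisms \<open>X \<rightarrow> Y\<close> are the carrier of the
  \<open>k\<close>-module \<open>Hom X Y\<close>, of which only the additive and scalar part is used (the fields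
  \<open>mult\<close> and \<open>one\<close> that the record type inherits from rings are irrelevant).
  Nothing is required of \<open>Hom X Y\<close> unless \<open>X\<close> and \<open>Y\<close> both lie in \<open>Obj\<close>, so a full
  subcategory is obtained by shrinking \<open>Obj\<close>.
\<close>

record ('k, 'o, 'a) cat =
  Obj :: "'o set"
  Hom :: "'o \<Rightarrow> 'o \<Rightarrow> ('k, 'a) module"
  Dom :: "'a \<Rightarrow> 'o"
  Cod :: "'a \<Rightarrow> 'o"
  Id :: "'o \<Rightarrow> 'a"
  Comp :: "'a \<Rightarrow> 'a \<Rightarrow> 'a" (infixr \<open>\<bullet>\<index>\<close> 70)

abbreviation homs :: "('k, 'o, 'a, 'm) cat_scheme \<Rightarrow> 'o \<Rightarrow> 'o \<Rightarrow> 'a set"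
  where "homs C X Y \<equiv> carrier (Hom C X Y)"

abbreviation zero_arr :: "('k, 'o, 'a, 'm) cat_scheme \<Rightarrow> 'o \<Rightarrow> 'o \<Rightarrow> 'a"
  where "zero_arr C X Y \<equiv> \<zero>\<^bsub>Hom C X Y\<^esub>"

locale linear_category =
  fixes k :: "'k ring" and C :: "('k, 'o, 'a, 'm) cat_scheme" (structure)
  assumes field_k: "field k"
    and dom_cod: "\<lbrakk>X \<in> Obj C; Y \<in> Obj C; f \<in> homs C X Y\<rbrakk> \<Longrightarrow> Dom C f = X \<and> Cod C f = Y"
    and hom_module: "\<lbrakk>X \<in> Obj C; Y \<in> Obj C\<rbrakk> \<Longrightarrow> module k (Hom C X Y)"
    and id_hom: "X \<in> Obj C \<Longrightarrow> Id C X \<in> homs C X X"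
    and comp_hom: "\<lbrakk>X \<in> Obj C; Y \<in> Obj C; Z \<in> Obj C; f \<in> homs C X Y; g \<in> homs C Y Z\<rbrakk>
      \<Longrightarrow> g \<bullet> f \<in> homs C X Z"
    and id_left: "\<lbrakk>X \<in> Obj C; Y \<in> Obj C; f \<in> homs C X Y\<rbrakk> \<Longrightarrow> Id C Y \<bullet> f = f"
    and id_right: "\<lbrakk>X \<in> Obj C; Y \<in> Obj C; f \<in> homs C X Y\<rbrakk> \<Longrightarrow> f \<bullet> Id C X = f"
    and comp_assoc: "\<lbrakk>W \<in> Obj C; X \<in> Obj C; Y \<in> Obj C; Z \<in> Obj C;
        f \<in> homs C W X; g \<in> homs C X Y; h \<in> homs C Y Z\<rbrakk>
      \<Longrightarrow> (h \<bullet> g) \<bullet> f = h \<bullet> (g \<bullet> f)"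
    and comp_add_left: "\<lbrakk>X \<in> Obj C; Y \<in> Obj C; Z \<in> Obj C;
        f \<in> homs C X Y; g \<in> homs C Y Z; g' \<in> homs C Y Z\<rbrakk>
      \<Longrightarrow> (g \<oplus>\<^bsub>Hom C Y Z\<^esub> g') \<bullet> f = (g \<bullet> f) \<oplus>\<^bsub>Hom C X Z\<^esub> (g' \<bullet> f)"
    and comp_add_right: "\<lbrakk>X \<in> Obj C; Y \<in> Obj C; Z \<in> Obj C;
        f \<in> homs C X Y; f' \<in> homs C X Y; g \<in> homs C Y Z\<rbrakk>
      \<Longrightarrow> g \<bullet> (f \<oplus>\<^bsub>Hom C X Y\<^esub> f') = (g \<bullet> f) \<oplus>\<^bsub>Hom C X Z\<^esub> (g \<bullet> f')"
    and comp_smult_left: "\<lbrakk>X \<in> Obj C; Y \<in> Obj C; Z \<in> Obj C;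
        c \<in> carrier k; f \<in> homs C X Y; g \<in> homs C Y Z\<rbrakk>
      \<Longrightarrow> (c \<odot>\<^bsub>Hom C Y Z\<^esub> g) \<bullet> f = c \<odot>\<^bsub>Hom C X Z\<^esub> (g \<bullet> f)"
    and comp_smult_right: "\<lbrakk>X \<in> Obj C; Y \<in> Obj C; Z \<in> Obj C;
        c \<in> carrier k; f \<in> homs C X Y; g \<in> homs C Y Z\<rbrakk>
      \<Longrightarrow> g \<bullet> (c \<odot>\<^bsub>Hom C X Y\<^esub> f) = c \<odot>\<^bsub>Hom C X Z\<^esub> (g \<bullet> f)"

definition arrow :: "('k, 'o, 'a, 'm) cat_scheme \<Rightarrow> 'a \<Rightarrow> bool"
  where "arrow C f \<longleftrightarrow> Dom C f \<in> Obj C \<and> Cod C f \<in> Obj C \<and> f \<in> homs C (Dom C f) (Cod C f)"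

definition inverse_arrows :: "('k, 'o, 'a, 'm) cat_scheme \<Rightarrow> 'a \<Rightarrow> 'a \<Rightarrow> bool"
  where "inverse_arrows C f g \<longleftrightarrow> arrow C f \<and> arrow C g \<and>
    Dom C g = Cod C f \<and> Cod C g = Dom C f \<and>
    g \<bullet>\<^bsub>C\<^esub> f = Id C (Dom C f) \<and> f \<bullet>\<^bsub>C\<^esub> g = Id C (Cod C f)"

definition is_iso :: "('k, 'o, 'a, 'm) cat_scheme \<Rightarrow> 'a \<Rightarrow> bool"
  where "is_iso C f \<longleftrightarrow> (\<exists>g. inverse_arrows C f g)"

definition arr_inv :: "('k, 'o, 'a, 'm) cat_scheme \<Rightarrow> 'a \<Rightarrow> 'a"
  where "arr_inv C f = (THE g. inverse_arrows C f g)"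

definition isomorphic :: "('k, 'o, 'a, 'm) cat_scheme \<Rightarrow> 'o \<Rightarrow> 'o \<Rightarrow> bool"
  where "isomorphic C X Y \<longleftrightarrow> X \<in> Obj C \<and> Y \<in> Obj C \<and> (\<exists>f \<in> homs C X Y. is_iso C f)"

definition is_mono :: "('k, 'o, 'a, 'm) cat_scheme \<Rightarrow> 'a \<Rightarrow> bool"
  where "is_mono C f \<longleftrightarrow> arrow C f \<and>
    (\<forall>T \<in> Obj C. \<forall>u \<in> homs C T (Dom C f). \<forall>v \<in> homs C T (Dom C f).
      f \<bullet>\<^bsub>C\<^esub> u = f \<bullet>\<^bsub>C\<^esub> v \<longrightarrow> u = v)"

definition is_epi :: "('k, 'o, 'a, 'm) cat_scheme \<Rightarrow> 'a \<Rightarrow> bool"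
  where "is_epi C f \<longleftrightarrow> arrow C f \<and>
    (\<forall>T \<in> Obj C. \<forall>u \<in> homs C (Cod C f) T. \<forall>v \<in> homs C (Cod C f) T.
      u \<bullet>\<^bsub>C\<^esub> f = v \<bullet>\<^bsub>C\<^esub> f \<longrightarrow> u = v)"

definition zero_obj :: "('k, 'o, 'a, 'm) cat_scheme \<Rightarrow> 'o \<Rightarrow> bool"
  where "zero_obj C Z \<longleftrightarrow> Z \<in> Obj C \<and>
    (\<forall>X \<in> Obj C. (\<exists>!f. f \<in> homs C Z X) \<and> (\<exists>!f. f \<in> homs C X Z))"

text \<open>\<open>m\<close> is a kernel of \<open>f\<close>; \<open>q\<close> is a cokernel of \<open>f\<close>.\<close>

definition is_kernel :: "('k, 'o, 'a, 'm) cat_scheme \<Rightarrow> 'a \<Rightarrow> 'a \<Rightarrow> bool"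
  where "is_kernel C f m \<longleftrightarrow> arrow C f \<and> arrow C m \<and> Cod C m = Dom C f \<and>
    f \<bullet>\<^bsub>C\<^esub> m = zero_arr C (Dom C m) (Cod C f) \<and>
    (\<forall>T \<in> Obj C. \<forall>t \<in> homs C T (Dom C f). f \<bullet>\<^bsub>C\<^esub> t = zero_arr C T (Cod C f) \<longrightarrow>
      (\<exists>!u. u \<in> homs C T (Dom C m) \<and> m \<bullet>\<^bsub>C\<^esub> u = t))"

definition is_cokernel :: "('k, 'o, 'a, 'm) cat_scheme \<Rightarrow> 'a \<Rightarrow> 'a \<Rightarrow> bool"
  where "is_cokernel C f q \<longleftrightarrow> arrow C f \<and> arrow C q \<and> Dom C q = Cod C f \<and>
    q \<bullet>\<^bsub>C\<^esub> f = zero_arr C (Dom C f) (Cod C q) \<and>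
    (\<forall>T \<in> Obj C. \<forall>t \<in> homs C (Cod C f) T. t \<bullet>\<^bsub>C\<^esub> f = zero_arr C (Dom C f) T \<longrightarrow>
      (\<exists>!u. u \<in> homs C (Cod C q) T \<and> u \<bullet>\<^bsub>C\<^esub> q = t))"

text \<open>The sum of a family of morphisms \<open>X \<rightarrow> Y\<close> of which only finitely many are nonzero.\<close>

definition arr_sum ::
    "('k, 'o, 'a, 'm) cat_scheme \<Rightarrow> 'o \<Rightarrow> 'o \<Rightarrow> 'b set \<Rightarrow> ('b \<Rightarrow> 'a) \<Rightarrow> 'a"
  where "arr_sum C X Y I f = finsum (Hom C X Y) f {a \<in> I. f a \<noteq> zero_arr C X Y}"

text \<open>
  \<open>B\<close>, with injections \<open>i\<close> and projections \<open>p\<close>, is a direct sum of the objects \<open>X a\<close>,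
  \<open>a \<in> I\<close>, of which all but finitely many have to be zero.
\<close>

definition is_dsum :: "('k, 'o, 'a, 'm) cat_scheme \<Rightarrow> 'b set \<Rightarrow> ('b \<Rightarrow> 'o) \<Rightarrow>
    'o \<Rightarrow> ('b \<Rightarrow> 'a) \<Rightarrow> ('b \<Rightarrow> 'a) \<Rightarrow> bool"
  where "is_dsum C I X B i p \<longleftrightarrow> B \<in> Obj C \<and>
    (\<forall>a \<in> I. X a \<in> Obj C \<and> i a \<in> homs C (X a) B \<and> p a \<in> homs C B (X a)) \<and>
    finite {a \<in> I. \<not> zero_obj C (X a)} \<and>
    (\<forall>a \<in> I. \<forall>b \<in> I. p b \<bullet>\<^bsub>C\<^esub> i a = (if a = b then Id C (X a) else zero_arr C (X a) (X b))) \<and>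
    arr_sum C B B I (\<lambda>a. i a \<bullet>\<^bsub>C\<^esub> p a) = Id C B"

definition direct_summand :: "('k, 'o, 'a, 'm) cat_scheme \<Rightarrow> 'o \<Rightarrow> 'o \<Rightarrow> bool"
  where "direct_summand C Z W \<longleftrightarrow>
    (\<exists>Z' i p. is_dsum C (UNIV :: bool set) (\<lambda>b. if b then Z else Z') W i p)"

text \<open>Objects isomorphic to a finite direct sum of members of \<open>S\<close>, and \<open>add S\<close>.\<close>

definition finite_dsums :: "('k, 'o, 'a, 'm) cat_scheme \<Rightarrow> 'o set \<Rightarrow> 'o set"
  where "finite_dsums C S =
    {B. \<exists>(n :: nat) X i p. (\<forall>j < n. X j \<in> S) \<and> is_dsum C {..<n} X B i p}"

definition add_closure :: "('k, 'o, 'a, 'm) cat_scheme \<Rightarrow> 'o set \<Rightarrow> 'o set"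
  where "add_closure C S = {K \<in> Obj C. \<exists>B \<in> finite_dsums C S. direct_summand C K B}"

text \<open>A choice of direct sums: object, injections and projections.\<close>

definition dsum_data :: "('k, 'o, 'a, 'm) cat_scheme \<Rightarrow> 'b set \<Rightarrow> ('b \<Rightarrow> 'o) \<Rightarrow>
    'o \<times> ('b \<Rightarrow> 'a) \<times> ('b \<Rightarrow> 'a)"
  where "dsum_data C I X = (SOME (B, i, p). is_dsum C I X B i p)"

definition dsum :: "('k, 'o, 'a, 'm) cat_scheme \<Rightarrow> 'b set \<Rightarrow> ('b \<Rightarrow> 'o) \<Rightarrow> 'o"
  where "dsum C I X = fst (dsum_data C I X)"

definition dinj :: "('k, 'o, 'a, 'm) cat_scheme \<Rightarrow> 'b set \<Rightarrow> ('b \<Rightarrow> 'o) \<Rightarrow> 'b \<Rightarrow> 'a"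
  where "dinj C I X = fst (snd (dsum_data C I X))"

definition dprj :: "('k, 'o, 'a, 'm) cat_scheme \<Rightarrow> 'b set \<Rightarrow> ('b \<Rightarrow> 'o) \<Rightarrow> 'b \<Rightarrow> 'a"
  where "dprj C I X = snd (snd (dsum_data C I X))"

definition the_zero :: "('k, 'o, 'a, 'm) cat_scheme \<Rightarrow> 'o"
  where "the_zero C = (SOME Z. zero_obj C Z)"

locale abelian_category = linear_category +
  assumes has_zero: "\<exists>Z. zero_obj C Z"
    and has_dsums: "\<lbrakk>X \<in> Obj C; Y \<in> Obj C\<rbrakk>
      \<Longrightarrow> \<exists>B i p. is_dsum C (UNIV :: bool set) (\<lambda>b. if b then X else Y) B i p"
    and has_kernels: "arrow C f \<Longrightarrow> \<exists>m. is_kernel C f m"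
    and has_cokernels: "arrow C f \<Longrightarrow> \<exists>q. is_cokernel C f q"
    and mono_normal: "is_mono C m \<Longrightarrow> \<exists>f. is_kernel C f m"
    and epi_normal: "is_epi C q \<Longrightarrow> \<exists>f. is_cokernel C f q"

definition short_exact :: "('k, 'o, 'a, 'm) cat_scheme \<Rightarrow> 'a \<Rightarrow> 'a \<Rightarrow> bool"
  where "short_exact C f g \<longleftrightarrow> is_kernel C g f \<and> is_cokernel C f g"

definition simple_obj :: "('k, 'o, 'a, 'm) cat_scheme \<Rightarrow> 'o \<Rightarrow> bool"
  where "simple_obj C X \<longleftrightarrow> X \<in> Obj C \<and> \<not> zero_obj C X \<and>
    (\<forall>m. is_mono C m \<and> Cod C m = X \<longrightarrow> zero_obj C (Dom C m) \<or> is_iso C m)"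

inductive finite_length :: "('k, 'o, 'a, 'm) cat_scheme \<Rightarrow> 'o \<Rightarrow> bool"
  for C :: "('k, 'o, 'a, 'm) cat_scheme" where
  zero: "zero_obj C Z \<Longrightarrow> finite_length C Z"
| extend: "\<lbrakk>short_exact C f g; finite_length C (Dom C f); simple_obj C (Cod C g)\<rbrakk>
    \<Longrightarrow> finite_length C (Cod C f)"

definition finite_dimensional :: "'k ring \<Rightarrow> ('k, 'a) module \<Rightarrow> bool"
  where "finite_dimensional k M \<longleftrightarrow> (\<exists>B. finite B \<and> B \<subseteq> carrier M \<and>
    (\<forall>v \<in> carrier M. \<exists>c \<in> B \<rightarrow> carrier k. v = (\<Oplus>\<^bsub>M\<^esub>b\<in>B. c b \<odot>\<^bsub>M\<^esub> b)))"


section \<open>Tensor categories\<close>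

record ('k, 'o, 'a) tcat = "('k, 'o, 'a) cat" +
  TObj :: "'o \<Rightarrow> 'o \<Rightarrow> 'o" (infixl \<open>\<boxtimes>\<index>\<close> 75)
  TArr :: "'a \<Rightarrow> 'a \<Rightarrow> 'a" (infixl \<open>\<star>\<index>\<close> 75)
  TUnit :: "'o"
  Assoc :: "'o \<Rightarrow> 'o \<Rightarrow> 'o \<Rightarrow> 'a"
  LUnit :: "'o \<Rightarrow> 'a"
  RUnit :: "'o \<Rightarrow> 'a"

locale linear_monoidal_category =
  linear_category k C for k :: "'k ring" and C :: "('k, 'o, 'a, 'm) tcat_scheme" (structure) +
  assumes tobj: "\<lbrakk>X \<in> Obj C; Y \<in> Obj C\<rbrakk> \<Longrightarrow> X \<boxtimes> Y \<in> Obj C"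
    and tarr: "\<lbrakk>X \<in> Obj C; X' \<in> Obj C; Y \<in> Obj C; Y' \<in> Obj C; f \<in> homs C X X'; g \<in> homs C Y Y'\<rbrakk>
      \<Longrightarrow> f \<star> g \<in> homs C (X \<boxtimes> Y) (X' \<boxtimes> Y')"
    and tarr_id: "\<lbrakk>X \<in> Obj C; Y \<in> Obj C\<rbrakk> \<Longrightarrow> Id C X \<star> Id C Y = Id C (X \<boxtimes> Y)"
    and tarr_comp: "\<lbrakk>X \<in> Obj C; X' \<in> Obj C; X'' \<in> Obj C; Y \<in> Obj C; Y' \<in> Obj C; Y'' \<in> Obj C;
        f \<in> homs C X X'; f' \<in> homs C X' X''; g \<in> homs C Y Y'; g' \<in> homs C Y' Y''\<rbrakk>
      \<Longrightarrow> (f' \<bullet> f) \<star> (g' \<bullet> g) = (f' \<star> g') \<bullet> (f \<star> g)"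
    and tarr_add_left: "\<lbrakk>X \<in> Obj C; X' \<in> Obj C; Y \<in> Obj C; Y' \<in> Obj C;
        f \<in> homs C X X'; f' \<in> homs C X X'; g \<in> homs C Y Y'\<rbrakk>
      \<Longrightarrow> (f \<oplus>\<^bsub>Hom C X X'\<^esub> f') \<star> g = (f \<star> g) \<oplus>\<^bsub>Hom C (X \<boxtimes> Y) (X' \<boxtimes> Y')\<^esub> (f' \<star> g)"
    and tarr_add_right: "\<lbrakk>X \<in> Obj C; X' \<in> Obj C; Y \<in> Obj C; Y' \<in> Obj C;
        f \<in> homs C X X'; g \<in> homs C Y Y'; g' \<in> homs C Y Y'\<rbrakk>
      \<Longrightarrow> f \<star> (g \<oplus>\<^bsub>Hom C Y Y'\<^esub> g') = (f \<star> g) \<oplus>\<^bsub>Hom C (X \<boxtimes> Y) (X' \<boxtimes> Y')\<^esub> (f \<star> g')"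
    and tarr_smult_left: "\<lbrakk>X \<in> Obj C; X' \<in> Obj C; Y \<in> Obj C; Y' \<in> Obj C;
        c \<in> carrier k; f \<in> homs C X X'; g \<in> homs C Y Y'\<rbrakk>
      \<Longrightarrow> (c \<odot>\<^bsub>Hom C X X'\<^esub> f) \<star> g = c \<odot>\<^bsub>Hom C (X \<boxtimes> Y) (X' \<boxtimes> Y')\<^esub> (f \<star> g)"
    and tarr_smult_right: "\<lbrakk>X \<in> Obj C; X' \<in> Obj C; Y \<in> Obj C; Y' \<in> Obj C;
        c \<in> carrier k; f \<in> homs C X X'; g \<in> homs C Y Y'\<rbrakk>
      \<Longrightarrow> f \<star> (c \<odot>\<^bsub>Hom C Y Y'\<^esub> g) = c \<odot>\<^bsub>Hom C (X \<boxtimes> Y) (X' \<boxtimes> Y')\<^esub> (f \<star> g)"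
    and unit_obj: "TUnit C \<in> Obj C"
    and assoc_hom: "\<lbrakk>X \<in> Obj C; Y \<in> Obj C; Z \<in> Obj C\<rbrakk>
      \<Longrightarrow> Assoc C X Y Z \<in> homs C ((X \<boxtimes> Y) \<boxtimes> Z) (X \<boxtimes> (Y \<boxtimes> Z))"
    and assoc_iso: "\<lbrakk>X \<in> Obj C; Y \<in> Obj C; Z \<in> Obj C\<rbrakk> \<Longrightarrow> is_iso C (Assoc C X Y Z)"
    and assoc_natural: "\<lbrakk>X \<in> Obj C; X' \<in> Obj C; Y \<in> Obj C; Y' \<in> Obj C; Z \<in> Obj C; Z' \<in> Obj C;
        f \<in> homs C X X'; g \<in> homs C Y Y'; h \<in> homs C Z Z'\<rbrakk>
      \<Longrightarrow> Assoc C X' Y' Z' \<bullet> ((f \<star> g) \<star> h) = (f \<star> (g \<star> h)) \<bullet> Assoc C X Y Z"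
    and lunit_hom: "X \<in> Obj C \<Longrightarrow> LUnit C X \<in> homs C (TUnit C \<boxtimes> X) X"
    and lunit_iso: "X \<in> Obj C \<Longrightarrow> is_iso C (LUnit C X)"
    and lunit_natural: "\<lbrakk>X \<in> Obj C; Y \<in> Obj C; f \<in> homs C X Y\<rbrakk>
      \<Longrightarrow> LUnit C Y \<bullet> (Id C (TUnit C) \<star> f) = f \<bullet> LUnit C X"
    and runit_hom: "X \<in> Obj C \<Longrightarrow> RUnit C X \<in> homs C (X \<boxtimes> TUnit C) X"
    and runit_iso: "X \<in> Obj C \<Longrightarrow> is_iso C (RUnit C X)"
    and runit_natural: "\<lbrakk>X \<in> Obj C; Y \<in> Obj C; f \<in> homs C X Y\<rbrakk>
      \<Longrightarrow> RUnit C Y \<bullet> (f \<star> Id C (TUnit C)) = f \<bullet> RUnit C X"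
    and pentagon: "\<lbrakk>W \<in> Obj C; X \<in> Obj C; Y \<in> Obj C; Z \<in> Obj C\<rbrakk>
      \<Longrightarrow> (Id C W \<star> Assoc C X Y Z) \<bullet> Assoc C W (X \<boxtimes> Y) Z \<bullet> (Assoc C W X Y \<star> Id C Z)
        = Assoc C W X (Y \<boxtimes> Z) \<bullet> Assoc C (W \<boxtimes> X) Y Z"
    and triangle: "\<lbrakk>X \<in> Obj C; Y \<in> Obj C\<rbrakk>
      \<Longrightarrow> (Id C X \<star> LUnit C Y) \<bullet> Assoc C X (TUnit C) Y = RUnit C X \<star> Id C Y"

text \<open>
  \<open>D\<close> is a left dual of \<open>X\<close> (equivalently, \<open>X\<close> is a right dual of \<open>D\<close>), with evaluation
  \<open>ev : D \<otimes> X \<rightarrow> 1\<close> and coevaluation \<open>cv : 1 \<rightarrow> X \<otimes> D\<close>.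
\<close>

definition is_left_dual :: "('k, 'o, 'a, 'm) tcat_scheme \<Rightarrow> 'o \<Rightarrow> 'o \<Rightarrow> 'a \<Rightarrow> 'a \<Rightarrow> bool"
  where "is_left_dual C X D ev cv \<longleftrightarrow> X \<in> Obj C \<and> D \<in> Obj C \<and>
    ev \<in> homs C (D \<boxtimes>\<^bsub>C\<^esub> X) (TUnit C) \<and> cv \<in> homs C (TUnit C) (X \<boxtimes>\<^bsub>C\<^esub> D) \<and>
    RUnit C X \<bullet>\<^bsub>C\<^esub> (Id C X \<star>\<^bsub>C\<^esub> ev) \<bullet>\<^bsub>C\<^esub> Assoc C X D X
      \<bullet>\<^bsub>C\<^esub> (cv \<star>\<^bsub>C\<^esub> Id C X) \<bullet>\<^bsub>C\<^esub> arr_inv C (LUnit C X) = Id C X \<and>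
    LUnit C D \<bullet>\<^bsub>C\<^esub> (ev \<star>\<^bsub>C\<^esub> Id C D) \<bullet>\<^bsub>C\<^esub> arr_inv C (Assoc C D X D)
      \<bullet>\<^bsub>C\<^esub> (Id C D \<star>\<^bsub>C\<^esub> cv) \<bullet>\<^bsub>C\<^esub> arr_inv C (RUnit C D) = Id C D"

locale tensor_category =
  linear_monoidal_category k C + abelian_category k C
  for k :: "'k ring" and C :: "('k, 'o, 'a, 'm) tcat_scheme" (structure) +
  assumes left_rigid: "X \<in> Obj C \<Longrightarrow> \<exists>D ev cv. is_left_dual C X D ev cv"
    and right_rigid: "X \<in> Obj C \<Longrightarrow> \<exists>D ev cv. is_left_dual C D X ev cv"
    and hom_finite: "\<lbrakk>X \<in> Obj C; Y \<in> Obj C\<rbrakk> \<Longrightarrow> finite_dimensional k (Hom C X Y)"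
    and obj_finite_length: "X \<in> Obj C \<Longrightarrow> finite_length C X"
    and unit_simple: "simple_obj C (TUnit C)"
    and unit_end: "bij_betw (\<lambda>c. c \<odot>\<^bsub>Hom C (TUnit C) (TUnit C)\<^esub> Id C (TUnit C))
      (carrier k) (homs C (TUnit C) (TUnit C))"

definition semisimple :: "('k, 'o, 'a, 'm) cat_scheme \<Rightarrow> bool"
  where "semisimple C \<longleftrightarrow> Obj C \<subseteq> finite_dsums C {S. simple_obj C S}"


section \<open>Functors\<close>

record ('o, 'a, 'p, 'b) functr =
  FObj :: "'o \<Rightarrow> 'p"
  FArr :: "'a \<Rightarrow> 'b"

definition linear_functor :: "'k ring \<Rightarrow> ('k, 'o, 'a, 'm) cat_scheme \<Rightarrow>
    ('k, 'p, 'b, 'n) cat_scheme \<Rightarrow> ('o, 'a, 'p, 'b) functr \<Rightarrow> bool"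
  where "linear_functor k C D F \<longleftrightarrow>
    (\<forall>X \<in> Obj C. FObj F X \<in> Obj D \<and> FArr F (Id C X) = Id D (FObj F X)) \<and>
    (\<forall>X \<in> Obj C. \<forall>Y \<in> Obj C. \<forall>f \<in> homs C X Y. FArr F f \<in> homs D (FObj F X) (FObj F Y)) \<and>
    (\<forall>X \<in> Obj C. \<forall>Y \<in> Obj C. \<forall>Z \<in> Obj C. \<forall>f \<in> homs C X Y. \<forall>g \<in> homs C Y Z.
      FArr F (g \<bullet>\<^bsub>C\<^esub> f) = FArr F g \<bullet>\<^bsub>D\<^esub> FArr F f) \<and>
    (\<forall>X \<in> Obj C. \<forall>Y \<in> Obj C. \<forall>f \<in> homs C X Y. \<forall>g \<in> homs C X Y.
      FArr F (f \<oplus>\<^bsub>Hom C X Y\<^esub> g) = FArr F f \<oplus>\<^bsub>Hom D (FObj F X) (FObj F Y)\<^esub> FArr F g) \<and>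
    (\<forall>X \<in> Obj C. \<forall>Y \<in> Obj C. \<forall>c \<in> carrier k. \<forall>f \<in> homs C X Y.
      FArr F (c \<odot>\<^bsub>Hom C X Y\<^esub> f) = c \<odot>\<^bsub>Hom D (FObj F X) (FObj F Y)\<^esub> FArr F f)"

definition exact_functor :: "('k, 'o, 'a, 'm) cat_scheme \<Rightarrow>
    ('k, 'p, 'b, 'n) cat_scheme \<Rightarrow> ('o, 'a, 'p, 'b) functr \<Rightarrow> bool"
  where "exact_functor C D F \<longleftrightarrow>
    (\<forall>f g. short_exact C f g \<longrightarrow> short_exact D (FArr F f) (FArr F g))"

definition id_functor :: "('o, 'a, 'o, 'a) functr"
  where "id_functor = \<lparr>FObj = (\<lambda>X. X), FArr = (\<lambda>f. f)\<rparr>"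

definition comp_functor :: "('p, 'b, 'q, 'c) functr \<Rightarrow> ('o, 'a, 'p, 'b) functr \<Rightarrow>
    ('o, 'a, 'q, 'c) functr"
  where "comp_functor G F =
    \<lparr>FObj = (\<lambda>X. FObj G (FObj F X)), FArr = (\<lambda>f. FArr G (FArr F f))\<rparr>"

definition natural_iso :: "('k, 'o, 'a, 'm) cat_scheme \<Rightarrow> ('k, 'p, 'b, 'n) cat_scheme \<Rightarrow>
    ('o, 'a, 'p, 'b) functr \<Rightarrow> ('o, 'a, 'p, 'b) functr \<Rightarrow> ('o \<Rightarrow> 'b) \<Rightarrow> bool"
  where "natural_iso C D F G \<eta> \<longleftrightarrow>
    (\<forall>X \<in> Obj C. \<eta> X \<in> homs D (FObj F X) (FObj G X) \<and> is_iso D (\<eta> X)) \<and>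
    (\<forall>X \<in> Obj C. \<forall>Y \<in> Obj C. \<forall>f \<in> homs C X Y.
      \<eta> Y \<bullet>\<^bsub>D\<^esub> FArr F f = FArr G f \<bullet>\<^bsub>D\<^esub> \<eta> X)"

definition linear_equivalence :: "'k ring \<Rightarrow> ('k, 'o, 'a, 'm) cat_scheme \<Rightarrow>
    ('k, 'p, 'b, 'n) cat_scheme \<Rightarrow> ('o, 'a, 'p, 'b) functr \<Rightarrow> bool"
  where "linear_equivalence k C D F \<longleftrightarrow> linear_functor k C D F \<and>
    (\<exists>G \<eta> \<theta>. linear_functor k D C G \<and>
      natural_iso C C id_functor (comp_functor G F) \<eta> \<and>
      natural_iso D D (comp_functor F G) id_functor \<theta>)"

text \<open>
  Strong monoidal structures: natural isomorphisms
  \<open>\<mu> X Y : F X \<otimes> F Y \<rightarrow> F (X \<otimes> Y)\<close> and an isomorphism \<open>\<epsilon> : 1 \<rightarrow> F 1\<close>, coherent with the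
  associators and unitors.
\<close>

definition strong_monoidal_structure :: "('k, 'o, 'a, 'm) tcat_scheme \<Rightarrow>
    ('k, 'p, 'b, 'n) tcat_scheme \<Rightarrow> ('o, 'a, 'p, 'b) functr \<Rightarrow> ('o \<Rightarrow> 'o \<Rightarrow> 'b) \<Rightarrow> 'b \<Rightarrow> bool"
  where "strong_monoidal_structure C D F \<mu> \<epsilon> \<longleftrightarrow>
    (\<forall>X \<in> Obj C. \<forall>Y \<in> Obj C.
      \<mu> X Y \<in> homs D (FObj F X \<boxtimes>\<^bsub>D\<^esub> FObj F Y) (FObj F (X \<boxtimes>\<^bsub>C\<^esub> Y)) \<and> is_iso D (\<mu> X Y)) \<and>
    \<epsilon> \<in> homs D (TUnit D) (FObj F (TUnit C)) \<and> is_iso D \<epsilon> \<and>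
    (\<forall>X \<in> Obj C. \<forall>X' \<in> Obj C. \<forall>Y \<in> Obj C. \<forall>Y' \<in> Obj C.
      \<forall>f \<in> homs C X X'. \<forall>g \<in> homs C Y Y'.
        \<mu> X' Y' \<bullet>\<^bsub>D\<^esub> (FArr F f \<star>\<^bsub>D\<^esub> FArr F g) = FArr F (f \<star>\<^bsub>C\<^esub> g) \<bullet>\<^bsub>D\<^esub> \<mu> X Y) \<and>
    (\<forall>X \<in> Obj C. \<forall>Y \<in> Obj C. \<forall>Z \<in> Obj C.
      FArr F (Assoc C X Y Z) \<bullet>\<^bsub>D\<^esub> \<mu> (X \<boxtimes>\<^bsub>C\<^esub> Y) Z \<bullet>\<^bsub>D\<^esub> (\<mu> X Y \<star>\<^bsub>D\<^esub> Id D (FObj F Z))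
      = \<mu> X (Y \<boxtimes>\<^bsub>C\<^esub> Z) \<bullet>\<^bsub>D\<^esub> (Id D (FObj F X) \<star>\<^bsub>D\<^esub> \<mu> Y Z)
          \<bullet>\<^bsub>D\<^esub> Assoc D (FObj F X) (FObj F Y) (FObj F Z)) \<and>
    (\<forall>X \<in> Obj C.
      FArr F (LUnit C X) \<bullet>\<^bsub>D\<^esub> \<mu> (TUnit C) X \<bullet>\<^bsub>D\<^esub> (\<epsilon> \<star>\<^bsub>D\<^esub> Id D (FObj F X))
        = LUnit D (FObj F X) \<and>
      FArr F (RUnit C X) \<bullet>\<^bsub>D\<^esub> \<mu> X (TUnit C) \<bullet>\<^bsub>D\<^esub> (Id D (FObj F X) \<star>\<^bsub>D\<^esub> \<epsilon>)
        = RUnit D (FObj F X))"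

definition exact_tensor_equivalence :: "'k ring \<Rightarrow> ('k, 'o, 'a, 'm) tcat_scheme \<Rightarrow>
    ('k, 'p, 'b, 'n) tcat_scheme \<Rightarrow> ('o, 'a, 'p, 'b) functr \<Rightarrow> ('o \<Rightarrow> 'o \<Rightarrow> 'b) \<Rightarrow> 'b \<Rightarrow> bool"
  where "exact_tensor_equivalence k C D F \<mu> \<epsilon> \<longleftrightarrow>
    tensor_category k C \<and> tensor_category k D \<and>
    strong_monoidal_structure C D F \<mu> \<epsilon> \<and> exact_functor C D F \<and> linear_equivalence k C D F"


section \<open>The universal grading group\<close>

definition iso_class :: "('k, 'o, 'a, 'm) cat_scheme \<Rightarrow> 'o \<Rightarrow> 'o set"
  where "iso_class C X = {Y. isomorphic C X Y}"

definition Irr :: "('k, 'o, 'a, 'm) cat_scheme \<Rightarrow> 'o set set"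
  where "Irr C = iso_class C ` {X. simple_obj C X}"

text \<open>
  The universal grading group is presented by a generator for each class in \<open>Irr C\<close> and a
  relation \<open>[Z] = [X][Y]\<close> whenever \<open>Z\<close> is a direct summand of \<open>X \<otimes> Y\<close>. Its elements are
  classes of words in the letters \<open>(x, True)\<close>, standing for \<open>x\<close>, and \<open>(x, False)\<close>, standing
  for \<open>x\<inverse>\<close>. The universal property is proved below.
\<close>

definition grading_words :: "('k, 'o, 'a, 'm) cat_scheme \<Rightarrow> ('o set \<times> bool) list set"
  where "grading_words C = lists (Irr C \<times> UNIV)"

inductive grading_eq :: "('k, 'o, 'a, 'm) tcat_scheme \<Rightarrow>
    ('o set \<times> bool) list \<Rightarrow> ('o set \<times> bool) list \<Rightarrow> bool"
  for C :: "('k, 'o, 'a, 'm) tcat_scheme" where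
  refl: "w \<in> grading_words C \<Longrightarrow> grading_eq C w w"
| sym: "grading_eq C u v \<Longrightarrow> grading_eq C v u"
| trans: "\<lbrakk>grading_eq C u v; grading_eq C v w\<rbrakk> \<Longrightarrow> grading_eq C u w"
| cong: "\<lbrakk>grading_eq C u u'; grading_eq C v v'\<rbrakk> \<Longrightarrow> grading_eq C (u @ v) (u' @ v')"
| cancel: "x \<in> Irr C \<Longrightarrow> grading_eq C [(x, b), (x, \<not> b)] []"
| grade: "\<lbrakk>simple_obj C X; simple_obj C Y; simple_obj C Z; direct_summand C Z (X \<boxtimes>\<^bsub>C\<^esub> Y)\<rbrakk>
    \<Longrightarrow> grading_eq C [(iso_class C Z, True)] [(iso_class C X, True), (iso_class C Y, True)]"

definition universal_grading_group ::
    "('k, 'o, 'a, 'm) tcat_scheme \<Rightarrow> ('o set \<times> bool) list set monoid"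
  where "universal_grading_group C =
    \<lparr>carrier = grading_words C // {(u, v). grading_eq C u v},
     monoid.mult = (\<lambda>A B. {w. \<exists>u \<in> A. \<exists>v \<in> B. grading_eq C (u @ v) w}),
     one = {w. grading_eq C [] w}\<rparr>"

definition deg :: "('k, 'o, 'a, 'm) tcat_scheme \<Rightarrow> 'o set \<Rightarrow> ('o set \<times> bool) list set"
  where "deg C x = {w. grading_eq C [(x, True)] w}"

definition is_grading :: "('k, 'o, 'a, 'm) tcat_scheme \<Rightarrow> ('g, 'n) monoid_scheme \<Rightarrow>
    ('o set \<Rightarrow> 'g) \<Rightarrow> bool"
  where "is_grading C G d \<longleftrightarrow> d \<in> Irr C \<rightarrow> carrier G \<and>
    (\<forall>X Y Z. simple_obj C X \<and> simple_obj C Y \<and> simple_obj C Z \<and>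
      direct_summand C Z (X \<boxtimes>\<^bsub>C\<^esub> Y) \<longrightarrow>
      d (iso_class C Z) = d (iso_class C X) \<otimes>\<^bsub>G\<^esub> d (iso_class C Y))"


lemma grading_eq_words:
  "grading_eq C u v \<Longrightarrow> u \<in> grading_words C \<and> v \<in> grading_words C"
  by (induction rule: grading_eq.induct) (auto simp: grading_words_def Irr_def)

lemma grading_eq_equiv: "equiv (grading_words C) {(u, v). grading_eq C u v}"
proof (rule equivI)
  show "{(u, v). grading_eq C u v} \<subseteq> grading_words C \<times> grading_words C"
    using grading_eq_words by fastforce
  show "refl_on (grading_words C) {(u, v). grading_eq C u v}"
    by (auto simp: refl_on_def intro: grading_eq.refl)
  show "sym {(u, v). grading_eq C u v}"
    by (auto simp: sym_def intro: grading_eq.sym)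
  show "trans {(u, v). grading_eq C u v}"
    by (auto simp: trans_def intro: grading_eq.trans)
qed

abbreviation word_class ::
    "('k, 'o, 'a, 'm) tcat_scheme \<Rightarrow> ('o set \<times> bool) list \<Rightarrow> ('o set \<times> bool) list set"
  where "word_class C u \<equiv> {w. grading_eq C u w}"

lemma word_class_eq_iff:
  "u \<in> grading_words C \<Longrightarrow> word_class C u = word_class C v \<longleftrightarrow> grading_eq C u v"
  by (blast intro: grading_eq.intros)

lemma carrier_grading_group:
  "carrier (universal_grading_group C) = word_class C ` grading_words C"
  by (auto simp: universal_grading_group_def quotient_def)

lemma mult_grading_group:
  assumes "u \<in> grading_words C" "v \<in> grading_words C"
  shows "word_class C u \<otimes>\<^bsub>universal_grading_group C\<^esub> word_class C v = word_class C (u @ v)"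
proof -
  have "grading_eq C (u @ v) w" if "grading_eq C u u'" "grading_eq C v v'" "grading_eq C (u' @ v') w"
    for u' v' w
    using grading_eq.trans[OF grading_eq.cong[OF that(1,2)] that(3)] .
  then show ?thesis
    using assms grading_eq.refl[of u C] grading_eq.refl[of v C]
    unfolding universal_grading_group_def by fastforce
qed

lemma one_grading_group: "\<one>\<^bsub>universal_grading_group C\<^esub> = word_class C []"
  by (simp add: universal_grading_group_def)

lemma append_grading_words:
  "u \<in> grading_words C \<Longrightarrow> v \<in> grading_words C \<Longrightarrow> u @ v \<in> grading_words C"
  by (auto simp: grading_words_def)

lemma inverse_grading_word:
  assumes "u \<in> grading_words C"
  shows "\<exists>v \<in> grading_words C. grading_eq C (v @ u) []"
  using assms
proof (induction u)
  case Nil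
  then show ?case by (auto intro: grading_eq.refl)
next
  case (Cons a u)
  obtain x b where a: "a = (x, b)" and x: "x \<in> Irr C" and u: "u \<in> grading_words C"
    using Cons.prems by (cases a) (auto simp: grading_words_def)
  obtain v where v: "v \<in> grading_words C" "grading_eq C (v @ u) []"
    using Cons.IH u by blast
  have "grading_eq C (v @ [(x, \<not> b), (x, \<not> \<not> b)] @ u) (v @ [] @ u)"
    by (intro grading_eq.cong grading_eq.cancel grading_eq.refl x u v)
  then have "grading_eq C ((v @ [(x, \<not> b)]) @ (a # u)) []"
    using v(2) by (auto simp: a intro: grading_eq.trans)
  moreover have "v @ [(x, \<not> b)] \<in> grading_words C"
    using v(1) x by (auto simp: grading_words_def)
  ultimately show ?case by blast
qed

lemma group_universal_grading_group: "group (universal_grading_group C)"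
proof (rule groupI)
  let ?U = "universal_grading_group C"
  have nil: "[] \<in> grading_words C" by (simp add: grading_words_def)
  show "\<one>\<^bsub>?U\<^esub> \<in> carrier ?U"
    using nil by (auto simp: carrier_grading_group one_grading_group)
  show "A \<otimes>\<^bsub>?U\<^esub> B \<in> carrier ?U" if "A \<in> carrier ?U" "B \<in> carrier ?U" for A B
    using that append_grading_words by (fastforce simp: carrier_grading_group mult_grading_group)
  show "A \<otimes>\<^bsub>?U\<^esub> B \<otimes>\<^bsub>?U\<^esub> D = A \<otimes>\<^bsub>?U\<^esub> (B \<otimes>\<^bsub>?U\<^esub> D)"
    if "A \<in> carrier ?U" "B \<in> carrier ?U" "D \<in> carrier ?U" for A B D
    using that by (auto simp: carrier_grading_group mult_grading_group append_grading_words)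
  show "\<one>\<^bsub>?U\<^esub> \<otimes>\<^bsub>?U\<^esub> A = A" if "A \<in> carrier ?U" for A
    using that nil by (auto simp: carrier_grading_group one_grading_group mult_grading_group)
  show "\<exists>B \<in> carrier ?U. B \<otimes>\<^bsub>?U\<^esub> A = \<one>\<^bsub>?U\<^esub>" if A: "A \<in> carrier ?U" for A
  proof -
    obtain u where u: "u \<in> grading_words C" "A = word_class C u"
      using A by (auto simp: carrier_grading_group)
    obtain v where v: "v \<in> grading_words C" "grading_eq C (v @ u) []"
      using inverse_grading_word[OF u(1)] by blast
    have "word_class C v \<otimes>\<^bsub>?U\<^esub> A = \<one>\<^bsub>?U\<^esub>"
      using u v by (simp add: mult_grading_group one_grading_group word_class_eq_iff append_grading_words)
    then show ?thesis using v(1) by (auto simp: carrier_grading_group)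
  qed
qed

lemma deg_word_class: "deg C x = word_class C [(x, True)]"
  by (simp add: deg_def)

lemma letter_grading_word: "x \<in> Irr C \<Longrightarrow> [(x, b)] \<in> grading_words C"
  by (simp add: grading_words_def)

lemma is_grading_deg: "is_grading C (universal_grading_group C) (deg C)"
  unfolding is_grading_def
proof (intro conjI allI impI)
  show "deg C \<in> Irr C \<rightarrow> carrier (universal_grading_group C)"
    by (auto simp: deg_word_class carrier_grading_group letter_grading_word intro!: imageI)
  fix X Y Z
  assume *: "simple_obj C X \<and> simple_obj C Y \<and> simple_obj C Z \<and> direct_summand C Z (X \<boxtimes>\<^bsub>C\<^esub> Y)"
  then have "iso_class C X \<in> Irr C" "iso_class C Y \<in> Irr C" "iso_class C Z \<in> Irr C"
    by (auto simp: Irr_def)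
  then show "deg C (iso_class C Z) =
      deg C (iso_class C X) \<otimes>\<^bsub>universal_grading_group C\<^esub> deg C (iso_class C Y)"
    using * grading_eq.grade[of C X Y Z]
    by (simp add: deg_word_class mult_grading_group letter_grading_word word_class_eq_iff)
qed

fun word_value :: "('g, 'n) monoid_scheme \<Rightarrow> ('x \<Rightarrow> 'g) \<Rightarrow> ('x \<times> bool) list \<Rightarrow> 'g" where
  "word_value G d [] = \<one>\<^bsub>G\<^esub>"
| "word_value G d ((x, b) # w) = (if b then d x else inv\<^bsub>G\<^esub> d x) \<otimes>\<^bsub>G\<^esub> word_value G d w"

lemma word_value_closed:
  assumes "group G" "d \<in> Irr C \<rightarrow> carrier G" "w \<in> grading_words C"
  shows "word_value G d w \<in> carrier G"
proof -
  interpret group G by fact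
  show ?thesis
    using assms(3) by (induction w) (use assms(2) in \<open>auto simp: grading_words_def Pi_iff\<close>)
qed

lemma word_value_append:
  assumes "group G" "d \<in> Irr C \<rightarrow> carrier G" "u \<in> grading_words C" "v \<in> grading_words C"
  shows "word_value G d (u @ v) = word_value G d u \<otimes>\<^bsub>G\<^esub> word_value G d v"
proof -
  interpret group G by fact
  show ?thesis
    using assms(3)
  proof (induction u)
    case Nil
    then show ?case using word_value_closed[OF assms(1,2,4)] by simp
  next
    case (Cons a u)
    have u: "u \<in> grading_words C" using Cons.prems by (auto simp: grading_words_def)
    have "(if snd a then d (fst a) else inv\<^bsub>G\<^esub> d (fst a)) \<in> carrier G"
      using Cons.prems assms(2) by (auto simp: grading_words_def Pi_iff)
    then show ?case
      using Cons.IH[OF u] word_value_closed[OF assms(1,2) u] word_value_closed[OF assms(1,2,4)]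
      by (cases a) (auto simp: m_assoc)
  qed
qed

lemma word_value_cong:
  assumes "group G" "is_grading C G d" "grading_eq C u v"
  shows "word_value G d u = word_value G d v"
proof -
  interpret group G by fact
  have d: "d \<in> Irr C \<rightarrow> carrier G" using assms(2) by (simp add: is_grading_def)
  show ?thesis
    using assms(3)
  proof (induction rule: grading_eq.induct)
    case (cong u u' v v')
    then show ?case
      using word_value_append[OF assms(1) d] grading_eq_words by metis
  next
    case (cancel x b)
    then show ?case using d by (auto simp: Pi_iff)
  next
    case (grade X Y Z)
    then have "iso_class C X \<in> Irr C" "iso_class C Y \<in> Irr C" "iso_class C Z \<in> Irr C"
      by (auto simp: Irr_def)
    then have "d (iso_class C X) \<in> carrier G" "d (iso_class C Y) \<in> carrier G"
      using d by auto
    then show ?case using grade assms(2) by (auto simp: is_grading_def)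
  qed auto
qed

lemma universal_grading_exists:
  assumes G: "group G" and d: "is_grading C G d"
  shows "\<exists>\<phi> \<in> hom (universal_grading_group C) G. \<forall>x \<in> Irr C. \<phi> (deg C x) = d x"
proof -
  interpret group G by (rule G)
  have dc: "d \<in> Irr C \<rightarrow> carrier G" using d by (simp add: is_grading_def)
  define \<phi> where "\<phi> A = word_value G d (SOME w. w \<in> A)" for A
  have \<phi>: "\<phi> (word_class C u) = word_value G d u" if "u \<in> grading_words C" for u
  proof -
    have "grading_eq C u (SOME w. w \<in> word_class C u)"
      using someI[of "\<lambda>w. w \<in> word_class C u" u] that by (auto intro: grading_eq.refl)
    then show ?thesis unfolding \<phi>_def using word_value_cong[OF G d] by metis
  qed
  have "\<phi> \<in> hom (universal_grading_group C) G"
    by (rule homI)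
      (auto simp: carrier_grading_group \<phi> mult_grading_group append_grading_words
        word_value_closed[OF G dc] word_value_append[OF G dc])
  moreover have "\<phi> (deg C x) = d x" if "x \<in> Irr C" for x
    using that dc by (auto simp: deg_word_class \<phi> letter_grading_word Pi_iff)
  ultimately show ?thesis by blast
qed

lemma universal_grading_unique:
  assumes G: "group G"
    and \<phi>: "\<phi> \<in> hom (universal_grading_group C) G" and \<psi>: "\<psi> \<in> hom (universal_grading_group C) G"
    and eq: "\<And>x. x \<in> Irr C \<Longrightarrow> \<phi> (deg C x) = \<psi> (deg C x)"
    and A: "A \<in> carrier (universal_grading_group C)"
  shows "\<phi> A = \<psi> A"
proof -
  let ?U = "universal_grading_group C"
  interpret U: group ?U by (rule group_universal_grading_group)
  interpret f: group_hom ?U G \<phi>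
    using G \<phi> by (simp add: group_hom_def group_hom_axioms_def U.is_group)
  interpret g: group_hom ?U G \<psi>
    using G \<psi> by (simp add: group_hom_def group_hom_axioms_def U.is_group)
  have "\<phi> (word_class C u) = \<psi> (word_class C u)" if "u \<in> grading_words C" for u
    using that
  proof (induction u)
    case Nil
    then show ?case using f.hom_one g.hom_one by (simp add: one_grading_group)
  next
    case (Cons a u)
    obtain x b where a: "a = (x, b)" and x: "x \<in> Irr C" and u: "u \<in> grading_words C"
      using Cons.prems by (cases a) (auto simp: grading_words_def)
    have l: "word_class C [(x, c)] \<in> carrier ?U" for c
      using letter_grading_word[OF x] by (auto simp: carrier_grading_group)
    have "word_class C [(x, False)] \<otimes>\<^bsub>?U\<^esub> word_class C [(x, True)] = \<one>\<^bsub>?U\<^esub>"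
      using grading_eq.cancel[OF x, of False] letter_grading_word[OF x]
        append_grading_words[OF letter_grading_word[OF x] letter_grading_word[OF x]]
      by (simp add: mult_grading_group one_grading_group word_class_eq_iff)
    then have "word_class C [(x, False)] = inv\<^bsub>?U\<^esub> deg C x"
      using l by (simp add: deg_word_class U.inv_equality)
    then have "\<phi> (word_class C [a]) = \<psi> (word_class C [a])"
      using eq[OF x] l by (cases b) (simp_all add: a deg_word_class)
    moreover have "word_class C (a # u) = word_class C [a] \<otimes>\<^bsub>?U\<^esub> word_class C u"
      using letter_grading_word[OF x] u by (simp add: a mult_grading_group)
    moreover have "word_class C u \<in> carrier ?U" using u by (auto simp: carrier_grading_group)
    ultimately show ?case using Cons.IH[OF u] l by (simp add: a)
  qed
  then show ?thesis using A by (auto simp: carrier_grading_group)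
qed


section \<open>Bounded complexes\<close>

record ('o, 'a) cplx =
  cobj :: "int \<Rightarrow> 'o"
  cdiff :: "int \<Rightarrow> 'a"

definition bounded_complex :: "('k, 'o, 'a, 'm) cat_scheme \<Rightarrow> ('o, 'a) cplx \<Rightarrow> bool"
  where "bounded_complex C K \<longleftrightarrow>
    (\<forall>i. cobj K i \<in> Obj C \<and> cdiff K i \<in> homs C (cobj K i) (cobj K (i + 1)) \<and>
      cdiff K (i + 1) \<bullet>\<^bsub>C\<^esub> cdiff K i = zero_arr C (cobj K i) (cobj K (i + 2))) \<and>
    finite {i. \<not> zero_obj C (cobj K i)}"

definition chain_map :: "('k, 'o, 'a, 'm) cat_scheme \<Rightarrow> ('o, 'a) cplx \<Rightarrow> ('o, 'a) cplx \<Rightarrow>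
    (int \<Rightarrow> 'a) \<Rightarrow> bool"
  where "chain_map C K L f \<longleftrightarrow>
    (\<forall>i. f i \<in> homs C (cobj K i) (cobj L i) \<and>
      cdiff L i \<bullet>\<^bsub>C\<^esub> f i = f (i + 1) \<bullet>\<^bsub>C\<^esub> cdiff K i)"

definition chain_id :: "('k, 'o, 'a, 'm) cat_scheme \<Rightarrow> ('o, 'a) cplx \<Rightarrow> int \<Rightarrow> 'a"
  where "chain_id C K = (\<lambda>i. Id C (cobj K i))"

definition chain_comp :: "('k, 'o, 'a, 'm) cat_scheme \<Rightarrow> (int \<Rightarrow> 'a) \<Rightarrow> (int \<Rightarrow> 'a) \<Rightarrow> int \<Rightarrow> 'a"
  where "chain_comp C g f = (\<lambda>i. g i \<bullet>\<^bsub>C\<^esub> f i)"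

definition homotopic :: "('k, 'o, 'a, 'm) cat_scheme \<Rightarrow> ('o, 'a) cplx \<Rightarrow> ('o, 'a) cplx \<Rightarrow>
    (int \<Rightarrow> 'a) \<Rightarrow> (int \<Rightarrow> 'a) \<Rightarrow> bool"
  where "homotopic C K L f g \<longleftrightarrow>
    (\<exists>h. (\<forall>i. h i \<in> homs C (cobj K i) (cobj L (i - 1))) \<and>
      (\<forall>i. f i \<ominus>\<^bsub>Hom C (cobj K i) (cobj L i)\<^esub> g i =
        (cdiff L (i - 1) \<bullet>\<^bsub>C\<^esub> h i) \<oplus>\<^bsub>Hom C (cobj K i) (cobj L i)\<^esub> (h (i + 1) \<bullet>\<^bsub>C\<^esub> cdiff K i)))"

text \<open>
  \<open>z\<close> is the inclusion of the \<open>i\<close>-cocycles of \<open>K\<close> and \<open>q\<close> the quotient map from them onto the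
  \<open>i\<close>-th cohomology object \<open>Cod q\<close>.
\<close>

definition is_cohomology :: "('k, 'o, 'a, 'm) cat_scheme \<Rightarrow> ('o, 'a) cplx \<Rightarrow> int \<Rightarrow>
    'a \<Rightarrow> 'a \<Rightarrow> bool"
  where "is_cohomology C K i z q \<longleftrightarrow> is_kernel C (cdiff K i) z \<and>
    (\<exists>b \<in> homs C (cobj K (i - 1)) (Dom C z). z \<bullet>\<^bsub>C\<^esub> b = cdiff K (i - 1) \<and> is_cokernel C b q)"

definition quasi_iso :: "('k, 'o, 'a, 'm) cat_scheme \<Rightarrow> ('o, 'a) cplx \<Rightarrow> ('o, 'a) cplx \<Rightarrow>
    (int \<Rightarrow> 'a) \<Rightarrow> bool"
  where "quasi_iso C K L f \<longleftrightarrow> chain_map C K L f \<and>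
    (\<forall>i. \<exists>z q z' q' a h. is_cohomology C K i z q \<and> is_cohomology C L i z' q' \<and>
      a \<in> homs C (Dom C z) (Dom C z') \<and> z' \<bullet>\<^bsub>C\<^esub> a = f i \<bullet>\<^bsub>C\<^esub> z \<and>
      h \<in> homs C (Cod C q) (Cod C q') \<and> h \<bullet>\<^bsub>C\<^esub> q = q' \<bullet>\<^bsub>C\<^esub> a \<and> is_iso C h)"

definition stalk :: "('k, 'o, 'a, 'm) cat_scheme \<Rightarrow> 'o \<Rightarrow> ('o, 'a) cplx"
  where "stalk C X = (let K = (\<lambda>i. if i = 0 then X else the_zero C) in
    \<lparr>cobj = K, cdiff = (\<lambda>i. zero_arr C (K i) (K (i + 1)))\<rparr>)"

definition stalk_map :: "('k, 'o, 'a, 'm) cat_scheme \<Rightarrow> 'a \<Rightarrow> int \<Rightarrow> 'a"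
  where "stalk_map C f = (\<lambda>i. if i = 0 then f else zero_arr C (the_zero C) (the_zero C))"

text \<open>\<open>(-1)\<^sup>n f\<close> for \<open>f : X \<rightarrow> Y\<close>.\<close>

definition sgn_arr :: "('k, 'o, 'a, 'm) cat_scheme \<Rightarrow> 'o \<Rightarrow> 'o \<Rightarrow> int \<Rightarrow> 'a \<Rightarrow> 'a"
  where "sgn_arr C X Y n f = (if even n then f else \<ominus>\<^bsub>Hom C X Y\<^esub> f)"

definition shift :: "('k, 'o, 'a, 'm) cat_scheme \<Rightarrow> int \<Rightarrow> ('o, 'a) cplx \<Rightarrow> ('o, 'a) cplx"
  where "shift C n K = \<lparr>cobj = (\<lambda>i. cobj K (i + n)),
    cdiff = (\<lambda>i. sgn_arr C (cobj K (i + n)) (cobj K (i + n + 1)) n (cdiff K (i + n)))\<rparr>"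

definition shift_map :: "int \<Rightarrow> (int \<Rightarrow> 'a) \<Rightarrow> int \<Rightarrow> 'a"
  where "shift_map n f = (\<lambda>i. f (i + n))"

text \<open>Direct sums of complexes, formed degreewise, and the map induced by maps of the summands.\<close>

definition cplx_dsum :: "('k, 'o, 'a, 'm) cat_scheme \<Rightarrow> 'b set \<Rightarrow> ('b \<Rightarrow> ('o, 'a) cplx) \<Rightarrow>
    ('o, 'a) cplx"
  where "cplx_dsum C I K = (let X = (\<lambda>i a. cobj (K a) i) in
    \<lparr>cobj = (\<lambda>i. dsum C I (X i)),
     cdiff = (\<lambda>i. arr_sum C (dsum C I (X i)) (dsum C I (X (i + 1))) I
       (\<lambda>a. dinj C I (X (i + 1)) a \<bullet>\<^bsub>C\<^esub> cdiff (K a) i \<bullet>\<^bsub>C\<^esub> dprj C I (X i) a))\<rparr>)"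

definition cplx_dsum_map :: "('k, 'o, 'a, 'm) cat_scheme \<Rightarrow> 'b set \<Rightarrow> ('b \<Rightarrow> ('o, 'a) cplx) \<Rightarrow>
    ('b \<Rightarrow> ('o, 'a) cplx) \<Rightarrow> ('b \<Rightarrow> int \<Rightarrow> 'a) \<Rightarrow> int \<Rightarrow> 'a"
  where "cplx_dsum_map C I K L f = (let X = (\<lambda>i a. cobj (K a) i); Y = (\<lambda>i a. cobj (L a) i) in
    (\<lambda>i. arr_sum C (dsum C I (X i)) (dsum C I (Y i)) I
      (\<lambda>a. dinj C I (Y i) a \<bullet>\<^bsub>C\<^esub> f a i \<bullet>\<^bsub>C\<^esub> dprj C I (X i) a)))"


section \<open>Tensor products of complexes\<close>

definition antidiag :: "int \<Rightarrow> (int \<times> int) set"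
  where "antidiag r = {(i, j). i + j = r}"

definition tfam :: "('k, 'o, 'a, 'm) tcat_scheme \<Rightarrow> ('o, 'a) cplx \<Rightarrow> ('o, 'a) cplx \<Rightarrow>
    int \<times> int \<Rightarrow> 'o"
  where "tfam C K L = (\<lambda>(i, j). cobj K i \<boxtimes>\<^bsub>C\<^esub> cobj L j)"

abbreviation tinj :: "('k, 'o, 'a, 'm) tcat_scheme \<Rightarrow> ('o, 'a) cplx \<Rightarrow> ('o, 'a) cplx \<Rightarrow>
    int \<Rightarrow> int \<Rightarrow> 'a"
  where "tinj C K L i j \<equiv> dinj C (antidiag (i + j)) (tfam C K L) (i, j)"

abbreviation tprj :: "('k, 'o, 'a, 'm) tcat_scheme \<Rightarrow> ('o, 'a) cplx \<Rightarrow> ('o, 'a) cplx \<Rightarrow>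
    int \<Rightarrow> int \<Rightarrow> 'a"
  where "tprj C K L i j \<equiv> dprj C (antidiag (i + j)) (tfam C K L) (i, j)"

definition cplx_tensor :: "('k, 'o, 'a, 'm) tcat_scheme \<Rightarrow> ('o, 'a) cplx \<Rightarrow> ('o, 'a) cplx \<Rightarrow>
    ('o, 'a) cplx"
  where "cplx_tensor C K L = (let T = (\<lambda>r. dsum C (antidiag r) (tfam C K L)) in
    \<lparr>cobj = T,
     cdiff = (\<lambda>r. arr_sum C (T r) (T (r + 1)) (antidiag r) (\<lambda>(i, j).
       (tinj C K L (i + 1) j \<bullet>\<^bsub>C\<^esub> (cdiff K i \<star>\<^bsub>C\<^esub> Id C (cobj L j)) \<bullet>\<^bsub>C\<^esub> tprj C K L i j)
       \<oplus>\<^bsub>Hom C (T r) (T (r + 1))\<^esub>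
       sgn_arr C (T r) (T (r + 1)) i
         (tinj C K L i (j + 1) \<bullet>\<^bsub>C\<^esub> (Id C (cobj K i) \<star>\<^bsub>C\<^esub> cdiff L j) \<bullet>\<^bsub>C\<^esub> tprj C K L i j)))\<rparr>)"

definition chain_tensor :: "('k, 'o, 'a, 'm) tcat_scheme \<Rightarrow> ('o, 'a) cplx \<Rightarrow> ('o, 'a) cplx \<Rightarrow>
    ('o, 'a) cplx \<Rightarrow> ('o, 'a) cplx \<Rightarrow> (int \<Rightarrow> 'a) \<Rightarrow> (int \<Rightarrow> 'a) \<Rightarrow> int \<Rightarrow> 'a"
  where "chain_tensor C K L K' L' f g = (\<lambda>r.
    arr_sum C (cobj (cplx_tensor C K L) r) (cobj (cplx_tensor C K' L') r) (antidiag r)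
      (\<lambda>(i, j). tinj C K' L' i j \<bullet>\<^bsub>C\<^esub> (f i \<star>\<^bsub>C\<^esub> g j) \<bullet>\<^bsub>C\<^esub> tprj C K L i j))"

definition cplx_assoc :: "('k, 'o, 'a, 'm) tcat_scheme \<Rightarrow> ('o, 'a) cplx \<Rightarrow> ('o, 'a) cplx \<Rightarrow>
    ('o, 'a) cplx \<Rightarrow> int \<Rightarrow> 'a"
  where "cplx_assoc C K L M = (\<lambda>r.
    arr_sum C (cobj (cplx_tensor C (cplx_tensor C K L) M) r)
      (cobj (cplx_tensor C K (cplx_tensor C L M)) r) {(i, j, l). i + j + l = r}
      (\<lambda>(i, j, l).
        tinj C K (cplx_tensor C L M) i (j + l) \<bullet>\<^bsub>C\<^esub> (Id C (cobj K i) \<star>\<^bsub>C\<^esub> tinj C L M j l)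
        \<bullet>\<^bsub>C\<^esub> Assoc C (cobj K i) (cobj L j) (cobj M l)
        \<bullet>\<^bsub>C\<^esub> (tprj C K L i j \<star>\<^bsub>C\<^esub> Id C (cobj M l)) \<bullet>\<^bsub>C\<^esub> tprj C (cplx_tensor C K L) M (i + j) l))"

text \<open>
  The unit complex is the unit object in degree \<open>0\<close>, so only the summands \<open>1 \<otimes> K\<^sup>r\<close> and
  \<open>K\<^sup>r \<otimes> 1\<close> contribute to the unitors.
\<close>

definition cplx_lunit :: "('k, 'o, 'a, 'm) tcat_scheme \<Rightarrow> ('o, 'a) cplx \<Rightarrow> int \<Rightarrow> 'a"
  where "cplx_lunit C K = (\<lambda>r. LUnit C (cobj K r) \<bullet>\<^bsub>C\<^esub> tprj C (stalk C (TUnit C)) K 0 r)"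

definition cplx_runit :: "('k, 'o, 'a, 'm) tcat_scheme \<Rightarrow> ('o, 'a) cplx \<Rightarrow> int \<Rightarrow> 'a"
  where "cplx_runit C K = (\<lambda>r. RUnit C (cobj K r) \<bullet>\<^bsub>C\<^esub> tprj C K (stalk C (TUnit C)) r 0)"


section \<open>The bounded derived category\<close>

text \<open>
  The localisation of the homotopy category of bounded complexes at the quasi-isomorphisms, by
  the calculus of fractions: a morphism \<open>K \<rightarrow> L\<close> is a class of roofs \<open>(M, s, f)\<close>,
  \<open>s : M \<rightarrow> K\<close> a quasi-isomorphism and \<open>f : M \<rightarrow> L\<close> a chain map. It is stored together with
  its source and target as \<open>(K, L, F)\<close>, where \<open>F\<close> is the whole class.
\<close>

type_synonym ('o, 'a) roof = "('o, 'a) cplx \<times> (int \<Rightarrow> 'a) \<times> (int \<Rightarrow> 'a)"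

type_synonym ('o, 'a) darr = "('o, 'a) cplx \<times> ('o, 'a) cplx \<times> ('o, 'a) roof set"

definition is_roof :: "('k, 'o, 'a, 'm) cat_scheme \<Rightarrow> ('o, 'a) cplx \<Rightarrow> ('o, 'a) cplx \<Rightarrow>
    ('o, 'a) roof \<Rightarrow> bool"
  where "is_roof C K L = (\<lambda>(M, s, f).
    bounded_complex C M \<and> quasi_iso C M K s \<and> chain_map C M L f)"

definition roof_eq :: "('k, 'o, 'a, 'm) cat_scheme \<Rightarrow> ('o, 'a) cplx \<Rightarrow> ('o, 'a) cplx \<Rightarrow>
    ('o, 'a) roof \<Rightarrow> ('o, 'a) roof \<Rightarrow> bool"
  where "roof_eq C K L = (\<lambda>(M, s, f) (M', s', f').
    is_roof C K L (M, s, f) \<and> is_roof C K L (M', s', f') \<and>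
    (\<exists>N u v. bounded_complex C N \<and> chain_map C N M u \<and> chain_map C N M' v \<and>
      quasi_iso C N K (chain_comp C s u) \<and>
      homotopic C N K (chain_comp C s u) (chain_comp C s' v) \<and>
      homotopic C N L (chain_comp C f u) (chain_comp C f' v)))"

definition roof_class :: "('k, 'o, 'a, 'm) cat_scheme \<Rightarrow> ('o, 'a) cplx \<Rightarrow> ('o, 'a) cplx \<Rightarrow>
    ('o, 'a) roof \<Rightarrow> ('o, 'a) darr"
  where "roof_class C K L r = (K, L, {r'. roof_eq C K L r r'})"

definition chain_class :: "('k, 'o, 'a, 'm) cat_scheme \<Rightarrow> ('o, 'a) cplx \<Rightarrow> ('o, 'a) cplx \<Rightarrow>
    (int \<Rightarrow> 'a) \<Rightarrow> ('o, 'a) darr"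
  where "chain_class C K L f = roof_class C K L (K, chain_id C K, f)"

definition roof_hom :: "('k, 'o, 'a, 'm) cat_scheme \<Rightarrow> ('o, 'a) cplx \<Rightarrow> ('o, 'a) cplx \<Rightarrow>
    ('k, ('o, 'a) darr) module"
  where "roof_hom C K L =
    \<lparr>carrier = roof_class C K L ` {r. is_roof C K L r},
     monoid.mult = undefined, monoid.one = undefined,
     ring.zero = chain_class C K L (\<lambda>i. zero_arr C (cobj K i) (cobj L i)),
     ring.add = (\<lambda>(_, _, F) (_, _, G). (K, L, {r. \<exists>M s f g. (M, s, f) \<in> F \<and> (M, s, g) \<in> G \<and>
       roof_eq C K L (M, s, \<lambda>i. f i \<oplus>\<^bsub>Hom C (cobj M i) (cobj L i)\<^esub> g i) r})),
     module.smult = (\<lambda>c (_, _, F). (K, L, {r. \<exists>M s f. (M, s, f) \<in> F \<and>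
       roof_eq C K L (M, s, \<lambda>i. c \<odot>\<^bsub>Hom C (cobj M i) (cobj L i)\<^esub> f i) r}))\<rparr>"

text \<open>
  \<open>(N, t, g) \<circ> (M, s, f)\<close> is the class of \<open>(P, s u, g v)\<close> for any completion
  \<open>u : P \<rightarrow> M\<close>, \<open>v : P \<rightarrow> N\<close> of the corner \<open>(f, t)\<close> to a square commuting up to homotopy,
  with \<open>u\<close> a quasi-isomorphism.
\<close>

definition roof_comp :: "('k, 'o, 'a, 'm) cat_scheme \<Rightarrow> ('o, 'a) darr \<Rightarrow> ('o, 'a) darr \<Rightarrow>
    ('o, 'a) darr"
  where "roof_comp C = (\<lambda>(L, A, G) (K, L', F). (K, A, {r. \<exists>M s f N t g P u v.
    (M, s, f) \<in> F \<and> (N, t, g) \<in> G \<and>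
    bounded_complex C P \<and> quasi_iso C P M u \<and> chain_map C P N v \<and>
    homotopic C P L (chain_comp C f u) (chain_comp C t v) \<and>
    roof_eq C K A (P, chain_comp C s u, chain_comp C g v) r}))"

definition roof_tensor :: "('k, 'o, 'a, 'm) tcat_scheme \<Rightarrow> ('o, 'a) darr \<Rightarrow> ('o, 'a) darr \<Rightarrow>
    ('o, 'a) darr"
  where "roof_tensor C = (\<lambda>(K, L, F) (K', L', F').
    (cplx_tensor C K K', cplx_tensor C L L', {r. \<exists>M s f M' s' f'.
      (M, s, f) \<in> F \<and> (M', s', f') \<in> F' \<and>
      roof_eq C (cplx_tensor C K K') (cplx_tensor C L L')
        (cplx_tensor C M M', chain_tensor C M M' K K' s s', chain_tensor C M M' L L' f f') r}))"

definition Db :: "('k, 'o, 'a, 'm) tcat_scheme \<Rightarrow> ('k, ('o, 'a) cplx, ('o, 'a) darr) tcat"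
  where "Db C =
    \<lparr>Obj = {K. bounded_complex C K},
     Hom = roof_hom C,
     Dom = fst,
     Cod = (\<lambda>\<phi>. fst (snd \<phi>)),
     Id = (\<lambda>K. chain_class C K K (chain_id C K)),
     Comp = roof_comp C,
     TObj = cplx_tensor C,
     TArr = roof_tensor C,
     TUnit = stalk C (TUnit C),
     Assoc = (\<lambda>K L M. chain_class C (cplx_tensor C (cplx_tensor C K L) M)
       (cplx_tensor C K (cplx_tensor C L M)) (cplx_assoc C K L M)),
     LUnit = (\<lambda>K. chain_class C (cplx_tensor C (stalk C (TUnit C)) K) K (cplx_lunit C K)),
     RUnit = (\<lambda>K. chain_class C (cplx_tensor C K (stalk C (TUnit C))) K (cplx_runit C K))\<rparr>"


section \<open>The heart and the functor attached to a character\<close>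

type_synonym 'o character = "('o set \<times> bool) list set \<Rightarrow> int"

definition weight :: "('k, 'o, 'a, 'm) tcat_scheme \<Rightarrow> 'o character \<Rightarrow> 'o \<Rightarrow> int"
  where "weight C \<chi> X = \<chi> (deg C (iso_class C X))"

definition heart :: "('k, 'o, 'a, 'm) tcat_scheme \<Rightarrow> 'o character \<Rightarrow>
    ('k, ('o, 'a) cplx, ('o, 'a) darr) tcat"
  where "heart C \<chi> = Db C
    \<lparr>Obj := add_closure (Db C) {shift C (weight C \<chi> X) (stalk C X) | X. simple_obj C X}\<rparr>"

definition graded_component :: "('k, 'o, 'a, 'm) tcat_scheme \<Rightarrow> 'o character \<Rightarrow> int \<Rightarrow> 'o set"
  where "graded_component C \<chi> n = finite_dsums C {X. simple_obj C X \<and> weight C \<chi> X = n}"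

text \<open>
  A chosen decomposition \<open>X = \<Oplus>\<^sub>n X\<^sub>n\<close> with injections and projections. Morphisms between
  different graded components vanish, so it is functorial with
  \<open>f\<^sub>n = p\<^sub>n \<circ> f \<circ> i\<^sub>n\<close>.
\<close>

definition grading_data :: "('k, 'o, 'a, 'm) tcat_scheme \<Rightarrow> 'o character \<Rightarrow> 'o \<Rightarrow>
    (int \<Rightarrow> 'o) \<times> (int \<Rightarrow> 'a) \<times> (int \<Rightarrow> 'a)"
  where "grading_data C \<chi> X = (SOME (Y, i, p).
    is_dsum C UNIV Y X i p \<and> (\<forall>n. Y n \<in> graded_component C \<chi> n))"

definition component :: "('k, 'o, 'a, 'm) tcat_scheme \<Rightarrow> 'o character \<Rightarrow> 'o \<Rightarrow> int \<Rightarrow> 'o"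
  where "component C \<chi> X n = fst (grading_data C \<chi> X) n"

definition component_arr :: "('k, 'o, 'a, 'm) tcat_scheme \<Rightarrow> 'o character \<Rightarrow> 'a \<Rightarrow> int \<Rightarrow> 'a"
  where "component_arr C \<chi> f n =
    snd (snd (grading_data C \<chi> (Cod C f))) n \<bullet>\<^bsub>C\<^esub> f \<bullet>\<^bsub>C\<^esub> fst (snd (grading_data C \<chi> (Dom C f))) n"

definition R_obj :: "('k, 'o, 'a, 'm) tcat_scheme \<Rightarrow> 'o character \<Rightarrow> 'o \<Rightarrow> ('o, 'a) cplx"
  where "R_obj C \<chi> X =
    cplx_dsum C (UNIV :: int set) (\<lambda>n. shift C n (stalk C (component C \<chi> X n)))"

definition R_functor :: "('k, 'o, 'a, 'm) tcat_scheme \<Rightarrow> 'o character \<Rightarrow>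
    ('o, 'a, ('o, 'a) cplx, ('o, 'a) darr) functr"
  where "R_functor C \<chi> =
    \<lparr>FObj = R_obj C \<chi>,
     FArr = (\<lambda>f. chain_class C (R_obj C \<chi> (Dom C f)) (R_obj C \<chi> (Cod C f))
       (cplx_dsum_map C (UNIV :: int set)
         (\<lambda>n. shift C n (stalk C (component C \<chi> (Dom C f) n)))
         (\<lambda>n. shift C n (stalk C (component C \<chi> (Cod C f) n)))
         (\<lambda>n. shift_map n (stalk_map C (component_arr C \<chi> f n)))))\<rparr>"

end

theory Submission
  imports Defs
begin

text \<open>
  Semisimplicity makes quasi-isomorphisms of bounded complexes homotopy equivalences, so every
  morphism of \<open>D\<^sup>b(\<C>)\<close> is the class of a chain map, unique up to homotopy, and tensor products of
  roofs are computed on chain maps. The complex \<open>R\<^sub>\<chi> X\<close> has zero differential, and \<open>X\<close> is the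
  direct sum of its terms. There are no nonzero morphisms between objects of different weights,
  so the tensor product of the inclusions of the degree \<open>i\<close> term of \<open>R\<^sub>\<chi> X\<close> and the degree \<open>j\<close> term
  of \<open>R\<^sub>\<chi> Y\<close> factors through the degree \<open>i + j\<close> term of \<open>R\<^sub>\<chi> (X \<otimes> Y)\<close>. Hence chain maps \<open>R\<^sub>\<chi> X \<rightarrow> R\<^sub>\<chi> Y\<close> are the same as
  morphisms \<open>X \<rightarrow> Y\<close>, and all coherence identities for \<open>R\<^sub>\<chi> X \<otimes> R\<^sub>\<chi> Y \<cong> R\<^sub>\<chi> (X \<otimes> Y)\<close> follow
  from those in \<open>\<C>\<close> after composition with the inclusions of the terms. Idempotents of \<open>\<C>\<close>
  split, so the heart is the essential image of \<open>R\<^sub>\<chi>\<close>, and it inherits from \<open>\<C>\<close> all axioms of a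
  tensor category.
\<close>

text \<open>\<open>mu\<close> needs no sign: the Koszul sign multiplies only terms that contain a
  differential, the associator and the unitors act degreewise without signs, and no braiding occurs,
  so on complexes with zero differential the tensor product is that of graded objects. Signs matter
  for arbitrary bounded complexes, which enter because the heart is closed under isomorphism in
  \<open>Db\<close> and its tensor product is the one of \<open>Db\<close>: there d d = 0, homotopy
  invariance and the associator have to be checked with signs. Direct sums, graded components and
  the terms of a tensor product are arbitrary choices, known only up to isomorphism. So comparison
  maps are specified by their restrictions to the summands, and equations are tested on these. The
  shift by n puts weight n into degree -n; hence degree i carries the component of weight -i. The
  passage from C to the heart is isolated in an abstract statement: a linear monoidal category D
  that receives a fully faithful, essentially surjective strong monoidal functor from a tensor
  category is a tensor category. Its proof never looks inside complexes.\<close>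

no_notation monoid.mult (infixl \<open>\<otimes>\<index>\<close> 70)
no_notation (ASCII) comp (infixl \<open>o\<close> 55)
notation Comp (infixr \<open>o\<index>\<close> 70)

section \<open>Arrows and sums in a linear category\<close>

text \<open>Typing by equations for \<open>Dom\<close> and \<open>Cod\<close> instead of membership
  in a hom carrier: the simplifier then computes the source and target of composites and settles
  typing conditions by rewriting.\<close>

abbreviation ar :: "('k, 'o, 'a, 'm) cat_scheme \<Rightarrow> 'a \<Rightarrow> 'o \<Rightarrow> 'o \<Rightarrow> bool"
  where "ar C f X Y \<equiv> arrow C f \<and> Dom C f = X \<and> Cod C f = Y \<and> X \<in> Obj C \<and> Y \<in> Obj C"

text \<open>Cuts a typing statement into the three facts that become simp rules; every operation on
  arrows below gets its typing rules in this way.\<close>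

lemmas arD = conjunct1 conjunct2[THEN conjunct1] conjunct2[THEN conjunct2, THEN conjunct1]

context linear_category
begin

abbreviation add_arr (\<open>_ +[_, _] _\<close> [65, 0, 0, 66] 65)
  where "f +[X, Y] g \<equiv> f \<oplus>\<^bsub>Hom C X Y\<^esub> g"

abbreviation zer where "zer X Y \<equiv> zero_arr C X Y"

abbreviation neg_arr (\<open>-[_, _] _\<close> [0, 0, 81] 80)
  where "-[X, Y] f \<equiv> \<ominus>\<^bsub>Hom C X Y\<^esub> f"

lemma homs_iff: "\<lbrakk>X \<in> Obj C; Y \<in> Obj C\<rbrakk> \<Longrightarrow> f \<in> homs C X Y \<longleftrightarrow> ar C f X Y"
  using dom_cod by (auto simp: arrow_def)

lemma arrow_homs: "arrow C f \<Longrightarrow> f \<in> homs C (Dom C f) (Cod C f)"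
  by (simp add: arrow_def)

lemma arrow_Obj [simp]: "arrow C f \<Longrightarrow> Dom C f \<in> Obj C" "arrow C f \<Longrightarrow> Cod C f \<in> Obj C"
  by (simp_all add: arrow_def)

lemma comp_ar:
  assumes "arrow C f" "arrow C g" "Dom C g = Cod C f"
  shows "ar C (g o f) (Dom C f) (Cod C g)"
proof -
  have "g o f \<in> homs C (Dom C f) (Cod C g)"
    using assms comp_hom[of "Dom C f" "Cod C f" "Cod C g" f g] arrow_homs[of f] arrow_homs[of g] by simp
  then show ?thesis using homs_iff assms by simp
qed

lemmas comp_simps [simp] = arD[OF comp_ar]

lemma assoc_arr [simp]:
  "\<lbrakk>arrow C f; arrow C g; arrow C h; Dom C g = Cod C f; Dom C h = Cod C g\<rbrakk>
    \<Longrightarrow> (h o g) o f = h o (g o f)"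
  using comp_assoc[of "Dom C f" "Cod C f" "Cod C g" "Cod C h" f g h]
    arrow_homs[of f] arrow_homs[of g] arrow_homs[of h] by simp

text \<open>Composites are normalised to the right by \<open>assoc_arr\<close>, so an equation
  between two-fold composites no longer matches inside a longer one. This form carries the further
  factor \<open>x\<close>.\<close>

lemma comp_eq_reassoc:
  assumes "g o f = g' o f'" "arrow C f" "arrow C g" "arrow C f'" "arrow C g'"
    "Dom C g = Cod C f" "Dom C g' = Cod C f'" "arrow C x" "Cod C x = Dom C f" "Dom C f' = Dom C f"
  shows "g o (f o x) = g' o (f' o x)"
proof -
  have "g o (f o x) = (g o f) o x" using assms(2-) by simp
  also have "\<dots> = g' o (f' o x)" unfolding assms(1) using assms(2-) by simp
  finally show ?thesis .
qed

lemma comp_eq_reassoc1: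
  assumes "g o f = f'" "arrow C f" "arrow C g"
    "Dom C g = Cod C f" "arrow C x" "Cod C x = Dom C f"
  shows "g o (f o x) = f' o x"
proof -
  have "g o (f o x) = (g o f) o x" using assms(2-) by simp
  then show ?thesis using assms(1) by simp
qed

lemma Id_ar: "X \<in> Obj C \<Longrightarrow> ar C (Id C X) X X"
  using id_hom homs_iff by simp

lemmas Id_simps [simp] = arD[OF Id_ar]

lemma Id_comp [simp]: "\<lbrakk>arrow C f; Cod C f = Y\<rbrakk> \<Longrightarrow> Id C Y o f = f"
  using id_left[of "Dom C f" Y] arrow_homs by auto

lemma comp_Id [simp]: "\<lbrakk>arrow C f; Dom C f = Y\<rbrakk> \<Longrightarrow> f o Id C Y = f"
  using id_right[of Y "Cod C f"] arrow_homs by auto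

lemma hom_abelian_group: "\<lbrakk>X \<in> Obj C; Y \<in> Obj C\<rbrakk> \<Longrightarrow> abelian_group (Hom C X Y)"
  using hom_module module.axioms(2) by blast

lemma zero_ar: "\<lbrakk>X \<in> Obj C; Y \<in> Obj C\<rbrakk> \<Longrightarrow> ar C (zer X Y) X Y"
  using homs_iff abelian_group.axioms(1)[OF hom_abelian_group] abelian_monoid.zero_closed by metis

lemmas zero_simps [simp] = arD[OF zero_ar]

lemma add_ar:
  assumes "arrow C f" "arrow C g" "Dom C f = X" "Dom C g = X" "Cod C f = Y" "Cod C g = Y"
  shows "ar C (f +[X, Y] g) X Y"
proof -
  interpret abelian_group "Hom C X Y" using assms hom_abelian_group by auto
  have o: "X \<in> Obj C" "Y \<in> Obj C" using assms by auto
  have "f +[X, Y] g \<in> homs C X Y"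
    by (rule add.m_closed) (use assms o in \<open>auto simp: homs_iff\<close>)
  then show ?thesis using o by (simp add: homs_iff)
qed

lemmas add_simps [simp] = arD[OF add_ar]

lemma neg_ar:
  assumes "arrow C f" "Dom C f = X" "Cod C f = Y"
  shows "ar C (-[X, Y] f) X Y"
proof -
  interpret abelian_group "Hom C X Y" using assms hom_abelian_group by auto
  have o: "X \<in> Obj C" "Y \<in> Obj C" using assms by auto
  have "-[X, Y] f \<in> homs C X Y"
    by (rule a_inv_closed) (use assms o in \<open>auto simp: homs_iff\<close>)
  then show ?thesis using o by (simp add: homs_iff)
qed

lemmas neg_simps [simp] = arD[OF neg_ar]

lemma smult_ar:
  assumes "c \<in> carrier k" "arrow C f" "Dom C f = X" "Cod C f = Y"
  shows "ar C (c \<odot>\<^bsub>Hom C X Y\<^esub> f) X Y"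
proof -
  interpret module k "Hom C X Y" using assms hom_module by auto
  have o: "X \<in> Obj C" "Y \<in> Obj C" using assms by auto
  have "c \<odot>\<^bsub>Hom C X Y\<^esub> f \<in> homs C X Y"
    by (rule smult_closed) (use assms o in \<open>auto simp: homs_iff\<close>)
  then show ?thesis using o by (simp add: homs_iff)
qed

lemmas smult_simps [simp] = arD[OF smult_ar]

lemma add_comp [simp]:
  "\<lbrakk>arrow C f; arrow C g; arrow C g'; Dom C g = Y; Dom C g' = Y; Cod C g = Z; Cod C g' = Z; Cod C f = Y\<rbrakk>
    \<Longrightarrow> (g +[Y, Z] g') o f = (g o f) +[Dom C f, Z] (g' o f)"
  by (rule comp_add_left) (auto simp: homs_iff)

lemma comp_add [simp]:
  "\<lbrakk>arrow C g; arrow C f; arrow C f'; Dom C f = X; Dom C f' = X; Cod C f = Y; Cod C f' = Y; Dom C g = Y\<rbrakk>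
    \<Longrightarrow> g o (f +[X, Y] f') = (g o f) +[X, Cod C g] (g o f')"
  by (rule comp_add_right) (auto simp: homs_iff)

lemma smult_comp [simp]:
  "\<lbrakk>c \<in> carrier k; arrow C f; arrow C g; Dom C g = Y; Cod C g = Z; Cod C f = Y\<rbrakk>
    \<Longrightarrow> (c \<odot>\<^bsub>Hom C Y Z\<^esub> g) o f = c \<odot>\<^bsub>Hom C (Dom C f) Z\<^esub> (g o f)"
  by (rule comp_smult_left) (auto simp: homs_iff)

lemma comp_smult [simp]:
  "\<lbrakk>c \<in> carrier k; arrow C f; arrow C g; Dom C f = X; Cod C f = Y; Dom C g = Y\<rbrakk>
    \<Longrightarrow> g o (c \<odot>\<^bsub>Hom C X Y\<^esub> f) = c \<odot>\<^bsub>Hom C X (Cod C g)\<^esub> (g o f)"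
  by (rule comp_smult_right) (auto simp: homs_iff)

lemma add_laws:
  assumes "ar C f X Y" "ar C g X Y" "ar C h X Y"
  shows add_assoc_arr: "(f +[X, Y] g) +[X, Y] h = f +[X, Y] (g +[X, Y] h)"
    and add_lcomm_arr: "f +[X, Y] (g +[X, Y] h) = g +[X, Y] (f +[X, Y] h)"
    and add_cancel_arr: "f +[X, Y] g = f +[X, Y] h \<longleftrightarrow> g = h"
proof -
  interpret abelian_group "Hom C X Y" using assms hom_abelian_group by auto
  have "f \<in> homs C X Y" "g \<in> homs C X Y" "h \<in> homs C X Y" using assms by (simp_all add: homs_iff)
  then show "(f +[X, Y] g) +[X, Y] h = f +[X, Y] (g +[X, Y] h)"
    "f +[X, Y] (g +[X, Y] h) = g +[X, Y] (f +[X, Y] h)"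
    "f +[X, Y] g = f +[X, Y] h \<longleftrightarrow> g = h"
    by - (simp add: a_assoc, simp add: a_lcomm, simp)
qed

lemma add_laws2:
  assumes "ar C f X Y" "ar C g X Y"
  shows add_comm_arr: "f +[X, Y] g = g +[X, Y] f"
    and neg_add_arr: "-[X, Y] (f +[X, Y] g) = (-[X, Y] f) +[X, Y] (-[X, Y] g)"
    and add_neg_assoc: "f +[X, Y] ((-[X, Y] f) +[X, Y] g) = g"
    and neg_add_assoc: "(-[X, Y] f) +[X, Y] (f +[X, Y] g) = g"
proof -
  interpret abelian_group "Hom C X Y" using assms hom_abelian_group by auto
  have "f \<in> homs C X Y" "g \<in> homs C X Y" using assms by (simp_all add: homs_iff)
  then show "f +[X, Y] g = g +[X, Y] f"
    "-[X, Y] (f +[X, Y] g) = (-[X, Y] f) +[X, Y] (-[X, Y] g)"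
    "f +[X, Y] ((-[X, Y] f) +[X, Y] g) = g"
    "(-[X, Y] f) +[X, Y] (f +[X, Y] g) = g"
    by - (simp add: a_comm, simp_all add: minus_add r_neg1 r_neg2)
qed

lemma add_zero_laws [simp]:
  assumes "arrow C f" "Dom C f = X" "Cod C f = Y"
  shows add_zero: "f +[X, Y] zer X Y = f"
    and zero_add: "zer X Y +[X, Y] f = f"
    and add_neg: "f +[X, Y] (-[X, Y] f) = zer X Y"
    and neg_add: "(-[X, Y] f) +[X, Y] f = zer X Y"
    and neg_neg: "-[X, Y] (-[X, Y] f) = f"
proof -
  interpret abelian_group "Hom C X Y" using assms hom_abelian_group by auto
  have "f \<in> homs C X Y" using assms arrow_homs by blast
  then show "f +[X, Y] zer X Y = f" "zer X Y +[X, Y] f = f"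
    "f +[X, Y] (-[X, Y] f) = zer X Y"
    "(-[X, Y] f) +[X, Y] f = zer X Y"
    "-[X, Y] (-[X, Y] f) = f"
    by (simp_all add: r_neg l_neg)
qed

lemma neg_zero [simp]: "\<lbrakk>X \<in> Obj C; Y \<in> Obj C\<rbrakk> \<Longrightarrow> \<ominus>\<^bsub>Hom C X Y\<^esub> (zer X Y) = zer X Y"
  using add_neg[of "zer X Y" X Y] zero_add[of "-[X, Y] zer X Y" X Y] by simp

lemma smult_zero [simp]:
  "\<lbrakk>c \<in> carrier k; X \<in> Obj C; Y \<in> Obj C\<rbrakk> \<Longrightarrow> c \<odot>\<^bsub>Hom C X Y\<^esub> (zer X Y) = zer X Y"
  by (rule module.smult_r_null[OF hom_module])

text \<open>The standard argument that an additive operation preserves zero: its value at zero is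
  additively idempotent. It serves composition, tensor product and linear functors alike.\<close>

lemma add_self_zero:
  assumes "ar C f X Y" "f +[X, Y] f = f"
  shows "f = zer X Y"
  using assms add_cancel_arr[of f X Y f "zer X Y"] by simp

lemma zero_comp [simp]:
  assumes "arrow C f" "Cod C f = Y" "Z \<in> Obj C"
  shows "zer Y Z o f = zer (Dom C f) Z"
proof (rule add_self_zero)
  show "ar C (zer Y Z o f) (Dom C f) Z" using assms by auto
  have Y: "Y \<in> Obj C" using assms by auto
  have "zer Y Z o f = (zer Y Z +[Y, Z] zer Y Z) o f"
    using assms Y by simp
  also have "\<dots> = (zer Y Z o f) +[Dom C f, Z] (zer Y Z o f)"
    using assms Y by (intro add_comp) auto
  finally show "(zer Y Z o f) +[Dom C f, Z] (zer Y Z o f) = zer Y Z o f"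
    by simp
qed

lemma comp_zero [simp]:
  assumes "arrow C f" "Dom C f = Y" "X \<in> Obj C"
  shows "f o zer X Y = zer X (Cod C f)"
proof (rule add_self_zero)
  show "ar C (f o zer X Y) X (Cod C f)" using assms by auto
  have Y: "Y \<in> Obj C" using assms by auto
  have "f o zer X Y = f o (zer X Y +[X, Y] zer X Y)"
    using assms Y by simp
  also have "\<dots> = (f o zer X Y) +[X, Cod C f] (f o zer X Y)"
    using assms Y by (intro comp_add) auto
  finally show "(f o zer X Y) +[X, Cod C f] (f o zer X Y) = f o zer X Y"
    by simp
qed

text \<open>The analogue for negatives: an additive operation sends \<open>f\<close> and its
  negative to two arrows with sum zero.\<close>

lemma add_eq_zero_neg:
  assumes "ar C f X Y" "ar C g X Y" "f +[X, Y] g = zer X Y"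
  shows "g = -[X, Y] f"
  using assms add_cancel_arr[of f X Y g "-[X, Y] f"] by simp

lemma neg_comp [simp]:
  assumes "arrow C f" "arrow C g" "Dom C g = Y" "Cod C g = Z" "Cod C f = Y"
  shows "(-[Y, Z] g) o f = -[Dom C f, Z] (g o f)"
proof (rule add_eq_zero_neg)
  show "ar C (g o f) (Dom C f) Z" "ar C ((-[Y, Z] g) o f) (Dom C f) Z"
    using assms by auto
  have "(g o f) +[Dom C f, Z] ((-[Y, Z] g) o f) = (g +[Y, Z] (-[Y, Z] g)) o f"
    by (rule add_comp[symmetric]) (use assms in auto)
  also have "\<dots> = zer (Dom C f) Z" using assms arrow_Obj by (subst add_neg) auto
  finally show "(g o f) +[Dom C f, Z] ((-[Y, Z] g) o f) = zer (Dom C f) Z" .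
qed

lemma comp_neg [simp]:
  assumes "arrow C g" "arrow C f" "Dom C f = X" "Cod C f = Y" "Dom C g = Y"
  shows "g o (-[X, Y] f) = -[X, Cod C g] (g o f)"
proof (rule add_eq_zero_neg)
  show "ar C (g o f) X (Cod C g)" "ar C (g o (-[X, Y] f)) X (Cod C g)"
    using assms by auto
  have "(g o f) +[X, Cod C g] (g o (-[X, Y] f)) = g o (f +[X, Y] (-[X, Y] f))"
    by (rule comp_add[symmetric]) (use assms in auto)
  also have "\<dots> = zer X (Cod C g)" using assms arrow_Obj by (subst add_neg) auto
  finally show "(g o f) +[X, Cod C g] (g o (-[X, Y] f)) = zer X (Cod C g)" .
qed

lemma diff_arr: "f \<ominus>\<^bsub>Hom C X Y\<^esub> g = f +[X, Y] (-[X, Y] g)"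
  by (simp add: a_minus_def)

lemma diff_eq_iff:
  assumes "ar C f X Y" "ar C g X Y" "ar C h X Y"
  shows "f \<ominus>\<^bsub>Hom C X Y\<^esub> g = h \<longleftrightarrow> f = g +[X, Y] h"
proof
  assume "f \<ominus>\<^bsub>Hom C X Y\<^esub> g = h"
  then have "g +[X, Y] h = g +[X, Y] (f +[X, Y] (-[X, Y] g))" by (simp add: diff_arr)
  also have "\<dots> = g +[X, Y] ((-[X, Y] g) +[X, Y] f)"
    using assms by (subst add_comm_arr[of f X Y "-[X, Y] g"]) auto
  also have "\<dots> = f" using assms by (subst add_neg_assoc) auto
  finally show "f = g +[X, Y] h" by simp
next
  assume f: "f = g +[X, Y] h"
  have "f \<ominus>\<^bsub>Hom C X Y\<^esub> g = (-[X, Y] g) +[X, Y] f"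
    using assms by (subst add_comm_arr) (auto simp: diff_arr)
  also have "\<dots> = h" unfolding f using assms by (subst neg_add_assoc) auto
  finally show "f \<ominus>\<^bsub>Hom C X Y\<^esub> g = h" .
qed

lemma sgn_arr_ar:
  assumes "arrow C f" "Dom C f = X" "Cod C f = Y"
  shows "ar C (sgn_arr C X Y n f) X Y"
  using assms by (auto simp: sgn_arr_def)

lemmas sgn_arr_simps [simp] = arD[OF sgn_arr_ar]

lemma sgn_arr_zero [simp]:
  "\<lbrakk>X \<in> Obj C; Y \<in> Obj C\<rbrakk> \<Longrightarrow> sgn_arr C X Y n (zer X Y) = zer X Y"
  by (auto simp: sgn_arr_def)

lemma sgn_arr_comp [simp]:
  "\<lbrakk>arrow C f; arrow C g; Dom C g = Y; Cod C g = Z; Cod C f = Y\<rbrakk>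
    \<Longrightarrow> sgn_arr C Y Z n g o f = sgn_arr C (Dom C f) Z n (g o f)"
  by (auto simp: sgn_arr_def)

lemma comp_sgn_arr [simp]:
  "\<lbrakk>arrow C g; arrow C f; Dom C f = X; Cod C f = Y; Dom C g = Y\<rbrakk>
    \<Longrightarrow> g o sgn_arr C X Y n f = sgn_arr C X (Cod C g) n (g o f)"
  by (auto simp: sgn_arr_def)

end

text \<open>\<open>arr_sum\<close> runs over the support of its family. Finitely many zero terms may
  be added, which makes sums with different supports comparable.\<close>

lemma arr_sum_eq_finsum:
  assumes "abelian_group (Hom C X Y)" "finite A" "{a \<in> I. f a \<noteq> zero_arr C X Y} \<subseteq> A" "A \<subseteq> I"
    "f \<in> I \<rightarrow> homs C X Y"
  shows "arr_sum C X Y I f = finsum (Hom C X Y) f A"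
proof -
  interpret abelian_group "Hom C X Y" by fact
  show ?thesis unfolding arr_sum_def
    by (rule add.finprod_mono_neutral_cong) (use assms in \<open>auto intro: finite_subset\<close>)
qed

lemma finsum_hom:
  assumes "abelian_group G" "abelian_group H" "\<phi> \<in> carrier G \<rightarrow> carrier H"
    "\<And>x y. \<lbrakk>x \<in> carrier G; y \<in> carrier G\<rbrakk> \<Longrightarrow> \<phi> (x \<oplus>\<^bsub>G\<^esub> y) = \<phi> x \<oplus>\<^bsub>H\<^esub> \<phi> y"
    "finite A" "f \<in> A \<rightarrow> carrier G"
  shows "\<phi> (finsum G f A) = finsum H (\<lambda>a. \<phi> (f a)) A"
proof -
  interpret G: abelian_group G by fact
  interpret H: abelian_group H by fact
  have 0: "\<phi> \<zero>\<^bsub>G\<^esub> = \<zero>\<^bsub>H\<^esub>"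
  proof -
    have c: "\<phi> \<zero>\<^bsub>G\<^esub> \<in> carrier H" using assms(3) by auto
    have "\<phi> \<zero>\<^bsub>G\<^esub> = \<phi> \<zero>\<^bsub>G\<^esub> \<oplus>\<^bsub>H\<^esub> \<phi> \<zero>\<^bsub>G\<^esub>" using assms(4)[of "\<zero>\<^bsub>G\<^esub>" "\<zero>\<^bsub>G\<^esub>"] by simp
    then show ?thesis using c by (metis H.add.l_cancel_one H.add.m_comm)
  qed
  show ?thesis
    using assms(5,6)
  proof (induction A rule: finite_induct)
    case empty
    then show ?case by (simp add: 0)
  next
    case (insert a A)
    then have "\<phi> (f a \<oplus>\<^bsub>G\<^esub> finsum G f A) = \<phi> (f a) \<oplus>\<^bsub>H\<^esub> \<phi> (finsum G f A)"
      by (intro assms(4) G.finsum_closed) auto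
    moreover have "finsum G f (insert a A) = f a \<oplus>\<^bsub>G\<^esub> finsum G f A"
      using insert by (intro G.finsum_insert) auto
    moreover have "finsum H (\<lambda>a. \<phi> (f a)) (insert a A) = \<phi> (f a) \<oplus>\<^bsub>H\<^esub> finsum H (\<lambda>a. \<phi> (f a)) A"
      using insert assms(3) by (intro H.finsum_insert) auto
    ultimately show ?case using insert by simp
  qed
qed

text \<open>The support may shrink under \<open>\<phi>\<close>, so the two sums run over different
  sets; both are rewritten over the support of the original family.\<close>

lemma arr_sum_hom:
  assumes "abelian_group (Hom C X Y)" "abelian_group (Hom D X' Y')" "\<phi> \<in> homs C X Y \<rightarrow> homs D X' Y'"
    "\<And>x y. \<lbrakk>x \<in> homs C X Y; y \<in> homs C X Y\<rbrakk> \<Longrightarrow> \<phi> (x \<oplus>\<^bsub>Hom C X Y\<^esub> y) = \<phi> x \<oplus>\<^bsub>Hom D X' Y'\<^esub> \<phi> y"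
    "finite {a \<in> I. f a \<noteq> zero_arr C X Y}" "f \<in> I \<rightarrow> homs C X Y"
  shows "\<phi> (arr_sum C X Y I f) = arr_sum D X' Y' I (\<lambda>a. \<phi> (f a))" (is "?L = ?R")
proof -
  let ?A = "{a \<in> I. f a \<noteq> zero_arr C X Y}"
  interpret G: abelian_group "Hom C X Y" by fact
  interpret H: abelian_group "Hom D X' Y'" by fact
  have "\<phi> (finsum (Hom C X Y) f {}) = finsum (Hom D X' Y') (\<lambda>a. \<phi> (f a)) {}"
    by (rule finsum_hom) (use assms in auto)
  then have 0: "\<phi> (zero_arr C X Y) = zero_arr D X' Y'" by simp
  have "?L = finsum (Hom D X' Y') (\<lambda>a. \<phi> (f a)) ?A"
    unfolding arr_sum_def by (rule finsum_hom) (use assms in auto)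
  also have "\<dots> = ?R"
    by (rule arr_sum_eq_finsum[symmetric]) (use assms 0 in auto)
  finally show ?thesis .
qed

section \<open>Sums of arrows, zero objects and direct sums\<close>

context linear_category
begin

lemma arr_sum_ar:
  assumes "\<And>a. a \<in> I \<Longrightarrow> ar C (f a) X Y" "X \<in> Obj C" "Y \<in> Obj C"
  shows "ar C (arr_sum C X Y I f) X Y"
proof -
  interpret abelian_group "Hom C X Y" using assms hom_abelian_group by auto
  have "arr_sum C X Y I f \<in> homs C X Y"
    unfolding arr_sum_def by (rule finsum_closed) (use assms in \<open>auto simp: homs_iff\<close>)
  then show ?thesis using assms homs_iff by simp
qed

lemma comp_arr_sum:
  assumes "\<And>a. a \<in> I \<Longrightarrow> ar C (f a) X Y" "X \<in> Obj C" "ar C h Y Z"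
    "finite {a \<in> I. f a \<noteq> zer X Y}"
  shows "h o arr_sum C X Y I f = arr_sum C X Z I (\<lambda>a. h o f a)"
proof (rule arr_sum_hom[where \<phi> = "\<lambda>x. h o x"])
  show "(\<lambda>x. h o x) \<in> homs C X Y \<rightarrow> homs C X Z" using assms by (auto simp: homs_iff)
  show "h o (x +[X, Y] y) = (h o x) +[X, Z] (h o y)"
    if "x \<in> homs C X Y" "y \<in> homs C X Y" for x y using that assms by (auto simp: homs_iff)
qed (use assms hom_abelian_group in \<open>auto simp: homs_iff\<close>)

lemma arr_sum_comp:
  assumes "\<And>a. a \<in> I \<Longrightarrow> ar C (f a) X Y" "Y \<in> Obj C" "ar C h W X"
    "finite {a \<in> I. f a \<noteq> zer X Y}"
  shows "arr_sum C X Y I f o h = arr_sum C W Y I (\<lambda>a. f a o h)"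
proof (rule arr_sum_hom[where \<phi> = "\<lambda>x. x o h"])
  show "(\<lambda>x. x o h) \<in> homs C X Y \<rightarrow> homs C W Y" using assms by (auto simp: homs_iff)
  show "(x +[X, Y] y) o h = (x o h) +[W, Y] (y o h)"
    if "x \<in> homs C X Y" "y \<in> homs C X Y" for x y using that assms by (auto simp: homs_iff)
qed (use assms hom_abelian_group in \<open>auto simp: homs_iff\<close>)

lemma arr_sum_single:
  assumes "b \<in> I" "\<And>a. \<lbrakk>a \<in> I; a \<noteq> b\<rbrakk> \<Longrightarrow> f a = zer X Y" "ar C (f b) X Y"
  shows "arr_sum C X Y I f = f b"
proof -
  interpret abelian_group "Hom C X Y" using assms hom_abelian_group by auto
  have h: "f a \<in> homs C X Y" if "a \<in> I" for a
    using assms(2)[OF that] assms(3) by (cases "a = b") (auto simp: homs_iff)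
  have "arr_sum C X Y I f = finsum (Hom C X Y) f {b}"
    by (rule arr_sum_eq_finsum) (use assms h in \<open>auto simp: hom_abelian_group\<close>)
  also have "\<dots> = f b" using assms by (subst finsum_insert) (auto simp: homs_iff)
  finally show ?thesis .
qed

lemma arr_sum_zero:
  assumes "\<And>a. a \<in> I \<Longrightarrow> f a = zer X Y" "X \<in> Obj C" "Y \<in> Obj C"
  shows "arr_sum C X Y I f = zer X Y"
proof -
  interpret abelian_group "Hom C X Y" using assms hom_abelian_group by auto
  have e: "{a \<in> I. f a \<noteq> zer X Y} = {}" using assms by auto
  show ?thesis unfolding arr_sum_def e by simp
qed

lemma arr_sum_cong:
  assumes "\<And>a. a \<in> I \<Longrightarrow> f a = g a" "\<And>a. a \<in> I \<Longrightarrow> ar C (g a) X Y" "X \<in> Obj C" "Y \<in> Obj C"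
  shows "arr_sum C X Y I f = arr_sum C X Y I g"
proof -
  interpret abelian_group "Hom C X Y" using assms hom_abelian_group by auto
  have "{a \<in> I. f a \<noteq> zer X Y} = {a \<in> I. g a \<noteq> zer X Y}" using assms by auto
  then show ?thesis unfolding arr_sum_def
    by (intro finsum_cong') (use assms in \<open>auto simp: homs_iff\<close>)
qed

text \<open>The equation on the right is what additive functors and tensor products visibly
  preserve, unlike the two universal properties.\<close>

lemma zero_obj_iff: "zero_obj C Z \<longleftrightarrow> Z \<in> Obj C \<and> Id C Z = zer Z Z"
proof
  assume Z: "zero_obj C Z"
  then have o: "Z \<in> Obj C" by (simp add: zero_obj_def)
  have "Id C Z \<in> homs C Z Z" "zer Z Z \<in> homs C Z Z" using o by (auto simp: homs_iff)
  then show "Z \<in> Obj C \<and> Id C Z = zer Z Z" using Z o unfolding zero_obj_def by blast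
next
  assume Z: "Z \<in> Obj C \<and> Id C Z = zer Z Z"
  have 1: "f = zer Z X" if "ar C f Z X" for f X
    using comp_Id[of f Z] that Z by (metis comp_zero)
  have 2: "f = zer X Z" if "ar C f X Z" for f X
    using Id_comp[of f Z] that Z by (metis zero_comp)
  show "zero_obj C Z" unfolding zero_obj_def
  proof (intro conjI ballI)
    fix X assume X: "X \<in> Obj C"
    show "\<exists>!f. f \<in> homs C Z X"
      by (rule ex1I[of _ "zer Z X"]) (use Z X 1 in \<open>auto simp: homs_iff\<close>)
    show "\<exists>!f. f \<in> homs C X Z"
      by (rule ex1I[of _ "zer X Z"]) (use Z X 2 in \<open>auto simp: homs_iff\<close>)
  qed (use Z in simp)
qed

lemma from_zero_obj: "\<lbrakk>zero_obj C Z; ar C f Z X\<rbrakk> \<Longrightarrow> f = zer Z X"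
  using comp_Id[of f Z] comp_zero[of f Z Z] by (simp add: zero_obj_iff)

lemma to_zero_obj: "\<lbrakk>zero_obj C Z; ar C f X Z\<rbrakk> \<Longrightarrow> f = zer X Z"
  using Id_comp[of f Z] zero_comp[of f Z Z] by (simp add: zero_obj_iff)

lemma is_dsumD:
  assumes "is_dsum C I X B i p"
  shows "B \<in> Obj C" "\<And>a. a \<in> I \<Longrightarrow> ar C (i a) (X a) B" "\<And>a. a \<in> I \<Longrightarrow> ar C (p a) B (X a)"
    "finite {a \<in> I. \<not> zero_obj C (X a)}"
    "\<And>a. a \<in> I \<Longrightarrow> p a o i a = Id C (X a)"
    "\<And>a b. \<lbrakk>a \<in> I; b \<in> I; a \<noteq> b\<rbrakk> \<Longrightarrow> p b o i a = zer (X a) (X b)"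
    "arr_sum C B B I (\<lambda>a. i a o p a) = Id C B"
  using assms unfolding is_dsum_def by (auto simp: homs_iff)

text \<open>An arrow that factors through a zero object vanishes, so the family of composites
  inherits its finite support from the summands.\<close>

lemma finite_dsum_support:
  assumes "finite {a \<in> I. \<not> zero_obj C (X a)}"
    "\<And>a. a \<in> I \<Longrightarrow> ar C (g a) (X a) Z" "\<And>a. a \<in> I \<Longrightarrow> ar C (f a) Y (X a)" "Y \<in> Obj C"
  shows "finite {a \<in> I. g a o f a \<noteq> zer Y Z}"
proof -
  have "g a o f a = zer Y Z" if "a \<in> I" "zero_obj C (X a)" for a
    using to_zero_obj[OF that(2), of "f a" Y] assms(2,3)[OF that(1)] assms(4) by simp
  then have "{a \<in> I. g a o f a \<noteq> zer Y Z} \<subseteq> {a \<in> I. \<not> zero_obj C (X a)}" by blast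
  then show ?thesis using assms(1) finite_subset by blast
qed

text \<open>Composition with the resolution of the identity rebuilds an arrow from its restrictions
  to the summands. Together with the dual \<open>dsum_mono\<close> this is the main device for
  proving arrows equal.\<close>

lemma dsum_epi:
  assumes B: "is_dsum C I X B i p" and f: "ar C f B Z" and g: "ar C g B Z"
    and eq: "\<And>a. a \<in> I \<Longrightarrow> f o i a = g o i a"
  shows "f = g"
proof -
  note D = is_dsumD[OF B]
  have fin: "finite {a \<in> I. i a o p a \<noteq> zer B B}"
    by (rule finite_dsum_support[of _ X]) (use D in auto)
  have e: "h = arr_sum C B Z I (\<lambda>a. (h o i a) o p a)" if h: "ar C h B Z" for h
  proof -
    have "h = h o Id C B" using h by simp
    also have "\<dots> = arr_sum C B Z I (\<lambda>a. h o i a o p a)"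
      unfolding D(7)[symmetric] by (rule comp_arr_sum) (use D fin h in auto)
    also have "\<dots> = arr_sum C B Z I (\<lambda>a. (h o i a) o p a)"
      by (rule arr_sum_cong) (use D h in auto)
    finally show ?thesis .
  qed
  have "arr_sum C B Z I (\<lambda>a. (f o i a) o p a) = arr_sum C B Z I (\<lambda>a. (g o i a) o p a)"
    by (rule arr_sum_cong) (use D f g eq in auto)
  then show ?thesis using e[OF f] e[OF g] by simp
qed

lemma dsum_mono:
  assumes B: "is_dsum C I X B i p" and f: "ar C f Z B" and g: "ar C g Z B"
    and eq: "\<And>a. a \<in> I \<Longrightarrow> p a o f = p a o g"
  shows "f = g"
proof -
  note D = is_dsumD[OF B]
  have fin: "finite {a \<in> I. i a o p a \<noteq> zer B B}"
    by (rule finite_dsum_support[of _ X]) (use D in auto)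
  have e: "h = arr_sum C Z B I (\<lambda>a. i a o p a o h)" if h: "ar C h Z B" for h
  proof -
    have "h = Id C B o h" using h by simp
    also have "\<dots> = arr_sum C Z B I (\<lambda>a. (i a o p a) o h)"
      unfolding D(7)[symmetric] by (rule arr_sum_comp) (use D fin h in auto)
    also have "\<dots> = arr_sum C Z B I (\<lambda>a. i a o p a o h)"
      by (rule arr_sum_cong) (use D h in auto)
    finally show ?thesis .
  qed
  have "arr_sum C Z B I (\<lambda>a. i a o p a o f) = arr_sum C Z B I (\<lambda>a. i a o p a o g)"
    by (rule arr_sum_cong) (use D f g eq in auto)
  then show ?thesis using e[OF f] e[OF g] by simp
qed

lemma arr_sum_comp_single:
  assumes "b \<in> I" "\<And>a. a \<in> I \<Longrightarrow> ar C (f a) X Y" "ar C h W X"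
    "finite {a \<in> I. f a \<noteq> zer X Y}"
    "\<And>a. \<lbrakk>a \<in> I; a \<noteq> b\<rbrakk> \<Longrightarrow> f a o h = zer W Y"
  shows "arr_sum C X Y I f o h = f b o h"
proof -
  have "arr_sum C X Y I f o h = arr_sum C W Y I (\<lambda>a. f a o h)"
    by (rule arr_sum_comp) (use assms(2)[OF assms(1)] assms in auto)
  also have "\<dots> = f b o h" by (rule arr_sum_single) (use assms(2)[OF assms(1)] assms in auto)
  finally show ?thesis .
qed

lemma comp_arr_sum_single:
  assumes "b \<in> I" "\<And>a. a \<in> I \<Longrightarrow> ar C (f a) X Y" "ar C h Y Z"
    "finite {a \<in> I. f a \<noteq> zer X Y}"
    "\<And>a. \<lbrakk>a \<in> I; a \<noteq> b\<rbrakk> \<Longrightarrow> h o f a = zer X Z"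
  shows "h o arr_sum C X Y I f = h o f b"
proof -
  have "h o arr_sum C X Y I f = arr_sum C X Z I (\<lambda>a. h o f a)"
    by (rule comp_arr_sum) (use assms(2)[OF assms(1)] assms in auto)
  also have "\<dots> = h o f b" by (rule arr_sum_single) (use assms(2)[OF assms(1)] assms in auto)
  finally show ?thesis .
qed

text \<open>The coproduct property with the induced arrow written out. The differential, the tensor
  product of maps and the associator of complexes are all sums of this shape, so each is determined
  by the second clause.\<close>

lemma dsum_induced:
  assumes B: "is_dsum C I X B i p" and f: "\<And>a. a \<in> I \<Longrightarrow> ar C (f a) (X a) Z" and Z: "Z \<in> Obj C"
  shows "ar C (arr_sum C B Z I (\<lambda>a. f a o p a)) B Z"
    and "b \<in> I \<Longrightarrow> arr_sum C B Z I (\<lambda>a. f a o p a) o i b = f b"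
proof -
  note D = is_dsumD[OF B]
  show "ar C (arr_sum C B Z I (\<lambda>a. f a o p a)) B Z" by (rule arr_sum_ar) (use f Z D in auto)
  assume b: "b \<in> I"
  have fin: "finite {a \<in> I. f a o p a \<noteq> zer B Z}"
    by (rule finite_dsum_support[of _ X]) (use D f in auto)
  have "arr_sum C B Z I (\<lambda>a. f a o p a) o i b = (f b o p b) o i b"
    by (rule arr_sum_comp_single) (use b fin D f in auto)
  then show "arr_sum C B Z I (\<lambda>a. f a o p a) o i b = f b" using b D f by simp
qed

lemma dsum_coinduced:
  assumes B: "is_dsum C I X B i p" and f: "\<And>a. a \<in> I \<Longrightarrow> ar C (f a) Z (X a)" and Z: "Z \<in> Obj C"
  shows "ar C (arr_sum C Z B I (\<lambda>a. i a o f a)) Z B"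
    and "b \<in> I \<Longrightarrow> p b o arr_sum C Z B I (\<lambda>a. i a o f a) = f b"
proof -
  note D = is_dsumD[OF B]
  show "ar C (arr_sum C Z B I (\<lambda>a. i a o f a)) Z B" by (rule arr_sum_ar) (use f Z D in auto)
  assume b: "b \<in> I"
  have fin: "finite {a \<in> I. i a o f a \<noteq> zer Z B}"
    by (rule finite_dsum_support[of _ X]) (use D f Z in auto)
  have z: "p b o i a o f a = zer Z (X b)" if "a \<in> I" "a \<noteq> b" for a
    using comp_eq_reassoc1[OF D(6)[OF that(1) b that(2)], of "f a"] D that f b Z by simp
  have "p b o arr_sum C Z B I (\<lambda>a. i a o f a) = p b o (i b o f b)"
    by (rule comp_arr_sum_single) (use b fin D f z Z in auto)
  then show "p b o arr_sum C Z B I (\<lambda>a. i a o f a) = f b"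
    using b D f comp_eq_reassoc1[OF D(5)[OF b], of "f b"] by simp
qed

text \<open>Joint epimorphy of the injections replaces the resolution of the identity.\<close>

lemma is_dsumI:
  assumes B: "B \<in> Obj C" and i: "\<And>a. a \<in> I \<Longrightarrow> ar C (i a) (X a) B"
    and p: "\<And>a. a \<in> I \<Longrightarrow> ar C (p a) B (X a)"
    and fin: "finite {a \<in> I. \<not> zero_obj C (X a)}"
    and pi: "\<And>a. a \<in> I \<Longrightarrow> p a o i a = Id C (X a)"
    and pi0: "\<And>a b. \<lbrakk>a \<in> I; b \<in> I; a \<noteq> b\<rbrakk> \<Longrightarrow> p b o i a = zer (X a) (X b)"
    and epi: "\<And>f g. \<lbrakk>ar C f B B; ar C g B B; \<And>a. a \<in> I \<Longrightarrow> f o i a = g o i a\<rbrakk> \<Longrightarrow> f = g"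
  shows "is_dsum C I X B i p"
proof -
  let ?s = "arr_sum C B B I (\<lambda>a. i a o p a)"
  have fin': "finite {a \<in> I. i a o p a \<noteq> zer B B}"
    by (rule finite_dsum_support[of _ X]) (use i p fin B in auto)
  have "?s = Id C B"
  proof (rule epi)
    show "ar C ?s B B" by (rule arr_sum_ar) (use i p B in auto)
    show "ar C (Id C B) B B" using B by simp
    fix b assume b: "b \<in> I"
    have "?s o i b = (i b o p b) o i b"
      by (rule arr_sum_comp_single) (use b fin' i p pi0 in auto)
    then show "?s o i b = Id C B o i b" using b i p pi by simp
  qed
  then show ?thesis unfolding is_dsum_def using assms by (auto simp: homs_iff)
qed

lemma zero_summand_comp:
  "\<lbrakk>is_dsum C I X B i p; a \<in> I; zero_obj C (X a); ar C f B Z\<rbrakk> \<Longrightarrow> f o i a = zer (X a) Z"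
  using is_dsumD(2)[of I X B i p a] from_zero_obj[of "X a" "f o i a" Z] by simp

section \<open>Isomorphisms and manipulation of direct sums\<close>

lemma inverse_arrows_iff:
  "inverse_arrows C f g \<longleftrightarrow> arrow C f \<and> ar C g (Cod C f) (Dom C f) \<and>
    g o f = Id C (Dom C f) \<and> f o g = Id C (Cod C f)"
  by (auto simp: inverse_arrows_def)

lemma inverse_arrows_unique:
  assumes "inverse_arrows C f g" "inverse_arrows C f h"
  shows "g = h"
proof -
  have "g = g o (f o h)" using assms by (simp add: inverse_arrows_iff)
  also have "\<dots> = (g o f) o h" using assms by (intro assoc_arr[symmetric]) (auto simp: inverse_arrows_iff)
  also have "\<dots> = h" using assms by (simp add: inverse_arrows_iff)
  finally show ?thesis .
qed

lemma arr_inv_eq: "inverse_arrows C f g \<Longrightarrow> arr_inv C f = g"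
  unfolding arr_inv_def using inverse_arrows_unique by blast

lemma is_isoI: "\<lbrakk>ar C f X Y; ar C g Y X; g o f = Id C X; f o g = Id C Y\<rbrakk> \<Longrightarrow> is_iso C f"
  unfolding is_iso_def inverse_arrows_iff by blast

lemma is_isoE:
  assumes "is_iso C f" "Dom C f = X" "Cod C f = Y"
  obtains g where "arrow C f" "ar C g Y X" "g o f = Id C X" "f o g = Id C Y"
  using assms unfolding is_iso_def inverse_arrows_iff by auto

lemma is_iso_inverse: "inverse_arrows C f g \<Longrightarrow> is_iso C f \<and> is_iso C g"
  unfolding is_iso_def inverse_arrows_def by metis

lemma is_iso_Id: "X \<in> Obj C \<Longrightarrow> is_iso C (Id C X)"
  by (rule is_isoI[of _ X X "Id C X"]) auto

lemma arr_inv_simps: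
  assumes "is_iso C f"
  shows "ar C (arr_inv C f) (Cod C f) (Dom C f)" "arr_inv C f o f = Id C (Dom C f)"
    "f o arr_inv C f = Id C (Cod C f)" "is_iso C (arr_inv C f)"
proof -
  obtain g where g: "inverse_arrows C f g" using assms by (auto simp: is_iso_def)
  then have "arr_inv C f = g" by (rule arr_inv_eq)
  then show "ar C (arr_inv C f) (Cod C f) (Dom C f)" "arr_inv C f o f = Id C (Dom C f)"
    "f o arr_inv C f = Id C (Cod C f)" "is_iso C (arr_inv C f)"
    using g is_iso_inverse by (auto simp: inverse_arrows_iff)
qed

lemma is_iso_comp:
  assumes "is_iso C f" "is_iso C g" "Dom C g = Cod C f"
  shows "is_iso C (g o f)"
proof -
  obtain f' where f: "arrow C f" "ar C f' (Cod C f) (Dom C f)" "f' o f = Id C (Dom C f)"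
    "f o f' = Id C (Cod C f)" using assms(1) by (rule is_isoE) auto
  obtain g' where g: "arrow C g" "ar C g' (Cod C g) (Dom C g)" "g' o g = Id C (Dom C g)"
    "g o g' = Id C (Cod C g)" using assms(2) by (rule is_isoE) auto
  show ?thesis
  proof (rule is_isoI)
    show "ar C (g o f) (Dom C f) (Cod C g)" "ar C (f' o g') (Cod C g) (Dom C f)"
      using f g assms(3) by auto
    show "(f' o g') o (g o f) = Id C (Dom C f)"
      using f g assms(3) comp_eq_reassoc1[OF g(3), of f] by simp
    show "(g o f) o (f' o g') = Id C (Cod C g)"
      using f g assms(3) comp_eq_reassoc1[OF f(4), of g'] by simp
  qed
qed

lemma isomorphicI: "\<lbrakk>ar C f X Y; is_iso C f\<rbrakk> \<Longrightarrow> isomorphic C X Y"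
  unfolding isomorphic_def by (auto simp: homs_iff)

lemma isomorphicE:
  assumes "isomorphic C X Y"
  obtains f g where "ar C f X Y" "ar C g Y X" "g o f = Id C X" "f o g = Id C Y"
proof -
  obtain f where f: "ar C f X Y" "is_iso C f"
    using assms unfolding isomorphic_def by (auto simp: homs_iff)
  from f(2) obtain g where "arrow C f" "ar C g Y X" "g o f = Id C X" "f o g = Id C Y"
    by (rule is_isoE) (use f in auto)
  with f that show thesis by blast
qed

lemma isomorphic_sym: "isomorphic C X Y \<Longrightarrow> isomorphic C Y X"
  by (elim isomorphicE) (rule isomorphicI, blast, rule is_isoI; blast)

lemma isomorphic_trans: "\<lbrakk>isomorphic C X Y; isomorphic C Y Z\<rbrakk> \<Longrightarrow> isomorphic C X Z"
  unfolding isomorphic_def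
  by (metis arrow_def comp_hom homs_iff is_iso_comp)

lemma inverse_cancel:
  assumes "ar C f X Y" "ar C g Y X" "g o f = Id C X" "ar C x W X"
  shows "g o (f o x) = x"
  using comp_eq_reassoc1[OF assms(3), of x] assms by simp

text \<open>Carries the inverse as a named arrow, so that conjugation and cancellation need no
  choice through \<open>arr_inv\<close>.\<close>

definition iso_pair where
  "iso_pair f g X Y \<longleftrightarrow> ar C f X Y \<and> ar C g Y X \<and> g o f = Id C X \<and> f o g = Id C Y"

lemma iso_pairD:
  assumes "iso_pair f g X Y"
  shows "ar C f X Y" "ar C g Y X" "g o f = Id C X" "f o g = Id C Y" "is_iso C f" "is_iso C g" "iso_pair g f Y X"
    "\<And>x W. ar C x W X \<Longrightarrow> g o (f o x) = x" "\<And>x W. ar C x W Y \<Longrightarrow> f o (g o x) = x"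
proof -
  show a: "ar C f X Y" "ar C g Y X" "g o f = Id C X" "f o g = Id C Y" using assms by (auto simp: iso_pair_def)
  show "is_iso C f" "is_iso C g" using is_isoI[OF a] is_isoI[OF a(2,1,4,3)] .
  show "iso_pair g f Y X" using a by (auto simp: iso_pair_def)
  show "\<And>x W. ar C x W X \<Longrightarrow> g o (f o x) = x" "\<And>x W. ar C x W Y \<Longrightarrow> f o (g o x) = x"
    using inverse_cancel a by blast+
qed

lemma iso_pair_isomorphic: "isomorphic C X Y \<Longrightarrow> \<exists>f g. iso_pair f g X Y"
  by (elim isomorphicE) (auto simp: iso_pair_def)

lemma iso_pair_iso: "\<lbrakk>is_iso C f; ar C f X Y\<rbrakk> \<Longrightarrow> iso_pair f (arr_inv C f) X Y"
  using arr_inv_simps[of f] by (simp add: iso_pair_def)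

text \<open>The two induced arrows are inverse because they are so on every summand. The description
  of \<open>f\<close> on the injections is part of the conclusion because the associator of
  complexes is later recognised as such an \<open>f\<close>.\<close>

lemma dsum_isomorphic:
  assumes B: "is_dsum C I X B i p" and A: "is_dsum C I Y A j q" and c: "\<And>a. a \<in> I \<Longrightarrow> iso_pair (c a) (c' a) (X a) (Y a)"
  obtains f g where "iso_pair f g B A" "\<And>a. a \<in> I \<Longrightarrow> f o i a = j a o c a"
proof -
  note DB = is_dsumD[OF B] and DA = is_dsumD[OF A] and P = iso_pairD[OF c]
  have 1: "ar C (j a o c a) (X a) A" "ar C (i a o c' a) (Y a) B" if "a \<in> I" for a
    using P(1,2)[OF that] DA(2)[OF that] DB(2)[OF that] by simp_all
  obtain f where f: "ar C f B A" "\<And>a. a \<in> I \<Longrightarrow> f o i a = j a o c a" using dsum_induced[OF B 1(1) DA(1)] by blast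
  obtain g where g: "ar C g A B" "\<And>a. a \<in> I \<Longrightarrow> g o j a = i a o c' a" using dsum_induced[OF A 1(2) DB(1)] by blast
  have "g o f = Id C B"
  proof (rule dsum_epi[OF B, where Z = B])
    fix a assume a: "a \<in> I"
    have "(g o f) o i a = (g o j a) o c a" using f(2)[OF a] f(1) g(1) DB(2)[OF a] DA(2)[OF a] P(1)[OF a] by simp
    also have "\<dots> = i a" unfolding g(2)[OF a] using DB(2)[OF a] P(1,2,3)[OF a] by simp
    finally show "(g o f) o i a = Id C B o i a" using DB(2)[OF a] by simp
  qed (use f(1) g(1) in simp_all)
  moreover have "f o g = Id C A"
  proof (rule dsum_epi[OF A, where Z = A])
    fix a assume a: "a \<in> I"
    have "(f o g) o j a = (f o i a) o c' a" using g(2)[OF a] f(1) g(1) DB(2)[OF a] DA(2)[OF a] P(2)[OF a] by simp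
    also have "\<dots> = j a" unfolding f(2)[OF a] using DA(2)[OF a] P(1,2,4)[OF a] by simp
    finally show "(f o g) o j a = Id C A o j a" using DA(2)[OF a] by simp
  qed (use f(1) g(1) in simp_all)
  ultimately have "iso_pair f g B A" using f(1) g(1) by (simp add: iso_pair_def)
  then show thesis using that[of f g] f(2) by blast
qed

lemma dsum_reindex:
  assumes d: "is_dsum C I X B i p" and h: "bij_betw h K I"
    and eq: "\<And>c. c \<in> K \<Longrightarrow> X' c = X (h c)" "\<And>c. c \<in> K \<Longrightarrow> i' c = i (h c)" "\<And>c. c \<in> K \<Longrightarrow> p' c = p (h c)"
  shows "is_dsum C K X' B i' p'"
proof -
  note D = is_dsumD[OF d]
  have hI: "h c \<in> I" if "c \<in> K" for c using h that by (auto simp: bij_betw_def)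
  have inj: "inj_on h K" using h by (auto simp: bij_betw_def)
  show ?thesis
  proof (rule is_dsumI)
    fix f g assume fg: "ar C f B B" "ar C g B B" "\<And>a. a \<in> K \<Longrightarrow> f o i' a = g o i' a"
    show "f = g"
    proof (rule dsum_epi[OF d fg(1,2)])
      fix j assume "j \<in> I"
      then obtain a where "a \<in> K" "j = h a" using h by (fastforce simp: bij_betw_def)
      then show "f o i j = g o i j" using fg(3)[of a] eq(2)[of a] by simp
    qed
  next
    show "finite {c \<in> K. \<not> zero_obj C (X' c)}"
      by (rule finite_subset[OF _ finite_vimage_IntI[OF D(4) inj]]) (use hI eq(1) in auto)
    show "ar C (i' a) (X' a) B" "ar C (p' a) B (X' a)" "p' a o i' a = Id C (X' a)" if "a \<in> K" for a
      using D(2,3,5)[OF hI[OF that]] unfolding eq[OF that] by blast+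
    show "p' b o i' a = zer (X' a) (X' b)" if "a \<in> K" "b \<in> K" "a \<noteq> b" for a b
      using D(6)[OF hI[OF that(1)] hI[OF that(2)]] inj that unfolding eq[OF that(1)] eq[OF that(2)] inj_on_def by blast
  qed (rule D(1))
qed

text \<open>Iterated sums become one sum over pairs; in this way a term of a threefold tensor
  product of complexes can be tested on all triples of degrees at once.\<close>

lemma dsum_dsum:
  assumes B: "is_dsum C I X B i p" and Y: "\<And>a. a \<in> I \<Longrightarrow> is_dsum C (J a) (Y a) (X a) (j a) (q a)"
    and fin: "finite {(a, b). a \<in> I \<and> b \<in> J a \<and> \<not> zero_obj C (Y a b)}"
  shows "is_dsum C (Sigma I J) (\<lambda>(a, b). Y a b) B (\<lambda>(a, b). i a o j a b) (\<lambda>(a, b). q a b o p a)"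
proof -
  note D = is_dsumD[OF B] and E = is_dsumD[OF Y]
  have c: "(q a b o p a) o (i a' o j a' b') = (if (a, b) = (a', b') then Id C (Y a b) else zer (Y a' b') (Y a b))"
    if h: "a \<in> I" "b \<in> J a" "a' \<in> I" "b' \<in> J a'" for a b a' b'
  proof -
    note t = D(2)[OF h(3)] D(3)[OF h(1)] E(2)[OF h(3,4)] E(3)[OF h(1,2)]
    have "(q a b o p a) o (i a' o j a' b') = q a b o ((p a o i a') o j a' b')" using t by simp
    also have "\<dots> = (if (a, b) = (a', b') then Id C (Y a b) else zer (Y a' b') (Y a b))"
    proof (cases "a = a'")
      case True
      then show ?thesis using t D(5)[OF h(1)] E(5)[OF h(1,2)] E(6)[OF h(1), of b' b] h by auto
    next
      case False
      then show ?thesis using t D(6)[OF h(3,1)] by simp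
    qed
    finally show ?thesis .
  qed
  show ?thesis
  proof (rule is_dsumI)
    have "{c \<in> Sigma I J. \<not> zero_obj C (case c of (a, b) \<Rightarrow> Y a b)} = {(a, b). a \<in> I \<and> b \<in> J a \<and> \<not> zero_obj C (Y a b)}"
      by auto
    then show "finite {c \<in> Sigma I J. \<not> zero_obj C (case c of (a, b) \<Rightarrow> Y a b)}" using fin by simp
  next
    fix f g assume fg: "ar C f B B" "ar C g B B"
      "\<And>c. c \<in> Sigma I J \<Longrightarrow> f o (case c of (a, b) \<Rightarrow> i a o j a b) = g o (case c of (a, b) \<Rightarrow> i a o j a b)"
    show "f = g"
    proof (rule dsum_epi[OF B fg(1,2)])
      fix a assume a: "a \<in> I"
      show "f o i a = g o i a"
      proof (rule dsum_epi[OF Y[OF a], where Z = B])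
        fix b assume b: "b \<in> J a"
        show "(f o i a) o j a b = (g o i a) o j a b" using fg(3)[of "(a, b)"] fg(1,2) a b D(2)[OF a] E(2)[OF a b] by simp
      qed (use fg D(2)[OF a] in simp_all)
    qed
  next
    fix c assume "c \<in> Sigma I J"
    then obtain a b where ab: "c = (a, b)" "a \<in> I" "b \<in> J a" by auto
    note t = D(2,3)[OF ab(2)] E(2,3)[OF ab(2,3)]
    show "ar C (case c of (a, b) \<Rightarrow> i a o j a b) (case c of (a, b) \<Rightarrow> Y a b) B"
      "ar C (case c of (a, b) \<Rightarrow> q a b o p a) B (case c of (a, b) \<Rightarrow> Y a b)" using t by (simp_all add: ab(1))
    show "(case c of (a, b) \<Rightarrow> q a b o p a) o (case c of (a, b) \<Rightarrow> i a o j a b) = Id C (case c of (a, b) \<Rightarrow> Y a b)"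
      unfolding ab(1) prod.case c[OF ab(2,3,2,3)] by simp
    fix c' assume "c' \<in> Sigma I J" and ne: "c \<noteq> c'"
    then obtain a' b' where ab': "c' = (a', b')" "a' \<in> I" "b' \<in> J a'" by auto
    show "(case c' of (a, b) \<Rightarrow> q a b o p a) o (case c of (a, b) \<Rightarrow> i a o j a b) =
        zer (case c of (a, b) \<Rightarrow> Y a b) (case c' of (a, b) \<Rightarrow> Y a b)"
      using ne unfolding ab(1) ab'(1) prod.case c[OF ab'(2,3) ab(2,3)] by auto
  qed (rule D(1))
qed

section \<open>Monomorphisms, epimorphisms, kernels and cokernels\<close>

lemma is_mono_iff:
  "is_mono C f \<longleftrightarrow> arrow C f \<and>
    (\<forall>T u v. ar C u T (Dom C f) \<and> ar C v T (Dom C f) \<and> f o u = f o v \<longrightarrow> u = v)"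
  unfolding is_mono_def by (auto simp: homs_iff)

lemma is_epi_iff:
  "is_epi C f \<longleftrightarrow> arrow C f \<and>
    (\<forall>T u v. ar C u (Cod C f) T \<and> ar C v (Cod C f) T \<and> u o f = v o f \<longrightarrow> u = v)"
proof (cases "arrow C f")
  case True
  then have "u \<in> homs C (Cod C f) T \<longleftrightarrow> ar C u (Cod C f) T" if "T \<in> Obj C" for u T
    using that by (simp add: homs_iff)
  note h = this
  show ?thesis
  proof (intro iffI conjI allI impI)
    fix T u v
    assume "is_epi C f" "ar C u (Cod C f) T \<and> ar C v (Cod C f) T \<and> u o f = v o f"
    then show "u = v" using h[of T] unfolding is_epi_def by metis
  next
    assume r: "arrow C f \<and> (\<forall>T u v. ar C u (Cod C f) T \<and> ar C v (Cod C f) T \<and> u o f = v o f \<longrightarrow> u = v)"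
    show "is_epi C f" unfolding is_epi_def
    proof (intro conjI ballI impI)
      fix T u v
      assume "T \<in> Obj C" "u \<in> homs C (Cod C f) T" "v \<in> homs C (Cod C f) T" "u o f = v o f"
      then show "u = v" using h[of T] r by metis
    qed (use True in simp)
  qed (use True in simp)
qed (simp add: is_epi_def)

lemma monoD: "\<lbrakk>is_mono C f; ar C u T (Dom C f); ar C v T (Dom C f); f o u = f o v\<rbrakk> \<Longrightarrow> u = v"
  unfolding is_mono_iff by blast

lemma epiD: "\<lbrakk>is_epi C f; ar C u (Cod C f) T; ar C v (Cod C f) T; u o f = v o f\<rbrakk> \<Longrightarrow> u = v"
  unfolding is_epi_iff by blast

lemma split_mono: assumes "ar C f X Y" "ar C g Y X" "g o f = Id C X" shows "is_mono C f"
  unfolding is_mono_iff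
proof (intro conjI allI impI)
  fix T u v assume *: "ar C u T (Dom C f) \<and> ar C v T (Dom C f) \<and> f o u = f o v"
  then have t: "ar C u T X" "ar C v T X" and eq: "f o u = f o v" using assms(1) by auto
  have "u = g o (f o u)" using comp_eq_reassoc1[OF assms(3), of u] t assms(1,2) by simp
  also have "\<dots> = v" unfolding eq using comp_eq_reassoc1[OF assms(3), of v] t assms(1,2) by simp
  finally show "u = v" .
qed (use assms in simp)

lemma split_epi: assumes "ar C f X Y" "ar C g Y X" "f o g = Id C Y" shows "is_epi C f"
  unfolding is_epi_iff
proof (intro conjI allI impI)
  fix T u v assume *: "ar C u (Cod C f) T \<and> ar C v (Cod C f) T \<and> u o f = v o f"
  then have t: "ar C u Y T" "ar C v Y T" and eq: "u o f = v o f" using assms(1) by auto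
  have "u = (u o f) o g" using t assms by simp
  also have "\<dots> = v" unfolding eq using t assms by simp
  finally show "u = v" .
qed (use assms in simp)

lemma is_iso_mono: assumes "is_iso C f" shows "is_mono C f"
  using assms by (rule is_isoE[OF _ HOL.refl HOL.refl]) (rule split_mono; auto)

lemma is_iso_epi: assumes "is_iso C f" shows "is_epi C f"
  using assms by (rule is_isoE[OF _ HOL.refl HOL.refl]) (rule split_epi; auto)

text \<open>Separates existence of factorisations from uniqueness. Uniqueness for the test arrow
  \<open>m o u\<close> is precisely that \<open>m\<close> is mono.\<close>

lemma is_kernelD:
  assumes "is_kernel C f m"
  shows "arrow C f" "arrow C m" "Cod C m = Dom C f" "f o m = zer (Dom C m) (Cod C f)"
    "\<And>t T. \<lbrakk>ar C t T (Dom C f); f o t = zer T (Cod C f)\<rbrakk> \<Longrightarrow> \<exists>u. ar C u T (Dom C m) \<and> m o u = t"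
    "is_mono C m"
proof -
  note K = assms[unfolded is_kernel_def]
  show a: "arrow C f" "arrow C m" "Cod C m = Dom C f" "f o m = zer (Dom C m) (Cod C f)"
    using K by auto
  show "\<exists>u. ar C u T (Dom C m) \<and> m o u = t"
    if "ar C t T (Dom C f)" "f o t = zer T (Cod C f)" for t T
  proof -
    have "T \<in> Obj C" "t \<in> homs C T (Dom C f)" using that a by (auto simp: homs_iff)
    then have "\<exists>!u. u \<in> homs C T (Dom C m) \<and> m o u = t" using K that by blast
    then show ?thesis using that a by (auto simp: homs_iff)
  qed
  show "is_mono C m" unfolding is_mono_iff
  proof (intro conjI allI impI)
    show "arrow C m" by fact
    fix T u v assume *: "ar C u T (Dom C m) \<and> ar C v T (Dom C m) \<and> m o u = m o v"
    have "f o (m o u) = zer T (Cod C f)"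
      using * a comp_eq_reassoc1[OF a(4), of u] by simp
    moreover have "m o u \<in> homs C T (Dom C f)" using * a by (auto simp: homs_iff)
    ultimately have "\<exists>!w. w \<in> homs C T (Dom C m) \<and> m o w = m o u" using K * by blast
    moreover have "u \<in> homs C T (Dom C m)" "v \<in> homs C T (Dom C m)" using * a by (auto simp: homs_iff)
    ultimately show "u = v" using * by metis
  qed
qed

lemma is_kernelI:
  assumes "arrow C f" "arrow C m" "Cod C m = Dom C f" "f o m = zer (Dom C m) (Cod C f)"
    "\<And>t T. \<lbrakk>ar C t T (Dom C f); f o t = zer T (Cod C f)\<rbrakk> \<Longrightarrow> \<exists>u. ar C u T (Dom C m) \<and> m o u = t"
    "is_mono C m"
  shows "is_kernel C f m"
  unfolding is_kernel_def
proof (intro conjI ballI impI)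
  fix T t assume "T \<in> Obj C" "t \<in> homs C T (Dom C f)" "f o t = zer T (Cod C f)"
  then obtain u where u: "ar C u T (Dom C m)" "m o u = t" using assms(1,5) by (auto simp: homs_iff)
  show "\<exists>!u. u \<in> homs C T (Dom C m) \<and> m o u = t"
  proof (rule ex1I[of _ u])
    show "u \<in> homs C T (Dom C m) \<and> m o u = t" using u by (auto simp: homs_iff)
    show "v = u" if v: "v \<in> homs C T (Dom C m) \<and> m o v = t" for v
    proof (rule monoD[OF assms(6) _ u(1)])
      show "ar C v T (Dom C m)" using v \<open>T \<in> Obj C\<close> assms(2) homs_iff[of T "Dom C m"] by simp
      show "m o v = m o u" using v u by simp
    qed
  qed
qed (use assms in auto)

lemma is_cokernelD:
  assumes "is_cokernel C f q"
  shows "arrow C f" "arrow C q" "Dom C q = Cod C f" "q o f = zer (Dom C f) (Cod C q)"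
    "\<And>t T. \<lbrakk>ar C t (Cod C f) T; t o f = zer (Dom C f) T\<rbrakk> \<Longrightarrow> \<exists>u. ar C u (Cod C q) T \<and> u o q = t"
    "is_epi C q"
proof -
  note K = assms[unfolded is_cokernel_def]
  show a: "arrow C f" "arrow C q" "Dom C q = Cod C f" "q o f = zer (Dom C f) (Cod C q)"
    using K by auto
  show "\<exists>u. ar C u (Cod C q) T \<and> u o q = t"
    if "ar C t (Cod C f) T" "t o f = zer (Dom C f) T" for t T
  proof -
    have "T \<in> Obj C" "t \<in> homs C (Cod C f) T" using that a by (auto simp: homs_iff)
    then have "\<exists>!u. u \<in> homs C (Cod C q) T \<and> u o q = t" using K that by blast
    then show ?thesis using that a by (auto simp: homs_iff)
  qed
  show "is_epi C q" unfolding is_epi_iff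
  proof (intro conjI allI impI)
    show "arrow C q" by fact
    fix T u v assume *: "ar C u (Cod C q) T \<and> ar C v (Cod C q) T \<and> u o q = v o q"
    have "(u o q) o f = zer (Dom C f) T"
      using * a by simp
    moreover have "u o q \<in> homs C (Cod C f) T" using * a by (auto simp: homs_iff)
    ultimately have "\<exists>!w. w \<in> homs C (Cod C q) T \<and> w o q = u o q" using K * by blast
    moreover have "u \<in> homs C (Cod C q) T" "v \<in> homs C (Cod C q) T" using * a by (auto simp: homs_iff)
    ultimately show "u = v" using * by metis
  qed
qed

lemma is_cokernelI:
  assumes "arrow C f" "arrow C q" "Dom C q = Cod C f" "q o f = zer (Dom C f) (Cod C q)"
    "\<And>t T. \<lbrakk>ar C t (Cod C f) T; t o f = zer (Dom C f) T\<rbrakk> \<Longrightarrow> \<exists>u. ar C u (Cod C q) T \<and> u o q = t"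
    "is_epi C q"
  shows "is_cokernel C f q"
  unfolding is_cokernel_def
proof (intro conjI ballI impI)
  fix T t assume "T \<in> Obj C" "t \<in> homs C (Cod C f) T" "t o f = zer (Dom C f) T"
  then obtain u where u: "ar C u (Cod C q) T" "u o q = t" using assms(1,5) by (auto simp: homs_iff)
  show "\<exists>!u. u \<in> homs C (Cod C q) T \<and> u o q = t"
  proof (rule ex1I[of _ u])
    show "u \<in> homs C (Cod C q) T \<and> u o q = t" using u by (auto simp: homs_iff)
    show "v = u" if v: "v \<in> homs C (Cod C q) T \<and> v o q = t" for v
    proof (rule epiD[OF assms(6) _ u(1)])
      show "ar C v (Cod C q) T" using v \<open>T \<in> Obj C\<close> assms(2) homs_iff[of "Cod C q" T] by simp
      show "v o q = u o q" using v u by simp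
    qed
  qed
qed (use assms in auto)

lemma zero_objI: "\<lbrakk>Z \<in> Obj C; Id C Z = zer Z Z\<rbrakk> \<Longrightarrow> zero_obj C Z"
  by (simp add: zero_obj_iff)

lemma zero_obj_retract:
  assumes "zero_obj C Z" "ar C f X Z" "ar C g Z X" "g o f = Id C X"
  shows "zero_obj C X"
  using to_zero_obj[OF assms(1,2)] assms by (simp add: zero_obj_iff)

lemma empty_dsum_zero:
  assumes "is_dsum C I X B i p" "\<And>a. a \<in> I \<Longrightarrow> zero_obj C (X a)"
  shows "zero_obj C B"
proof (rule zero_objI)
  note D = is_dsumD[OF assms(1)]
  show B: "B \<in> Obj C" by (rule D)
  show "Id C B = zer B B"
    by (rule dsum_epi[OF assms(1)])
      (use B D zero_summand_comp[OF assms(1)] assms(2) in auto)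
qed

end

section \<open>Direct sums of finitely supported families and split idempotents\<close>

context abelian_category
begin

lemma zero_obj_the_zero [simp]: "zero_obj C (the_zero C)"
  unfolding the_zero_def using has_zero by (rule someI_ex)

lemma the_zero_Obj [simp]: "the_zero C \<in> Obj C"
  using zero_obj_the_zero zero_obj_iff by blast

text \<open>The index set may be infinite, so the induction runs over a finite set \<open>F\<close>
  that contains the support. In the base case all members are zero objects and the zero object is
  their sum.\<close>

lemma dsum_exists:
  assumes "finite F" "{a \<in> I. \<not> zero_obj C (X a)} \<subseteq> F" "\<And>a. a \<in> I \<Longrightarrow> X a \<in> Obj C"
  shows "\<exists>B i p. is_dsum C I X B i p"
  using assms
proof (induction F arbitrary: I rule: finite_induct)
  case empty
  have z: "zero_obj C (X a)" if "a \<in> I" for a using that empty by auto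
  have "is_dsum C I X (the_zero C) (\<lambda>a. zer (X a) (the_zero C)) (\<lambda>a. zer (the_zero C) (X a))"
  proof (rule is_dsumI)
    have e: "{a \<in> I. \<not> zero_obj C (X a)} = {}" using empty by auto
    show "finite {a \<in> I. \<not> zero_obj C (X a)}" unfolding e by simp
    show "f = g" if "ar C f (the_zero C) (the_zero C)" "ar C g (the_zero C) (the_zero C)" for f g
      using from_zero_obj[OF zero_obj_the_zero] that by metis
    show "zer (the_zero C) (X a) o zer (X a) (the_zero C) = Id C (X a)" if "a \<in> I" for a
      using z[OF that] by (simp add: zero_obj_iff)
  qed (use empty in auto)
  then show ?case by blast
next
  case (insert b F)
  let ?I = "I - {b}"
  have "\<exists>B i p. is_dsum C ?I X B i p" using insert by (intro insert.IH) auto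
  then obtain B i p where B: "is_dsum C ?I X B i p" by blast
  note D = is_dsumD[OF B]
  show ?case
  proof (cases "b \<in> I")
    case False
    then show ?thesis using B by auto
  next
    \<comment> \<open>A sum of the remaining members is joined to \<open>X b\<close> by a binary
      direct sum; \<open>jt\<close>, \<open>jf\<close>, \<open>qt\<close>, \<open>qf\<close> are its
      structure arrows.\<close>
    case b: True
    obtain A j q where A: "is_dsum C (UNIV :: bool set) (\<lambda>c. if c then X b else B) A j q"
      using has_dsums[of "X b" B] D(1) insert.prems(2)[OF b] by blast
    note E = is_dsumD[OF A]
    define jt jf qt qf where "jt = j True" and "jf = j False" and "qt = q True" and "qf = q False"
    have jq: "ar C jt (X b) A" "ar C jf B A" "ar C qt A (X b)" "ar C qf A B"
      "qt o jt = Id C (X b)" "qf o jf = Id C B"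
      "qt o jf = zer B (X b)" "qf o jt = zer (X b) B"
      using E(2)[of True] E(2)[of False] E(3)[of True] E(3)[of False] E(5)[of True] E(5)[of False]
        E(6)[of True False] E(6)[of False True] by (auto simp: jt_def jf_def qt_def qf_def)
    have ra: "qf o (jf o i a) = i a" "qt o (jf o i a) = zer (X a) (X b)"
      "qf o jf o i a = i a" if "a \<in> ?I" for a
      using comp_eq_reassoc1[OF jq(6), of "i a"] comp_eq_reassoc1[OF jq(7), of "i a"] jq(1-4) D(2)[OF that]
      by simp_all
    let ?i = "\<lambda>a. if a = b then jt else jf o i a" and ?p = "\<lambda>a. if a = b then qt else p a o qf"
    have "is_dsum C I X A ?i ?p"
    proof (rule is_dsumI)
      show "A \<in> Obj C" by (rule E(1))
      show "finite {a \<in> I. \<not> zero_obj C (X a)}" using insert.hyps(1) insert.prems(1)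
        by (meson finite_insert finite_subset)
      show "ar C (?i a) (X a) A" "ar C (?p a) A (X a)" if "a \<in> I" for a
        using jq(1-4) D(2,3)[of a] that by simp_all
      show "?p a o ?i a = Id C (X a)" if "a \<in> I" for a
        using jq(1-5) D(2,3,5)[of a] ra[of a] that by simp
      show "?p c o ?i a = zer (X a) (X c)" if "a \<in> I" "c \<in> I" "a \<noteq> c" for a c
        using jq D(2,3)[of a] D(2,3)[of c] D(6)[of a c] ra[of a] that by (cases "a = b"; cases "c = b") simp_all
      fix f g assume fg: "ar C f A A" "ar C g A A" "\<And>a. a \<in> I \<Longrightarrow> f o ?i a = g o ?i a"
      have 1: "f o jf = g o jf"
      proof (rule dsum_epi[OF B])
        show "ar C (f o jf) B A" "ar C (g o jf) B A" using fg(1,2) jq(2) by simp_all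
        fix a assume "a \<in> ?I"
        then show "(f o jf) o i a = (g o jf) o i a"
          using fg(1,2) fg(3)[of a] jq(2) D(2)[of a] by simp
      qed
      have 2: "f o jt = g o jt" using fg(3)[OF b] by simp
      show "f = g"
        by (rule dsum_epi[OF A fg(1,2)]) (use 1 2 in \<open>unfold jt_def jf_def; metis (full_types)\<close>)
    qed
    then show ?thesis by blast
  qed
qed

lemma is_dsum_dsum:
  assumes "finite {a \<in> I. \<not> zero_obj C (X a)}" "\<And>a. a \<in> I \<Longrightarrow> X a \<in> Obj C"
  shows "is_dsum C I X (dsum C I X) (dinj C I X) (dprj C I X)"
proof -
  have "\<exists>d. case d of (B, i, p) \<Rightarrow> is_dsum C I X B i p"
    using dsum_exists[OF assms(1) order_refl assms(2)] by auto
  then have "case dsum_data C I X of (B, i, p) \<Rightarrow> is_dsum C I X B i p"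
    unfolding dsum_data_def by (rule someI_ex)
  then show ?thesis by (simp add: dsum_def dinj_def dprj_def case_prod_beta)
qed

lemma kernel_exists:
  assumes "arrow C f"
  obtains m where "is_kernel C f m"
  using has_kernels[OF assms] by blast

text \<open>The image of \<open>e\<close> is the kernel of 1 - e: \<open>e\<close> factors through
  this kernel because (1 - e) e = 0, and \<open>e\<close> fixes the inclusion \<open>m\<close>
  because (1 - e) m = 0.\<close>

lemma idempotent_split:
  assumes e: "ar C e X X" "e o e = e"
  obtains M m u where "ar C m M X" "ar C u X M" "u o m = Id C M" "m o u = e"
proof -
  let ?n = "Id C X +[X, X] (-[X, X] e)"
  have n: "ar C ?n X X" using e by simp
  obtain m where m: "is_kernel C ?n m" using kernel_exists n by blast
  note K = is_kernelD[OF m]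
  have m1: "ar C m (Dom C m) X" using K n by auto
  have ne: "?n o e = zer X X" using e by simp
  obtain u where u: "ar C u X (Dom C m)" "m o u = e" using K(5)[of e X] e n ne by auto
  have em: "e o m = m"
  proof -
    have "m +[Dom C m, X] (-[Dom C m, X] (e o m)) = zer (Dom C m) X"
      using K(4) m1 e n by simp
    then have "-[Dom C m, X] (e o m) = -[Dom C m, X] m"
      by (intro add_eq_zero_neg) (use m1 e in auto)
    then show ?thesis using neg_neg[of "e o m" "Dom C m" X] neg_neg[of m "Dom C m" X] m1 e by auto
  qed
  have "u o m = Id C (Dom C m)"
  proof -
    have "m o (u o m) = m o Id C (Dom C m)"
      using comp_eq_reassoc1[OF u(2), of m] u m1 em by simp
    then show ?thesis by (rule monoD[OF K(6), rotated 2]) (use u m1 in auto)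
  qed
  then show thesis using that m1 u by blast
qed

text \<open>The complement is the image of the idempotent 1 - i p, which exists because idempotents
  split.\<close>

lemma retract_direct_summand:
  assumes "ar C i Z W" "ar C p W Z" "p o i = Id C Z"
  shows "direct_summand C Z W"
proof -
  define e where "e = Id C W +[W, W] (-[W, W] (i o p))"
  have ra: "p o i o x = x" if "ar C x T Z" for x T
    using comp_eq_reassoc1[OF assms(3), of x] assms that by simp
  have e: "ar C e W W" using assms(1,2) by (simp add: e_def)
  have pe: "p o e = zer W Z" "e o i = zer Z W"
    unfolding e_def using assms ra[of p] by simp_all
  have "e o e = e +[W, W] (-[W, W] (i o (p o e)))"
    by (subst (1) e_def) (use assms(1,2) e in simp)
  then have "e o e = e" using assms(1,2) e pe(1) by simp
  then obtain M m u where m: "ar C m M W" "ar C u W M" "u o m = Id C M" "m o u = e"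
    using idempotent_split[OF e] by blast
  have rm: "u o (m o x) = x" if "ar C x T M" for x T
    using comp_eq_reassoc1[OF m(3), of x] m(1,2) that by simp
  have "e o m = m" unfolding m(4)[symmetric] using m(1-3) by simp
  then have pm: "p o m = zer M Z"
    using comp_eq_reassoc1[OF pe(1), of m] m(1) e assms(2) by simp
  have ui: "u o i = zer Z M"
  proof -
    have "u o i = u o (m o (u o i))" using rm[of "u o i" Z] m(2) assms(1) by simp
    also have "\<dots> = u o (e o i)" using comp_eq_reassoc1[OF m(4), of i] m(1,2) assms(1) by simp
    finally show ?thesis using pe m(2) assms(1) by simp
  qed
  \<comment> \<open>From 1 = i p + e with e = m u, an arrow out of \<open>W\<close> is recovered
    from its composites with \<open>i\<close> and \<open>m\<close>.\<close>
  have dec: "h = (h o (i o p)) +[W, W] (h o e)" if h: "ar C h W W" for h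
  proof -
    have "(i o p) +[W, W] e = Id C W" unfolding e_def
      using assms add_comm_arr[of "Id C W" W W "-[W, W] (i o p)"]
        add_neg_assoc[of "i o p" W W "Id C W"] by simp
    then have "h = h o ((i o p) +[W, W] e)" using h by simp
    also have "\<dots> = (h o (i o p)) +[W, W] (h o e)" using h e assms(1,2) by simp
    finally show ?thesis .
  qed
  have "is_dsum C UNIV (\<lambda>b. if b then Z else M) W (\<lambda>b. if b then i else m) (\<lambda>b. if b then p else u)"
  proof (rule is_dsumI)
    fix f g assume fg: "ar C f W W" "ar C g W W"
      "\<And>a. a \<in> UNIV \<Longrightarrow> f o (if a then i else m) = g o (if a then i else m)"
    have "f o i = g o i" "f o m = g o m" using fg(3)[of True] fg(3)[of False] by auto
    then have "f o (i o p) = g o (i o p)" "f o (m o u) = g o (m o u)"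
      using comp_eq_reassoc[of f i g i p] comp_eq_reassoc[of f m g m u] fg(1,2) m(1,2) assms(1,2) by simp_all
    then show "f = g" using dec[OF fg(1)] dec[OF fg(2)] m(4) by simp
  qed (use assms m pm ui in auto)
  then show ?thesis unfolding direct_summand_def by blast
qed

end

section \<open>Semisimple abelian categories\<close>

context abelian_category
begin

lemma simple_Obj: "simple_obj C S \<Longrightarrow> S \<in> Obj C"
  by (simp add: simple_obj_def)

text \<open>Schur's lemma. The kernel of \<open>f\<close> is a subobject of \<open>S\<close> that is
  not everything, hence zero, so \<open>f\<close> is mono; as its source is non-zero, simplicity of
  \<open>T\<close> makes it an isomorphism.\<close>

lemma simple_nonzero_iso:
  assumes S: "simple_obj C S" and T: "simple_obj C T" and f: "ar C f S T" and nz: "f \<noteq> zer S T"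
  shows "is_iso C f"
proof -
  obtain m where m: "is_kernel C f m" using kernel_exists f by blast
  note K = is_kernelD[OF m]
  have m1: "ar C m (Dom C m) S" using K f by auto
  have "\<not> is_iso C m"
  proof
    assume "is_iso C m"
    then obtain g where g: "ar C g S (Dom C m)" "m o g = Id C S"
      by (rule is_isoE[OF _ HOL.refl]) (use m1 in auto)
    have "f = (f o m) o g" using g f m1 by simp
    then show False using nz K(4) g f m1 by simp
  qed
  then have Z: "zero_obj C (Dom C m)" using S K(6) m1 by (auto simp: simple_obj_def)
  have "is_mono C f" unfolding is_mono_iff
  proof (intro conjI allI impI)
    fix W u v assume *: "ar C u W (Dom C f) \<and> ar C v W (Dom C f) \<and> f o u = f o v"
    then have t: "ar C u W S" "ar C v W S" and eq: "f o u = f o v" using f by auto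
    let ?w = "u +[W, S] (-[W, S] v)"
    have "f o ?w = zer W T" using t f eq by simp
    then obtain x where x: "ar C x W (Dom C m)" "m o x = ?w" using K(5)[of ?w W] t f by auto
    have "?w = zer W S" using to_zero_obj[OF Z x(1)] x m1 by simp
    then have "-[W, S] v = -[W, S] u" by (intro add_eq_zero_neg) (use t in auto)
    then show "u = v" using neg_neg[of u W S] neg_neg[of v W S] t by simp
  qed (use f in simp)
  then show ?thesis using T f S by (auto simp: simple_obj_def)
qed

lemma simple_hom_zero:
  "\<lbrakk>simple_obj C S; simple_obj C T; \<not> isomorphic C S T; ar C f S T\<rbrakk> \<Longrightarrow> f = zer S T"
  using simple_nonzero_iso isomorphicI by blast

text \<open>An arrow between finite direct sums is determined by its matrix entries, and
  \<open>AB\<close> kills each entry.\<close>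

lemma finite_dsums_hom_zero:
  assumes X: "X \<in> finite_dsums C A" and Y: "Y \<in> finite_dsums C B"
    and AB: "\<And>s t h. \<lbrakk>s \<in> A; t \<in> B; ar C h s t\<rbrakk> \<Longrightarrow> h = zer s t"
    and f: "ar C f X Y"
  shows "f = zer X Y"
proof -
  obtain n S i p where S: "\<forall>j < n. S j \<in> A" "is_dsum C {..<n::nat} S X i p"
    using X unfolding finite_dsums_def by blast
  obtain m T j q where T: "\<forall>j < m. T j \<in> B" "is_dsum C {..<m::nat} T Y j q"
    using Y unfolding finite_dsums_def by blast
  note D = is_dsumD[OF S(2)] and E = is_dsumD[OF T(2)]
  show ?thesis
  proof (rule dsum_epi[OF S(2) f])
    fix a assume a: "a \<in> {..<n}"
    have "f o i a = zer (S a) Y"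
    proof (rule dsum_mono[OF T(2)])
      fix b assume b: "b \<in> {..<m}"
      have "q b o (f o i a) = zer (S a) (T b)"
        using AB[of "S a" "T b" "q b o (f o i a)"] S(1) T(1) a b D(2)[OF a] E(3)[OF b] f by simp
      then show "q b o (f o i a) = q b o zer (S a) Y"
        using E(3)[OF b] D(2)[OF a] by simp
    qed (use D(2)[OF a] f in auto)
    then show "f o i a = zer X Y o i a" using D(2)[OF a] f by simp
  qed (use f in auto)
qed

lemma finite_dsums_Obj: "X \<in> finite_dsums C A \<Longrightarrow> X \<in> Obj C"
  unfolding finite_dsums_def is_dsum_def by blast

end

locale semisimple_category = abelian_category +
  assumes semisimple_C: "semisimple C"
begin

lemma simple_dsum:
  assumes "X \<in> Obj C"
  obtains n S i p where "\<And>j. j < n \<Longrightarrow> simple_obj C (S j)" "is_dsum C {..<n::nat} S X i p"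
  using semisimple_C assms unfolding semisimple_def finite_dsums_def by blast

text \<open>Some entry of \<open>f\<close> in a decomposition of \<open>Y\<close> into simple
  objects is non-zero, hence invertible by Schur's lemma; its inverse after the projection is the
  retraction.\<close>

lemma simple_arrow_retraction:
  assumes S: "simple_obj C S" and f: "ar C f S Y" and nz: "f \<noteq> zer S Y"
  obtains r where "ar C r Y S" "r o f = Id C S"
proof -
  have "Y \<in> Obj C" using f by simp
  then obtain n T j q where T: "\<And>j. j < n \<Longrightarrow> simple_obj C (T j)" "is_dsum C {..<n::nat} T Y j q"
    by (rule simple_dsum) blast
  note E = is_dsumD[OF T(2)]
  obtain b where b: "b \<in> {..<n}" "q b o f \<noteq> zer S (T b)"
  proof (rule ccontr)
    assume "\<not> thesis"
    with that have z: "q b o f = zer S (T b)" if "b \<in> {..<n}" for b using \<open>b \<in> {..<n}\<close> by blast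
    have "f = zer S Y"
      by (rule dsum_mono[OF T(2) f]) (use z f E(3) in auto)
    then show False using nz by simp
  qed
  have qf: "ar C (q b o f) S (T b)" using f E(3)[OF b(1)] by simp
  have "is_iso C (q b o f)"
    by (rule simple_nonzero_iso[OF S _ qf b(2)]) (use T(1) b in auto)
  then obtain w where w: "ar C w (T b) S" "w o (q b o f) = Id C S"
    by (rule is_isoE) (use qf in auto)
  show thesis by (rule that[of "w o q b"]) (use w f E(3)[OF b(1)] in simp_all)
qed

text \<open>Semisimplicity enters the comparison of complexes only through von Neumann regularity.\<close>

lemma regular:
  assumes "ar C f X Y"
  obtains g where "ar C g Y X" "f o g o f = f"
proof -
  have "X \<in> Obj C" using assms by simp
  then obtain n S i p where S: "\<And>j. j < n \<Longrightarrow> simple_obj C (S j)" "is_dsum C {..<n::nat} S X i p"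
    by (rule simple_dsum) blast
  note D = is_dsumD[OF S(2)]
  \<comment> \<open>Induction on a set \<open>A\<close> of simple summands outside which
    \<open>f\<close> vanishes, with \<open>f\<close> varying: one column of \<open>f\<close> is
    cleared at each step, as in Gaussian elimination.\<close>
  have "\<exists>g. ar C g Y X \<and> f o g o f = f"
    if "finite A" "A \<subseteq> {..<n}" "ar C f X Y" "\<And>a. a \<in> {..<n} - A \<Longrightarrow> f o i a = zer (S a) Y"
    for A f
    using that
  proof (induction A arbitrary: f rule: finite_induct)
    case empty
    have "f = zer X Y"
      by (rule dsum_epi[OF S(2)]) (use empty D in auto)
    then show ?case using empty by (intro exI[of _ "zer Y X"]) simp
  next
    case (insert b A)
    note f = insert.prems(2)
    have b: "b \<in> {..<n}" using insert by auto
    have ib: "ar C (i b) (S b) X" "simple_obj C (S b)" using D(2)[OF b] S(1) b by auto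
    show ?case
    proof (cases "f o i b = zer (S b) Y")
      case True
      show ?thesis by (rule insert.IH) (use insert.prems True in auto)
    next
      case False
      obtain r where r: "ar C r Y (S b)" "r o (f o i b) = Id C (S b)"
        by (rule simple_arrow_retraction[OF ib(2) _ False]) (use f ib in auto)
      \<comment> \<open>\<open>u\<close> is an idempotent of \<open>Y\<close> that fixes the column
        \<open>f o i b\<close>, because \<open>r\<close> retracts it. Hence 1 - u kills this column,
        and \<open>?k o f\<close> is covered by the induction hypothesis.\<close>
      define u where "u = f o i b o r"
      have u: "ar C u Y Y" using r f ib by (simp add: u_def)
      let ?k = "Id C Y +[Y, Y] (-[Y, Y] u)"
      have k: "ar C ?k Y Y" using u by simp
      have uf: "u o (f o i b) = f o i b" using r f ib by (simp add: u_def)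
      have "\<exists>g. ar C g Y X \<and> (?k o f) o g o (?k o f) = ?k o f"
      proof (rule insert.IH)
        show "A \<subseteq> {..<n}" using insert.prems by auto
        show "ar C (?k o f) X Y" using k f by simp
        fix a assume a: "a \<in> {..<n} - A"
        show "(?k o f) o i a = zer (S a) Y"
        proof (cases "a = b")
          case True
          then show ?thesis using f ib u uf by simp
        next
          case False
          then have "f o i a = zer (S a) Y" using insert.prems(3) a by auto
          then show ?thesis using f D(2)[of a] a u by simp
        qed
      qed
      then obtain g where g: "ar C g Y X" "(?k o f) o g o (?k o f) = ?k o f" by blast
      let ?c = "Id C X +[X, X] (-[X, X] (i b o r o f))"
      have c: "ar C ?c X X" using ib r f by simp
      have fc: "f o ?c = ?k o f" using f ib r by (simp add: u_def)
      \<comment> \<open>With c = 1 - i r f and k = 1 - u one has f c = k f. So f composed with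
        \<open>?g\<close> is u + (k f) g k, and a further f gives u f + k f = f.\<close>
      let ?g = "(i b o r) +[Y, X] (?c o g o ?k)"
      have "f o ?g = u +[Y, Y] (f o ?c o g o ?k)"
        unfolding u_def by (subst comp_add) (use f ib r g c k in \<open>simp_all add: u_def del: comp_add add_comp\<close>)
      also have "f o ?c o g o ?k = (?k o f) o g o ?k"
        using comp_eq_reassoc1[OF fc, of "g o ?k"] f g c k by (simp del: comp_add add_comp)
      finally have "(f o ?g) o f = (u o f) +[X, Y] (((?k o f) o g o ?k) o f)"
        using add_comp[of f u "(?k o f) o g o ?k" Y Y] f g u k by (simp del: comp_add add_comp)
      also have "((?k o f) o g o ?k) o f = ?k o f"
        using g f k by (simp del: comp_add add_comp)
      also have "(u o f) +[X, Y] (?k o f) = f"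
        using f u add_comm_arr[of f X Y "-[X, Y] (u o f)"] add_neg_assoc[of "u o f" X Y f] by simp
      finally have "(f o ?g) o f = f" .
      moreover have gt: "ar C ?g Y X" using ib r g c k by (simp del: comp_add add_comp)
      ultimately have "f o ?g o f = f" using f by (simp del: comp_add add_comp)
      then show ?thesis using gt by blast
    qed
  qed
  from this[of "{..<n}" f] assms that show thesis by auto
qed

end

section \<open>Homotopy of complexes\<close>

context abelian_category
begin

abbreviation bdd where "bdd \<equiv> bounded_complex C"
abbreviation ccomp where "ccomp \<equiv> chain_comp C"
abbreviation cid where "cid \<equiv> chain_id C"

lemma bounded_complexD:
  assumes "bdd K"
  shows "cobj K i \<in> Obj C" "arrow C (cdiff K i)" "Dom C (cdiff K i) = cobj K i"
    "Cod C (cdiff K i) = cobj K (i + 1)" "cdiff K (i + 1) o cdiff K i = zer (cobj K i) (cobj K (i + 2))"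
    "finite {i. \<not> zero_obj C (cobj K i)}"
proof -
  show o: "cobj K j \<in> Obj C" for j using assms by (simp add: bounded_complex_def)
  have "cdiff K i \<in> homs C (cobj K i) (cobj K (i + 1))" using assms by (simp add: bounded_complex_def)
  then show "arrow C (cdiff K i)" "Dom C (cdiff K i) = cobj K i" "Cod C (cdiff K i) = cobj K (i + 1)"
    using o by (auto simp: homs_iff)
qed (use assms in \<open>auto simp: bounded_complex_def\<close>)

lemmas cplx_simps [simp] = bounded_complexD(1-4)

lemma cdiff_cdiff:
  "bdd K \<Longrightarrow> cdiff K i o cdiff K (i - 1) = zer (cobj K (i - 1)) (cobj K (i + 1))"
  using bounded_complexD(5)[of K "i - 1"] by (simp add: algebra_simps)

lemma chain_map_iff:
  assumes "bdd K" "bdd L"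
  shows "chain_map C K L f \<longleftrightarrow> (\<forall>i. ar C (f i) (cobj K i) (cobj L i)) \<and>
    (\<forall>i. cdiff L i o f i = f (i + 1) o cdiff K i)"
  using assms by (auto simp: chain_map_def homs_iff)

lemma chain_mapD:
  assumes "chain_map C K L f" "bdd K" "bdd L"
  shows "ar C (f i) (cobj K i) (cobj L i)" "cdiff L i o f i = f (i + 1) o cdiff K i"
  using assms chain_map_iff by auto

lemma chain_map_pred:
  assumes "chain_map C K L f" "bdd K" "bdd L"
  shows "f i o cdiff K (i - 1) = cdiff L (i - 1) o f (i - 1)"
  using chain_mapD(2)[OF assms, of "i - 1"] by simp

lemma chain_map_id [simp]: "bdd K \<Longrightarrow> chain_map C K K (cid K)"
  by (auto simp: chain_map_iff chain_id_def)

lemma chain_map_comp: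
  assumes "chain_map C K L f" "chain_map C L M g" "bdd K" "bdd L" "bdd M"
  shows "chain_map C K M (ccomp g f)"
  unfolding chain_map_iff[OF assms(3,5)]
proof (intro conjI allI)
  note F = chain_mapD[OF assms(1,3,4)] and G = chain_mapD[OF assms(2,4,5)]
  fix i
  have t: "ar C (f j) (cobj K j) (cobj L j)" "ar C (g j) (cobj L j) (cobj M j)" for j
    using F(1) G(1) by auto
  show "arrow C (ccomp g f i)" "Dom C (ccomp g f i) = cobj K i"
    "Cod C (ccomp g f i) = cobj M i" "cobj K i \<in> Obj C" "cobj M i \<in> Obj C"
    using t by (simp_all add: chain_comp_def)
  have "cdiff M i o (g i o f i) = g (i + 1) o (cdiff L i o f i)"
    by (rule comp_eq_reassoc[OF G(2)]) (use t assms in simp_all)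
  then show "cdiff M i o ccomp g f i = ccomp g f (i + 1) o cdiff K i"
    using t assms by (simp add: chain_comp_def F(2))
qed

lemma chain_comp_assoc:
  assumes "chain_map C J K f" "chain_map C K L g" "chain_map C L M h"
    "bdd J" "bdd K" "bdd L" "bdd M"
  shows "ccomp (ccomp h g) f = ccomp h (ccomp g f)"
  using chain_mapD(1)[OF assms(1,4,5)] chain_mapD(1)[OF assms(2,5,6)] chain_mapD(1)[OF assms(3,6,7)]
  by (auto simp: chain_comp_def)

lemma chain_comp_id [simp]:
  assumes "chain_map C K L f" "bdd K" "bdd L"
  shows "ccomp f (cid K) = f" "ccomp (cid L) f = f"
  using chain_mapD(1)[OF assms] by (auto simp: chain_comp_def chain_id_def)

text \<open>The differential of \<open>h\<close>, taken as an element of degree -1, in the Hom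
  complex from \<open>K\<close> to \<open>L\<close>.\<close>

definition boundary where
   "boundary K L h i =
    (cdiff L (i - 1) o h i) +[cobj K i, cobj L i] (h (i + 1) o cdiff K i)"

text \<open>Only the typing of a family of degree -1. In spite of the name no equation with the
  differentials is imposed.\<close>

definition contraction where
   "contraction K L h \<longleftrightarrow> (\<forall>i. ar C (h i) (cobj K i) (cobj L (i - 1)))"

lemma boundary_ar:
  assumes "contraction K L h" "bdd K" "bdd L"
  shows "ar C (boundary K L h i) (cobj K i) (cobj L i)"
proof -
  have "ar C (h j) (cobj K j) (cobj L (j - 1))" for j using assms by (simp add: contraction_def)
  from this[of i] this[of "i + 1"] show ?thesis using assms(2,3) by (simp add: boundary_def)
qed

text \<open>Moving the subtracted map to the other side turns homotopies into equations between
  sums, so that reflexivity, transitivity and additivity become reassociation of sums.\<close>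

lemma homotopic_iff:
  assumes "bdd K" "bdd L"
    "\<And>i. ar C (f i) (cobj K i) (cobj L i)" "\<And>i. ar C (g i) (cobj K i) (cobj L i)"
  shows "homotopic C K L f g \<longleftrightarrow> (\<exists>h. contraction K L h \<and>
    (\<forall>i. f i = g i +[cobj K i, cobj L i] boundary K L h i))"
proof -
  have "(\<forall>i. h i \<in> homs C (cobj K i) (cobj L (i - 1))) \<longleftrightarrow> contraction K L h" for h
    using assms by (auto simp: contraction_def homs_iff)
  moreover have "f i \<ominus>\<^bsub>Hom C (cobj K i) (cobj L i)\<^esub> g i = boundary K L h i \<longleftrightarrow>
      f i = g i +[cobj K i, cobj L i] boundary K L h i" if "contraction K L h" for h i
    using assms boundary_ar[OF that assms(1,2)] by (intro diff_eq_iff) auto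
  ultimately show ?thesis unfolding homotopic_def boundary_def[symmetric] by metis
qed

lemma homotopicI:
  assumes "bdd K" "bdd L"
    "\<And>i. ar C (f i) (cobj K i) (cobj L i)" "\<And>i. ar C (g i) (cobj K i) (cobj L i)"
    "contraction K L h" "\<And>i. f i = g i +[cobj K i, cobj L i] boundary K L h i"
  shows "homotopic C K L f g"
  using homotopic_iff[OF assms(1-4)] assms(5,6) by blast

lemma homotopicE:
  assumes "homotopic C K L f g" "bdd K" "bdd L"
    "\<And>i. ar C (f i) (cobj K i) (cobj L i)" "\<And>i. ar C (g i) (cobj K i) (cobj L i)"
  obtains h where "\<And>i. ar C (h i) (cobj K i) (cobj L (i - 1))" "contraction K L h"
    "\<And>i. f i = g i +[cobj K i, cobj L i] boundary K L h i"
  using homotopic_iff[OF assms(2-5)] assms(1) unfolding contraction_def by blast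

lemma homotopic_refl:
  assumes "bdd K" "bdd L" "chain_map C K L f"
  shows "homotopic C K L f f"
proof (rule homotopicI)
  show "contraction K L (\<lambda>i. zer (cobj K i) (cobj L (i - 1)))"
    using assms by (simp add: contraction_def)
  show "f i = f i +[cobj K i, cobj L i] boundary K L (\<lambda>i. zer (cobj K i) (cobj L (i - 1))) i" for i
    using chain_mapD(1)[OF assms(3,1,2)] assms by (simp add: boundary_def)
qed (use assms chain_mapD(1)[OF assms(3,1,2)] in auto)

lemma homotopic_sym:
  assumes "homotopic C K L f g" "bdd K" "bdd L" "chain_map C K L f" "chain_map C K L g"
  shows "homotopic C K L g f"
proof -
  note F = chain_mapD(1)[OF assms(4,2,3)] and G = chain_mapD(1)[OF assms(5,2,3)]
  obtain h where h: "\<And>i. ar C (h i) (cobj K i) (cobj L (i - 1))" "contraction K L h"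
    "\<And>i. f i = g i +[cobj K i, cobj L i] boundary K L h i"
    by (rule homotopicE[OF assms(1-3) F G]) blast
  let ?h = "\<lambda>i. \<ominus>\<^bsub>Hom C (cobj K i) (cobj L (i - 1))\<^esub> (h i)"
  have h1: "ar C (h (i + 1)) (cobj K (i + 1)) (cobj L i)" for i using h(1)[of "i + 1"] by simp
  have b: "boundary K L ?h i = -[cobj K i, cobj L i] (boundary K L h i)" for i
    unfolding boundary_def using h(1)[of i] h1 assms(2,3) by (subst neg_add_arr) auto
  show ?thesis
  proof (rule homotopicI[OF assms(2,3) G F])
    show "contraction K L ?h" using h(1) by (simp add: contraction_def)
    have B: "ar C (boundary K L h i) (cobj K i) (cobj L i)" for i using boundary_ar[OF h(2) assms(2,3)] .
    show "g i = f i +[cobj K i, cobj L i] boundary K L ?h i" for i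
      unfolding b h(3)[of i] using G[of i] B[of i] by (subst add_assoc_arr) auto
  qed
qed

lemma boundary_add:
  assumes "bdd K" "bdd L" "contraction K L h" "contraction K L h'"
  shows "boundary K L (\<lambda>i. h i +[cobj K i, cobj L (i - 1)] h' i) i =
      boundary K L h i +[cobj K i, cobj L i] boundary K L h' i"
    and "contraction K L (\<lambda>i. h i +[cobj K i, cobj L (i - 1)] h' i)"
proof -
  have h: "ar C (h i) (cobj K i) (cobj L (i - 1))" "ar C (h' i) (cobj K i) (cobj L (i - 1))"
    "ar C (h (i+1)) (cobj K (i+1)) (cobj L i)" "ar C (h' (i+1)) (cobj K (i+1)) (cobj L i)" for i
    using assms(3,4) unfolding contraction_def by (metis add_diff_cancel_right')+
  show "contraction K L (\<lambda>i. h i +[cobj K i, cobj L (i - 1)] h' i)"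
    unfolding contraction_def using h by simp
  show "boundary K L (\<lambda>i. h i +[cobj K i, cobj L (i - 1)] h' i) i =
      boundary K L h i +[cobj K i, cobj L i] boundary K L h' i"
  proof -
    let ?a = "cdiff L (i - 1) o h i" and ?b = "cdiff L (i - 1) o h' i"
      and ?c = "h (i + 1) o cdiff K i" and ?d = "h' (i + 1) o cdiff K i"
    have t: "ar C ?a (cobj K i) (cobj L i)" "ar C ?b (cobj K i) (cobj L i)"
      "ar C ?c (cobj K i) (cobj L i)" "ar C ?d (cobj K i) (cobj L i)"
      using h[of i] assms(1,2) by simp_all
    show ?thesis unfolding boundary_def using h[of i] assms(1,2) t add_lcomm_arr[OF t(2,3,4)]
      by (simp add: add_assoc_arr)
  qed
qed

lemma homotopic_trans:
  assumes "homotopic C K L f g" "homotopic C K L g h" "bdd K" "bdd L"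
    "chain_map C K L f" "chain_map C K L g" "chain_map C K L h"
  shows "homotopic C K L f h"
proof -
  note F = chain_mapD(1)[OF assms(5,3,4)] and G = chain_mapD(1)[OF assms(6,3,4)] and H = chain_mapD(1)[OF assms(7,3,4)]
  obtain a where a: "contraction K L a" "\<And>i. f i = g i +[cobj K i, cobj L i] boundary K L a i"
    by (rule homotopicE[OF assms(1,3,4) F G]) blast
  obtain b where b: "contraction K L b" "\<And>i. g i = h i +[cobj K i, cobj L i] boundary K L b i"
    by (rule homotopicE[OF assms(2,3,4) G H]) blast
  note B = boundary_add[OF assms(3,4) b(1) a(1)]
  show ?thesis
  proof (rule homotopicI[OF assms(3,4) F H B(2)])
    fix i
    show "f i = h i +[cobj K i, cobj L i]
        boundary K L (\<lambda>i. b i +[cobj K i, cobj L (i - 1)] a i) i"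
      unfolding B(1) a(2)[of i] b(2)[of i]
      by (rule add_assoc_arr[OF H boundary_ar[OF b(1) assms(3,4)] boundary_ar[OF a(1) assms(3,4)]])
  qed
qed

text \<open>A chain map commutes with \<open>boundary\<close>: the family
  \<open>u (i - 1) o h i\<close> has boundary u (d h + h d).\<close>

lemma homotopic_comp_left:
  assumes "homotopic C K L f g" "chain_map C L M u" "chain_map C K L f" "chain_map C K L g"
    "bdd K" "bdd L" "bdd M"
  shows "homotopic C K M (ccomp u f) (ccomp u g)"
proof -
  note F = chain_mapD(1)[OF assms(3,5,6)] and G = chain_mapD(1)[OF assms(4,5,6)] and M = chain_mapD(1)[OF assms(2,6,7)]
  obtain h where h: "\<And>i. ar C (h i) (cobj K i) (cobj L (i - 1))" "contraction K L h"
    "\<And>i. f i = g i +[cobj K i, cobj L i] boundary K L h i"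
    by (rule homotopicE[OF assms(1,5,6) F G]) blast
  have h1: "ar C (h (i + 1)) (cobj K (i + 1)) (cobj L i)" for i using h(1)[of "i + 1"] by simp
  have eq: "u i o cdiff L (i - 1) = cdiff M (i - 1) o u (i - 1)" for i
    using chain_map_pred[OF assms(2,6,7)] .
  show ?thesis
  proof (rule homotopicI)
    show "contraction K M (\<lambda>i. u (i - 1) o h i)" using h(1) M by (simp add: contraction_def)
    fix i
    have "u i o (cdiff L (i - 1) o h i) = cdiff M (i - 1) o (u (i - 1) o h i)"
      by (rule comp_eq_reassoc[OF eq]) (use h(1)[of i] M[of i] M[of "i - 1"] assms in auto)
    then show "ccomp u f i = ccomp u g i +[cobj K i, cobj M i]
      boundary K M (\<lambda>i. u (i - 1) o h i) i"
      using h(1)[of i] h1[of i] G[of i] M[of i] assms(5-7) by (simp add: chain_comp_def h(3) boundary_def)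
  qed (use assms F G M in \<open>auto simp: chain_comp_def\<close>)
qed

lemma homotopic_comp_right:
  assumes "homotopic C K L f g" "chain_map C J K u" "chain_map C K L f" "chain_map C K L g"
    "bdd K" "bdd L" "bdd J"
  shows "homotopic C J L (ccomp f u) (ccomp g u)"
proof -
  note F = chain_mapD(1)[OF assms(3,5,6)] and G = chain_mapD(1)[OF assms(4,5,6)] and M = chain_mapD(1)[OF assms(2,7,5)]
  obtain h where h: "\<And>i. ar C (h i) (cobj K i) (cobj L (i - 1))" "contraction K L h"
    "\<And>i. f i = g i +[cobj K i, cobj L i] boundary K L h i"
    by (rule homotopicE[OF assms(1,5,6) F G]) blast
  have h1: "ar C (h (i + 1)) (cobj K (i + 1)) (cobj L i)" for i using h(1)[of "i + 1"] by simp
  show ?thesis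
  proof (rule homotopicI)
    show "contraction J L (\<lambda>i. h i o u i)" using h(1) M by (simp add: contraction_def)
    fix i
    have "cdiff K i o u i = u (i + 1) o cdiff J i" using chain_mapD(2)[OF assms(2,7,5)] .
    then show "ccomp f u i = ccomp g u i +[cobj J i, cobj L i]
      boundary J L (\<lambda>i. h i o u i) i"
      using h(1)[of i] h1[of i] G[of i] M[of i] M[of "i + 1"] assms(5-7)
      by (simp add: chain_comp_def h(3) boundary_def)
  qed (use assms F G M in \<open>auto simp: chain_comp_def\<close>)
qed

lemma chain_map_add:
  assumes "chain_map C K L f" "chain_map C K L g" "bdd K" "bdd L"
  shows "chain_map C K L (\<lambda>i. f i +[cobj K i, cobj L i] g i)"
  using chain_mapD[OF assms(1,3,4)] chain_mapD[OF assms(2,3,4)] assms(3,4)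
  by (simp add: chain_map_iff)

lemma homotopic_add:
  assumes "homotopic C K L f f'" "homotopic C K L g g'" "chain_map C K L f" "chain_map C K L f'"
    "chain_map C K L g" "chain_map C K L g'" "bdd K" "bdd L"
  shows "homotopic C K L (\<lambda>i. f i +[cobj K i, cobj L i] g i)
    (\<lambda>i. f' i +[cobj K i, cobj L i] g' i)"
proof -
  note F = chain_mapD(1)[OF assms(3,7,8)] chain_mapD(1)[OF assms(4,7,8)]
    chain_mapD(1)[OF assms(5,7,8)] chain_mapD(1)[OF assms(6,7,8)]
  obtain a where a: "contraction K L a" "\<And>i. f i = f' i +[cobj K i, cobj L i] boundary K L a i"
    by (rule homotopicE[OF assms(1,7,8) F(1,2)]) blast
  obtain b where b: "contraction K L b" "\<And>i. g i = g' i +[cobj K i, cobj L i] boundary K L b i"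
    by (rule homotopicE[OF assms(2,7,8) F(3,4)]) blast
  note B = boundary_add[OF assms(7,8) a(1) b(1)]
  have t: "ar C (boundary K L a i) (cobj K i) (cobj L i)" "ar C (boundary K L b i) (cobj K i) (cobj L i)" for i
    using boundary_ar[OF a(1) assms(7,8)] boundary_ar[OF b(1) assms(7,8)] by auto
  show ?thesis
  proof (rule homotopicI[OF assms(7,8) _ _ B(2)])
    fix i
    show "f i +[cobj K i, cobj L i] g i = (f' i +[cobj K i, cobj L i] g' i)
        +[cobj K i, cobj L i]
        boundary K L (\<lambda>i. a i +[cobj K i, cobj L (i - 1)] b i) i"
      unfolding B(1) a(2)[of i] b(2)[of i] using F(2,4)[of i] t[of i]
        add_lcomm_arr[of "g' i" "cobj K i" "cobj L i" "boundary K L a i" "boundary K L b i"]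
      by (simp add: add_assoc_arr)
  qed (use F in auto)
qed

lemma chain_map_smult:
  assumes "chain_map C K L f" "bdd K" "bdd L" "c \<in> carrier k"
  shows "chain_map C K L (\<lambda>i. c \<odot>\<^bsub>Hom C (cobj K i) (cobj L i)\<^esub> f i)"
  using chain_mapD[OF assms(1-3)] assms(2-4) by (simp add: chain_map_iff)

lemma smult_add_arr:
  "\<lbrakk>c \<in> carrier k; ar C f X Y; ar C g X Y\<rbrakk> \<Longrightarrow>
    c \<odot>\<^bsub>Hom C X Y\<^esub> (f +[X, Y] g) = (c \<odot>\<^bsub>Hom C X Y\<^esub> f) +[X, Y] (c \<odot>\<^bsub>Hom C X Y\<^esub> g)"
  using module.smult_r_distr[OF hom_module, of X Y c f g] by (simp add: homs_iff)

lemma homotopic_smult: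
  assumes "homotopic C K L f f'" "chain_map C K L f" "chain_map C K L f'"
    "bdd K" "bdd L" "c \<in> carrier k"
  shows "homotopic C K L (\<lambda>i. c \<odot>\<^bsub>Hom C (cobj K i) (cobj L i)\<^esub> f i) (\<lambda>i. c \<odot>\<^bsub>Hom C (cobj K i) (cobj L i)\<^esub> f' i)"
proof -
  note F = chain_mapD(1)[OF assms(2,4,5)] chain_mapD(1)[OF assms(3,4,5)]
  obtain h where h: "\<And>i. ar C (h i) (cobj K i) (cobj L (i - 1))" "contraction K L h"
    "\<And>i. f i = f' i +[cobj K i, cobj L i] boundary K L h i"
    by (rule homotopicE[OF assms(1,4,5) F(1,2)]) blast
  have h1: "ar C (h (i + 1)) (cobj K (i + 1)) (cobj L i)" for i using h(1)[of "i + 1"] by simp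
  let ?h = "\<lambda>i. c \<odot>\<^bsub>Hom C (cobj K i) (cobj L (i - 1))\<^esub> h i"
  show ?thesis
  proof (rule homotopicI)
    show "contraction K L ?h" using h(1) assms(6) by (simp add: contraction_def)
    show "c \<odot>\<^bsub>Hom C (cobj K i) (cobj L i)\<^esub> f i = (c \<odot>\<^bsub>Hom C (cobj K i) (cobj L i)\<^esub> f' i)
      +[cobj K i, cobj L i] boundary K L ?h i" for i
      unfolding h(3)[of i] boundary_def using h(1)[of i] h1[of i] F(2)[of i] assms(4-6)
      by (simp add: smult_add_arr)
  qed (use assms F in auto)
qed

section \<open>Maps induced on cohomology\<close>

definition homotopy_equivalence where
   "homotopy_equivalence K L f g \<longleftrightarrow> chain_map C K L f \<and> chain_map C L K g \<and>
    homotopic C K K (ccomp g f) (cid K) \<and> homotopic C L L (ccomp f g) (cid L)"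

lemma is_cohomologyD:
  assumes "is_cohomology C K i z q" "bdd K"
  shows "ar C z (Dom C z) (cobj K i)" "cdiff K i o z = zer (Dom C z) (cobj K (i + 1))"
    "is_mono C z" "ar C q (Dom C z) (Cod C q)" "is_epi C q"
    "\<And>T t. \<lbrakk>ar C t T (cobj K i); cdiff K i o t = zer T (cobj K (i + 1))\<rbrakk>
      \<Longrightarrow> \<exists>u. ar C u T (Dom C z) \<and> z o u = t"
    "\<exists>b. ar C b (cobj K (i - 1)) (Dom C z) \<and> z o b = cdiff K (i - 1) \<and>
      q o b = zer (cobj K (i - 1)) (Cod C q) \<and>
      (\<forall>t T. ar C t (Dom C z) T \<and> t o b = zer (cobj K (i - 1)) T \<longrightarrow>
        (\<exists>u. ar C u (Cod C q) T \<and> u o q = t))"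
proof -
  have k: "is_kernel C (cdiff K i) z" using assms by (simp add: is_cohomology_def)
  note Z = is_kernelD[OF k]
  show z: "ar C z (Dom C z) (cobj K i)" "cdiff K i o z = zer (Dom C z) (cobj K (i + 1))" "is_mono C z"
    "\<And>T t. \<lbrakk>ar C t T (cobj K i); cdiff K i o t = zer T (cobj K (i + 1))\<rbrakk>
      \<Longrightarrow> \<exists>u. ar C u T (Dom C z) \<and> z o u = t"
    using Z assms(2) by auto
  obtain b where b: "b \<in> homs C (cobj K (i - 1)) (Dom C z)" "z o b = cdiff K (i - 1)" "is_cokernel C b q"
    using assms by (auto simp: is_cohomology_def)
  have b1: "ar C b (cobj K (i - 1)) (Dom C z)"
    using b(1) z(1) assms(2) homs_iff[of "cobj K (i - 1)" "Dom C z" b] by simp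
  note Q = is_cokernelD[OF b(3)]
  show "ar C q (Dom C z) (Cod C q)" "is_epi C q" using Q b1 by auto
  show "\<exists>b. ar C b (cobj K (i - 1)) (Dom C z) \<and> z o b = cdiff K (i - 1) \<and>
      q o b = zer (cobj K (i - 1)) (Cod C q) \<and>
      (\<forall>t T. ar C t (Dom C z) T \<and> t o b = zer (cobj K (i - 1)) T \<longrightarrow>
        (\<exists>u. ar C u (Cod C q) T \<and> u o q = t))"
    using b1 b(2) Q(4,5) by (intro exI[of _ b]) auto
qed

lemma cohomology_exists:
  assumes K: "bdd K"
  shows "\<exists>z q. is_cohomology C K i z q"
proof -
  obtain z where z: "is_kernel C (cdiff K i) z" using has_kernels[of "cdiff K i"] K by auto
  note Z = is_kernelD[OF z]
  have zt: "ar C z (Dom C z) (cobj K i)" using Z K by auto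
  obtain b where b: "ar C b (cobj K (i - 1)) (Dom C z)" "z o b = cdiff K (i - 1)"
    using Z(5)[of "cdiff K (i - 1)" "cobj K (i - 1)"] K cdiff_cdiff[OF K, of i] by auto
  obtain q where "is_cokernel C b q" using has_cokernels b by blast
  then have "is_cohomology C K i z q" unfolding is_cohomology_def
    using z b zt K homs_iff[of "cobj K (i - 1)" "Dom C z" b] by auto
  then show ?thesis by blast
qed

text \<open>A relation instead of a function: the cocycles and the cohomology object are given by
  any kernel \<open>z\<close> and cokernel \<open>q\<close>, and none is chosen.\<close>

definition induced_on_cohomology where
  "induced_on_cohomology z q z' q' \<phi> h \<longleftrightarrow> (\<exists>a. ar C a (Dom C z) (Dom C z') \<and> z' o a = \<phi> o z \<and>
    ar C h (Cod C q) (Cod C q') \<and> h o q = q' o a)"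

lemma induced_on_cohomology_exists:
  assumes K: "bdd K" and L: "bdd L" and f: "chain_map C K L f"
    and z: "is_cohomology C K i z q" and z': "is_cohomology C L i z' q'"
  shows "\<exists>h. induced_on_cohomology z q z' q' (f i) h"
proof -
  note F = chain_mapD[OF f K L] and Z = is_cohomologyD[OF z K] and Z' = is_cohomologyD[OF z' L]
  obtain b where b: "ar C b (cobj K (i - 1)) (Dom C z)" "z o b = cdiff K (i - 1)"
      "\<And>t T. ar C t (Dom C z) T \<Longrightarrow> t o b = zer (cobj K (i - 1)) T \<Longrightarrow>
        (\<exists>u. ar C u (Cod C q) T \<and> u o q = t)" using Z(7) by blast
  obtain b' where b': "ar C b' (cobj L (i - 1)) (Dom C z')" "z' o b' = cdiff L (i - 1)"
    "q' o b' = zer (cobj L (i - 1)) (Cod C q')" using Z'(7) by blast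
  have "cdiff L i o (f i o z) = f (i + 1) o (cdiff K i o z)"
    by (rule comp_eq_reassoc[OF F(2)]) (use F(1)[of i] F(1)[of "i + 1"] Z(1) K L in simp_all)
  then obtain a where a: "ar C a (Dom C z) (Dom C z')" "z' o a = f i o z"
    using Z'(6)[of "f i o z" "Dom C z"] Z(1,2) F(1)[of i] F(1)[of "i + 1"] K L by auto
  \<comment> \<open>Boundaries go to boundaries. As \<open>z'\<close> is mono this may be checked in
    \<open>L\<close>, where it is the chain map equation of \<open>f\<close>; afterwards
    \<open>q' o a\<close> factors through the cokernel \<open>q\<close>.\<close>
  have "a o b = b' o f (i - 1)"
  proof (rule monoD[OF Z'(3)])
    show "ar C (a o b) (cobj K (i - 1)) (Dom C z')" "ar C (b' o f (i - 1)) (cobj K (i - 1)) (Dom C z')"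
      using a b b' F(1)[of "i - 1"] by simp_all
    have "z' o (a o b) = f i o (z o b)"
      by (rule comp_eq_reassoc[OF a(2)]) (use a Z(1) Z'(1) b F(1)[of i] in simp_all)
    also have "\<dots> = cdiff L (i - 1) o f (i - 1)" unfolding b(2) by (rule chain_map_pred[OF f K L])
    also have "\<dots> = z' o (b' o f (i - 1))"
      by (rule comp_eq_reassoc1[OF b'(2), symmetric]) (use Z'(1) b' F(1)[of "i - 1"] in simp_all)
    finally show "z' o (a o b) = z' o (b' o f (i - 1))" .
  qed
  then have "(q' o a) o b = zer (cobj K (i - 1)) (Cod C q')"
    using comp_eq_reassoc1[OF b'(3), of "f (i - 1)"] F(1)[of "i - 1"] a b b' Z'(4) by simp
  then obtain h where "ar C h (Cod C q) (Cod C q')" "h o q = q' o a"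
    using b(3)[of "q' o a" "Cod C q'"] a Z'(4) by auto
  then show ?thesis unfolding induced_on_cohomology_def using a by blast
qed

text \<open>On cocycles the summand h d vanishes, while d h takes values in boundaries, which
  \<open>q'\<close> kills. The case of a map homotopic to itself gives uniqueness of the induced
  arrow.\<close>

lemma induced_on_cohomology_homotopic:
  assumes K: "bdd K" and L: "bdd L"
    and f: "chain_map C K L f" and g: "chain_map C K L g" and fg: "homotopic C K L f g"
    and z: "is_cohomology C K i z q" and z': "is_cohomology C L i z' q'"
    and hf: "induced_on_cohomology z q z' q' (f i) hf" and hg: "induced_on_cohomology z q z' q' (g i) hg"
  shows "hf = hg"
proof -
  note F = chain_mapD(1)[OF f K L] and G = chain_mapD(1)[OF g K L]
  note Z = is_cohomologyD[OF z K] and Z' = is_cohomologyD[OF z' L]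
  obtain b' where b': "ar C b' (cobj L (i - 1)) (Dom C z')" "z' o b' = cdiff L (i - 1)"
    "q' o b' = zer (cobj L (i - 1)) (Cod C q')" using Z'(7) by blast
  obtain h where h: "\<And>i. ar C (h i) (cobj K i) (cobj L (i - 1))"
    "\<And>i. f i = g i +[cobj K i, cobj L i] boundary K L h i"
    by (rule homotopicE[OF fg K L F G]) blast
  obtain a where a: "ar C a (Dom C z) (Dom C z')" "z' o a = f i o z"
    "ar C hf (Cod C q) (Cod C q')" "hf o q = q' o a" using hf unfolding induced_on_cohomology_def by blast
  obtain c where c: "ar C c (Dom C z) (Dom C z')" "z' o c = g i o z"
    "ar C hg (Cod C q) (Cod C q')" "hg o q = q' o c" using hg unfolding induced_on_cohomology_def by blast
  have h1: "ar C (h (i + 1)) (cobj K (i + 1)) (cobj L i)" using h(1)[of "i + 1"] by simp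
  \<comment> \<open>The part d h of the homotopy on cocycles, lifted through \<open>z'\<close> to
    the arrow \<open>b'\<close> that presents the boundaries.\<close>
  let ?y = "b' o (h i o z)"
  have y: "ar C ?y (Dom C z) (Dom C z')" using b' h(1)[of i] Z(1) by simp
  have "a = c +[Dom C z, Dom C z'] ?y"
  proof (rule monoD[OF Z'(3) a(1)])
    show "ar C (c +[Dom C z, Dom C z'] ?y) (Dom C z) (Dom C z')" using c(1) y by simp
    have "z' o ?y = cdiff L (i - 1) o (h i o z)"
      by (rule comp_eq_reassoc1[OF b'(2)]) (use Z'(1) b' h(1)[of i] Z(1) in simp_all)
    moreover have "boundary K L h i o z = cdiff L (i - 1) o (h i o z)"
      unfolding boundary_def using h(1)[of i] h1 Z(1,2) K L by simp
    moreover have "ar C (boundary K L h i) (cobj K i) (cobj L i)"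
      using boundary_ar[OF _ K L, of h] h(1) L by (simp add: contraction_def)
    ultimately show "z' o a = z' o (c +[Dom C z, Dom C z'] ?y)"
      unfolding a(2) h(2)[of i] using c(1,2) y Z'(1) Z(1) G[of i] by simp
  qed
  then have "q' o a = q' o c" using Z'(4) c(1) y b'(3) comp_eq_reassoc1[OF b'(3), of "h i o z"] b' h(1)[of i] Z(1)
    by simp
  then have "hf o q = hg o q" using a c by simp
  then show ?thesis by (rule epiD[OF Z(5), rotated 2]) (use a c in auto)
qed

lemma induced_on_cohomology_comp:
  assumes K: "bdd K" and L: "bdd L" and M: "bdd M"
    and f: "chain_map C K L f" and g: "chain_map C L M g"
    and z: "is_cohomology C K i z q" and z': "is_cohomology C L i z' q'" and z'': "is_cohomology C M i z'' q''"
    and hf: "induced_on_cohomology z q z' q' (f i) hf" and hg: "induced_on_cohomology z' q' z'' q'' (g i) hg"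
  shows "induced_on_cohomology z q z'' q'' (ccomp g f i) (hg o hf)"
proof -
  note F = chain_mapD(1)[OF f K L] and G = chain_mapD(1)[OF g L M]
  note Z = is_cohomologyD[OF z K] and Z' = is_cohomologyD[OF z' L] and Z'' = is_cohomologyD[OF z'' M]
  obtain a where a: "ar C a (Dom C z) (Dom C z')" "z' o a = f i o z"
    "ar C hf (Cod C q) (Cod C q')" "hf o q = q' o a" using hf unfolding induced_on_cohomology_def by blast
  obtain c where c: "ar C c (Dom C z') (Dom C z'')" "z'' o c = g i o z'"
    "ar C hg (Cod C q') (Cod C q'')" "hg o q' = q'' o c" using hg unfolding induced_on_cohomology_def by blast
  show ?thesis unfolding induced_on_cohomology_def
  proof (intro exI[of _ "c o a"] conjI)
    have "z'' o (c o a) = g i o (z' o a)"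
      by (rule comp_eq_reassoc[OF c(2)]) (use c a Z' Z'' G[of i] in simp_all)
    then show "z'' o (c o a) = ccomp g f i o z"
      using a(2) F[of i] G[of i] Z(1) by (simp add: chain_comp_def)
    have "hg o (q' o a) = q'' o (c o a)"
      by (rule comp_eq_reassoc[OF c(4)]) (use c a Z' Z'' in simp_all)
    then show "(hg o hf) o q = q'' o (c o a)" using a c Z(4) by simp
  qed (use a c in simp_all)
qed

text \<open>By functoriality and homotopy invariance of induced maps, \<open>f\<close> and
  \<open>g\<close> induce mutually inverse arrows on cohomology. This direction holds in every
  abelian category.\<close>

lemma homotopy_equivalence_quasi_iso:
  assumes K: "bdd K" and L: "bdd L" and fg: "homotopy_equivalence K L f g"
  shows "quasi_iso C K L f"
proof -
  have f: "chain_map C K L f" and g: "chain_map C L K g"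
    and gf: "homotopic C K K (ccomp g f) (cid K)"
    and fg: "homotopic C L L (ccomp f g) (cid L)"
    using fg by (auto simp: homotopy_equivalence_def)
  have id: "induced_on_cohomology z q z q (cid M i) (Id C (Cod C q))"
    if "bdd M" "is_cohomology C M i z q" for M i z q
    using is_cohomologyD[OF that(2,1)] unfolding induced_on_cohomology_def
    by (intro exI[of _ "Id C (Dom C z)"]) (simp add: chain_id_def)
  show ?thesis unfolding quasi_iso_def
  proof (intro conjI allI)
    fix i
    obtain z q where z: "is_cohomology C K i z q" using cohomology_exists[OF K] by blast
    obtain z' q' where z': "is_cohomology C L i z' q'" using cohomology_exists[OF L] by blast
    obtain h where h: "induced_on_cohomology z q z' q' (f i) h"
      using induced_on_cohomology_exists[OF K L f z z'] by blast
    obtain h' where h': "induced_on_cohomology z' q' z q (g i) h'"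
      using induced_on_cohomology_exists[OF L K g z' z] by blast
    have "h' o h = Id C (Cod C q)"
      by (rule induced_on_cohomology_homotopic[OF K K chain_map_comp[OF f g K L K] chain_map_id[OF K] gf z z
        induced_on_cohomology_comp[OF K L K f g z z' z h h'] id[OF K z]])
    moreover have "h o h' = Id C (Cod C q')"
      by (rule induced_on_cohomology_homotopic[OF L L chain_map_comp[OF g f L K L] chain_map_id[OF L] fg z' z'
        induced_on_cohomology_comp[OF L K L g f z' z z' h' h] id[OF L z']])
    moreover obtain a where a: "ar C a (Dom C z) (Dom C z')" "z' o a = f i o z" "h o q = q' o a"
      "ar C h (Cod C q) (Cod C q')" using h unfolding induced_on_cohomology_def by blast
    moreover have "ar C h' (Cod C q') (Cod C q)" using h' unfolding induced_on_cohomology_def by blast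
    ultimately have "is_iso C h" by (intro is_isoI[of h "Cod C q" "Cod C q'" h']) auto
    then show "\<exists>z q z' q' a h. is_cohomology C K i z q \<and> is_cohomology C L i z' q' \<and>
      a \<in> homs C (Dom C z) (Dom C z') \<and> z' o a = f i o z \<and>
      h \<in> homs C (Cod C q) (Cod C q') \<and> h o q = q' o a \<and> is_iso C h"
      using z z' a homs_iff[of "Dom C z" "Dom C z'" a] homs_iff[of "Cod C q" "Cod C q'" h] by blast
  qed (rule f)
qed

end

section \<open>Splitting of complexes in a semisimple category\<close>

context semisimple_category
begin

text \<open>With \<open>d g d = d\<close>, the endomorphism \<open>e = 1 - d g - g d\<close> is homotopic to the identity and
  is killed by the differential on both sides.\<close>

lemma minimal_endomorphism:
  assumes K: "bdd K"
  obtains e where "chain_map C K K e" "homotopic C K K e (cid K)"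
    "\<And>i. cdiff K i o e i = zer (cobj K i) (cobj K (i + 1))"
    "\<And>i. e i o cdiff K (i - 1) = zer (cobj K (i - 1)) (cobj K i)"
    "\<And>i T x. \<lbrakk>ar C x T (cobj K i); cdiff K i o x = zer T (cobj K (i + 1))\<rbrakk> \<Longrightarrow>
      \<exists>y. ar C y T (cobj K (i - 1)) \<and> x = (e i o x) +[T, cobj K i] (cdiff K (i - 1) o y)"
proof -
  have "\<exists>g. ar C g (cobj K (i + 1)) (cobj K i) \<and> cdiff K i o g o cdiff K i = cdiff K i" for i
    using regular[of "cdiff K i" "cobj K i" "cobj K (i + 1)"] K by simp metis
  then obtain g where g: "\<And>i. ar C (g i) (cobj K (i + 1)) (cobj K i)"
    "\<And>i. cdiff K i o g i o cdiff K i = cdiff K i" by metis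
  \<comment> \<open>The generalised inverse of the differential leaving degree i starts in degree i
    + 1; the shift of index turns it into a family of degree -1.\<close>
  define h where "h i = g (i - 1)" for i
  have h: "ar C (h i) (cobj K i) (cobj K (i - 1))" for i using g(1)[of "i - 1"] by (simp add: h_def)
  have h1: "ar C (h (i + 1)) (cobj K (i + 1)) (cobj K i)" for i using g(1)[of i] by (simp add: h_def)
  have dhd: "cdiff K i o h (i + 1) o cdiff K i = cdiff K i" for i using g(2)[of i] by (simp add: h_def)
  have dhd': "cdiff K (i - 1) o h i o cdiff K (i - 1) = cdiff K (i - 1)" for i using g(2)[of "i - 1"] by (simp add: h_def)
  have c: "contraction K K h" using h by (simp add: contraction_def)
  note B = boundary_ar[OF c K K]
  \<comment> \<open>As d d = 0, only d h d = d survives in d (d h + h d), and symmetrically on the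
    other side in \<open>bd\<close>; so 1 minus the boundary is annihilated on both sides.\<close>
  have db: "cdiff K i o boundary K K h i = cdiff K i" for i
    unfolding boundary_def using h[of i] h1[of i] K dhd[of i]
      comp_eq_reassoc1[OF cdiff_cdiff[OF K, of i], of "h i"] by simp
  have bd: "boundary K K h i o cdiff K (i - 1) = cdiff K (i - 1)" for i
    unfolding boundary_def using h[of i] h1[of i] K dhd'[of i] cdiff_cdiff[OF K, of i] by simp
  define e where "e i = Id C (cobj K i) +[cobj K i, cobj K i]
    (-[cobj K i, cobj K i] (boundary K K h i))" for i
  have e: "ar C (e i) (cobj K i) (cobj K i)" for i using B[of i] by (simp add: e_def)
  have de: "cdiff K i o e i = zer (cobj K i) (cobj K (i + 1))" for i
    unfolding e_def using B[of i] K db[of i] by simp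
  have ed: "e i o cdiff K (i - 1) = zer (cobj K (i - 1)) (cobj K i)" for i
    unfolding e_def using B[of i] K bd[of i] by simp
  have ch: "chain_map C K K e"
    using e de ed[of "_ + 1"] by (simp add: chain_map_iff[OF K K])
  have idd: "cid K i = e i +[cobj K i, cobj K i] boundary K K h i" for i
    unfolding e_def chain_id_def using B[of i] by (subst add_assoc_arr) auto
  have "homotopic C K K (cid K) e"
    by (rule homotopicI[OF K K _ e c idd]) (use K in \<open>auto simp: chain_id_def\<close>)
  then have hom: "homotopic C K K e (cid K)"
    by (rule homotopic_sym[OF _ K K chain_map_id[OF K] ch])
  \<comment> \<open>A cocycle satisfies x = e x + (d h + h d) x, and h d x = 0, so it differs from
    its value under \<open>e\<close> by the coboundary of \<open>h i o x\<close>.\<close>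
  have "\<exists>y. ar C y T (cobj K (i - 1)) \<and> x = (e i o x) +[T, cobj K i] (cdiff K (i - 1) o y)"
    if x: "ar C x T (cobj K i)" "cdiff K i o x = zer T (cobj K (i + 1))" for i T x
  proof (intro exI[of _ "h i o x"] conjI)
    have "x = cid K i o x" using x by (simp add: chain_id_def)
    also have "\<dots> = (e i o x) +[T, cobj K i] (boundary K K h i o x)"
      unfolding idd using x e[of i] B[of i] by simp
    also have "boundary K K h i o x = cdiff K (i - 1) o (h i o x)"
      unfolding boundary_def using h[of i] h1[of i] x K by simp
    finally show "x = (e i o x) +[T, cobj K i] (cdiff K (i - 1) o (h i o x))" .
  qed (use x h[of i] in simp_all)
  then show thesis using that[OF ch hom de ed] by blast
qed

text \<open>Since \<open>e\<close> has values in cocycles, e = z r; since it kills boundaries, e z =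
  s q. With p = q r the composite s p is e e, which is homotopic to the identity. Up to homotopy the
  identity of \<open>K\<close> thus factors through the cohomology objects.\<close>

lemma cohomology_retract:
  assumes K: "bdd K" and zq: "\<And>i. is_cohomology C K i (z i) (q i)"
  obtains s p where "\<And>i. ar C (s i) (Cod C (q i)) (cobj K i)" "\<And>i. ar C (p i) (cobj K i) (Cod C (q i))"
    "\<And>i. cdiff K i o s i = zer (Cod C (q i)) (cobj K (i + 1))"
    "\<And>i. p i o cdiff K (i - 1) = zer (cobj K (i - 1)) (Cod C (q i))"
    "\<And>i. q i = p i o z i"
    "\<And>i. \<exists>y. ar C y (Dom C (z i)) (cobj K (i - 1)) \<and>
      z i = (s i o q i) +[Dom C (z i), cobj K i] (cdiff K (i - 1) o y)"
    "chain_map C K K (\<lambda>i. s i o p i)" "homotopic C K K (\<lambda>i. s i o p i) (cid K)"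
proof -
  obtain e where e: "chain_map C K K e" "homotopic C K K e (cid K)"
    "\<And>i. cdiff K i o e i = zer (cobj K i) (cobj K (i + 1))"
    "\<And>i. e i o cdiff K (i - 1) = zer (cobj K (i - 1)) (cobj K i)"
    "\<And>i T x. \<lbrakk>ar C x T (cobj K i); cdiff K i o x = zer T (cobj K (i + 1))\<rbrakk> \<Longrightarrow>
      \<exists>y. ar C y T (cobj K (i - 1)) \<and> x = (e i o x) +[T, cobj K i] (cdiff K (i - 1) o y)"
    by (rule minimal_endomorphism[OF K]) blast
  note Z = is_cohomologyD[OF zq K] and E = chain_mapD(1)[OF e(1) K K]
  have "\<exists>b. ar C b (cobj K (i - 1)) (Dom C (z i)) \<and> z i o b = cdiff K (i - 1) \<and>
      q i o b = zer (cobj K (i - 1)) (Cod C (q i)) \<and>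
      (\<forall>t T. ar C t (Dom C (z i)) T \<and> t o b = zer (cobj K (i - 1)) T \<longrightarrow>
        (\<exists>u. ar C u (Cod C (q i)) T \<and> u o q i = t))" for i using Z(7) .
  then obtain b where b: "\<And>i. ar C (b i) (cobj K (i - 1)) (Dom C (z i))" "\<And>i. z i o b i = cdiff K (i - 1)"
    "\<And>i. q i o b i = zer (cobj K (i - 1)) (Cod C (q i))"
    "\<And>i t T. \<lbrakk>ar C t (Dom C (z i)) T; t o b i = zer (cobj K (i - 1)) T\<rbrakk> \<Longrightarrow>
        (\<exists>u. ar C u (Cod C (q i)) T \<and> u o q i = t)" by metis
  have "\<exists>u. ar C u (cobj K i) (Dom C (z i)) \<and> z i o u = e i" for i using Z(6) E e(3) by blast
  then obtain r where r: "\<And>i. ar C (r i) (cobj K i) (Dom C (z i))" "\<And>i. z i o r i = e i" by metis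
  have "(e i o z i) o b i = zer (cobj K (i - 1)) (cobj K i)" for i
    using E[of i] Z(1)[of i] b(1,2)[of i] e(4)[of i] by simp
  then have "\<exists>u. ar C u (Cod C (q i)) (cobj K i) \<and> u o q i = e i o z i" for i
    by (intro b(4)) (use E[of i] Z(1)[of i] in simp_all)
  then obtain s where s: "\<And>i. ar C (s i) (Cod C (q i)) (cobj K i)" "\<And>i. s i o q i = e i o z i" by metis
  define p where "p i = q i o r i" for i
  have p: "ar C (p i) (cobj K i) (Cod C (q i))" for i using r(1)[of i] Z(4)[of i] by (simp add: p_def)
  have 1: "cdiff K i o s i = zer (Cod C (q i)) (cobj K (i + 1))" for i
  proof (rule epiD[OF Z(5)[of i]])
    have "(cdiff K i o s i) o q i = cdiff K i o (e i o z i)" using s[of i] Z(4)[of i] K by simp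
    also have "\<dots> = zer (Dom C (z i)) (cobj K (i + 1))"
      using comp_eq_reassoc1[OF e(3)[of i], of "z i"] E[of i] Z(1)[of i] K by simp
    finally show "(cdiff K i o s i) o q i = zer (Cod C (q i)) (cobj K (i + 1)) o q i"
      using Z(4)[of i] K by simp
  qed (use s(1)[of i] K in auto)
  have 2: "p i o cdiff K (i - 1) = zer (cobj K (i - 1)) (Cod C (q i))" for i
  proof -
    have "r i o cdiff K (i - 1) = zer (cobj K (i - 1)) (Dom C (z i))"
    proof (rule monoD[OF Z(3)[of i]])
      show "z i o (r i o cdiff K (i - 1)) = z i o zer (cobj K (i - 1)) (Dom C (z i))"
        using comp_eq_reassoc1[OF r(2)[of i], of "cdiff K (i - 1)"] r(1)[of i] Z(1)[of i] K e(4)[of i] by simp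
    qed (use r(1)[of i] Z(1)[of i] K in auto)
    then show ?thesis using r(1)[of i] Z(4)[of i] K by (simp add: p_def)
  qed
  have 3: "\<exists>y. ar C y (Dom C (z i)) (cobj K (i - 1)) \<and>
      z i = (s i o q i) +[Dom C (z i), cobj K i] (cdiff K (i - 1) o y)" for i
    unfolding s(2) by (rule e(5)) (use Z(1,2)[of i] in auto)
  have 4: "q i = p i o z i" for i
  proof -
    obtain y where y: "ar C y (Dom C (z i)) (cobj K (i - 1))"
      "z i = (e i o z i) +[Dom C (z i), cobj K i] (cdiff K (i - 1) o y)"
      using e(5)[of "z i"] Z(1,2)[of i] by blast
    \<comment> \<open>The identity of the cocycles differs from \<open>r i o z i\<close> by an arrow
      through the boundaries, and \<open>q i\<close> kills the difference.\<close>
    have "Id C (Dom C (z i)) = (r i o z i) +[Dom C (z i), Dom C (z i)] (b i o y)"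
    proof (rule monoD[OF Z(3)[of i]])
      have "z i o (r i o z i) = e i o z i" "z i o (b i o y) = cdiff K (i - 1) o y"
        using comp_eq_reassoc1[OF r(2)[of i], of "z i"] comp_eq_reassoc1[OF b(2)[of i], of y]
          r(1)[of i] Z(1)[of i] b(1)[of i] y(1) by simp_all
      then show "z i o Id C (Dom C (z i)) =
          z i o ((r i o z i) +[Dom C (z i), Dom C (z i)] (b i o y))"
        using r(1)[of i] Z(1)[of i] b(1)[of i] y by simp
    qed (use r(1)[of i] Z(1)[of i] b(1)[of i] y(1) in auto)
    then have "q i = q i o ((r i o z i) +[Dom C (z i), Dom C (z i)] (b i o y))"
      using Z(4)[of i] comp_Id[of "q i" "Dom C (z i)"] by metis
    also have "\<dots> = (q i o r i o z i)"
      using Z(4)[of i] Z(1)[of i] r(1)[of i] b(1,3)[of i] y(1) comp_eq_reassoc1[OF b(3)[of i], of y] by simp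
    finally show ?thesis using Z(1,4)[of i] r(1)[of i] by (simp add: p_def)
  qed
  have 5: "(\<lambda>i. s i o p i) = ccomp e e"
  proof
    fix i
    have "s i o (q i o r i) = e i o (z i o r i)"
      by (rule comp_eq_reassoc[OF s(2)]) (use s(1)[of i] Z(1,4)[of i] E[of i] r(1)[of i] in simp_all)
    then show "s i o p i = ccomp e e i" by (simp add: p_def chain_comp_def r(2))
  qed
  have 6: "chain_map C K K (\<lambda>i. s i o p i)" unfolding 5 by (rule chain_map_comp[OF e(1) e(1) K K K])
  have "homotopic C K K (ccomp e e) (ccomp e (cid K))"
    by (rule homotopic_comp_left[OF e(2) e(1) e(1) chain_map_id[OF K] K K K])
  then have 7: "homotopic C K K (\<lambda>i. s i o p i) (cid K)"
    unfolding 5 chain_comp_id(1)[OF e(1) K K]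
    by (rule homotopic_trans[OF _ e(2) K K chain_map_comp[OF e(1) e(1) K K K] e(1) chain_map_id[OF K]])
  show thesis using that[OF s(1) p 1 2 4 3 6 7] .
qed

text \<open>The homotopy inverse passes through cohomology: project \<open>L\<close> by
  \<open>p'\<close>, invert the isomorphism induced by \<open>f\<close>, and embed into
  \<open>K\<close> by \<open>s\<close>. It is a chain map because both composites with differentials
  vanish.\<close>

lemma quasi_iso_homotopy_equivalence:
  assumes K: "bdd K" and L: "bdd L" and f: "quasi_iso C K L f"
  obtains g where "homotopy_equivalence K L f g"
proof -
  have fc: "chain_map C K L f" using f by (simp add: quasi_iso_def)
  note F = chain_mapD(1)[OF fc K L]
  have "\<forall>i. \<exists>z q z' q' a h. is_cohomology C K i z q \<and> is_cohomology C L i z' q' \<and>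
      a \<in> homs C (Dom C z) (Dom C z') \<and> z' o a = f i o z \<and>
      h \<in> homs C (Cod C q) (Cod C q') \<and> h o q = q' o a \<and> is_iso C h"
    using f by (simp add: quasi_iso_def)
  then obtain z q z' q' a h where *: "\<And>i. is_cohomology C K i (z i) (q i) \<and> is_cohomology C L i (z' i) (q' i) \<and>
      a i \<in> homs C (Dom C (z i)) (Dom C (z' i)) \<and> z' i o a i = f i o z i \<and>
      h i \<in> homs C (Cod C (q i)) (Cod C (q' i)) \<and> h i o q i = q' i o a i \<and> is_iso C (h i)" by metis
  have zq: "\<And>i. is_cohomology C K i (z i) (q i)" and zq': "\<And>i. is_cohomology C L i (z' i) (q' i)" using * by auto
  note Z = is_cohomologyD[OF zq K] and Z' = is_cohomologyD[OF zq' L]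
  have a: "ar C (a i) (Dom C (z i)) (Dom C (z' i))" "z' i o a i = f i o z i" for i
    using *[of i] Z(1)[of i] Z'(1)[of i] homs_iff[of "Dom C (z i)" "Dom C (z' i)" "a i"] by auto
  have h: "ar C (h i) (Cod C (q i)) (Cod C (q' i))" "h i o q i = q' i o a i" "is_iso C (h i)" for i
    using *[of i] Z(4)[of i] Z'(4)[of i] homs_iff[of "Cod C (q i)" "Cod C (q' i)" "h i"] by auto
  have "\<exists>w. ar C w (Cod C (q' i)) (Cod C (q i)) \<and> w o h i = Id C (Cod C (q i)) \<and> h i o w = Id C (Cod C (q' i))" for i
    using h(1)[of i] arr_inv_simps[OF h(3)[of i]] by auto
  then obtain w where w: "\<And>i. ar C (w i) (Cod C (q' i)) (Cod C (q i))"
    "\<And>i. w i o h i = Id C (Cod C (q i))" "\<And>i. h i o w i = Id C (Cod C (q' i))" by metis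
  obtain s p where sp: "\<And>i. ar C (s i) (Cod C (q i)) (cobj K i)" "\<And>i. ar C (p i) (cobj K i) (Cod C (q i))"
    "\<And>i. cdiff K i o s i = zer (Cod C (q i)) (cobj K (i + 1))"
    "\<And>i. \<exists>y. ar C y (Dom C (z i)) (cobj K (i - 1)) \<and>
      z i = (s i o q i) +[Dom C (z i), cobj K i] (cdiff K (i - 1) o y)"
    "chain_map C K K (\<lambda>i. s i o p i)" "homotopic C K K (\<lambda>i. s i o p i) (cid K)"
    by (rule cohomology_retract[of K z q, OF K zq]) blast
  obtain s' p' where sp': "\<And>i. ar C (s' i) (Cod C (q' i)) (cobj L i)" "\<And>i. ar C (p' i) (cobj L i) (Cod C (q' i))"
    "\<And>i. p' i o cdiff L (i - 1) = zer (cobj L (i - 1)) (Cod C (q' i))"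
    "\<And>i. q' i = p' i o z' i"
    "chain_map C L L (\<lambda>i. s' i o p' i)" "homotopic C L L (\<lambda>i. s' i o p' i) (cid L)"
    by (rule cohomology_retract[of L z' q', OF L zq']) blast
  \<comment> \<open>\<open>f\<close> acts as \<open>h\<close> on the chosen representatives. After
    the epimorphism \<open>q\<close> one replaces s q by z minus a coboundary; \<open>f\<close>
    carries that coboundary to a coboundary of \<open>L\<close>, which \<open>p'\<close>
    kills.\<close>
  have pfs: "p' i o f i o s i = h i" for i
  proof (rule epiD[OF Z(5)[of i]])
    obtain y where y: "ar C y (Dom C (z i)) (cobj K (i - 1))"
      "z i = (s i o q i) +[Dom C (z i), cobj K i] (cdiff K (i - 1) o y)" using sp(4) by blast
    note t = y(1) F[of i] F[of "i - 1"] sp'(2)[of i] sp(1)[of i] Z(1,4)[of i] Z'(1)[of i] a(1)[of i] K L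
    have "f i o (cdiff K (i - 1) o y) = cdiff L (i - 1) o (f (i - 1) o y)"
      by (rule comp_eq_reassoc[OF chain_map_pred[OF fc K L]]) (use t in simp_all)
    then have 0: "p' i o (f i o (cdiff K (i - 1) o y)) = zer (Dom C (z i)) (Cod C (q' i))"
      using comp_eq_reassoc1[OF sp'(3)[of i], of "f (i - 1) o y"] t by simp
    have "h i o q i = p' i o (z' i o a i)" unfolding h(2) sp'(4)[of i] using t by simp
    also have "\<dots> = p' i o (f i o ((s i o q i) +[Dom C (z i), cobj K i] (cdiff K (i - 1) o y)))"
      unfolding a(2) using y(2) by simp
    also have "\<dots> = p' i o (f i o (s i o q i))" using t 0 by simp
    finally show "(p' i o f i o s i) o q i = h i o q i" using t by simp
  qed (use F[of i] sp'(2)[of i] sp(1)[of i] h(1)[of i] in auto)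
  define g where "g i = s i o w i o p' i" for i
  have g: "ar C (g i) (cobj L i) (cobj K i)" for i using sp(1)[of i] w(1)[of i] sp'(2)[of i] by (simp add: g_def)
  have gc: "chain_map C L K g"
    unfolding chain_map_iff[OF L K]
  proof (intro conjI allI)
    fix i
    have "cdiff K i o g i = zer (cobj L i) (cobj K (i + 1))"
      using comp_eq_reassoc1[OF sp(3)[of i], of "w i o p' i"] sp(1)[of i] w(1)[of i] sp'(2)[of i] K
      by (simp add: g_def)
    moreover have "g (i + 1) o cdiff L i = zer (cobj L i) (cobj K (i + 1))"
      using sp'(3)[of "i + 1"] sp(1)[of "i + 1"] w(1)[of "i + 1"] sp'(2)[of "i + 1"] L by (simp add: g_def)
    ultimately show "cdiff K i o g i = g (i + 1) o cdiff L i" by simp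
  qed (use g K L in auto)
  have gf: "chain_map C K K (ccomp g f)" and fg: "chain_map C L L (ccomp f g)"
    using chain_map_comp[OF fc gc K L K] chain_map_comp[OF gc fc L K L] by auto
  \<comment> \<open>g f is homotopic to g f s p, and this equals s w h p = s p by
    \<open>pfs\<close>, which is homotopic to the identity. The second half inserts s' p' on the
    other side.\<close>
  have 1: "homotopic C K K (ccomp g f) (cid K)"
  proof -
    have "homotopic C K K (ccomp (ccomp g f) (\<lambda>i. s i o p i)) (ccomp (ccomp g f) (cid K))"
      by (rule homotopic_comp_left[OF sp(6) gf sp(5) chain_map_id[OF K] K K K])
    moreover have "ccomp (ccomp g f) (\<lambda>i. s i o p i) = (\<lambda>i. s i o p i)"
    proof
      fix i
      note t = F[of i] sp(1,2)[of i] sp'(1,2)[of i] w(1)[of i] h(1)[of i]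
      have "p' i o f i o s i o p i = (p' i o f i o s i) o p i" using t by simp
      also have "\<dots> = h i o p i" unfolding pfs ..
      finally show "ccomp (ccomp g f) (\<lambda>i. s i o p i) i = s i o p i"
        using t comp_eq_reassoc1[OF w(2)[of i], of "p i"] by (simp add: chain_comp_def g_def)
    qed
    ultimately have "homotopic C K K (\<lambda>i. s i o p i) (ccomp g f)"
      using chain_comp_id(1)[OF gf K K] by simp
    then show ?thesis
      using homotopic_trans[OF homotopic_sym[OF _ K K sp(5) gf] sp(6) K K gf sp(5) chain_map_id[OF K]] by blast
  qed
  have 2: "homotopic C L L (ccomp f g) (cid L)"
  proof -
    have "homotopic C L L (ccomp (\<lambda>i. s' i o p' i) (ccomp f g)) (ccomp (cid L) (ccomp f g))"
      by (rule homotopic_comp_right[OF sp'(6) fg sp'(5) chain_map_id[OF L] L L L])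
    moreover have "ccomp (\<lambda>i. s' i o p' i) (ccomp f g) = (\<lambda>i. s' i o p' i)"
    proof
      fix i
      note t = F[of i] sp(1,2)[of i] sp'(1,2)[of i] w(1)[of i] h(1)[of i]
      have "p' i o f i o s i o w i o p' i = (p' i o f i o s i) o w i o p' i" using t by simp
      also have "\<dots> = p' i" unfolding pfs using t comp_eq_reassoc1[OF w(3)[of i], of "p' i"] by simp
      finally show "ccomp (\<lambda>i. s' i o p' i) (ccomp f g) i = s' i o p' i"
        using t by (simp add: chain_comp_def g_def)
    qed
    ultimately have "homotopic C L L (\<lambda>i. s' i o p' i) (ccomp f g)"
      using chain_comp_id(2)[OF fg L L] by simp
    then show ?thesis
      using homotopic_trans[OF homotopic_sym[OF _ L L sp'(5) fg] sp'(6) L L fg sp'(5) chain_map_id[OF L]] by blast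
  qed
  show thesis using that[of g] fc gc 1 2 by (simp add: homotopy_equivalence_def)
qed

end

section \<open>Roofs and homotopy classes\<close>

context abelian_category
begin

text \<open>Boundedness of both ends is bundled into the map, so that composition, homotopy and
  tensor rules need one premise per chain map.\<close>

definition chm where
  "chm K L f \<longleftrightarrow> bdd K \<and> bdd L \<and> chain_map C K L f"

definition htpc where
  "htpc K L f g \<longleftrightarrow> chm K L f \<and> chm K L g \<and> homotopic C K L f g"

lemma chmD:
  assumes "chm K L f"
  shows "bdd K" "bdd L" "chain_map C K L f"
    "ar C (f i) (cobj K i) (cobj L i)" "cdiff L i o f i = f (i + 1) o cdiff K i"
  using assms chain_mapD unfolding chm_def by auto

lemma chm_comp: "\<lbrakk>chm K L f; chm L M g\<rbrakk> \<Longrightarrow> chm K M (ccomp g f)"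
  unfolding chm_def using chain_map_comp by blast

lemma chm_id: "bdd K \<Longrightarrow> chm K K (cid K)"
  unfolding chm_def by simp

lemma chm_comp_id: "chm K L f \<Longrightarrow> ccomp f (cid K) = f"
  "chm K L f \<Longrightarrow> ccomp (cid L) f = f"
  unfolding chm_def by auto

lemma chm_comp_assoc:
  "\<lbrakk>chm J K f; chm K L g; chm L M h\<rbrakk> \<Longrightarrow> ccomp (ccomp h g) f = ccomp h (ccomp g f)"
  unfolding chm_def using chain_comp_assoc by blast

lemma htpc_refl: "chm K L f \<Longrightarrow> htpc K L f f"
  unfolding htpc_def chm_def using homotopic_refl by blast

lemma htpc_sym: "htpc K L f g \<Longrightarrow> htpc K L g f"
  unfolding htpc_def chm_def using homotopic_sym by blast

lemma htpc_trans [trans]: "\<lbrakk>htpc K L f g; htpc K L g h\<rbrakk> \<Longrightarrow> htpc K L f h"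
  unfolding htpc_def chm_def using homotopic_trans by blast

lemma htpc_comp:
  assumes "htpc K L f f'" "htpc L M g g'"
  shows "htpc K M (ccomp g f) (ccomp g' f')"
proof -
  note A = assms[unfolded htpc_def chm_def]
  have "homotopic C K M (ccomp g f) (ccomp g f')"
    using homotopic_comp_left A by blast
  moreover have "homotopic C K M (ccomp g f') (ccomp g' f')"
    using homotopic_comp_right A by blast
  moreover have "chm K M (ccomp g f)" "chm K M (ccomp g f')" "chm K M (ccomp g' f')"
    using chm_comp assms unfolding htpc_def by blast+
  ultimately have "htpc K M (ccomp g f) (ccomp g f')" "htpc K M (ccomp g f') (ccomp g' f')"
    unfolding htpc_def by auto
  then show ?thesis by (rule htpc_trans)
qed

lemma htpc_chm: "htpc K L f g \<Longrightarrow> chm K L f" "htpc K L f g \<Longrightarrow> chm K L g"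
  by (simp_all add: htpc_def)

definition chain_add where
  "chain_add K L f g = (\<lambda>i. f i +[cobj K i, cobj L i] g i)"

definition chain_smult where
  "chain_smult K L c f = (\<lambda>i. c \<odot>\<^bsub>Hom C (cobj K i) (cobj L i)\<^esub> f i)"

definition chain_zero where
  "chain_zero K L = (\<lambda>i. zer (cobj K i) (cobj L i))"

lemma chm_zero: "\<lbrakk>bdd K; bdd L\<rbrakk> \<Longrightarrow> chm K L (chain_zero K L)"
  by (simp add: chm_def chain_map_iff chain_zero_def)

lemma htpc_add:
  "\<lbrakk>htpc K L f f'; htpc K L g g'\<rbrakk> \<Longrightarrow> htpc K L (chain_add K L f g) (chain_add K L f' g')"
  unfolding htpc_def chm_def chain_add_def using homotopic_add chain_map_add by blast

lemma htpc_smult: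
  "\<lbrakk>htpc K L f f'; c \<in> carrier k\<rbrakk> \<Longrightarrow> htpc K L (chain_smult K L c f) (chain_smult K L c f')"
  unfolding htpc_def chm_def chain_smult_def using homotopic_smult chain_map_smult by blast

lemma chm_add: "\<lbrakk>chm K L f; chm K L g\<rbrakk> \<Longrightarrow> chm K L (chain_add K L f g)"
  unfolding chm_def chain_add_def using chain_map_add by blast

lemma chm_smult: "\<lbrakk>chm K L f; c \<in> carrier k\<rbrakk> \<Longrightarrow> chm K L (chain_smult K L c f)"
  unfolding chm_def chain_smult_def using chain_map_smult by blast

lemma chain_add_comp:
  assumes "chm K L f" "chm K L f'" "chm J K s"
  shows "ccomp (chain_add K L f f') s = chain_add J L (ccomp f s) (ccomp f' s)"
  using chmD(4)[OF assms(1)] chmD(4)[OF assms(2)] chmD(4)[OF assms(3)]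
  by (auto simp: chain_comp_def chain_add_def)

lemma chain_comp_add:
  assumes "chm K L f" "chm K L f'" "chm L M s"
  shows "ccomp s (chain_add K L f f') = chain_add K M (ccomp s f) (ccomp s f')"
  using chmD(4)[OF assms(1)] chmD(4)[OF assms(2)] chmD(4)[OF assms(3)]
  by (auto simp: chain_comp_def chain_add_def)

lemma chain_smult_comp:
  assumes "chm K L f" "chm J K s" "c \<in> carrier k"
  shows "ccomp (chain_smult K L c f) s = chain_smult J L c (ccomp f s)"
  using chmD(4)[OF assms(1)] chmD(4)[OF assms(2)] assms(3)
  by (auto simp: chain_comp_def chain_smult_def)

lemma chain_comp_smult:
  assumes "chm K L f" "chm L M s" "c \<in> carrier k"
  shows "ccomp s (chain_smult K L c f) = chain_smult K M c (ccomp s f)"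
  using chmD(4)[OF assms(1)] chmD(4)[OF assms(2)] assms(3)
  by (auto simp: chain_comp_def chain_smult_def)

lemma homotopy_equivalence_iff:
  assumes "bdd K" "bdd L"
  shows "homotopy_equivalence K L f g \<longleftrightarrow> chm K L f \<and> chm L K g \<and>
    htpc K K (ccomp g f) (cid K) \<and> htpc L L (ccomp f g) (cid L)"
  using assms chm_comp[of K L f K g] chm_comp[of L K g L f] chm_id[of K] chm_id[of L]
  by (auto simp: homotopy_equivalence_def htpc_def chm_def)

end

section \<open>Roofs in a semisimple category\<close>

context semisimple_category
begin

lemma quasi_iso_iff:
  assumes "bdd K" "bdd L"
  shows "quasi_iso C K L f \<longleftrightarrow> (\<exists>g. chm K L f \<and> chm L K g \<and>
    htpc K K (ccomp g f) (cid K) \<and> htpc L L (ccomp f g) (cid L))"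
  using quasi_iso_homotopy_equivalence[OF assms] homotopy_equivalence_quasi_iso[OF assms]
    homotopy_equivalence_iff[OF assms] by metis

lemma quasi_isoE:
  assumes "quasi_iso C K L f" "bdd K" "bdd L"
  obtains g where "chm K L f" "chm L K g" "htpc K K (ccomp g f) (cid K)"
    "htpc L L (ccomp f g) (cid L)"
  using assms quasi_iso_iff by blast

lemma quasi_iso_comp:
  assumes "quasi_iso C K L f" "quasi_iso C L M g"
    "bdd K" "bdd L" "bdd M"
  shows "quasi_iso C K M (ccomp g f)"
proof -
  obtain f' where f: "chm K L f" "chm L K f'" "htpc K K (ccomp f' f) (cid K)"
    "htpc L L (ccomp f f') (cid L)" using quasi_isoE[OF assms(1,3,4)] by blast
  obtain g' where g: "chm L M g" "chm M L g'" "htpc L L (ccomp g' g) (cid L)"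
    "htpc M M (ccomp g g') (cid M)" using quasi_isoE[OF assms(2,4,5)] by blast
  have "htpc K L (ccomp (ccomp g' g) f) (ccomp (cid L) f)"
    by (rule htpc_comp[OF htpc_refl[OF f(1)] g(3)])
  then have "htpc K L (ccomp g' (ccomp g f)) f"
    by (simp only: chm_comp_assoc[OF f(1) g(1,2)] chm_comp_id[OF f(1)])
  from htpc_comp[OF this htpc_refl[OF f(2)]]
  have "htpc K K (ccomp (ccomp f' g') (ccomp g f)) (ccomp f' f)"
    by (simp only: chm_comp_assoc[OF chm_comp[OF f(1) g(1)] g(2) f(2)])
  then have 1: "htpc K K (ccomp (ccomp f' g') (ccomp g f)) (cid K)"
    using f(3) by (rule htpc_trans)
  have "htpc M L (ccomp (ccomp f f') g') (ccomp (cid L) g')"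
    by (rule htpc_comp[OF htpc_refl[OF g(2)] f(4)])
  then have "htpc M L (ccomp f (ccomp f' g')) g'"
    by (simp only: chm_comp_assoc[OF g(2) f(2,1)] chm_comp_id[OF g(2)])
  from htpc_comp[OF this htpc_refl[OF g(1)]]
  have "htpc M M (ccomp (ccomp g f) (ccomp f' g')) (ccomp g g')"
    by (simp only: chm_comp_assoc[OF chm_comp[OF g(2) f(2)] f(1) g(1)])
  then have 2: "htpc M M (ccomp (ccomp g f) (ccomp f' g')) (cid M)"
    using g(4) by (rule htpc_trans)
  show ?thesis unfolding quasi_iso_iff[OF assms(3,5)]
    using chm_comp[OF f(1) g(1)] chm_comp[OF g(2) f(2)] 1 2 by blast
qed

lemma quasi_iso_id: "bdd K \<Longrightarrow> quasi_iso C K K (cid K)"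
  unfolding quasi_iso_iff
  by (rule exI[of _ "cid K"]) (simp add: chm_comp_id[OF chm_id] htpc_refl chm_id)

text \<open>With a homotopy inverse \<open>t\<close> of \<open>s\<close>: f is homotopic to f s t,
  then to g s t, then to g.\<close>

lemma quasi_iso_cancel:
  assumes s: "quasi_iso C M K s" and M: "bdd M"
    and f: "chm K L f" and g: "chm K L g" and fg: "htpc M L (ccomp f s) (ccomp g s)"
  shows "htpc K L f g"
proof -
  have K: "bdd K" using f by (simp add: chm_def)
  obtain t where t: "chm M K s" "chm K M t" "htpc K K (ccomp s t) (cid K)"
    using quasi_isoE[OF s M K] by blast
  have "htpc K L (ccomp (ccomp f s) t) (ccomp (ccomp g s) t)"
    by (rule htpc_comp[OF htpc_refl[OF t(2)] fg])
  then have *: "htpc K L (ccomp f (ccomp s t)) (ccomp g (ccomp s t))"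
    by (simp only: chm_comp_assoc[OF t(2,1) f] chm_comp_assoc[OF t(2,1) g])
  have "htpc K L (ccomp f (ccomp s t)) f" "htpc K L (ccomp g (ccomp s t)) g"
    using htpc_comp[OF t(3) htpc_refl[OF f]] htpc_comp[OF t(3) htpc_refl[OF g]]
    by (simp_all only: chm_comp_id[OF f] chm_comp_id[OF g])
  then show ?thesis using * htpc_sym htpc_trans by blast
qed

lemma is_roof_iff:
  "is_roof C K L (M, s, f) \<longleftrightarrow> bdd M \<and> quasi_iso C M K s \<and> chain_map C M L f"
  by (simp add: is_roof_def)

text \<open>A homotopy inverse \<open>t\<close> of the left leg exists, and \<open>\<phi>\<close> is
  the right leg after \<open>t\<close>.\<close>

lemma roof_chain_map:
  assumes K: "bdd K" and L: "bdd L" and r: "is_roof C K L (M, s, f)"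
  obtains \<phi> where "chm K L \<phi>" "htpc M L f (ccomp \<phi> s)"
proof -
  have M: "bdd M" and s: "quasi_iso C M K s" and f: "chm M L f"
    using r L by (auto simp: is_roof_iff chm_def)
  obtain t where t: "chm M K s" "chm K M t" "htpc M M (ccomp t s) (cid M)"
    using quasi_isoE[OF s M K] by blast
  have "htpc M L (ccomp f (ccomp t s)) f"
    using htpc_comp[OF t(3) htpc_refl[OF f]] by (simp only: chm_comp_id[OF f])
  then have "htpc M L f (ccomp (ccomp f t) s)"
    by (simp only: chm_comp_assoc[OF t(1,2) f] htpc_sym)
  then show thesis using that chm_comp[OF t(2) f] by blast
qed

text \<open>Replaces the common refinement in \<open>roof_eq\<close> by a condition on each roof
  separately: both have to represent the same chain map \<open>\<phi>\<close>. All later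
  computations with roofs rest on this.\<close>

lemma roof_eq_iff:
  assumes K: "bdd K" and L: "bdd L"
    and r: "is_roof C K L (M, s, f)" and \<phi>: "chm K L \<phi>" "htpc M L f (ccomp \<phi> s)"
  shows "roof_eq C K L (M, s, f) (M', s', f') \<longleftrightarrow>
    is_roof C K L (M', s', f') \<and> htpc M' L f' (ccomp \<phi> s')"
proof
  have M: "bdd M" and s: "quasi_iso C M K s" and f: "chm M L f"
    using r L by (auto simp: is_roof_iff chm_def)
  have sc: "chm M K s" using s M K by (auto simp: quasi_iso_iff)
  {
    assume "roof_eq C K L (M, s, f) (M', s', f')"
    then obtain N u v where r': "is_roof C K L (M', s', f')" and N: "bdd N" "chain_map C N M u"
      "chain_map C N M' v" "quasi_iso C N K (ccomp s u)"
      "homotopic C N K (ccomp s u) (ccomp s' v)"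
      "homotopic C N L (ccomp f u) (ccomp f' v)"
      by (auto simp: roof_eq_def)
    have M': "bdd M'" and s': "quasi_iso C M' K s'" and f': "chm M' L f'"
      using r' L by (auto simp: is_roof_iff chm_def)
    have s'c: "chm M' K s'" using s' M' K by (auto simp: quasi_iso_iff)
    have u: "chm N M u" and v: "chm N M' v" using N M M' by (auto simp: chm_def)
    obtain \<psi> where \<psi>: "chm K L \<psi>" "htpc M' L f' (ccomp \<psi> s')"
      using roof_chain_map[OF K L r'] by blast
    have su: "htpc N K (ccomp s u) (ccomp s' v)"
      using N chm_comp[OF u sc] chm_comp[OF v s'c] by (simp add: htpc_def)
    have fu: "htpc N L (ccomp f u) (ccomp f' v)"
      using N chm_comp[OF u f] chm_comp[OF v f'] by (simp add: htpc_def)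
    have "htpc N L (ccomp \<phi> (ccomp s u)) (ccomp f u)"
      using htpc_comp[OF htpc_refl[OF u] htpc_sym[OF \<phi>(2)]]
      by (simp only: chm_comp_assoc[OF u sc \<phi>(1)])
    also note fu
    also have "htpc N L (ccomp f' v) (ccomp \<psi> (ccomp s' v))"
      using htpc_comp[OF htpc_refl[OF v] \<psi>(2)] by (simp only: chm_comp_assoc[OF v s'c \<psi>(1)])
    also have "htpc N L (ccomp \<psi> (ccomp s' v)) (ccomp \<psi> (ccomp s u))"
      by (rule htpc_comp[OF htpc_sym[OF su] htpc_refl[OF \<psi>(1)]])
    \<comment> \<open>The chain maps represented by the two roofs agree after
      \<open>ccomp s u\<close>, which is a quasi-isomorphism by the choice of the refinement and can
      be cancelled.\<close>
    finally have "htpc K L \<phi> \<psi>"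
      by (rule quasi_iso_cancel[OF N(4,1) \<phi>(1) \<psi>(1)])
    then have "htpc M' L f' (ccomp \<phi> s')"
      using htpc_trans[OF \<psi>(2) htpc_comp[OF htpc_refl[OF s'c] htpc_sym]] by blast
    then show "is_roof C K L (M', s', f') \<and> htpc M' L f' (ccomp \<phi> s')" using r' by simp
  }
  assume *: "is_roof C K L (M', s', f') \<and> htpc M' L f' (ccomp \<phi> s')"
  have M': "bdd M'" and s': "quasi_iso C M' K s'" and f': "chm M' L f'"
    using * L by (auto simp: is_roof_iff chm_def)
  obtain t where t: "chm M' K s'" "chm K M' t" "htpc K K (ccomp s' t) (cid K)"
    using quasi_isoE[OF s' M' K] by blast
  \<comment> \<open>\<open>M\<close> itself serves as the common refinement: it maps to itself by
    the identity and to \<open>M'\<close> by s followed by a homotopy inverse of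
    \<open>s'\<close>.\<close>
  have v: "chm M M' (ccomp t s)" by (rule chm_comp[OF sc t(2)])
  have 1: "htpc M K s (ccomp s' (ccomp t s))"
    using htpc_sym[OF htpc_comp[OF htpc_refl[OF sc] t(3)]]
    by (simp only: chm_comp_id[OF sc] chm_comp_assoc[OF sc t(2,1)])
  have "htpc M L f (ccomp \<phi> s)" by fact
  also have "htpc M L (ccomp \<phi> s) (ccomp \<phi> (ccomp s' (ccomp t s)))"
    by (rule htpc_comp[OF 1 htpc_refl[OF \<phi>(1)]])
  also have "htpc M L (ccomp \<phi> (ccomp s' (ccomp t s))) (ccomp f' (ccomp t s))"
    using htpc_comp[OF htpc_refl[OF v] htpc_sym[OF conjunct2[OF *]]]
    by (simp only: chm_comp_assoc[OF v t(1) \<phi>(1)])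
  finally have 2: "htpc M L f (ccomp f' (ccomp t s))" .
  show "roof_eq C K L (M, s, f) (M', s', f')"
    unfolding roof_eq_def prod.case
    using r * M v s 1 2 chm_comp_id(1)[OF sc] chm_comp_id(1)[OF f]
    by (intro conjI exI[of _ M] exI[of _ "cid M"] exI[of _ "ccomp t s"])
      (simp_all add: htpc_def chm_def)
qed

text \<open>The equivalence class of the roof with identity left leg and right leg
  \<open>\<phi>\<close>, described without refinements.\<close>

definition roofs_of where
  "roofs_of K L \<phi> = {(M, s, f). is_roof C K L (M, s, f) \<and> htpc M L f (ccomp \<phi> s)}"

lemma roof_class_eq:
  assumes "bdd K" "bdd L" "is_roof C K L (M, s, f)" "chm K L \<phi>"
    "htpc M L f (ccomp \<phi> s)"
  shows "{r. roof_eq C K L (M, s, f) r} = roofs_of K L \<phi>"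
  using roof_eq_iff[OF assms] unfolding roofs_of_def by auto

lemma is_roof_chm: "chm K L \<phi> \<Longrightarrow> is_roof C K L (K, cid K, \<phi>)"
  using quasi_iso_id by (auto simp: is_roof_iff chm_def)

lemma chain_class_eq: assumes "chm K L \<phi>" shows "chain_class C K L \<phi> = (K, L, roofs_of K L \<phi>)"
  unfolding chain_class_def roof_class_def
  using roof_class_eq[OF chmD(1,2)[OF assms] is_roof_chm[OF assms] assms] htpc_refl[OF assms]
  by (simp add: chm_comp_id[OF assms])

lemma mem_roofs_of: "chm K L \<phi> \<Longrightarrow> (K, cid K, \<phi>) \<in> roofs_of K L \<phi>"
  unfolding roofs_of_def using is_roof_chm htpc_refl by (simp add: chm_comp_id)

lemma roofs_of_cong: "htpc K L \<phi> \<psi> \<Longrightarrow> roofs_of K L \<phi> = roofs_of K L \<psi>"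
proof -
  have "roofs_of K L \<phi> \<subseteq> roofs_of K L \<psi>" if h: "htpc K L \<phi> \<psi>" for \<phi> \<psi>
  proof (clarsimp simp: roofs_of_def)
    fix M s f assume r: "is_roof C K L (M, s, f)" and f: "htpc M L f (ccomp \<phi> s)"
    have "chm M K s" using r h by (auto simp: is_roof_iff htpc_def chm_def quasi_iso_def)
    then show "htpc M L f (ccomp \<psi> s)"
      using htpc_trans[OF f htpc_comp[OF htpc_refl h]] by blast
  qed
  then show "htpc K L \<phi> \<psi> \<Longrightarrow> roofs_of K L \<phi> = roofs_of K L \<psi>" using htpc_sym by blast
qed

text \<open>The roof with identity left leg lies in its own class, and its membership in another
  class is a bare homotopy between chain maps.\<close>

lemma chain_class_eq_iff:
  assumes "chm K L \<phi>" "chm K L \<psi>"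
  shows "chain_class C K L \<phi> = chain_class C K L \<psi> \<longleftrightarrow> htpc K L \<phi> \<psi>"
proof
  assume "chain_class C K L \<phi> = chain_class C K L \<psi>"
  then have "(K, cid K, \<phi>) \<in> roofs_of K L \<psi>"
    using mem_roofs_of[OF assms(1)] by (simp add: chain_class_eq assms)
  then show "htpc K L \<phi> \<psi>" by (simp add: roofs_of_def chm_comp_id[OF assms(2)])
qed (simp add: chain_class_eq assms roofs_of_cong)

lemma roof_class_chain_class:
  assumes "bdd K" "bdd L" "is_roof C K L (M, s, f)" "chm K L \<phi>"
    "htpc M L f (ccomp \<phi> s)"
  shows "roof_class C K L (M, s, f) = chain_class C K L \<phi>"
  using roof_class_eq[OF assms] by (simp add: chain_class_eq[OF assms(4)] roof_class_def)

lemma roof_hom_carrier: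
  assumes K: "bdd K" and L: "bdd L"
  shows "carrier (roof_hom C K L) = {chain_class C K L \<phi> | \<phi>. chm K L \<phi>}"
proof -
  have "roof_class C K L ` {r. is_roof C K L r} \<subseteq> {chain_class C K L \<phi> | \<phi>. chm K L \<phi>}"
  proof
    fix x assume "x \<in> roof_class C K L ` {r. is_roof C K L r}"
    then obtain M s f where r: "is_roof C K L (M, s, f)" "x = roof_class C K L (M, s, f)" by auto
    obtain \<phi> where "chm K L \<phi>" "htpc M L f (ccomp \<phi> s)" using roof_chain_map[OF K L r(1)] .
    then show "x \<in> {chain_class C K L \<phi> | \<phi>. chm K L \<phi>}"
      using roof_class_chain_class[OF K L r(1)] r(2) by auto
  qed
  moreover have "{chain_class C K L \<phi> | \<phi>. chm K L \<phi>} \<subseteq> roof_class C K L ` {r. is_roof C K L r}"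
    using is_roof_chm by (auto simp: chain_class_def)
  ultimately show ?thesis by (simp add: roof_hom_def)
qed

lemma roof_hom_zero: "\<zero>\<^bsub>roof_hom C K L\<^esub> = chain_class C K L (chain_zero K L)"
  by (simp add: roof_hom_def chain_zero_def)

lemma roofs_of_roof_eq:
  assumes "chm K L \<phi>" "(M, s, f) \<in> roofs_of K L \<phi>"
  shows "{r. roof_eq C K L (M, s, f) r} = roofs_of K L \<phi>"
  using roof_class_eq[OF chmD(1,2)[OF assms(1)] _ assms(1)] assms(2) by (simp add: roofs_of_def)

lemma roofs_of_chm: "\<lbrakk>chm K L \<phi>; (M, s, f) \<in> roofs_of K L \<phi>\<rbrakk> \<Longrightarrow> chm M K s \<and> chm M L f"
  by (auto simp: roofs_of_def is_roof_iff chm_def quasi_iso_def)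

text \<open>Addition is defined through representatives with a common left leg. All such pairs give
  the same class, and the roofs with identity left leg form such a pair.\<close>

lemma roof_hom_add:
  assumes f: "chm K L f" and g: "chm K L g"
  shows "chain_class C K L f \<oplus>\<^bsub>roof_hom C K L\<^esub> chain_class C K L g = chain_class C K L (chain_add K L f g)"
proof -
  have *: "{r. roof_eq C K L (M, s, \<lambda>i. a i +[cobj M i, cobj L i] b i) r} = roofs_of K L (chain_add K L f g)"
    if a: "(M, s, a) \<in> roofs_of K L f" and b: "(M, s, b) \<in> roofs_of K L g" for M s a b
  proof (rule roofs_of_roof_eq[OF chm_add[OF f g]])
    have s: "chm M K s" using roofs_of_chm[OF f a] by simp
    have "htpc M L (chain_add M L a b) (chain_add M L (ccomp f s) (ccomp g s))"
      by (rule htpc_add) (use a b in \<open>auto simp: roofs_of_def\<close>)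
    then show "(M, s, \<lambda>i. a i +[cobj M i, cobj L i] b i) \<in> roofs_of K L (chain_add K L f g)"
      using a by (simp add: roofs_of_def is_roof_iff chain_add_comp[OF f g s])
        (auto simp: chain_add_def htpc_def chm_def)
  qed
  have "{r. \<exists>M s a b. (M, s, a) \<in> roofs_of K L f \<and> (M, s, b) \<in> roofs_of K L g \<and>
       roof_eq C K L (M, s, \<lambda>i. a i +[cobj M i, cobj L i] b i) r} = roofs_of K L (chain_add K L f g)"
    using * mem_roofs_of[OF f] mem_roofs_of[OF g] by blast
  then show ?thesis by (simp add: roof_hom_def chain_class_eq f g chm_add)
qed

lemma roof_hom_smult:
  assumes f: "chm K L f" and c: "c \<in> carrier k"
  shows "c \<odot>\<^bsub>roof_hom C K L\<^esub> chain_class C K L f = chain_class C K L (chain_smult K L c f)"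
proof -
  have *: "{r. roof_eq C K L (M, s, \<lambda>i. c \<odot>\<^bsub>Hom C (cobj M i) (cobj L i)\<^esub> a i) r} = roofs_of K L (chain_smult K L c f)"
    if a: "(M, s, a) \<in> roofs_of K L f" for M s a
  proof (rule roofs_of_roof_eq[OF chm_smult[OF f c]])
    have s: "chm M K s" using roofs_of_chm[OF f a] by simp
    have "htpc M L (chain_smult M L c a) (chain_smult M L c (ccomp f s))"
      by (rule htpc_smult) (use a c in \<open>auto simp: roofs_of_def\<close>)
    then show "(M, s, \<lambda>i. c \<odot>\<^bsub>Hom C (cobj M i) (cobj L i)\<^esub> a i) \<in> roofs_of K L (chain_smult K L c f)"
      using a by (simp add: roofs_of_def is_roof_iff chain_smult_comp[OF f s c])
        (auto simp: chain_smult_def htpc_def chm_def)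
  qed
  have "{r. \<exists>M s a. (M, s, a) \<in> roofs_of K L f \<and>
       roof_eq C K L (M, s, \<lambda>i. c \<odot>\<^bsub>Hom C (cobj M i) (cobj L i)\<^esub> a i) r} = roofs_of K L (chain_smult K L c f)"
    using * mem_roofs_of[OF f] by blast
  then show ?thesis by (simp add: roof_hom_def chain_class_eq f chm_smult c)
qed

text \<open>Every completion of the corner between two representing roofs yields the class of g f;
  so the union over all completions in the definition is this one class, once a completion
  exists.\<close>

lemma roof_comp_chain_class:
  assumes f: "chm K L f" and g: "chm L A g"
  shows "roof_comp C (chain_class C L A g) (chain_class C K L f) = chain_class C K A (ccomp g f)"
proof -
  note gf = chm_comp[OF f g]
  have *: "{r. roof_eq C K A (P, ccomp s u, ccomp b v) r} = roofs_of K A (ccomp g f)"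
    if a: "(M, s, a) \<in> roofs_of K L f" and b: "(N, t, b) \<in> roofs_of L A g"
      and P: "bdd P" "quasi_iso C P M u" "chain_map C P N v"
      "homotopic C P L (ccomp a u) (ccomp t v)" for M s a N t b P u v
  proof (rule roofs_of_roof_eq[OF gf])
    have s: "chm M K s" "chm M L a" "chm N L t" "chm N A b" using roofs_of_chm[OF f a] roofs_of_chm[OF g b] by auto
    have u: "chm P M u" and v: "chm P N v" using P s by (auto simp: chm_def quasi_iso_def)
    have av: "htpc P L (ccomp a u) (ccomp t v)"
      using P chm_comp[OF u s(2)] chm_comp[OF v s(3)] by (simp add: htpc_def)
    have "quasi_iso C P K (ccomp s u)"
      by (rule quasi_iso_comp[OF P(2)]) (use a s P in \<open>auto simp: roofs_of_def is_roof_iff chm_def\<close>)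
    then have r: "is_roof C K A (P, ccomp s u, ccomp b v)"
      using P chm_comp[OF v s(4)] by (simp add: is_roof_iff chm_def)
    have "htpc P A (ccomp b v) (ccomp g (ccomp t v))"
      using htpc_comp[OF htpc_refl[OF v], of A b "ccomp g t"] b
      by (simp add: roofs_of_def chm_comp_assoc[OF v s(3) g])
    also have "htpc P A (ccomp g (ccomp t v)) (ccomp g (ccomp a u))"
      by (rule htpc_comp[OF htpc_sym[OF av] htpc_refl[OF g]])
    also have "htpc P A (ccomp g (ccomp a u)) (ccomp g (ccomp f (ccomp s u)))"
      using htpc_comp[OF htpc_comp[OF htpc_refl[OF u], of L a "ccomp f s"] htpc_refl[OF g]] a
      by (simp add: roofs_of_def chm_comp_assoc[OF u s(1) f])
    finally show "(P, ccomp s u, ccomp b v) \<in> roofs_of K A (ccomp g f)"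
      using r by (simp add: roofs_of_def chm_comp_assoc[OF chm_comp[OF u s(1)] f g])
  qed
  have "{r. \<exists>M s a N t b P u v. (M, s, a) \<in> roofs_of K L f \<and> (N, t, b) \<in> roofs_of L A g \<and>
      bdd P \<and> quasi_iso C P M u \<and> chain_map C P N v \<and>
      homotopic C P L (ccomp a u) (ccomp t v) \<and>
      roof_eq C K A (P, ccomp s u, ccomp b v) r} = roofs_of K A (ccomp g f)"
    (is "?S = _")
  proof
    show "?S \<subseteq> roofs_of K A (ccomp g f)" using * by blast
    have K: "bdd K" and L: "bdd L" using f by (auto simp: chm_def)
    \<comment> \<open>For roofs with identity left legs the square is completed by \<open>K\<close>,
      with the identity and \<open>f\<close>, so the set of composites is not empty.\<close>
    have h: "homotopic C K L (ccomp f (cid K)) (ccomp (cid L) f)"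
      using htpc_refl[OF f] by (simp add: chm_comp_id[OF f] htpc_def)
    show "roofs_of K A (ccomp g f) \<subseteq> ?S"
      using *[OF mem_roofs_of[OF f] mem_roofs_of[OF g] K quasi_iso_id[OF K] chmD(3)[OF f] h]
        mem_roofs_of[OF f] mem_roofs_of[OF g] K quasi_iso_id[OF K] chmD(3)[OF f] h by blast
  qed
  then show ?thesis by (simp add: roof_comp_def chain_class_eq f g gf)
qed

lemma roof_hom_module:
  assumes K: "bdd K" and L: "bdd L"
  shows "module k (roof_hom C K L)"
proof -
  interpret k: field k by (rule field_k)
  let ?M = "roof_hom C K L"
  note R = roof_hom_carrier[OF K L]
  have M: "module k (Hom C (cobj K i) (cobj L i))" for i using hom_module K L by simp
  have h: "\<phi> i \<in> homs C (cobj K i) (cobj L i)" if "chm K L \<phi>" for \<phi> i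
    using chmD(4)[OF that, of i] by (simp add: homs_iff)
  note rules = module.smult_l_distr[OF M] module.smult_r_distr[OF M] module.smult_assoc1[OF M] module.smult_one[OF M]
  have "abelian_group ?M"
  proof (rule abelian_groupI)
    show "\<zero>\<^bsub>?M\<^esub> \<in> carrier ?M" using chm_zero[OF K L] by (auto simp: R roof_hom_zero)
    fix x y assume "x \<in> carrier ?M" "y \<in> carrier ?M"
    then obtain f g where f: "chm K L f" "x = chain_class C K L f" and g: "chm K L g" "y = chain_class C K L g"
      by (auto simp: R)
    show "x \<oplus>\<^bsub>?M\<^esub> y \<in> carrier ?M" using f g chm_add by (auto simp: R roof_hom_add)
    have "chain_add K L f g = chain_add K L g f"
      using add_comm_arr[OF chmD(4)[OF f(1)] chmD(4)[OF g(1)]] by (simp add: chain_add_def)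
    then show "x \<oplus>\<^bsub>?M\<^esub> y = y \<oplus>\<^bsub>?M\<^esub> x" using f g by (simp add: roof_hom_add)
    show "x \<oplus>\<^bsub>?M\<^esub> y \<oplus>\<^bsub>?M\<^esub> z = x \<oplus>\<^bsub>?M\<^esub> (y \<oplus>\<^bsub>?M\<^esub> z)" if z: "z \<in> carrier ?M" for z
    proof -
      obtain h where h: "chm K L h" "z = chain_class C K L h" using z by (auto simp: R)
      have "chain_add K L (chain_add K L f g) h = chain_add K L f (chain_add K L g h)"
        using add_assoc_arr[OF chmD(4)[OF f(1)] chmD(4)[OF g(1)] chmD(4)[OF h(1)]] by (simp add: chain_add_def)
      then show ?thesis using f g h chm_add by (simp add: roof_hom_add)
    qed
    have "chain_add K L (chain_zero K L) f = f"
      using chmD(4)[OF f(1)] by (simp add: chain_add_def chain_zero_def)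
    then show "\<zero>\<^bsub>?M\<^esub> \<oplus>\<^bsub>?M\<^esub> x = x" using f chm_zero[OF K L] by (simp add: roof_hom_add roof_hom_zero)
    let ?n = "\<lambda>i. \<ominus>\<^bsub>Hom C (cobj K i) (cobj L i)\<^esub> (f i)"
    have n: "chm K L ?n" using chmD(4,5)[OF f(1)] K L by (simp add: chm_def chain_map_iff)
    have "chain_add K L ?n f = chain_zero K L"
      using chmD(4)[OF f(1)] by (simp add: chain_add_def chain_zero_def)
    then have "chain_class C K L ?n \<oplus>\<^bsub>?M\<^esub> x = \<zero>\<^bsub>?M\<^esub>" using f n by (simp add: roof_hom_add roof_hom_zero)
    then show "\<exists>y\<in>carrier ?M. y \<oplus>\<^bsub>?M\<^esub> x = \<zero>\<^bsub>?M\<^esub>"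
      by (rule bexI) (use n in \<open>auto simp: R\<close>)
  qed
  then show ?thesis
  proof (rule moduleI[OF k.is_cring])
    fix x assume "x \<in> carrier ?M"
    then obtain f where f: "chm K L f" "x = chain_class C K L f" by (auto simp: R)
    have "chain_smult K L \<one>\<^bsub>k\<^esub> f = f" using rules(4)[OF h[OF f(1)]] by (simp add: chain_smult_def)
    then show "\<one>\<^bsub>k\<^esub> \<odot>\<^bsub>?M\<^esub> x = x" using f by (simp add: roof_hom_smult)
    fix a assume a: "a \<in> carrier k"
    show "a \<odot>\<^bsub>?M\<^esub> x \<in> carrier ?M" using f a chm_smult by (auto simp: R roof_hom_smult)
    show "(a \<oplus>\<^bsub>k\<^esub> b) \<odot>\<^bsub>?M\<^esub> x = a \<odot>\<^bsub>?M\<^esub> x \<oplus>\<^bsub>?M\<^esub> b \<odot>\<^bsub>?M\<^esub> x" if b: "b \<in> carrier k" for b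
    proof -
      have "chain_smult K L (a \<oplus>\<^bsub>k\<^esub> b) f = chain_add K L (chain_smult K L a f) (chain_smult K L b f)"
        using rules(1)[OF a b h[OF f(1)]] by (simp add: chain_add_def chain_smult_def)
      then show ?thesis using f a b chm_smult by (simp add: roof_hom_smult roof_hom_add)
    qed
    show "a \<odot>\<^bsub>?M\<^esub> (x \<oplus>\<^bsub>?M\<^esub> y) = a \<odot>\<^bsub>?M\<^esub> x \<oplus>\<^bsub>?M\<^esub> a \<odot>\<^bsub>?M\<^esub> y" if y: "y \<in> carrier ?M" for y
    proof -
      obtain g where g: "chm K L g" "y = chain_class C K L g" using y by (auto simp: R)
      have "chain_smult K L a (chain_add K L f g) = chain_add K L (chain_smult K L a f) (chain_smult K L a g)"
        using rules(2)[OF a h[OF f(1)] h[OF g(1)]] by (simp add: chain_add_def chain_smult_def)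
      then show ?thesis using f g a chm_smult chm_add by (simp add: roof_hom_smult roof_hom_add)
    qed
    show "(monoid.mult k a b) \<odot>\<^bsub>?M\<^esub> x = a \<odot>\<^bsub>?M\<^esub> (b \<odot>\<^bsub>?M\<^esub> x)" if b: "b \<in> carrier k" for b
    proof -
      have "chain_smult K L (monoid.mult k a b) f = chain_smult K L a (chain_smult K L b f)"
        using rules(3)[OF a b h[OF f(1)]] by (simp add: chain_smult_def)
      then show ?thesis using f a b chm_smult by (simp add: roof_hom_smult)
    qed
  qed
qed

end

section \<open>The bounded derived category as a linear category\<close>

locale semisimple_tensor_category = tensor_category k C + semisimple_category k C
  for k :: "'k ring" and C :: "('k, 'o, 'a, 'm) tcat_scheme" (structure)
begin

lemma Db_simps [simp]:
  "Obj (Db C) = {K. bdd K}" "Hom (Db C) = roof_hom C" "Dom (Db C) = fst"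
  "Cod (Db C) = (\<lambda>\<phi>. fst (snd \<phi>))" "Id (Db C) K = chain_class C K K (cid K)"
  "Comp (Db C) = roof_comp C" "TObj (Db C) = cplx_tensor C" "TArr (Db C) = roof_tensor C"
  "TUnit (Db C) = stalk C (TUnit C)"
  "Assoc (Db C) K L M = chain_class C (cplx_tensor C (cplx_tensor C K L) M)
       (cplx_tensor C K (cplx_tensor C L M)) (cplx_assoc C K L M)"
  "LUnit (Db C) K = chain_class C (cplx_tensor C (stalk C (TUnit C)) K) K (cplx_lunit C K)"
  "RUnit (Db C) K = chain_class C (cplx_tensor C K (stalk C (TUnit C))) K (cplx_runit C K)"
  by (simp_all add: Db_def)

lemma Db_homE:
  assumes "x \<in> homs (Db C) K L" "bdd K" "bdd L"
  obtains \<phi> where "chm K L \<phi>" "x = chain_class C K L \<phi>"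
  using assms by (auto simp: roof_hom_carrier)

lemma Db_linear_category: "linear_category k (Db C)"
proof (rule linear_category.intro)
  show "field k" by (rule field_k)
  show "module k (Hom (Db C) K L)" if "K \<in> Obj (Db C)" "L \<in> Obj (Db C)" for K L
    using that roof_hom_module by simp
  show "Id (Db C) K \<in> homs (Db C) K K" if "K \<in> Obj (Db C)" for K
    using that chm_id by (auto simp: roof_hom_carrier)
  fix K L f assume *: "K \<in> Obj (Db C)" "L \<in> Obj (Db C)" "f \<in> homs (Db C) K L"
  then obtain f0 where f0: "chm K L f0" "f = chain_class C K L f0" by (auto simp: roof_hom_carrier)
  show "Dom (Db C) f = K \<and> Cod (Db C) f = L" using f0 by (simp add: chain_class_eq)
  have bK: "bdd K" and bL: "bdd L" using f0 by (auto simp: chm_def)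
  show "Id (Db C) L o\<^bsub>Db C\<^esub> f = f" "f o\<^bsub>Db C\<^esub> Id (Db C) K = f"
    using f0 chm_id[OF bK] chm_id[OF bL] by (simp_all add: roof_comp_chain_class chm_comp_id)
  fix M g assume M: "M \<in> Obj (Db C)" and "g \<in> homs (Db C) L M"
  then obtain g0 where g0: "chm L M g0" "g = chain_class C L M g0" using * by (auto simp: roof_hom_carrier)
  show "g o\<^bsub>Db C\<^esub> f \<in> homs (Db C) K M"
    using f0 g0 M * chm_comp[OF f0(1) g0(1)] by (auto simp: roof_comp_chain_class roof_hom_carrier)
  show "(h o\<^bsub>Db C\<^esub> g) o\<^bsub>Db C\<^esub> f = h o\<^bsub>Db C\<^esub> (g o\<^bsub>Db C\<^esub> f)"
    if h: "N \<in> Obj (Db C)" "h \<in> homs (Db C) M N" for N h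
  proof -
    obtain h0 where "chm M N h0" "h = chain_class C M N h0" using h M by (auto simp: roof_hom_carrier)
    then show ?thesis using f0 g0 chm_comp by (simp add: roof_comp_chain_class chm_comp_assoc)
  qed
  show "(g \<oplus>\<^bsub>Hom (Db C) L M\<^esub> g') o\<^bsub>Db C\<^esub> f =
      (g o\<^bsub>Db C\<^esub> f) \<oplus>\<^bsub>Hom (Db C) K M\<^esub> (g' o\<^bsub>Db C\<^esub> f)" if h: "g' \<in> homs (Db C) L M" for g'
  proof -
    obtain h0 where "chm L M h0" "g' = chain_class C L M h0" using h M * by (auto simp: roof_hom_carrier)
    then show ?thesis using f0 g0 chm_comp chm_add
      by (simp add: roof_comp_chain_class roof_hom_add chain_add_comp)
  qed
  show "g o\<^bsub>Db C\<^esub> (f \<oplus>\<^bsub>Hom (Db C) K L\<^esub> f') =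
      (g o\<^bsub>Db C\<^esub> f) \<oplus>\<^bsub>Hom (Db C) K M\<^esub> (g o\<^bsub>Db C\<^esub> f')" if h: "f' \<in> homs (Db C) K L" for f'
  proof -
    obtain h0 where "chm K L h0" "f' = chain_class C K L h0" using h M * by (auto simp: roof_hom_carrier)
    then show ?thesis using f0 g0 chm_comp chm_add
      by (simp add: roof_comp_chain_class roof_hom_add chain_comp_add)
  qed
  fix c assume c: "c \<in> carrier k"
  show "(c \<odot>\<^bsub>Hom (Db C) L M\<^esub> g) o\<^bsub>Db C\<^esub> f = c \<odot>\<^bsub>Hom (Db C) K M\<^esub> (g o\<^bsub>Db C\<^esub> f)"
    "g o\<^bsub>Db C\<^esub> (c \<odot>\<^bsub>Hom (Db C) K L\<^esub> f) = c \<odot>\<^bsub>Hom (Db C) K M\<^esub> (g o\<^bsub>Db C\<^esub> f)"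
    using f0 g0 c chm_comp chm_smult
    by (simp_all add: roof_comp_chain_class roof_hom_smult chain_comp_smult chain_smult_comp)
qed

end

section \<open>Tensor products of complexes\<close>

context linear_monoidal_category
begin

lemma tensor_Obj [simp]: "\<lbrakk>X \<in> Obj C; Y \<in> Obj C\<rbrakk> \<Longrightarrow> X \<boxtimes> Y \<in> Obj C"
  by (rule tobj)

lemma unit_Obj [simp]: "TUnit C \<in> Obj C"
  by (rule unit_obj)

lemma tensor_ar:
  assumes "arrow C f" "arrow C g"
  shows "ar C (f \<star> g) (Dom C f \<boxtimes> Dom C g) (Cod C f \<boxtimes> Cod C g)"
  using tarr[of "Dom C f" "Cod C f" "Dom C g" "Cod C g" f g] assms arrow_homs by (simp add: homs_iff)

lemmas tensor_simps [simp] = arD[OF tensor_ar]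

lemma tensor_Id [simp]: "\<lbrakk>X \<in> Obj C; Y \<in> Obj C\<rbrakk> \<Longrightarrow> Id C X \<star> Id C Y = Id C (X \<boxtimes> Y)"
  by (rule tarr_id)

lemma tensor_comp:
  "\<lbrakk>arrow C f; arrow C f'; arrow C g; arrow C g'; Dom C f' = Cod C f; Dom C g' = Cod C g\<rbrakk>
    \<Longrightarrow> (f' \<star> g') o (f \<star> g) = (f' o f) \<star> (g' o g)"
  using tarr_comp[of "Dom C f" "Cod C f" "Cod C f'" "Dom C g" "Cod C g" "Cod C g'" f f' g g']
  by (simp add: homs_iff)

lemma tensor_comp_assoc:
  "\<lbrakk>arrow C f; arrow C f'; arrow C g; arrow C g'; Dom C f' = Cod C f; Dom C g' = Cod C g;
    arrow C x; Cod C x = Dom C f \<boxtimes> Dom C g\<rbrakk>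
    \<Longrightarrow> (f' \<star> g') o ((f \<star> g) o x) = ((f' o f) \<star> (g' o g)) o x"
  by (rule comp_eq_reassoc1[OF tensor_comp]) auto

lemma add_tensor [simp]:
  "\<lbrakk>arrow C f; arrow C f'; arrow C g; Dom C f = X; Dom C f' = X; Cod C f = X'; Cod C f' = X'\<rbrakk>
    \<Longrightarrow> (f +[X, X'] f') \<star> g = (f \<star> g) +[X \<boxtimes> Dom C g, X' \<boxtimes> Cod C g] (f' \<star> g)"
  by (rule tarr_add_left) (auto simp: homs_iff)

lemma tensor_add [simp]:
  "\<lbrakk>arrow C f; arrow C g; arrow C g'; Dom C g = Y; Dom C g' = Y; Cod C g = Y'; Cod C g' = Y'\<rbrakk>
    \<Longrightarrow> f \<star> (g +[Y, Y'] g') = (f \<star> g) +[Dom C f \<boxtimes> Y, Cod C f \<boxtimes> Y'] (f \<star> g')"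
  by (rule tarr_add_right) (auto simp: homs_iff)

lemma smult_tensor [simp]:
  "\<lbrakk>c \<in> carrier k; arrow C f; arrow C g; Dom C f = X; Cod C f = X'\<rbrakk>
    \<Longrightarrow> (c \<odot>\<^bsub>Hom C X X'\<^esub> f) \<star> g = c \<odot>\<^bsub>Hom C (X \<boxtimes> Dom C g) (X' \<boxtimes> Cod C g)\<^esub> (f \<star> g)"
  by (rule tarr_smult_left) (auto simp: homs_iff)

lemma tensor_smult [simp]:
  "\<lbrakk>c \<in> carrier k; arrow C f; arrow C g; Dom C g = Y; Cod C g = Y'\<rbrakk>
    \<Longrightarrow> f \<star> (c \<odot>\<^bsub>Hom C Y Y'\<^esub> g) = c \<odot>\<^bsub>Hom C (Dom C f \<boxtimes> Y) (Cod C f \<boxtimes> Y')\<^esub> (f \<star> g)"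
  by (rule tarr_smult_right) (auto simp: homs_iff)

lemma zero_tensor [simp]:
  assumes "X \<in> Obj C" "X' \<in> Obj C" "arrow C g"
  shows "zer X X' \<star> g = zer (X \<boxtimes> Dom C g) (X' \<boxtimes> Cod C g)"
proof (rule add_self_zero)
  show "ar C (zer X X' \<star> g) (X \<boxtimes> Dom C g) (X' \<boxtimes> Cod C g)" using assms by simp
  show "(zer X X' \<star> g) +[X \<boxtimes> Dom C g, X' \<boxtimes> Cod C g] (zer X X' \<star> g) = zer X X' \<star> g"
    using add_tensor[of "zer X X'" "zer X X'" g X X'] assms by simp
qed

lemma tensor_zero [simp]:
  assumes "Y \<in> Obj C" "Y' \<in> Obj C" "arrow C f"
  shows "f \<star> zer Y Y' = zer (Dom C f \<boxtimes> Y) (Cod C f \<boxtimes> Y')"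
proof (rule add_self_zero)
  show "ar C (f \<star> zer Y Y') (Dom C f \<boxtimes> Y) (Cod C f \<boxtimes> Y')" using assms by simp
  show "(f \<star> zer Y Y') +[Dom C f \<boxtimes> Y, Cod C f \<boxtimes> Y'] (f \<star> zer Y Y') = f \<star> zer Y Y'"
    using tensor_add[of f "zer Y Y'" "zer Y Y'" Y Y'] assms by simp
qed

lemma neg_tensor [simp]:
  assumes "arrow C f" "arrow C g" "Dom C f = X" "Cod C f = X'"
  shows "(-[X, X'] f) \<star> g = -[X \<boxtimes> Dom C g, X' \<boxtimes> Cod C g] (f \<star> g)"
proof (rule add_eq_zero_neg)
  have o: "X \<in> Obj C" "X' \<in> Obj C" using assms by auto
  show "ar C (f \<star> g) (X \<boxtimes> Dom C g) (X' \<boxtimes> Cod C g)"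
    "ar C ((-[X, X'] f) \<star> g) (X \<boxtimes> Dom C g) (X' \<boxtimes> Cod C g)" using assms o by simp_all
  show "(f \<star> g) +[X \<boxtimes> Dom C g, X' \<boxtimes> Cod C g] ((-[X, X'] f) \<star> g)
      = zer (X \<boxtimes> Dom C g) (X' \<boxtimes> Cod C g)"
    using add_tensor[of f "-[X, X'] f" g X X'] assms o by simp
qed

lemma tensor_neg [simp]:
  assumes "arrow C f" "arrow C g" "Dom C g = Y" "Cod C g = Y'"
  shows "f \<star> (-[Y, Y'] g) = -[Dom C f \<boxtimes> Y, Cod C f \<boxtimes> Y'] (f \<star> g)"
proof (rule add_eq_zero_neg)
  have o: "Y \<in> Obj C" "Y' \<in> Obj C" using assms by auto
  show "ar C (f \<star> g) (Dom C f \<boxtimes> Y) (Cod C f \<boxtimes> Y')"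
    "ar C (f \<star> (-[Y, Y'] g)) (Dom C f \<boxtimes> Y) (Cod C f \<boxtimes> Y')" using assms o by simp_all
  show "(f \<star> g) +[Dom C f \<boxtimes> Y, Cod C f \<boxtimes> Y'] (f \<star> (-[Y, Y'] g))
      = zer (Dom C f \<boxtimes> Y) (Cod C f \<boxtimes> Y')"
    using tensor_add[of f g "-[Y, Y'] g" Y Y'] assms o by simp
qed

lemma sgn_tensor [simp]:
  "\<lbrakk>arrow C f; arrow C g; Dom C f = X; Cod C f = X'\<rbrakk>
    \<Longrightarrow> sgn_arr C X X' n f \<star> g = sgn_arr C (X \<boxtimes> Dom C g) (X' \<boxtimes> Cod C g) n (f \<star> g)"
  by (simp add: sgn_arr_def)

lemma tensor_sgn [simp]:
  "\<lbrakk>arrow C f; arrow C g; Dom C g = Y; Cod C g = Y'\<rbrakk>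
    \<Longrightarrow> f \<star> sgn_arr C Y Y' n g = sgn_arr C (Dom C f \<boxtimes> Y) (Cod C f \<boxtimes> Y') n (f \<star> g)"
  by (simp add: sgn_arr_def)

lemma assoc_ar:
  "\<lbrakk>X \<in> Obj C; Y \<in> Obj C; Z \<in> Obj C\<rbrakk> \<Longrightarrow> ar C (Assoc C X Y Z) ((X \<boxtimes> Y) \<boxtimes> Z) (X \<boxtimes> (Y \<boxtimes> Z))"
  using assoc_hom by (simp add: homs_iff)

lemmas assoc_simps [simp] = arD[OF assoc_ar]

lemma assoc_nat:
  "\<lbrakk>arrow C f; arrow C g; arrow C h; Cod C f = X; Cod C g = Y; Cod C h = Z\<rbrakk>
    \<Longrightarrow> Assoc C X Y Z o ((f \<star> g) \<star> h) = (f \<star> (g \<star> h)) o Assoc C (Dom C f) (Dom C g) (Dom C h)"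
  by (rule assoc_natural) (auto simp: homs_iff)

lemma assoc_nat_assoc:
  "\<lbrakk>arrow C f; arrow C g; arrow C h; Cod C f = X; Cod C g = Y; Cod C h = Z;
    arrow C x; Cod C x = (Dom C f \<boxtimes> Dom C g) \<boxtimes> Dom C h\<rbrakk>
    \<Longrightarrow> Assoc C X Y Z o (((f \<star> g) \<star> h) o x) = (f \<star> (g \<star> h)) o (Assoc C (Dom C f) (Dom C g) (Dom C h) o x)"
  by (rule comp_eq_reassoc[OF assoc_nat]) auto

lemma lunit_ar: "X \<in> Obj C \<Longrightarrow> ar C (LUnit C X) (TUnit C \<boxtimes> X) X"
  using lunit_hom by (simp add: homs_iff)

lemma runit_ar: "X \<in> Obj C \<Longrightarrow> ar C (RUnit C X) (X \<boxtimes> TUnit C) X"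
  using runit_hom by (simp add: homs_iff)

lemmas unit_simps [simp] = arD[OF lunit_ar]
  arD[OF runit_ar]

lemma lunit_nat: "\<lbrakk>arrow C f; Cod C f = Y\<rbrakk> \<Longrightarrow> LUnit C Y o (Id C (TUnit C) \<star> f) = f o LUnit C (Dom C f)"
  by (rule lunit_natural) (auto simp: homs_iff)

lemma runit_nat: "\<lbrakk>arrow C f; Cod C f = Y\<rbrakk> \<Longrightarrow> RUnit C Y o (f \<star> Id C (TUnit C)) = f o RUnit C (Dom C f)"
  by (rule runit_natural) (auto simp: homs_iff)

lemma tensor_zero_obj: assumes "zero_obj C X" "Y \<in> Obj C" shows "zero_obj C (X \<boxtimes> Y)" "zero_obj C (Y \<boxtimes> X)"
proof -
  have X: "X \<in> Obj C" "Id C X = zer X X" using assms(1) by (auto simp: zero_obj_iff)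
  have "Id C (X \<boxtimes> Y) = zer X X \<star> Id C Y" "Id C (Y \<boxtimes> X) = Id C Y \<star> zer X X"
    using X(1) assms(2) unfolding X(2)[symmetric] by simp_all
  then show "zero_obj C (X \<boxtimes> Y)" "zero_obj C (Y \<boxtimes> X)" using X(1) assms(2) by (simp_all add: zero_obj_iff)
qed

text \<open>Tensoring with \<open>Y\<close> is additive, so it carries the resolution of the
  identity of \<open>B\<close> to one of the tensor product.\<close>

lemma dsum_tensor_left:
  assumes B: "is_dsum C I X B i p" and Y: "Y \<in> Obj C"
  shows "is_dsum C I (\<lambda>a. X a \<boxtimes> Y) (B \<boxtimes> Y) (\<lambda>a. i a \<star> Id C Y) (\<lambda>a. p a \<star> Id C Y)"
proof -
  note D = is_dsumD[OF B]
  have fin: "finite {a \<in> I. i a o p a \<noteq> zer B B}"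
    by (rule finite_dsum_support[of _ X]) (use D in auto)
  have "Id C (B \<boxtimes> Y) = arr_sum C B B I (\<lambda>a. i a o p a) \<star> Id C Y" unfolding D(7) using D(1) Y by simp
  also have "\<dots> = arr_sum C (B \<boxtimes> Y) (B \<boxtimes> Y) I (\<lambda>a. (i a o p a) \<star> Id C Y)"
    by (rule arr_sum_hom[where \<phi> = "\<lambda>x. x \<star> Id C Y"])
      (use D Y hom_abelian_group fin in \<open>auto simp: homs_iff\<close>)
  also have "\<dots> = arr_sum C (B \<boxtimes> Y) (B \<boxtimes> Y) I (\<lambda>a. (i a \<star> Id C Y) o (p a \<star> Id C Y))"
    by (rule arr_sum_cong) (use D Y in \<open>auto simp: tensor_comp\<close>)
  finally have s: "arr_sum C (B \<boxtimes> Y) (B \<boxtimes> Y) I (\<lambda>a. (i a \<star> Id C Y) o (p a \<star> Id C Y)) = Id C (B \<boxtimes> Y)" by simp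
  have "{a \<in> I. \<not> zero_obj C (X a \<boxtimes> Y)} \<subseteq> {a \<in> I. \<not> zero_obj C (X a)}"
    using tensor_zero_obj(1) Y by blast
  then have "finite {a \<in> I. \<not> zero_obj C (X a \<boxtimes> Y)}" using D(4) finite_subset by blast
  then show ?thesis unfolding is_dsum_def using D Y s by (auto simp: homs_iff tensor_comp)
qed

lemma dsum_tensor_right:
  assumes B: "is_dsum C I X B i p" and Y: "Y \<in> Obj C"
  shows "is_dsum C I (\<lambda>a. Y \<boxtimes> X a) (Y \<boxtimes> B) (\<lambda>a. Id C Y \<star> i a) (\<lambda>a. Id C Y \<star> p a)"
proof -
  note D = is_dsumD[OF B]
  have fin: "finite {a \<in> I. i a o p a \<noteq> zer B B}"
    by (rule finite_dsum_support[of _ X]) (use D in auto)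
  have "Id C (Y \<boxtimes> B) = Id C Y \<star> arr_sum C B B I (\<lambda>a. i a o p a)" unfolding D(7) using D(1) Y by simp
  also have "\<dots> = arr_sum C (Y \<boxtimes> B) (Y \<boxtimes> B) I (\<lambda>a. Id C Y \<star> (i a o p a))"
    by (rule arr_sum_hom[where \<phi> = "\<lambda>x. Id C Y \<star> x"])
      (use D Y hom_abelian_group fin in \<open>auto simp: homs_iff\<close>)
  also have "\<dots> = arr_sum C (Y \<boxtimes> B) (Y \<boxtimes> B) I (\<lambda>a. (Id C Y \<star> i a) o (Id C Y \<star> p a))"
    by (rule arr_sum_cong) (use D Y in \<open>auto simp: tensor_comp\<close>)
  finally have s: "arr_sum C (Y \<boxtimes> B) (Y \<boxtimes> B) I (\<lambda>a. (Id C Y \<star> i a) o (Id C Y \<star> p a)) = Id C (Y \<boxtimes> B)" by simp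
  have "{a \<in> I. \<not> zero_obj C (Y \<boxtimes> X a)} \<subseteq> {a \<in> I. \<not> zero_obj C (X a)}"
    using tensor_zero_obj(2) Y by blast
  then have "finite {a \<in> I. \<not> zero_obj C (Y \<boxtimes> X a)}" using D(4) finite_subset by blast
  then show ?thesis unfolding is_dsum_def using D Y s by (auto simp: homs_iff tensor_comp)
qed

end

section \<open>The tensor product of complexes and of chain maps\<close>

context semisimple_tensor_category
begin

abbreviation ctens where "ctens \<equiv> chain_tensor C"

text \<open>Opaque copies of \<open>tinj\<close> and \<open>tprj\<close>: as constants they admit
  typing rules by degree pairs, and the chosen direct sums stay hidden.\<close>

definition tin where "tin K L i j = dinj C (antidiag (i + j)) (tfam C K L) (i, j)"
definition tpr where "tpr K L i j = dprj C (antidiag (i + j)) (tfam C K L) (i, j)"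
abbreviation cten (infixl \<open>\<otimes>\<close> 75) where "K \<otimes> L \<equiv> cplx_tensor C K L"

lemma cobj_tensor: "cobj (K \<otimes> L) r = dsum C (antidiag r) (tfam C K L)"
  by (simp add: cplx_tensor_def Let_def)

lemma tfam_support:
  assumes "bdd K" "bdd L"
  shows "finite {(i, j). \<not> zero_obj C (cobj K i \<boxtimes> cobj L j)}"
proof (rule finite_subset)
  show "{(i, j). \<not> zero_obj C (cobj K i \<boxtimes> cobj L j)} \<subseteq>
      {i. \<not> zero_obj C (cobj K i)} \<times> {j. \<not> zero_obj C (cobj L j)}"
    using tensor_zero_obj assms by auto
  show "finite ({i. \<not> zero_obj C (cobj K i)} \<times> {j. \<not> zero_obj C (cobj L j)})"
    using bounded_complexD(6) assms by auto
qed

lemma tensor_dsum: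
  assumes "bdd K" "bdd L"
  shows "is_dsum C (antidiag r) (tfam C K L) (cobj (K \<otimes> L) r)
    (dinj C (antidiag r) (tfam C K L)) (dprj C (antidiag r) (tfam C K L))"
  unfolding cobj_tensor
proof (rule is_dsum_dsum)
  show "finite {a \<in> antidiag r. \<not> zero_obj C (tfam C K L a)}"
    by (rule finite_subset[OF _ tfam_support[OF assms]]) (auto simp: tfam_def)
qed (use assms in \<open>auto simp: tfam_def\<close>)

lemma tin_ar:
  assumes "bdd K" "bdd L"
  shows "ar C (tin K L i j) (cobj K i \<boxtimes> cobj L j) (cobj (K \<otimes> L) (i + j))"
    "ar C (tpr K L i j) (cobj (K \<otimes> L) (i + j)) (cobj K i \<boxtimes> cobj L j)"
  using is_dsumD(2,3)[OF tensor_dsum[OF assms], of "(i, j)" "i + j"]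
  by (auto simp: tin_def tpr_def antidiag_def tfam_def)

lemma cobj_tensor_Obj [simp]:
  "\<lbrakk>bdd K; bdd L\<rbrakk> \<Longrightarrow> cobj (K \<otimes> L) r \<in> Obj C"
  using is_dsumD(1)[OF tensor_dsum] by blast

lemma tin_simps [simp]:
  assumes "bdd K" "bdd L"
  shows "arrow C (tin K L i j)" "Dom C (tin K L i j) = cobj K i \<boxtimes> cobj L j"
    "Cod C (tin K L i j) = cobj (K \<otimes> L) (i + j)"
    "arrow C (tpr K L i j)" "Cod C (tpr K L i j) = cobj K i \<boxtimes> cobj L j"
    "Dom C (tpr K L i j) = cobj (K \<otimes> L) (i + j)"
  using tin_ar[OF assms] by simp_all

lemma tpr_tin:
  assumes "bdd K" "bdd L"
  shows "tpr K L i j o tin K L i j = Id C (cobj K i \<boxtimes> cobj L j)"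
    "\<lbrakk>i + j = i' + j'; (i, j) \<noteq> (i', j')\<rbrakk> \<Longrightarrow>
      tpr K L i' j' o tin K L i j = zer (cobj K i \<boxtimes> cobj L j) (cobj K i' \<boxtimes> cobj L j')"
  using is_dsumD(5)[OF tensor_dsum[OF assms], of "(i, j)" "i + j"]
    is_dsumD(6)[OF tensor_dsum[OF assms], of "(i, j)" "i + j" "(i', j')"]
  by (auto simp: tin_def tpr_def antidiag_def tfam_def)

lemma tin_epi:
  assumes "bdd K" "bdd L"
    "ar C f (cobj (K \<otimes> L) r) Z" "ar C g (cobj (K \<otimes> L) r) Z"
    "\<And>i j. r = i + j \<Longrightarrow> f o tin K L i j = g o tin K L i j"
  shows "f = g"
proof (rule dsum_epi[OF tensor_dsum[OF assms(1,2)] assms(3,4)])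
  fix a assume "a \<in> antidiag r"
  then show "f o dinj C (antidiag r) (tfam C K L) a = g o dinj C (antidiag r) (tfam C K L) a"
    using assms(5)[of "fst a" "snd a"] by (auto simp: antidiag_def tin_def)
qed

text \<open>The sum is written with \<open>tpr\<close>, whose implicit degree i + j depends on the
  pair, instead of with the projections of one fixed sum. This is the shape in which the maps of
  complexes are defined.\<close>

lemma tensor_induced:
  assumes K: "bdd K" and L: "bdd L"
    and f: "\<And>i j. r = i + j \<Longrightarrow> ar C (f i j) (cobj K i \<boxtimes> cobj L j) Z" and Z: "Z \<in> Obj C"
    and s: "s = arr_sum C (cobj (K \<otimes> L) r) Z (antidiag r) (\<lambda>(i, j). f i j o tpr K L i j)"
  shows "ar C s (cobj (K \<otimes> L) r) Z" "r = i + j \<Longrightarrow> s o tin K L i j = f i j"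
proof -
  have f': "\<And>a. a \<in> antidiag r \<Longrightarrow> ar C (case a of (i, j) \<Rightarrow> f i j) (tfam C K L a) Z"
    using f by (auto simp: antidiag_def tfam_def)
  have eq: "s = arr_sum C (cobj (K \<otimes> L) r) Z (antidiag r)
      (\<lambda>a. (case a of (i, j) \<Rightarrow> f i j) o dprj C (antidiag r) (tfam C K L) a)"
    unfolding s
  proof (rule arr_sum_cong)
    fix a assume a: "a \<in> antidiag r"
    then show "(case a of (i, j) \<Rightarrow> f i j o tpr K L i j) =
        (case a of (i, j) \<Rightarrow> f i j) o dprj C (antidiag r) (tfam C K L) a"
      by (auto simp: antidiag_def tpr_def)
    show "ar C ((case a of (i, j) \<Rightarrow> f i j) o dprj C (antidiag r) (tfam C K L) a) (cobj (K \<otimes> L) r) Z"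
      using f'[OF a] is_dsumD(3)[OF tensor_dsum[OF K L] a] by simp
  qed (use Z K L in auto)
  note I = dsum_induced[OF tensor_dsum[OF K L] f' Z]
  show "ar C s (cobj (K \<otimes> L) r) Z" unfolding eq by (rule I(1))
  show "s o tin K L i j = f i j" if "r = i + j"
    using I(2)[where b = "(i, j)"] that unfolding eq by (simp add: antidiag_def tin_def)
qed

text \<open>For homotopies, which are not given by a defining sum but only by prescribed values on
  the summands; the target degree may be shifted through \<open>Z\<close>.\<close>

lemma tensor_map_exists:
  assumes K: "bdd K" and L: "bdd L"
    and f: "\<And>i j. ar C (f i j) (cobj K i \<boxtimes> cobj L j) (Z (i + j))" and Z: "\<And>r. Z r \<in> Obj C"
  obtains F where "\<And>r. ar C (F r) (cobj (K \<otimes> L) r) (Z r)" "\<And>r i j. r = i + j \<Longrightarrow> F r o tin K L i j = f i j"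
proof -
  have f': "\<And>r i j. r = i + j \<Longrightarrow> ar C (f i j) (cobj K i \<boxtimes> cobj L j) (Z r)" using f by simp
  show thesis
    by (rule that[of "\<lambda>r. arr_sum C (cobj (K \<otimes> L) r) (Z r) (antidiag r) (\<lambda>(i, j). f i j o tpr K L i j)"])
      (rule tensor_induced[OF K L f' Z HOL.refl]; simp)+
qed

text \<open>The definition distributes the projection over both terms of the differential. Factoring
  it out again exhibits the differential as an induced arrow, with the stated restriction.\<close>

lemma cdiff_tensor:
  assumes K: "bdd K" and L: "bdd L"
  shows "ar C (cdiff (K \<otimes> L) r) (cobj (K \<otimes> L) r) (cobj (K \<otimes> L) (r + 1))"
    "r = i + j \<Longrightarrow> cdiff (K \<otimes> L) r o tin K L i j =
      (tin K L (i + 1) j o (cdiff K i \<star> Id C (cobj L j)))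
      +[cobj K i \<boxtimes> cobj L j, cobj (K \<otimes> L) (r + 1)]
      sgn_arr C (cobj K i \<boxtimes> cobj L j) (cobj (K \<otimes> L) (r + 1)) i (tin K L i (j + 1) o (Id C (cobj K i) \<star> cdiff L j))"
proof -
  let ?f = "\<lambda>i j. (tin K L (i + 1) j o (cdiff K i \<star> Id C (cobj L j)))
      +[cobj K i \<boxtimes> cobj L j, cobj (K \<otimes> L) (r + 1)]
      sgn_arr C (cobj K i \<boxtimes> cobj L j) (cobj (K \<otimes> L) (r + 1)) i (tin K L i (j + 1) o (Id C (cobj K i) \<star> cdiff L j))"
  have f: "ar C (?f i j) (cobj K i \<boxtimes> cobj L j) (cobj (K \<otimes> L) (r + 1))" if "r = i + j" for i j
    using K L that by (simp add: add_ac)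
  have s: "cdiff (K \<otimes> L) r = arr_sum C (cobj (K \<otimes> L) r) (cobj (K \<otimes> L) (r + 1)) (antidiag r)
      (\<lambda>(i, j). ?f i j o tpr K L i j)"
  proof -
    have "cdiff (K \<otimes> L) r = arr_sum C (cobj (K \<otimes> L) r) (cobj (K \<otimes> L) (r + 1)) (antidiag r) (\<lambda>(i, j).
       (tin K L (i + 1) j o (cdiff K i \<star> Id C (cobj L j)) o tpr K L i j)
       +[cobj (K \<otimes> L) r, cobj (K \<otimes> L) (r + 1)]
       sgn_arr C (cobj (K \<otimes> L) r) (cobj (K \<otimes> L) (r + 1)) i
         (tin K L i (j + 1) o (Id C (cobj K i) \<star> cdiff L j) o tpr K L i j))"
      by (simp add: cplx_tensor_def Let_def tin_def tpr_def)
    also have "\<dots> = arr_sum C (cobj (K \<otimes> L) r) (cobj (K \<otimes> L) (r + 1)) (antidiag r) (\<lambda>(i, j). ?f i j o tpr K L i j)"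
    proof (rule arr_sum_cong)
      fix a assume "a \<in> antidiag r"
      then obtain i j where a: "a = (i, j)" "r = i + j" by (auto simp: antidiag_def)
      show "ar C (case a of (i, j) \<Rightarrow> ?f i j o tpr K L i j) (cobj (K \<otimes> L) r) (cobj (K \<otimes> L) (r + 1))"
        using f[OF a(2)] K L a by simp
      show "(case a of (i, j) \<Rightarrow> (tin K L (i + 1) j o (cdiff K i \<star> Id C (cobj L j)) o tpr K L i j)
       +[cobj (K \<otimes> L) r, cobj (K \<otimes> L) (r + 1)]
       sgn_arr C (cobj (K \<otimes> L) r) (cobj (K \<otimes> L) (r + 1)) i
         (tin K L i (j + 1) o (Id C (cobj K i) \<star> cdiff L j) o tpr K L i j))
        = (case a of (i, j) \<Rightarrow> ?f i j o tpr K L i j)"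
        unfolding a using K L by (simp add: add_ac)
    qed (use K L in auto)
    finally show ?thesis .
  qed
  note I = tensor_induced[OF K L f cobj_tensor_Obj[OF K L] s]
  show "ar C (cdiff (K \<otimes> L) r) (cobj (K \<otimes> L) r) (cobj (K \<otimes> L) (r + 1))" by (rule I(1))
  show "cdiff (K \<otimes> L) r o tin K L i j = ?f i j" if "r = i + j" by (rule I(2)) (use that in auto)
qed

lemma cdiff_tensor_simps [simp]:
  assumes "bdd K" "bdd L"
  shows "arrow C (cdiff (K \<otimes> L) r)" "Dom C (cdiff (K \<otimes> L) r) = cobj (K \<otimes> L) r"
    "Cod C (cdiff (K \<otimes> L) r) = cobj (K \<otimes> L) (r + 1)"
  using cdiff_tensor(1)[OF assms] by auto

text \<open>The same formula precomposed with an arrow, so that signs need no types of their own.\<close>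

lemma cdiff_tensor_comp:
  assumes K: "bdd K" and L: "bdd L" and r: "r = i + j"
    and x: "ar C x W (cobj K i \<boxtimes> cobj L j)"
  shows "cdiff (K \<otimes> L) r o (tin K L i j o x) =
      (tin K L (i + 1) j o ((cdiff K i \<star> Id C (cobj L j)) o x))
      +[W, cobj (K \<otimes> L) (r + 1)]
      sgn_arr C W (cobj (K \<otimes> L) (r + 1)) i (tin K L i (j + 1) o ((Id C (cobj K i) \<star> cdiff L j) o x))"
  using comp_eq_reassoc1[OF cdiff_tensor(2)[OF K L r], of x] K L x r by (simp add: add_ac)

lemma tensor_support:
  assumes K: "bdd K" and L: "bdd L"
  shows "finite {r. \<not> zero_obj C (cobj (K \<otimes> L) r)}"
proof (rule finite_subset)
  show "finite ((\<lambda>(i, j). i + j) ` {(i, j). \<not> zero_obj C (cobj K i \<boxtimes> cobj L j)})"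
    using tfam_support[OF K L] by simp
  show "{r. \<not> zero_obj C (cobj (K \<otimes> L) r)} \<subseteq> (\<lambda>(i, j). i + j) ` {(i, j). \<not> zero_obj C (cobj K i \<boxtimes> cobj L j)}"
  proof (rule ccontr)
    assume "\<not> ?thesis"
    then obtain r where r: "\<not> zero_obj C (cobj (K \<otimes> L) r)"
      "r \<notin> (\<lambda>(i, j). i + j) ` {(i, j). \<not> zero_obj C (cobj K i \<boxtimes> cobj L j)}" by blast
    have "zero_obj C (cobj (K \<otimes> L) r)"
      by (rule empty_dsum_zero[OF tensor_dsum[OF K L]]) (use r(2) in \<open>auto simp: tfam_def antidiag_def\<close>)
    then show False using r(1) by simp
  qed
qed

lemma cdiff_sq:
  "bdd K \<Longrightarrow> cdiff K (i + 1) o cdiff K i = zer (cobj K i) (cobj K (i + 2))"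
  by (rule bounded_complexD)

lemma bounded_tensor [simp]:
  assumes K: "bdd K" and L: "bdd L"
  shows "bdd (K \<otimes> L)"
  unfolding bounded_complex_def
proof (intro conjI allI)
  fix r
  show "cdiff (K \<otimes> L) r \<in> homs C (cobj (K \<otimes> L) r) (cobj (K \<otimes> L) (r + 1))"
    using K L by (simp add: homs_iff)
  show "cdiff (K \<otimes> L) (r + 1) o cdiff (K \<otimes> L) r = zer (cobj (K \<otimes> L) r) (cobj (K \<otimes> L) (r + 2))"
  proof (rule tin_epi[OF K L])
    fix i j assume r: "r = i + j"
    let ?D = "cdiff (K \<otimes> L)" and ?W = "cobj K i \<boxtimes> cobj L j" and ?T = "cobj (K \<otimes> L) (r + 2)"
    \<comment> \<open>The mixed term d tensor d arises twice: with sign (-1)^(i+1) when the left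
      factor is differentiated first, and with sign (-1)^i otherwise. The two cancel.\<close>
    let ?x = "tin K L (i + 1) (j + 1) o (cdiff K i \<star> cdiff L j)"
    have x: "ar C ?x ?W ?T" using K L r by (simp add: add_ac)
    have dd: "cdiff K (i + 1) o cdiff K i = zer (cobj K i) (cobj K (i + 1 + 1))"
      "cdiff L (j + 1) o cdiff L j = zer (cobj L j) (cobj L (j + 1 + 1))"
      using cdiff_sq[OF K, of i] cdiff_sq[OF L, of j] by (simp_all add: add_ac)
    have 1: "?D (r + 1) o (tin K L (i + 1) j o (cdiff K i \<star> Id C (cobj L j))) = sgn_arr C ?W ?T (i + 1) ?x"
      by (subst cdiff_tensor_comp[OF K L, where W = ?W])
        (use K L r x dd in \<open>simp_all add: tensor_comp add_ac\<close>)
    have 2: "?D (r + 1) o (tin K L i (j + 1) o (Id C (cobj K i) \<star> cdiff L j)) = ?x"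
      by (subst cdiff_tensor_comp[OF K L, where W = ?W])
        (use K L r x dd in \<open>simp_all add: tensor_comp add_ac\<close>)
    have t: "ar C (tin K L (i + 1) j o (cdiff K i \<star> Id C (cobj L j))) ?W (cobj (K \<otimes> L) (r + 1))"
      "ar C (tin K L i (j + 1) o (Id C (cobj K i) \<star> cdiff L j)) ?W (cobj (K \<otimes> L) (r + 1))"
      using K L r by (simp_all add: add_ac)
    have "?D (r + 1) o (?D r o tin K L i j) = sgn_arr C ?W ?T (i + 1) ?x +[?W, ?T] sgn_arr C ?W ?T i ?x"
      unfolding cdiff_tensor(2)[OF K L r] using t K L 1 2 by (simp add: add_ac)
    also have "\<dots> = zer ?W ?T" using x by (auto simp: sgn_arr_def)
    finally show "(?D (r + 1) o ?D r) o tin K L i j = zer (cobj (K \<otimes> L) r) ?T o tin K L i j"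
      using K L r by (simp add: add_ac)
  qed (use K L in \<open>auto simp: add_ac\<close>)
qed (use K L tensor_support in auto)

lemma chain_tensor_tin:
  assumes f: "chm K K' f" and g: "chm L L' g"
  shows "ar C (ctens K L K' L' f g r) (cobj (K \<otimes> L) r) (cobj (K' \<otimes> L') r)"
    "r = i + j \<Longrightarrow> ctens K L K' L' f g r o tin K L i j = tin K' L' i j o (f i \<star> g j)"
proof -
  note F = chmD[OF f] and G = chmD[OF g]
  let ?f = "\<lambda>i j. tin K' L' i j o (f i \<star> g j)"
  have t: "ar C (?f i j) (cobj K i \<boxtimes> cobj L j) (cobj (K' \<otimes> L') r)" if "r = i + j" for i j
    using F(1,2) G(1,2) F(4)[of i] G(4)[of j] that by simp
  have s: "ctens K L K' L' f g r =
      arr_sum C (cobj (K \<otimes> L) r) (cobj (K' \<otimes> L') r) (antidiag r) (\<lambda>(i, j). ?f i j o tpr K L i j)"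
  proof -
    have "ctens K L K' L' f g r = arr_sum C (cobj (K \<otimes> L) r) (cobj (K' \<otimes> L') r) (antidiag r)
        (\<lambda>(i, j). tin K' L' i j o (f i \<star> g j) o tpr K L i j)"
      by (simp add: chain_tensor_def tin_def tpr_def)
    also have "\<dots> = arr_sum C (cobj (K \<otimes> L) r) (cobj (K' \<otimes> L') r) (antidiag r) (\<lambda>(i, j). ?f i j o tpr K L i j)"
    proof (rule arr_sum_cong)
      fix a assume "a \<in> antidiag r"
      then obtain i j where a: "a = (i, j)" "r = i + j" by (auto simp: antidiag_def)
      show "(case a of (i, j) \<Rightarrow> tin K' L' i j o (f i \<star> g j) o tpr K L i j) = (case a of (i, j) \<Rightarrow> ?f i j o tpr K L i j)"
        "ar C (case a of (i, j) \<Rightarrow> ?f i j o tpr K L i j) (cobj (K \<otimes> L) r) (cobj (K' \<otimes> L') r)"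
        unfolding a using F(1,2) G(1,2) F(4)[of i] G(4)[of j] by simp_all
    qed (use F(1,2) G(1,2) in auto)
    finally show ?thesis .
  qed
  note I = tensor_induced[OF F(1) G(1) t cobj_tensor_Obj[OF F(2) G(2)] s]
  show "ar C (ctens K L K' L' f g r) (cobj (K \<otimes> L) r) (cobj (K' \<otimes> L') r)" by (rule I(1))
  show "ctens K L K' L' f g r o tin K L i j = ?f i j" if "r = i + j" by (rule I(2)) (use that in auto)
qed

lemma chain_tensor_tin_comp:
  assumes f: "chm K K' f" and g: "chm L L' g" and r: "r = i + j" and x: "ar C x W (cobj K i \<boxtimes> cobj L j)"
  shows "ctens K L K' L' f g r o (tin K L i j o x) = tin K' L' i j o ((f i \<star> g j) o x)"
  by (rule comp_eq_reassoc[OF chain_tensor_tin(2)[OF f g r]])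
    (use chain_tensor_tin(1)[OF f g] chmD[OF f] chmD[OF g] x r in auto)

lemma chm_tensor:
  assumes f: "chm K K' f" and g: "chm L L' g"
  shows "chm (K \<otimes> L) (K' \<otimes> L') (ctens K L K' L' f g)"
proof -
  note F = chmD[OF f] and G = chmD[OF g] and T = chain_tensor_tin[OF f g]
  have "cdiff (K' \<otimes> L') r o ctens K L K' L' f g r = ctens K L K' L' f g (r + 1) o cdiff (K \<otimes> L) r" for r
  proof (rule tin_epi[OF F(1) G(1)])
    fix i j assume r: "r = i + j"
    let ?W = "cobj K i \<boxtimes> cobj L j" and ?Z = "cobj (K' \<otimes> L') (r + 1)"
    note t = F(1,2) G(1,2) F(4)[of i] G(4)[of j] F(4)[of "i + 1"] G(4)[of "j + 1"] T(1)[of r] T(1)[of "r + 1"]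
    let ?X = "(tin K' L' (i + 1) j o ((f (i + 1) o cdiff K i) \<star> g j))
      +[?W, ?Z] sgn_arr C ?W ?Z i (tin K' L' i (j + 1) o (f i \<star> (g (j + 1) o cdiff L j)))"
    have "(cdiff (K' \<otimes> L') r o ctens K L K' L' f g r) o tin K L i j =
        cdiff (K' \<otimes> L') r o (tin K' L' i j o (f i \<star> g j))" using t r T(2)[OF r] by simp
    also have "\<dots> = ?X"
      by (subst cdiff_tensor_comp[OF F(2) G(2) r, where W = ?W]) (use t r in \<open>simp_all add: tensor_comp F(5) G(5)\<close>)
    also have "\<dots> = ctens K L K' L' f g (r + 1) o (cdiff (K \<otimes> L) r o tin K L i j)"
    proof -
      have c1: "ctens K L K' L' f g (r + 1) o (tin K L (i + 1) j o (cdiff K i \<star> Id C (cobj L j)))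
          = tin K' L' (i + 1) j o ((f (i + 1) o cdiff K i) \<star> g j)"
        by (subst chain_tensor_tin_comp[OF f g, where W = ?W]) (use t r in \<open>simp_all add: tensor_comp\<close>)
      have c2: "ctens K L K' L' f g (r + 1) o (tin K L i (j + 1) o (Id C (cobj K i) \<star> cdiff L j))
          = tin K' L' i (j + 1) o (f i \<star> (g (j + 1) o cdiff L j))"
        by (subst chain_tensor_tin_comp[OF f g, where W = ?W]) (use t r in \<open>simp_all add: tensor_comp\<close>)
      show ?thesis unfolding cdiff_tensor(2)[OF F(1) G(1) r]
        using t r c1 c2 by (simp add: add_ac)
    qed
    finally show "(cdiff (K' \<otimes> L') r o ctens K L K' L' f g r) o tin K L i j
      = (ctens K L K' L' f g (r + 1) o cdiff (K \<otimes> L) r) o tin K L i j" using t r by simp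
  qed (use T(1)[of r] T(1)[of "r + 1"] F(1,2) G(1,2) in auto)
  then show ?thesis using F(1,2) G(1,2) T(1) by (simp add: chm_def chain_map_iff)
qed

lemma chain_tensor_id:
  assumes K: "bdd K" and L: "bdd L"
  shows "ctens K L K L (cid K) (cid L) = cid (K \<otimes> L)" (is "?L = _")
proof
  fix r
  note T = chain_tensor_tin[OF chm_id[OF K] chm_id[OF L]]
  show "?L r = cid (K \<otimes> L) r"
    by (rule tin_epi[OF K L T(1)]) (use K L T(2) in \<open>auto simp: chain_id_def\<close>)
qed

text \<open>Chain maps have degree 0, so the interchange law holds without signs and can be checked
  on each summand.\<close>

lemma chain_tensor_comp:
  assumes f: "chm K K' f" and g: "chm L L' g" and f': "chm K' K'' f'" and g': "chm L' L'' g'"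
  shows "ctens K L K'' L'' (ccomp f' f) (ccomp g' g) =
    ccomp (ctens K' L' K'' L'' f' g') (ctens K L K' L' f g)" (is "?L = ?R")
proof
  fix r
  note F = chmD[OF f] and G = chmD[OF g] and F' = chmD[OF f'] and G' = chmD[OF g']
  note T = chain_tensor_tin[OF f g] and T' = chain_tensor_tin[OF f' g']
    and T'' = chain_tensor_tin[OF chm_comp[OF f f'] chm_comp[OF g g']]
  show "?L r = ?R r"
  proof (rule tin_epi[OF F(1) G(1) T''(1)])
    fix i j assume r: "r = i + j"
    note t = F(1,2) G(1,2) F'(1,2) G'(1,2) F(4)[of i] G(4)[of j] F'(4)[of i] G'(4)[of j] T(1)[of r] T'(1)[of r]
    show "ctens K L K'' L'' (ccomp f' f) (ccomp g' g) r o tin K L i j =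
      ccomp (ctens K' L' K'' L'' f' g') (ctens K L K' L' f g) r o tin K L i j"
      using t T(2)[OF r] T''(2)[OF r] chain_tensor_tin_comp[OF f' g' r, of "f i \<star> g j"] r
      by (simp add: chain_comp_def tensor_comp)
  qed (use T(1)[of r] T'(1)[of r] in \<open>simp add: chain_comp_def\<close>)
qed

lemma chain_tensor_add_left:
  assumes f: "chm K K' f" and f': "chm K K' f'" and g: "chm L L' g"
  shows "ctens K L K' L' (chain_add K K' f f') g =
    chain_add (K \<otimes> L) (K' \<otimes> L') (ctens K L K' L' f g) (ctens K L K' L' f' g)" (is "?L = ?R")
proof
  fix r
  note F = chmD[OF f] and F' = chmD[OF f'] and G = chmD[OF g]
  note T = chain_tensor_tin[OF f g] and T' = chain_tensor_tin[OF f' g] and T'' = chain_tensor_tin[OF chm_add[OF f f'] g]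
  show "?L r = ?R r"
  proof (rule tin_epi[OF F(1) G(1) T''(1)])
    fix i j assume r: "r = i + j"
    show "ctens K L K' L' (chain_add K K' f f') g r o tin K L i j =
      chain_add (K \<otimes> L) (K' \<otimes> L') (ctens K L K' L' f g) (ctens K L K' L' f' g) r o tin K L i j"
      unfolding T''(2)[OF r] using F(1,2) G(1,2) F(4)[of i] F'(4)[of i] G(4)[of j] T(1)[of r] T'(1)[of r] T(2)[OF r] T'(2)[OF r] r
      by (simp add: chain_add_def)
  qed (use T(1)[of r] T'(1)[of r] in \<open>simp add: chain_add_def\<close>)
qed

lemma chain_tensor_add_right:
  assumes f: "chm K K' f" and g: "chm L L' g" and g': "chm L L' g'"
  shows "ctens K L K' L' f (chain_add L L' g g') =
    chain_add (K \<otimes> L) (K' \<otimes> L') (ctens K L K' L' f g) (ctens K L K' L' f g')" (is "?L = ?R")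
proof
  fix r
  note F = chmD[OF f] and G' = chmD[OF g'] and G = chmD[OF g]
  note T = chain_tensor_tin[OF f g] and T' = chain_tensor_tin[OF f g'] and T'' = chain_tensor_tin[OF f chm_add[OF g g']]
  show "?L r = ?R r"
  proof (rule tin_epi[OF F(1) G(1) T''(1)])
    fix i j assume r: "r = i + j"
    show "ctens K L K' L' f (chain_add L L' g g') r o tin K L i j =
      chain_add (K \<otimes> L) (K' \<otimes> L') (ctens K L K' L' f g) (ctens K L K' L' f g') r o tin K L i j"
      unfolding T''(2)[OF r] using F(1,2) G(1,2) F(4)[of i] G'(4)[of j] G(4)[of j] T(1)[of r] T'(1)[of r] T(2)[OF r] T'(2)[OF r] r
      by (simp add: chain_add_def)
  qed (use T(1)[of r] T'(1)[of r] in \<open>simp add: chain_add_def\<close>)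
qed

lemma chain_tensor_smult:
  assumes f: "chm K K' f" and g: "chm L L' g" and c: "c \<in> carrier k"
  shows "ctens K L K' L' (chain_smult K K' c f) g =
      chain_smult (K \<otimes> L) (K' \<otimes> L') c (ctens K L K' L' f g)"
    "ctens K L K' L' f (chain_smult L L' c g) =
      chain_smult (K \<otimes> L) (K' \<otimes> L') c (ctens K L K' L' f g)"
proof -
  note F = chmD[OF f] and G = chmD[OF g] and T = chain_tensor_tin[OF f g]
    and T1 = chain_tensor_tin[OF chm_smult[OF f c] g] and T2 = chain_tensor_tin[OF f chm_smult[OF g c]]
  have s: "ar C (chain_smult (K \<otimes> L) (K' \<otimes> L') c (ctens K L K' L' f g) r) (cobj (K \<otimes> L) r) (cobj (K' \<otimes> L') r)" for r
    using T(1)[of r] c by (simp add: chain_smult_def)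
  have e: "chain_smult (K \<otimes> L) (K' \<otimes> L') c (ctens K L K' L' f g) r o tin K L i j =
    c \<odot>\<^bsub>Hom C (cobj K i \<boxtimes> cobj L j) (cobj (K' \<otimes> L') r)\<^esub> (tin K' L' i j o (f i \<star> g j))" if r: "r = i + j" for r i j
    using T(1)[of r] T(2)[OF r] F(1,2) G(1,2) c r by (simp add: chain_smult_def)
  have "ctens K L K' L' (chain_smult K K' c f) g r =
      chain_smult (K \<otimes> L) (K' \<otimes> L') c (ctens K L K' L' f g) r" for r
  proof (rule tin_epi[OF F(1) G(1) T1(1) s])
    fix i j assume r: "r = i + j"
    show "ctens K L K' L' (chain_smult K K' c f) g r o tin K L i j =
      chain_smult (K \<otimes> L) (K' \<otimes> L') c (ctens K L K' L' f g) r o tin K L i j"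
      unfolding T1(2)[OF r] e[OF r] using F(1,2) G(1,2) F(4)[of i] G(4)[of j] c r by (simp add: chain_smult_def)
  qed
  moreover have "ctens K L K' L' f (chain_smult L L' c g) r =
      chain_smult (K \<otimes> L) (K' \<otimes> L') c (ctens K L K' L' f g) r" for r
  proof (rule tin_epi[OF F(1) G(1) T2(1) s])
    fix i j assume r: "r = i + j"
    show "ctens K L K' L' f (chain_smult L L' c g) r o tin K L i j =
      chain_smult (K \<otimes> L) (K' \<otimes> L') c (ctens K L K' L' f g) r o tin K L i j"
      unfolding T2(2)[OF r] e[OF r] using F(1,2) G(1,2) F(4)[of i] G(4)[of j] c r by (simp add: chain_smult_def)
  qed
  ultimately show "ctens K L K' L' (chain_smult K K' c f) g =
      chain_smult (K \<otimes> L) (K' \<otimes> L') c (ctens K L K' L' f g)"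
    "ctens K L K' L' f (chain_smult L L' c g) =
      chain_smult (K \<otimes> L) (K' \<otimes> L') c (ctens K L K' L' f g)" by auto
qed

end

section \<open>The monoidal bounded derived category\<close>

context semisimple_tensor_category
begin

lemma contraction_ar: "contraction K L h \<Longrightarrow> ar C (h i) (cobj K i) (cobj L (i - 1))"
  unfolding contraction_def by blast

lemma contraction_ar_Suc: "contraction K L h \<Longrightarrow> ar C (h (i + 1)) (cobj K (i + 1)) (cobj L i)"
  using contraction_ar[of K L h "i + 1"] by simp

lemma sgn_arr_pred: "ar C f X Y \<Longrightarrow> sgn_arr C X Y (i - 1) f = -[X, Y] (sgn_arr C X Y i f)"
  by (auto simp: sgn_arr_def)

lemma sgn_arr_succ: "ar C f X Y \<Longrightarrow> sgn_arr C X Y (i + 1) f = -[X, Y] (sgn_arr C X Y i f)"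
  by (auto simp: sgn_arr_def)

lemma sgn_arr_add: "\<lbrakk>ar C f X Y; ar C g X Y\<rbrakk> \<Longrightarrow> sgn_arr C X Y n (f +[X, Y] g) =
    sgn_arr C X Y n f +[X, Y] sgn_arr C X Y n g"
  by (auto simp: sgn_arr_def neg_add_arr)

lemma sgn_arr_sgn_arr: "ar C f X Y \<Longrightarrow> sgn_arr C X Y n (sgn_arr C X Y m f) = sgn_arr C X Y (n + m) f"
  by (auto simp: sgn_arr_def)

text \<open>The cancellation pattern of a homotopy on a tensor product: \<open>s\<close> is the
  mixed term, which involves the homotopy in one factor and the differential in the other.\<close>

lemma add_swap_cancel:
  assumes "ar C a X Y" "ar C b X Y" "ar C s X Y"
  shows "(a +[X, Y] (-[X, Y] s)) +[X, Y] (b +[X, Y] s) = a +[X, Y] b"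
    "(s +[X, Y] a) +[X, Y] ((-[X, Y] s) +[X, Y] b) = a +[X, Y] b"
proof -
  have n: "ar C (-[X, Y] s) X Y" using assms by simp
  have "b +[X, Y] s = s +[X, Y] b" using add_comm_arr assms by blast
  then show "(a +[X, Y] (-[X, Y] s)) +[X, Y] (b +[X, Y] s) = a +[X, Y] b"
    using assms n by (simp add: add_assoc_arr neg_add_assoc)
  have "s +[X, Y] a = a +[X, Y] s" using add_comm_arr assms by blast
  then show "(s +[X, Y] a) +[X, Y] ((-[X, Y] s) +[X, Y] b) = a +[X, Y] b"
    using assms n by (simp add: add_assoc_arr add_neg_assoc)
qed

text \<open>The homotopy is h tensor g without sign. The mixed terms h tensor d g and h tensor g d
  carry the signs (-1)^(i-1) and (-1)^i and cancel, because \<open>h\<close> lowers the left degree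
  by one.\<close>

lemma htpc_tensor_left:
  assumes f: "htpc K K' f f'" and g: "chm L L' g"
  shows "htpc (K \<otimes> L) (K' \<otimes> L') (ctens K L K' L' f g) (ctens K L K' L' f' g)"
proof -
  have fc: "chm K K' f" "chm K K' f'" and fh: "homotopic C K K' f f'" using f by (auto simp: htpc_def)
  note F = chmD[OF fc(1)] and F' = chmD[OF fc(2)] and G = chmD[OF g]
  note T = chain_tensor_tin[OF fc(1) g] and T' = chain_tensor_tin[OF fc(2) g]
  obtain h where h: "contraction K K' h" "\<And>i. f i = f' i +[cobj K i, cobj K' i] boundary K K' h i"
    by (rule homotopicE[OF fh F(1,2) F(4) F'(4)]) blast
  note h1 = contraction_ar[OF h(1)] and h2 = contraction_ar_Suc[OF h(1)]
  have "ar C (tin K' L' (i - 1) j o (h i \<star> g j)) (cobj K i \<boxtimes> cobj L j) (cobj (K' \<otimes> L') (i + j - 1))" for i j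
    using h1[of i] G(4)[of j] F(2) G(2) by (simp add: algebra_simps)
  then obtain H where H: "\<And>r. ar C (H r) (cobj (K \<otimes> L) r) (cobj (K' \<otimes> L') (r - 1))"
    "\<And>r i j. r = i + j \<Longrightarrow> H r o tin K L i j = tin K' L' (i - 1) j o (h i \<star> g j)"
    by (rule tensor_map_exists[OF F(1) G(1), of "\<lambda>i j. tin K' L' (i - 1) j o (h i \<star> g j)" "\<lambda>r. cobj (K' \<otimes> L') (r - 1)"])
      (use F(2) G(2) in auto)
  have Hc: "contraction (K \<otimes> L) (K' \<otimes> L') H" using H(1) by (simp add: contraction_def)
  note bT = bounded_tensor[OF F(1) G(1)] bounded_tensor[OF F(2) G(2)]
  have "homotopic C (K \<otimes> L) (K' \<otimes> L') (ctens K L K' L' f g) (ctens K L K' L' f' g)"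
  proof (rule homotopicI[OF bT T(1) T'(1) Hc])
    fix r
    note B = boundary_ar[OF Hc bT, of r]
    show "ctens K L K' L' f g r = ctens K L K' L' f' g r
      +[cobj (K \<otimes> L) r, cobj (K' \<otimes> L') r] boundary (K \<otimes> L) (K' \<otimes> L') H r"
    proof (rule tin_epi[OF F(1) G(1) T(1)])
      show "ar C (ctens K L K' L' f' g r
      +[cobj (K \<otimes> L) r, cobj (K' \<otimes> L') r] boundary (K \<otimes> L) (K' \<otimes> L') H r)
        (cobj (K \<otimes> L) r) (cobj (K' \<otimes> L') r)" using B T'(1)[of r] by simp
      fix i j assume r: "r = i + j"
      let ?W = "cobj K i \<boxtimes> cobj L j" and ?Z = "cobj (K' \<otimes> L') r"
      note t = F(1,2) G(1,2) F(4)[of i] F'(4)[of i] G(4)[of j] G(4)[of "j + 1"] h1[of i] h2[of i] bT H(1)[of r] H(1)[of "r + 1"]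
      let ?a = "tin K' L' i j o ((cdiff K' (i - 1) o h i) \<star> g j)"
      let ?b = "tin K' L' i j o ((h (i + 1) o cdiff K i) \<star> g j)"
      let ?s = "tin K' L' (i - 1) (j + 1) o (h i \<star> (g (j + 1) o cdiff L j))"
      have ab: "ar C ?a ?W ?Z" "ar C ?b ?W ?Z" "ar C ?s ?W ?Z" using t r by (simp_all add: add_ac)
      have "cdiff (K' \<otimes> L') (r - 1) o (tin K' L' (i - 1) j o (h i \<star> g j)) = ?a +[?W, ?Z] sgn_arr C ?W ?Z (i - 1) ?s"
        by (subst cdiff_tensor_comp[OF F(2) G(2), where W = ?W]) (use t r in \<open>simp_all add: tensor_comp G(5)\<close>)
      then have 1: "cdiff (K' \<otimes> L') (r - 1) o (H r o tin K L i j) = ?a +[?W, ?Z] (-[?W, ?Z] (sgn_arr C ?W ?Z i ?s))"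
        using H(2)[OF r] sgn_arr_pred[OF ab(3)] by simp
      have H1: "H (r + 1) o (tin K L (i + 1) j o (cdiff K i \<star> Id C (cobj L j))) = ?b"
        by (subst comp_eq_reassoc[OF H(2)]) (use t r in \<open>simp_all add: tensor_comp add_ac\<close>)
      have H2: "H (r + 1) o (tin K L i (j + 1) o (Id C (cobj K i) \<star> cdiff L j)) = ?s"
        by (subst comp_eq_reassoc[OF H(2)]) (use t r in \<open>simp_all add: tensor_comp add_ac\<close>)
      have 2: "H (r + 1) o (cdiff (K \<otimes> L) r o tin K L i j) = ?b +[?W, ?Z] sgn_arr C ?W ?Z i ?s"
        unfolding cdiff_tensor(2)[OF F(1) G(1) r] using t r H1 H2 by (simp add: add_ac)
      have "boundary (K \<otimes> L) (K' \<otimes> L') H r o tin K L i j = ?a +[?W, ?Z] ?b"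
        unfolding boundary_def using t r 1 2 add_swap_cancel(1)[OF ab(1,2), of "sgn_arr C ?W ?Z i ?s"] ab by simp
      moreover have "ctens K L K' L' f g r o tin K L i j = (tin K' L' i j o (f' i \<star> g j)) +[?W, ?Z] (?a +[?W, ?Z] ?b)"
        unfolding T(2)[OF r] h(2)[of i] boundary_def using t r by simp
      ultimately show "ctens K L K' L' f g r o tin K L i j = (ctens K L K' L' f' g r
        +[cobj (K \<otimes> L) r, cobj (K' \<otimes> L') r] boundary (K \<otimes> L) (K' \<otimes> L') H r) o tin K L i j"
        using t r T'(1)[of r] T'(2)[OF r] B by simp
    qed
  qed
  then show ?thesis using chm_tensor[OF fc(1) g] chm_tensor[OF fc(2) g] by (simp add: htpc_def)
qed

text \<open>Here f tensor h needs the factor (-1)^i: \<open>h\<close> has odd degree and moves past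
  an element of degree i. With it the mixed terms carry opposite signs, and the sign on the d h term
  squares to one.\<close>

lemma htpc_tensor_right:
  assumes f: "chm K K' f" and g: "htpc L L' g g'"
  shows "htpc (K \<otimes> L) (K' \<otimes> L') (ctens K L K' L' f g) (ctens K L K' L' f g')"
proof -
  have gc: "chm L L' g" "chm L L' g'" and gh: "homotopic C L L' g g'" using g by (auto simp: htpc_def)
  note F = chmD[OF f] and G = chmD[OF gc(1)] and G' = chmD[OF gc(2)]
  note T = chain_tensor_tin[OF f gc(1)] and T' = chain_tensor_tin[OF f gc(2)]
  obtain h where h: "contraction L L' h" "\<And>i. g i = g' i +[cobj L i, cobj L' i] boundary L L' h i"
    by (rule homotopicE[OF gh G(1,2) G(4) G'(4)]) blast
  note h1 = contraction_ar[OF h(1)] and h2 = contraction_ar_Suc[OF h(1)]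
  let ?H = "\<lambda>i j. sgn_arr C (cobj K i \<boxtimes> cobj L j) (cobj (K' \<otimes> L') (i + j - 1)) i (tin K' L' i (j - 1) o (f i \<star> h j))"
  have "ar C (?H i j) (cobj K i \<boxtimes> cobj L j) (cobj (K' \<otimes> L') (i + j - 1))" for i j
    using h1[of j] F(4)[of i] F(2) G(2) by (simp add: algebra_simps)
  then obtain H where H: "\<And>r. ar C (H r) (cobj (K \<otimes> L) r) (cobj (K' \<otimes> L') (r - 1))"
    "\<And>r i j. r = i + j \<Longrightarrow> H r o tin K L i j = ?H i j"
    by (rule tensor_map_exists[OF F(1) G(1), of ?H "\<lambda>r. cobj (K' \<otimes> L') (r - 1)"])
      (use F(2) G(2) in auto)
  have Hc: "contraction (K \<otimes> L) (K' \<otimes> L') H" using H(1) by (simp add: contraction_def)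
  note bT = bounded_tensor[OF F(1) G(1)] bounded_tensor[OF F(2) G(2)]
  have "homotopic C (K \<otimes> L) (K' \<otimes> L') (ctens K L K' L' f g) (ctens K L K' L' f g')"
  proof (rule homotopicI[OF bT T(1) T'(1) Hc])
    fix r
    note B = boundary_ar[OF Hc bT, of r]
    show "ctens K L K' L' f g r = ctens K L K' L' f g' r
      +[cobj (K \<otimes> L) r, cobj (K' \<otimes> L') r] boundary (K \<otimes> L) (K' \<otimes> L') H r"
    proof (rule tin_epi[OF F(1) G(1) T(1)])
      show "ar C (ctens K L K' L' f g' r
      +[cobj (K \<otimes> L) r, cobj (K' \<otimes> L') r] boundary (K \<otimes> L) (K' \<otimes> L') H r)
        (cobj (K \<otimes> L) r) (cobj (K' \<otimes> L') r)" using B T'(1)[of r] by simp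
      fix i j assume r: "r = i + j"
      let ?W = "cobj K i \<boxtimes> cobj L j" and ?Z = "cobj (K' \<otimes> L') r"
      note t = F(1,2) G(1,2) F(4)[of i] F(4)[of "i + 1"] G(4)[of j] G'(4)[of j] h1[of j] h2[of j] bT H(1)[of r] H(1)[of "r + 1"]
      let ?a = "tin K' L' i j o (f i \<star> (cdiff L' (j - 1) o h j))"
      let ?b = "tin K' L' i j o (f i \<star> (h (j + 1) o cdiff L j))"
      let ?s = "tin K' L' (i + 1) (j - 1) o ((f (i + 1) o cdiff K i) \<star> h j)"
      have ab: "ar C ?a ?W ?Z" "ar C ?b ?W ?Z" "ar C ?s ?W ?Z" using t r by (simp_all add: algebra_simps)
      have x: "ar C (tin K' L' i (j - 1) o (f i \<star> h j)) ?W (cobj (K' \<otimes> L') (r - 1))"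
        using t r by (simp add: algebra_simps)
      have "cdiff (K' \<otimes> L') (r - 1) o (tin K' L' i (j - 1) o (f i \<star> h j)) = ?s +[?W, ?Z] sgn_arr C ?W ?Z i ?a"
        by (subst cdiff_tensor_comp[OF F(2) G(2), where W = ?W]) (use t r in \<open>simp_all add: tensor_comp F(5)\<close>)
      then have "cdiff (K' \<otimes> L') (r - 1) o (H r o tin K L i j) = sgn_arr C ?W ?Z i (?s +[?W, ?Z] sgn_arr C ?W ?Z i ?a)"
        using H(2)[OF r] x t r by simp
      then have 1: "cdiff (K' \<otimes> L') (r - 1) o (H r o tin K L i j) = sgn_arr C ?W ?Z i ?s +[?W, ?Z] ?a"
        using ab by (auto simp: sgn_arr_def neg_add_arr)
      have y: "ar C (tin K L (i + 1) j o (cdiff K i \<star> Id C (cobj L j))) ?W (cobj (K \<otimes> L) (r + 1))"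
        "ar C (tin K L i (j + 1) o (Id C (cobj K i) \<star> cdiff L j)) ?W (cobj (K \<otimes> L) (r + 1))"
        using t r by (simp_all add: add_ac)
      have H1: "H (r + 1) o (tin K L (i + 1) j o (cdiff K i \<star> Id C (cobj L j))) = -[?W, ?Z] (sgn_arr C ?W ?Z i ?s)"
      proof -
        have "H (r + 1) o (tin K L (i + 1) j o (cdiff K i \<star> Id C (cobj L j))) = ?H (i + 1) j o (cdiff K i \<star> Id C (cobj L j))"
          by (rule comp_eq_reassoc1[OF H(2)]) (use t r in \<open>simp_all add: add_ac\<close>)
        also have "\<dots> = sgn_arr C ?W ?Z (i + 1) ?s"
          using t r by (simp add: tensor_comp algebra_simps)
        finally show ?thesis using sgn_arr_succ[OF ab(3)] by simp
      qed
      have H2: "H (r + 1) o (tin K L i (j + 1) o (Id C (cobj K i) \<star> cdiff L j)) = sgn_arr C ?W ?Z i ?b"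
      proof -
        have "H (r + 1) o (tin K L i (j + 1) o (Id C (cobj K i) \<star> cdiff L j)) = ?H i (j + 1) o (Id C (cobj K i) \<star> cdiff L j)"
          by (rule comp_eq_reassoc1[OF H(2)]) (use t r in \<open>simp_all add: add_ac\<close>)
        also have "\<dots> = sgn_arr C ?W ?Z i ?b"
          using t r by (simp add: tensor_comp algebra_simps)
        finally show ?thesis .
      qed
      have 2: "H (r + 1) o (cdiff (K \<otimes> L) r o tin K L i j) = (-[?W, ?Z] (sgn_arr C ?W ?Z i ?s)) +[?W, ?Z] ?b"
      proof -
        have "H (r + 1) o (cdiff (K \<otimes> L) r o tin K L i j) =
            (H (r + 1) o (tin K L (i + 1) j o (cdiff K i \<star> Id C (cobj L j)))) +[?W, ?Z]
            sgn_arr C ?W ?Z i (H (r + 1) o (tin K L i (j + 1) o (Id C (cobj K i) \<star> cdiff L j)))"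
          unfolding cdiff_tensor(2)[OF F(1) G(1) r] using y H(1)[of "r + 1"]
          by (subst comp_add) simp_all
        then show ?thesis unfolding H1 H2 using ab(2) by (auto simp: sgn_arr_def)
      qed
      have "boundary (K \<otimes> L) (K' \<otimes> L') H r o tin K L i j = ?a +[?W, ?Z] ?b"
        unfolding boundary_def using t r 1 2 add_swap_cancel(2)[OF ab(1,2), of "sgn_arr C ?W ?Z i ?s"] ab by simp
      moreover have "ctens K L K' L' f g r o tin K L i j = (tin K' L' i j o (f i \<star> g' j)) +[?W, ?Z] (?a +[?W, ?Z] ?b)"
        unfolding T(2)[OF r] h(2)[of j] boundary_def using t r by simp
      ultimately show "ctens K L K' L' f g r o tin K L i j = (ctens K L K' L' f g' r
        +[cobj (K \<otimes> L) r, cobj (K' \<otimes> L') r] boundary (K \<otimes> L) (K' \<otimes> L') H r) o tin K L i j"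
        using t r T'(1)[of r] T'(2)[OF r] B by simp
    qed
  qed
  then show ?thesis using chm_tensor[OF f gc(1)] chm_tensor[OF f gc(2)] by (simp add: htpc_def)
qed

lemma htpc_tensor:
  assumes "htpc K K' f f'" "htpc L L' g g'"
  shows "htpc (K \<otimes> L) (K' \<otimes> L') (ctens K L K' L' f g) (ctens K L K' L' f' g')"
  using htpc_trans[OF htpc_tensor_left[OF assms(1)] htpc_tensor_right[OF _ assms(2)]] assms
  by (auto simp: htpc_def)

text \<open>Quasi-isomorphisms are homotopy equivalences, and these are preserved by any bifunctor
  compatible with homotopy. Hence tensoring the legs of two roofs gives a roof.\<close>

lemma quasi_iso_tensor:
  assumes "quasi_iso C M K s" "quasi_iso C M' K' s'"
    "bdd M" "bdd K" "bdd M'" "bdd K'"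
  shows "quasi_iso C (M \<otimes> M') (K \<otimes> K') (ctens M M' K K' s s')"
proof -
  obtain t where s: "chm M K s" "chm K M t" "htpc M M (ccomp t s) (cid M)"
    "htpc K K (ccomp s t) (cid K)" using quasi_isoE[OF assms(1,3,4)] by blast
  obtain t' where s': "chm M' K' s'" "chm K' M' t'" "htpc M' M' (ccomp t' s') (cid M')"
    "htpc K' K' (ccomp s' t') (cid K')" using quasi_isoE[OF assms(2,5,6)] by blast
  have b: "bdd (M \<otimes> M')" "bdd (K \<otimes> K')" using assms by auto
  show ?thesis unfolding quasi_iso_iff[OF b]
  proof (intro exI conjI)
    show "chm (M \<otimes> M') (K \<otimes> K') (ctens M M' K K' s s')" by (rule chm_tensor[OF s(1) s'(1)])
    show "chm (K \<otimes> K') (M \<otimes> M') (ctens K K' M M' t t')" by (rule chm_tensor[OF s(2) s'(2)])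
    show "htpc (M \<otimes> M') (M \<otimes> M') (ccomp (ctens K K' M M' t t') (ctens M M' K K' s s'))
        (cid (M \<otimes> M'))"
      using htpc_tensor[OF s(3) s'(3)] assms
      by (simp add: chain_tensor_comp[OF s(1) s'(1) s(2) s'(2)] chain_tensor_id)
    show "htpc (K \<otimes> K') (K \<otimes> K') (ccomp (ctens M M' K K' s s') (ctens K K' M M' t t'))
        (cid (K \<otimes> K'))"
      using htpc_tensor[OF s(4) s'(4)] assms
      by (simp add: chain_tensor_comp[OF s(2) s'(2) s(1) s'(1)] chain_tensor_id)
  qed
qed

lemma roof_tensor_chain_class:
  assumes f: "chm K L f" and g: "chm K' L' g"
  shows "roof_tensor C (chain_class C K L f) (chain_class C K' L' g) =
    chain_class C (K \<otimes> K') (L \<otimes> L') (ctens K K' L L' f g)"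
proof -
  note fg = chm_tensor[OF f g]
  have m: "(M \<otimes> M', ctens M M' K K' s s', ctens M M' L L' a b)
      \<in> roofs_of (K \<otimes> K') (L \<otimes> L') (ctens K K' L L' f g)"
    if a: "(M, s, a) \<in> roofs_of K L f" and b: "(M', s', b) \<in> roofs_of K' L' g" for M s a M' s' b
  proof -
    have c: "chm M K s" "chm M L a" "chm M' K' s'" "chm M' L' b" using roofs_of_chm[OF f a] roofs_of_chm[OF g b] by auto
    have r: "is_roof C K L (M, s, a)" "htpc M L a (ccomp f s)" "is_roof C K' L' (M', s', b)"
      "htpc M' L' b (ccomp g s')" using a b by (auto simp: roofs_of_def)
    have q: "quasi_iso C (M \<otimes> M') (K \<otimes> K') (ctens M M' K K' s s')"
      by (rule quasi_iso_tensor) (use r c in \<open>auto simp: is_roof_iff chm_def\<close>)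
    show ?thesis using q htpc_tensor[OF r(2,4)] chm_tensor[OF c(2,4)]
      by (simp add: roofs_of_def is_roof_iff chm_def chain_tensor_comp[OF c(1,3) f g])
  qed
  have "{r. \<exists>M s a M' s' b. (M, s, a) \<in> roofs_of K L f \<and> (M', s', b) \<in> roofs_of K' L' g \<and>
      roof_eq C (K \<otimes> K') (L \<otimes> L')
        (M \<otimes> M', ctens M M' K K' s s', ctens M M' L L' a b) r}
      = roofs_of (K \<otimes> K') (L \<otimes> L') (ctens K K' L L' f g)"
    using roofs_of_roof_eq[OF fg m] mem_roofs_of[OF f] mem_roofs_of[OF g] by blast
  then show ?thesis by (simp add: roof_tensor_def chain_class_eq f g fg)
qed

section \<open>Threefold tensor products and the associator of complexes\<close>

lemma tensor3_support:
  assumes "bdd K" "bdd L" "bdd M"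
  shows "finite {(i, j, l). \<not> zero_obj C (cobj K i) \<and> \<not> zero_obj C (cobj L j) \<and> \<not> zero_obj C (cobj M l)}"
  by (rule finite_subset[of _ "{i. \<not> zero_obj C (cobj K i)} \<times> {j. \<not> zero_obj C (cobj L j)} \<times> {l. \<not> zero_obj C (cobj M l)}"])
    (use bounded_complexD(6) assms in auto)

lemma tensor3_dsum_left:
  assumes K: "bdd K" and L: "bdd L" and M: "bdd M"
  shows "is_dsum C {(i, j, l). r = i + (j + l)} (\<lambda>(i, j, l). (cobj K i \<boxtimes> cobj L j) \<boxtimes> cobj M l) (cobj ((K \<otimes> L) \<otimes> M) r)
    (\<lambda>(i, j, l). tin (K \<otimes> L) M (i + j) l o (tin K L i j \<star> Id C (cobj M l)))
    (\<lambda>(i, j, l). (tpr K L i j \<star> Id C (cobj M l)) o tpr (K \<otimes> L) M (i + j) l)"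
proof -
  \<comment> \<open>Sends a triple of degrees to its index in the iterated sum: the outer pair (i +
    j, l), then the inner pair (i, j).\<close>
  let ?h = "\<lambda>(i, j, l). ((i + j, l), (i, j))"
  have Y: "is_dsum C (antidiag (fst a)) (\<lambda>b. tfam C K L b \<boxtimes> cobj M (snd a)) (tfam C (K \<otimes> L) M a)
      (\<lambda>b. dinj C (antidiag (fst a)) (tfam C K L) b \<star> Id C (cobj M (snd a)))
      (\<lambda>b. dprj C (antidiag (fst a)) (tfam C K L) b \<star> Id C (cobj M (snd a)))" for a
    using dsum_tensor_left[OF tensor_dsum[OF K L, of "fst a"], of "cobj M (snd a)"] M
    unfolding tfam_def[of C "K \<otimes> L" M] case_prod_beta by simp
  have "finite {(a, b). a \<in> antidiag r \<and> b \<in> antidiag (fst a) \<and> \<not> zero_obj C (tfam C K L b \<boxtimes> cobj M (snd a))}"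
    by (rule finite_surj[OF tensor3_support[OF K L M], of _ ?h])
      (use K L M tensor_zero_obj in \<open>fastforce simp: antidiag_def tfam_def image_iff\<close>)
  note d = dsum_dsum[OF tensor_dsum[OF bounded_tensor[OF K L] M, of r] Y this]
  show ?thesis
  proof (rule dsum_reindex[OF d, of ?h])
    show "bij_betw ?h {(i, j, l). r = i + (j + l)} (Sigma (antidiag r) (\<lambda>a. antidiag (fst a)))"
      by (rule bij_betw_byWitness[where f' = "\<lambda>((m, l), (i, j)). (i, j, l)"]) (auto simp: antidiag_def)
  qed (auto simp: tfam_def tin_def tpr_def add.assoc)
qed

lemma tensor3_dsum_right:
  assumes K: "bdd K" and L: "bdd L" and M: "bdd M"
  shows "is_dsum C {(i, j, l). r = i + (j + l)} (\<lambda>(i, j, l). cobj K i \<boxtimes> (cobj L j \<boxtimes> cobj M l)) (cobj (K \<otimes> (L \<otimes> M)) r)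
    (\<lambda>(i, j, l). tin K (L \<otimes> M) i (j + l) o (Id C (cobj K i) \<star> tin L M j l))
    (\<lambda>(i, j, l). (Id C (cobj K i) \<star> tpr L M j l) o tpr K (L \<otimes> M) i (j + l))"
proof -
  let ?h = "\<lambda>(i, j, l). ((i, j + l), (j, l))"
  have Y: "is_dsum C (antidiag (snd a)) (\<lambda>b. cobj K (fst a) \<boxtimes> tfam C L M b) (tfam C K (L \<otimes> M) a)
      (\<lambda>b. Id C (cobj K (fst a)) \<star> dinj C (antidiag (snd a)) (tfam C L M) b)
      (\<lambda>b. Id C (cobj K (fst a)) \<star> dprj C (antidiag (snd a)) (tfam C L M) b)" for a
    using dsum_tensor_right[OF tensor_dsum[OF L M, of "snd a"], of "cobj K (fst a)"] K
    unfolding tfam_def[of C K "L \<otimes> M"] case_prod_beta by simp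
  have "finite {(a, b). a \<in> antidiag r \<and> b \<in> antidiag (snd a) \<and> \<not> zero_obj C (cobj K (fst a) \<boxtimes> tfam C L M b)}"
    by (rule finite_surj[OF tensor3_support[OF K L M], of _ ?h])
      (use K L M tensor_zero_obj in \<open>fastforce simp: antidiag_def tfam_def image_iff\<close>)
  note d = dsum_dsum[OF tensor_dsum[OF K bounded_tensor[OF L M], of r] Y this]
  show ?thesis
  proof (rule dsum_reindex[OF d, of ?h])
    show "bij_betw ?h {(i, j, l). r = i + (j + l)} (Sigma (antidiag r) (\<lambda>a. antidiag (snd a)))"
      by (rule bij_betw_byWitness[where f' = "\<lambda>((i, m), (j, l)). (i, j, l)"]) (auto simp: antidiag_def)
  qed (auto simp: tfam_def tin_def tpr_def)
qed

lemma tin3_epi: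
  assumes K: "bdd K" and L: "bdd L" and M: "bdd M"
    and f: "ar C f (cobj ((K \<otimes> L) \<otimes> M) r) Z" and g: "ar C g (cobj ((K \<otimes> L) \<otimes> M) r) Z"
    and eq: "\<And>i j l. r = i + (j + l) \<Longrightarrow> f o tin (K \<otimes> L) M (i + j) l o (tin K L i j \<star> Id C (cobj M l))
      = g o tin (K \<otimes> L) M (i + j) l o (tin K L i j \<star> Id C (cobj M l))"
  shows "f = g"
  by (rule dsum_epi[OF tensor3_dsum_left[OF K L M] f g]) (use eq in auto)

text \<open>The defining sum is the arrow induced from the decomposition over triples in
  \<open>tensor3_dsum_left\<close>, so on each triple the associator is that of C.\<close>

lemma cplx_assoc_tin:
  assumes K: "bdd K" and L: "bdd L" and M: "bdd M"
  shows "ar C (cplx_assoc C K L M r) (cobj ((K \<otimes> L) \<otimes> M) r) (cobj (K \<otimes> (L \<otimes> M)) r)"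
    "r = i + (j + l) \<Longrightarrow> cplx_assoc C K L M r o tin (K \<otimes> L) M (i + j) l o (tin K L i j \<star> Id C (cobj M l)) =
      tin K (L \<otimes> M) i (j + l) o (Id C (cobj K i) \<star> tin L M j l) o Assoc C (cobj K i) (cobj L j) (cobj M l)"
proof -
  let ?X = "cobj ((K \<otimes> L) \<otimes> M) r" and ?Y = "cobj (K \<otimes> (L \<otimes> M)) r" and ?I = "{(i, j, l). r = i + (j + l)}"
  let ?u = "\<lambda>(i, j, l). tin K (L \<otimes> M) i (j + l) o (Id C (cobj K i) \<star> tin L M j l) o Assoc C (cobj K i) (cobj L j) (cobj M l)"
  let ?v = "\<lambda>(i, j, l). (tpr K L i j \<star> Id C (cobj M l)) o tpr (K \<otimes> L) M (i + j) l"
  let ?O = "\<lambda>(i, j, l). (cobj K i \<boxtimes> cobj L j) \<boxtimes> cobj M l"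
  note d = tensor3_dsum_left[OF K L M, of r] and o = bounded_tensor[OF K L] bounded_tensor[OF L M]
  have u: "ar C (?u a) (?O a) ?Y" if "a \<in> ?I" for a using that K L M o by (auto simp: add_ac)
  have Y: "?Y \<in> Obj C" using K o by simp
  have "cplx_assoc C K L M r = arr_sum C ?X ?Y ?I (\<lambda>(i, j, l).
      tin K (L \<otimes> M) i (j + l) o (Id C (cobj K i) \<star> tin L M j l) o Assoc C (cobj K i) (cobj L j) (cobj M l)
      o (tpr K L i j \<star> Id C (cobj M l)) o tpr (K \<otimes> L) M (i + j) l)"
    by (simp add: cplx_assoc_def tin_def tpr_def add.assoc eq_commute[of r])
  also have "\<dots> = arr_sum C ?X ?Y ?I (\<lambda>a. ?u a o ?v a)"
  proof (rule arr_sum_cong)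
    fix a assume a: "a \<in> ?I"
    then obtain i j l where a': "a = (i, j, l)" by auto
    show "ar C (?u a o ?v a) ?X ?Y" using u[OF a] is_dsumD(3)[OF d a] by simp
    show "(case a of (i, j, l) \<Rightarrow> tin K (L \<otimes> M) i (j + l) o (Id C (cobj K i) \<star> tin L M j l)
      o Assoc C (cobj K i) (cobj L j) (cobj M l) o (tpr K L i j \<star> Id C (cobj M l)) o tpr (K \<otimes> L) M (i + j) l) = ?u a o ?v a"
      unfolding a' using K L M o by simp
  qed (use M o Y in auto)
  finally have e: "cplx_assoc C K L M r = arr_sum C ?X ?Y ?I (\<lambda>a. ?u a o ?v a)" .
  note S = dsum_induced[OF d u Y]
  show "ar C (cplx_assoc C K L M r) ?X ?Y" unfolding e by (rule S(1))
  show "cplx_assoc C K L M r o tin (K \<otimes> L) M (i + j) l o (tin K L i j \<star> Id C (cobj M l)) =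
      tin K (L \<otimes> M) i (j + l) o (Id C (cobj K i) \<star> tin L M j l) o Assoc C (cobj K i) (cobj L j) (cobj M l)"
    if "r = i + (j + l)" using S(2)[of "(i, j, l)"] that unfolding e prod.case by blast
qed

text \<open>The form used in calculations: \<open>u\<close> and \<open>v\<close> absorb whatever
  precedes the inclusion of a summand, and \<open>m\<close> is separate from i + j because degrees
  often agree only up to arithmetic.\<close>

lemma cplx_assoc_comp:
  assumes K: "bdd K" and L: "bdd L" and M: "bdd M"
    and m: "m = i + j" and r: "r = i + (j + l)"
    and u: "arrow C u" "Cod C u = cobj K i \<boxtimes> cobj L j" and v: "arrow C v" "Cod C v = cobj M l"
  shows "cplx_assoc C K L M r o (tin (K \<otimes> L) M m l o ((tin K L i j o u) \<star> v)) =
    tin K (L \<otimes> M) i (j + l) o ((Id C (cobj K i) \<star> tin L M j l) o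
      (Assoc C (cobj K i) (cobj L j) (cobj M l) o (u \<star> v)))"
proof -
  note t = K L M u v
  let ?A = "cplx_assoc C K L M r" and ?i = "tin K L i j \<star> Id C (cobj M l)"
  have A: "ar C ?A (cobj ((K \<otimes> L) \<otimes> M) (i + j + l)) (cobj (K \<otimes> (L \<otimes> M)) r)"
    using cplx_assoc_tin(1)[OF K L M, of r] r by (simp add: add_ac)
  have "(tin K L i j o u) \<star> v = ?i o (u \<star> v)" using t by (simp add: tensor_comp)
  then have "?A o (tin (K \<otimes> L) M m l o ((tin K L i j o u) \<star> v)) = (?A o tin (K \<otimes> L) M (i + j) l o ?i) o (u \<star> v)"
    using t A m by simp
  also have "\<dots> = (tin K (L \<otimes> M) i (j + l) o (Id C (cobj K i) \<star> tin L M j l) o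
      Assoc C (cobj K i) (cobj L j) (cobj M l)) o (u \<star> v)"
    unfolding cplx_assoc_tin(2)[OF K L M r] ..
  finally show ?thesis using t by simp
qed

text \<open>On a triple both sides consist of the same three terms, with signs 1, (-1)^i and
  (-1)^(i+j). With brackets to the left the last sign is that of the outer product; with brackets to
  the right it is the product of (-1)^i and (-1)^j.\<close>

lemma chm_cplx_assoc:
  assumes K: "bdd K" and L: "bdd L" and M: "bdd M"
  shows "chm ((K \<otimes> L) \<otimes> M) (K \<otimes> (L \<otimes> M)) (cplx_assoc C K L M)"
proof -
  have b: "bdd (K \<otimes> L)" "bdd (L \<otimes> M)"
    "bdd ((K \<otimes> L) \<otimes> M)" "bdd (K \<otimes> (L \<otimes> M))" using K L M by auto
  note A = cplx_assoc_tin(1)[OF K L M]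
  have "cdiff (K \<otimes> (L \<otimes> M)) r o cplx_assoc C K L M r = cplx_assoc C K L M (r + 1) o cdiff ((K \<otimes> L) \<otimes> M) r" for r
  proof (rule tin3_epi[OF K L M])
    fix i j l assume r: "r = i + (j + l)"
    then have r': "r = (i + j) + l" by simp
    let ?W = "(cobj K i \<boxtimes> cobj L j) \<boxtimes> cobj M l" and ?Z = "cobj (K \<otimes> (L \<otimes> M)) (r + 1)"
    let ?S = "cobj ((K \<otimes> L) \<otimes> M) (r + 1)" and ?\<alpha> = "Assoc C (cobj K i) (cobj L j) (cobj M l)"
    let ?x = "tin K L i j \<star> Id C (cobj M l)"
    note t = K L M b A[of r] A[of "r + 1"] r
    let ?a1 = "tin K (L \<otimes> M) (i + 1) (j + l) o ((cdiff K i \<star> tin L M j l) o ?\<alpha>)"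
    let ?a2 = "tin K (L \<otimes> M) i (j + l + 1) o ((Id C (cobj K i) \<star> (tin L M (j + 1) l o (cdiff L j \<star> Id C (cobj M l)))) o ?\<alpha>)"
    let ?a3 = "tin K (L \<otimes> M) i (j + l + 1) o ((Id C (cobj K i) \<star> (tin L M j (l + 1) o (Id C (cobj L j) \<star> cdiff M l))) o ?\<alpha>)"
    have a: "ar C ?a1 ?W ?Z" "ar C ?a2 ?W ?Z" "ar C ?a3 ?W ?Z" using t by (simp_all add: add_ac)
    let ?y1 = "tin (K \<otimes> L) M (i + j + 1) l o ((tin K L (i + 1) j o (cdiff K i \<star> Id C (cobj L j))) \<star> Id C (cobj M l))"
    let ?y2 = "tin (K \<otimes> L) M (i + j + 1) l o ((tin K L i (j + 1) o (Id C (cobj K i) \<star> cdiff L j)) \<star> Id C (cobj M l))"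
    let ?y3 = "tin (K \<otimes> L) M (i + j) (l + 1) o (tin K L i j \<star> cdiff M l)"
    have y: "ar C ?y1 ?W ?S" "ar C ?y2 ?W ?S" "ar C ?y3 ?W ?S" using t by (simp_all add: add_ac)
    have D: "cdiff ((K \<otimes> L) \<otimes> M) r o (tin (K \<otimes> L) M (i + j) l o ?x) =
        (?y1 +[?W, ?S] sgn_arr C ?W ?S i ?y2) +[?W, ?S] sgn_arr C ?W ?S (i + j) ?y3"
    proof -
      let ?V = "cobj K i \<boxtimes> cobj L j" and ?T = "cobj (K \<otimes> L) (i + j + 1)"
      let ?p = "tin K L (i + 1) j o (cdiff K i \<star> Id C (cobj L j))" and ?q = "tin K L i (j + 1) o (Id C (cobj K i) \<star> cdiff L j)"
      have pq: "ar C ?p ?V ?T" "ar C ?q ?V ?T" using t by (simp_all add: add_ac)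
      have 1: "(cdiff (K \<otimes> L) (i + j) \<star> Id C (cobj M l)) o ?x = (?p +[?V, ?T] sgn_arr C ?V ?T i ?q) \<star> Id C (cobj M l)"
        unfolding cdiff_tensor(2)[OF K L HOL.refl, symmetric] using t by (simp add: tensor_comp)
      have 2: "(Id C (cobj (K \<otimes> L) (i + j)) \<star> cdiff M l) o ?x = tin K L i j \<star> cdiff M l"
        using t by (simp add: tensor_comp)
      have "tin (K \<otimes> L) M (i + j + 1) l o ((?p +[?V, ?T] sgn_arr C ?V ?T i ?q) \<star> Id C (cobj M l)) =
        ?y1 +[?W, ?S] sgn_arr C ?W ?S i ?y2" using pq t by (simp add: add_ac)
      then show ?thesis
        by (subst cdiff_tensor_comp[OF b(1) M r', where W = ?W]) (use t 1 2 in simp_all)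
    qed
    have 1: "cplx_assoc C K L M (r + 1) o ?y1 = ?a1"
      by (subst cplx_assoc_comp[OF K L M]) (use t in \<open>simp_all add: assoc_nat tensor_comp tensor_comp_assoc\<close>)
    have 2: "cplx_assoc C K L M (r + 1) o ?y2 = ?a2"
      by (subst cplx_assoc_comp[OF K L M]) (use t in \<open>simp_all add: assoc_nat tensor_comp tensor_comp_assoc add_ac\<close>)
    have 3: "cplx_assoc C K L M (r + 1) o ?y3 = ?a3"
    proof -
      \<comment> \<open>Identities are inserted to give the inclusion the shape of a composite with
        some \<open>u\<close>, which \<open>cplx_assoc_comp\<close> expects.\<close>
      have e: "tin K L i j \<star> cdiff M l = (tin K L i j o (Id C (cobj K i) \<star> Id C (cobj L j))) \<star> cdiff M l" using t by simp
      show ?thesis unfolding e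
        by (subst cplx_assoc_comp[OF K L M])
          (use t in \<open>simp_all del: tensor_Id add: assoc_nat tensor_comp tensor_comp_assoc add_ac\<close>)
    qed
    have lhs: "cplx_assoc C K L M (r + 1) o (cdiff ((K \<otimes> L) \<otimes> M) r o (tin (K \<otimes> L) M (i + j) l o ?x)) =
        (?a1 +[?W, ?Z] sgn_arr C ?W ?Z i ?a2) +[?W, ?Z] sgn_arr C ?W ?Z (i + j) ?a3"
    proof -
      have "cplx_assoc C K L M (r + 1) o ((?y1 +[?W, ?S] sgn_arr C ?W ?S i ?y2) +[?W, ?S] sgn_arr C ?W ?S (i + j) ?y3)
        = ((cplx_assoc C K L M (r + 1) o ?y1) +[?W, ?Z] sgn_arr C ?W ?Z i (cplx_assoc C K L M (r + 1) o ?y2))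
          +[?W, ?Z] sgn_arr C ?W ?Z (i + j) (cplx_assoc C K L M (r + 1) o ?y3)"
        using A[of "r + 1"] y by simp
      then show ?thesis unfolding D 1 2 3 .
    qed
    have rhs: "cdiff (K \<otimes> (L \<otimes> M)) r o (cplx_assoc C K L M r o (tin (K \<otimes> L) M (i + j) l o ?x)) =
        ?a1 +[?W, ?Z] sgn_arr C ?W ?Z i (?a2 +[?W, ?Z] sgn_arr C ?W ?Z j ?a3)"
    proof -
      let ?V = "cobj L j \<boxtimes> cobj M l" and ?T = "cobj (L \<otimes> M) (j + l + 1)"
      let ?p = "tin L M (j + 1) l o (cdiff L j \<star> Id C (cobj M l))" and ?q = "tin L M j (l + 1) o (Id C (cobj L j) \<star> cdiff M l)"
      have pq: "ar C ?p ?V ?T" "ar C ?q ?V ?T" using t by (simp_all add: add_ac)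
      have 1: "(Id C (cobj K i) \<star> cdiff (L \<otimes> M) (j + l)) o ((Id C (cobj K i) \<star> tin L M j l) o ?\<alpha>) =
        (Id C (cobj K i) \<star> (?p +[?V, ?T] sgn_arr C ?V ?T j ?q)) o ?\<alpha>"
        unfolding cdiff_tensor(2)[OF L M HOL.refl, symmetric] using t by (simp add: tensor_comp_assoc)
      have 2: "(cdiff K i \<star> Id C (cobj (L \<otimes> M) (j + l))) o ((Id C (cobj K i) \<star> tin L M j l) o ?\<alpha>) = (cdiff K i \<star> tin L M j l) o ?\<alpha>"
        using t by (simp add: tensor_comp_assoc)
      have 3: "tin K (L \<otimes> M) i (j + l + 1) o ((Id C (cobj K i) \<star> (?p +[?V, ?T] sgn_arr C ?V ?T j ?q)) o ?\<alpha>) =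
        ?a2 +[?W, ?Z] sgn_arr C ?W ?Z j ?a3" using pq t by (simp add: add_ac)
      have "cdiff (K \<otimes> (L \<otimes> M)) r o (tin K (L \<otimes> M) i (j + l) o ((Id C (cobj K i) \<star> tin L M j l) o ?\<alpha>)) =
          ?a1 +[?W, ?Z] sgn_arr C ?W ?Z i (?a2 +[?W, ?Z] sgn_arr C ?W ?Z j ?a3)"
        by (subst cdiff_tensor_comp[OF K b(2) r, where W = ?W]) (use t 1 2 3 in simp_all)
      then show ?thesis unfolding cplx_assoc_tin(2)[OF K L M r] by simp
    qed
    have "(?a1 +[?W, ?Z] sgn_arr C ?W ?Z i ?a2) +[?W, ?Z] sgn_arr C ?W ?Z (i + j) ?a3 =
      ?a1 +[?W, ?Z] sgn_arr C ?W ?Z i (?a2 +[?W, ?Z] sgn_arr C ?W ?Z j ?a3)"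
      using a by (simp add: sgn_arr_add sgn_arr_sgn_arr add_assoc_arr)
    then show "(cdiff (K \<otimes> (L \<otimes> M)) r o cplx_assoc C K L M r) o tin (K \<otimes> L) M (i + j) l o ?x =
      (cplx_assoc C K L M (r + 1) o cdiff ((K \<otimes> L) \<otimes> M) r) o tin (K \<otimes> L) M (i + j) l o ?x"
      using lhs rhs t by (simp add: add_ac)
  qed (use A[of r] A[of "r + 1"] b in auto)
  then show ?thesis using A b by (simp add: chm_def chain_map_iff)
qed

lemma cplx_assoc_natural:
  assumes f: "chm K K' f" and g: "chm L L' g" and h: "chm M M' h"
  shows "ccomp (cplx_assoc C K' L' M')
      (ctens (K \<otimes> L) M (K' \<otimes> L') M' (ctens K L K' L' f g) h) =
    ccomp (ctens K (L \<otimes> M) K' (L' \<otimes> M') f (ctens L M L' M' g h)) (cplx_assoc C K L M)" (is "?L = ?R")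
proof
  fix r
  note F = chmD[OF f] and G = chmD[OF g] and H = chmD[OF h]
  note A = cplx_assoc_tin[OF F(1) G(1) H(1)] and A' = cplx_assoc_tin[OF F(2) G(2) H(2)]
  note fg = chm_tensor[OF f g] and gh = chm_tensor[OF g h]
  note T1 = chain_tensor_tin[OF f g] and T2 = chain_tensor_tin[OF g h]
    and T3 = chain_tensor_tin[OF fg h] and T4 = chain_tensor_tin[OF f gh]
  show "?L r = ?R r"
  proof (rule tin3_epi[OF F(1) G(1) H(1), where Z = "cobj (K' \<otimes> (L' \<otimes> M')) r"])
    fix i j l assume r: "r = i + (j + l)"
    then have r': "r = (i + j) + l" by simp
    note t = F(1,2) G(1,2) H(1,2) F(4)[of i] G(4)[of j] H(4)[of l] T1(1)[of "i + j"] T2(1)[of "j + l"]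
      T3(1)[of r] T4(1)[of r] A(1)[of r] A'(1)[of r]
    let ?x = "tin K L i j \<star> Id C (cobj M l)" and ?\<alpha> = "Assoc C (cobj K i) (cobj L j) (cobj M l)"
    let ?W = "(cobj K i \<boxtimes> cobj L j) \<boxtimes> cobj M l"
    let ?res = "tin K' (L' \<otimes> M') i (j + l) o ((f i \<star> (tin L' M' j l o (g j \<star> h l))) o ?\<alpha>)"
    have "ctens (K \<otimes> L) M (K' \<otimes> L') M' (ctens K L K' L' f g) h r o (tin (K \<otimes> L) M (i + j) l o ?x)
        = tin (K' \<otimes> L') M' (i + j) l o ((tin K' L' i j o (f i \<star> g j)) \<star> h l)"
      by (subst chain_tensor_tin_comp[OF fg h r', where W = ?W])
        (use t in \<open>simp_all add: tensor_comp T1(2)[OF HOL.refl]\<close>)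
    moreover have "cplx_assoc C K' L' M' r o (tin (K' \<otimes> L') M' (i + j) l o ((tin K' L' i j o (f i \<star> g j)) \<star> h l)) = ?res"
      by (subst cplx_assoc_comp[OF F(2) G(2) H(2) HOL.refl r])
        (use t in \<open>simp_all add: assoc_nat tensor_comp_assoc\<close>)
    moreover have "ctens K (L \<otimes> M) K' (L' \<otimes> M') f (ctens L M L' M' g h) r o
        (cplx_assoc C K L M r o (tin (K \<otimes> L) M (i + j) l o ?x)) = ?res"
      unfolding A(2)[OF r]
      by (subst chain_tensor_tin_comp[OF f gh r, where W = ?W])
        (use t in \<open>simp_all add: tensor_comp_assoc T2(2)[OF HOL.refl]\<close>)
    ultimately show "ccomp (cplx_assoc C K' L' M')
      (ctens (K \<otimes> L) M (K' \<otimes> L') M' (ctens K L K' L' f g) h) r o tin (K \<otimes> L) M (i + j) l o ?x =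
    ccomp (ctens K (L \<otimes> M) K' (L' \<otimes> M') f (ctens L M L' M' g h)) (cplx_assoc C K L M) r
      o tin (K \<otimes> L) M (i + j) l o ?x"
      using t r by (simp add: chain_comp_def add_ac)
  qed (use T3(1)[of r] T4(1)[of r] A(1)[of r] A'(1)[of r] in \<open>simp_all add: chain_comp_def\<close>)
qed

text \<open>A degreewise inverse of a chain map commutes with the differentials automatically, so
  degreewise isomorphisms are invertible strictly and not merely up to homotopy.\<close>

lemma chm_inverse:
  assumes f: "chm K L f" and g: "\<And>i. ar C (g i) (cobj L i) (cobj K i)"
    "\<And>i. g i o f i = Id C (cobj K i)" "\<And>i. f i o g i = Id C (cobj L i)"
  shows "chm L K g" "ccomp g f = cid K" "ccomp f g = cid L"
proof -
  note F = chmD[OF f]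
  have "cdiff K i o g i = g (i + 1) o cdiff L i" for i
  proof -
    have "cdiff K i o g i = g (i + 1) o ((f (i + 1) o cdiff K i) o g i)"
      using F(1,2) F(4)[of i] F(4)[of "i + 1"] g(1)[of i] g(1)[of "i + 1"]
        comp_eq_reassoc1[OF g(2)[of "i + 1"], of "cdiff K i o g i"] by simp
    also have "\<dots> = g (i + 1) o ((cdiff L i o f i) o g i)" unfolding F(5) ..
    also have "\<dots> = g (i + 1) o cdiff L i"
      using F(1,2) F(4)[of i] g(1)[of i] g(1)[of "i + 1"] g(3)[of i] by simp
    finally show ?thesis .
  qed
  then show "chm L K g" using F(1,2) g(1) by (simp add: chm_def chain_map_iff)
  show "ccomp g f = cid K" "ccomp f g = cid L"
    using g by (auto simp: chain_comp_def chain_id_def)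
qed

text \<open>In each degree the associator is the isomorphism that \<open>dsum_isomorphic\<close>
  builds from the associators of C between the two decompositions over triples.\<close>

lemma cplx_assoc_inverse:
  assumes K: "bdd K" and L: "bdd L" and M: "bdd M"
  obtains g where "chm (K \<otimes> (L \<otimes> M)) ((K \<otimes> L) \<otimes> M) g"
    "ccomp g (cplx_assoc C K L M) = cid ((K \<otimes> L) \<otimes> M)"
    "ccomp (cplx_assoc C K L M) g = cid (K \<otimes> (L \<otimes> M))"
proof -
  note A = cplx_assoc_tin[OF K L M]
  have "\<exists>g. iso_pair (cplx_assoc C K L M r) g (cobj ((K \<otimes> L) \<otimes> M) r) (cobj (K \<otimes> (L \<otimes> M)) r)" for r
  proof -
    let ?c = "\<lambda>(i, j, l). Assoc C (cobj K i) (cobj L j) (cobj M l)"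
    have c: "iso_pair (?c a) (arr_inv C (?c a)) (case a of (i, j, l) \<Rightarrow> (cobj K i \<boxtimes> cobj L j) \<boxtimes> cobj M l)
        (case a of (i, j, l) \<Rightarrow> cobj K i \<boxtimes> (cobj L j \<boxtimes> cobj M l))" for a
      by (rule iso_pair_iso) (use assoc_iso K L M in \<open>auto split: prod.splits\<close>)
    obtain f g where fg: "iso_pair f g (cobj ((K \<otimes> L) \<otimes> M) r) (cobj (K \<otimes> (L \<otimes> M)) r)"
      and f: "\<And>a. a \<in> {(i, j, l). r = i + (j + l)} \<Longrightarrow>
        f o (case a of (i, j, l) \<Rightarrow> tin (K \<otimes> L) M (i + j) l o (tin K L i j \<star> Id C (cobj M l))) =
        (case a of (i, j, l) \<Rightarrow> tin K (L \<otimes> M) i (j + l) o (Id C (cobj K i) \<star> tin L M j l)) o ?c a"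
      by (rule dsum_isomorphic[OF tensor3_dsum_left[OF K L M] tensor3_dsum_right[OF K L M] c]) blast
    have "cplx_assoc C K L M r = f"
    proof (rule tin3_epi[OF K L M A(1) iso_pairD(1)[OF fg]])
      fix i j l assume r: "r = i + (j + l)"
      show "cplx_assoc C K L M r o tin (K \<otimes> L) M (i + j) l o (tin K L i j \<star> Id C (cobj M l)) =
        f o tin (K \<otimes> L) M (i + j) l o (tin K L i j \<star> Id C (cobj M l))"
        unfolding A(2)[OF r] using f[of "(i, j, l)"] r K L M by simp
    qed
    then show ?thesis using fg by blast
  qed
  then obtain g where g: "\<And>r. iso_pair (cplx_assoc C K L M r) (g r) (cobj ((K \<otimes> L) \<otimes> M) r) (cobj (K \<otimes> (L \<otimes> M)) r)"
    by metis
  show thesis by (rule that; rule chm_inverse[OF chm_cplx_assoc[OF K L M]]; rule iso_pairD[OF g])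
qed

section \<open>Stalk complexes, unitors, triangle and pentagon\<close>

lemma stalk_cobj [simp]: "cobj (stalk C X) i = (if i = 0 then X else the_zero C)"
  by (simp add: stalk_def Let_def)

lemma stalk_cdiff: "cdiff (stalk C X) i = zer (cobj (stalk C X) i) (cobj (stalk C X) (i + 1))"
  by (simp add: stalk_def Let_def)

lemma bounded_zero_diff:
  assumes o: "\<And>i. cobj K i \<in> Obj C" and d: "\<And>i. cdiff K i = zer (cobj K i) (cobj K (i + 1))"
    and fin: "finite {i. \<not> zero_obj C (cobj K i)}"
  shows "bdd K"
  unfolding bounded_complex_def
proof (intro conjI allI fin o)
  fix i
  show "cdiff K i \<in> homs C (cobj K i) (cobj K (i + 1))" unfolding d using o by (simp add: homs_iff)
  have "cdiff K (i + 1) o cdiff K i = zer (cobj K i) (cobj K (i + 1 + 1))"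
    unfolding d using o by simp
  then show "cdiff K (i + 1) o cdiff K i = zer (cobj K i) (cobj K (i + 2))" by (simp add: add.assoc)
qed

lemma bounded_stalk [simp]: assumes X: "X \<in> Obj C" shows "bdd (stalk C X)"
proof (rule bounded_zero_diff[OF _ stalk_cdiff])
  have "{i. \<not> zero_obj C (cobj (stalk C X) i)} \<subseteq> {0}" by auto
  then show "finite {i. \<not> zero_obj C (cobj (stalk C X) i)}" using finite_subset by blast
qed (use X in simp)

abbreviation unit_cplx (\<open>\<one>\<^sub>c\<close>) where "\<one>\<^sub>c \<equiv> stalk C (TUnit C)"

text \<open>Every summand other than the one with left degree 0 has a zero object as a tensor
  factor, so it cannot distinguish \<open>f\<close> from \<open>g\<close>.\<close>

lemma lunit_tin_epi:
  assumes K: "bdd K" and f: "ar C f (cobj (\<one>\<^sub>c \<otimes> K) r) Z" and g: "ar C g (cobj (\<one>\<^sub>c \<otimes> K) r) Z"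
    and eq: "f o tin \<one>\<^sub>c K 0 r = g o tin \<one>\<^sub>c K 0 r"
  shows "f = g"
proof (rule tin_epi[OF bounded_stalk[OF unit_Obj] K f g])
  fix i j assume r: "r = i + j"
  show "f o tin \<one>\<^sub>c K i j = g o tin \<one>\<^sub>c K i j"
  proof (cases "i = 0")
    case True
    then show ?thesis using eq r by simp
  next
    case False
    then have z: "zero_obj C (cobj \<one>\<^sub>c i \<boxtimes> cobj K j)" using K tensor_zero_obj(1)[OF zero_obj_the_zero] by simp
    have t: "ar C (tin \<one>\<^sub>c K i j) (cobj \<one>\<^sub>c i \<boxtimes> cobj K j) (cobj (\<one>\<^sub>c \<otimes> K) r)"
      using tin_ar(1)[OF bounded_stalk[OF unit_Obj] K, of i j] unfolding r .
    show ?thesis using from_zero_obj[OF z, of "f o tin \<one>\<^sub>c K i j" Z] from_zero_obj[OF z, of "g o tin \<one>\<^sub>c K i j" Z] t f g by auto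
  qed
qed

lemma runit_tin_epi:
  assumes K: "bdd K" and f: "ar C f (cobj (K \<otimes> \<one>\<^sub>c) r) Z" and g: "ar C g (cobj (K \<otimes> \<one>\<^sub>c) r) Z"
    and eq: "f o tin K \<one>\<^sub>c r 0 = g o tin K \<one>\<^sub>c r 0"
  shows "f = g"
proof (rule tin_epi[OF K bounded_stalk[OF unit_Obj] f g])
  fix i j assume r: "r = i + j"
  show "f o tin K \<one>\<^sub>c i j = g o tin K \<one>\<^sub>c i j"
  proof (cases "j = 0")
    case True
    then show ?thesis using eq r by simp
  next
    case False
    then have z: "zero_obj C (cobj K i \<boxtimes> cobj \<one>\<^sub>c j)" using K tensor_zero_obj(2)[OF zero_obj_the_zero] by simp
    have t: "ar C (tin K \<one>\<^sub>c i j) (cobj K i \<boxtimes> cobj \<one>\<^sub>c j) (cobj (K \<otimes> \<one>\<^sub>c) r)"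
      using tin_ar(1)[OF K bounded_stalk[OF unit_Obj], of i j] unfolding r .
    show ?thesis using from_zero_obj[OF z, of "f o tin K \<one>\<^sub>c i j" Z] from_zero_obj[OF z, of "g o tin K \<one>\<^sub>c i j" Z] t f g by auto
  qed
qed

lemma cplx_lunit_tin:
  assumes K: "bdd K"
  shows "ar C (cplx_lunit C K r) (cobj (\<one>\<^sub>c \<otimes> K) r) (cobj K r)"
    "cplx_lunit C K r o tin \<one>\<^sub>c K 0 r = LUnit C (cobj K r)"
proof -
  have e: "cplx_lunit C K r = LUnit C (cobj K r) o tpr \<one>\<^sub>c K 0 r" by (simp add: cplx_lunit_def tpr_def)
  have b: "bdd \<one>\<^sub>c" by simp
  show "ar C (cplx_lunit C K r) (cobj (\<one>\<^sub>c \<otimes> K) r) (cobj K r)" unfolding e using K b by simp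
  show "cplx_lunit C K r o tin \<one>\<^sub>c K 0 r = LUnit C (cobj K r)"
    unfolding e using K b tpr_tin(1)[OF b K, of 0 r] by simp
qed

lemma cplx_runit_tin:
  assumes K: "bdd K"
  shows "ar C (cplx_runit C K r) (cobj (K \<otimes> \<one>\<^sub>c) r) (cobj K r)"
    "cplx_runit C K r o tin K \<one>\<^sub>c r 0 = RUnit C (cobj K r)"
proof -
  have e: "cplx_runit C K r = RUnit C (cobj K r) o tpr K \<one>\<^sub>c r 0" by (simp add: cplx_runit_def tpr_def)
  have b: "bdd \<one>\<^sub>c" by simp
  show "ar C (cplx_runit C K r) (cobj (K \<otimes> \<one>\<^sub>c) r) (cobj K r)" unfolding e using K b by simp
  show "cplx_runit C K r o tin K \<one>\<^sub>c r 0 = RUnit C (cobj K r)"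
    unfolding e using K b tpr_tin(1)[OF K b, of r 0] by simp
qed

lemma chm_cplx_lunit: assumes K: "bdd K" shows "chm (\<one>\<^sub>c \<otimes> K) K (cplx_lunit C K)"
proof -
  have b: "bdd \<one>\<^sub>c" by simp
  note bT = bounded_tensor[OF b K] and l = cplx_lunit_tin[OF K]
  have "cdiff K r o cplx_lunit C K r = cplx_lunit C K (r + 1) o cdiff (\<one>\<^sub>c \<otimes> K) r" for r
  proof (rule lunit_tin_epi[OF K, where Z = "cobj K (r + 1)"])
    note t = K b bT l(1)[of r] l(1)[of "r + 1"]
    let ?W = "TUnit C \<boxtimes> cobj K r"
    \<comment> \<open>The unit complex has zero differential, and the sign on the remaining term is
      that of left degree 0.\<close>
    have d: "cdiff (\<one>\<^sub>c \<otimes> K) r o tin \<one>\<^sub>c K 0 r = tin \<one>\<^sub>c K 0 (r + 1) o (Id C (TUnit C) \<star> cdiff K r)"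
      by (subst cdiff_tensor(2)[OF b K, of r 0 r]) (use t in \<open>simp_all add: stalk_cdiff sgn_arr_def add_ac\<close>)
    have "cplx_lunit C K (r + 1) o (tin \<one>\<^sub>c K 0 (r + 1) o (Id C (TUnit C) \<star> cdiff K r)) =
      LUnit C (cobj K (r + 1)) o (Id C (TUnit C) \<star> cdiff K r)"
      by (rule comp_eq_reassoc1[OF l(2)]) (use t in simp_all)
    also have "\<dots> = cdiff K r o LUnit C (cobj K r)" using t by (simp add: lunit_nat)
    finally show "(cdiff K r o cplx_lunit C K r) o tin \<one>\<^sub>c K 0 r = (cplx_lunit C K (r + 1) o cdiff (\<one>\<^sub>c \<otimes> K) r) o tin \<one>\<^sub>c K 0 r"
      using t d l(2)[of r] by simp
  qed (use l(1)[of r] l(1)[of "r + 1"] bT K in simp_all)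
  then show ?thesis using l(1) bT K by (simp add: chm_def chain_map_iff)
qed

lemma chm_cplx_runit: assumes K: "bdd K" shows "chm (K \<otimes> \<one>\<^sub>c) K (cplx_runit C K)"
proof -
  have b: "bdd \<one>\<^sub>c" by simp
  note bT = bounded_tensor[OF K b] and l = cplx_runit_tin[OF K]
  have "cdiff K r o cplx_runit C K r = cplx_runit C K (r + 1) o cdiff (K \<otimes> \<one>\<^sub>c) r" for r
  proof (rule runit_tin_epi[OF K, where Z = "cobj K (r + 1)"])
    note t = K b bT l(1)[of r] l(1)[of "r + 1"]
    let ?W = "cobj K r \<boxtimes> TUnit C"
    \<comment> \<open>The sign (-1)^r multiplies the term with the differential of the unit complex,
      which is zero.\<close>
    have d: "cdiff (K \<otimes> \<one>\<^sub>c) r o tin K \<one>\<^sub>c r 0 = tin K \<one>\<^sub>c (r + 1) 0 o (cdiff K r \<star> Id C (TUnit C))"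
      by (subst cdiff_tensor(2)[OF K b, of r r 0]) (use t in \<open>simp_all add: stalk_cdiff add_ac\<close>)
    have "cplx_runit C K (r + 1) o (tin K \<one>\<^sub>c (r + 1) 0 o (cdiff K r \<star> Id C (TUnit C))) =
      RUnit C (cobj K (r + 1)) o (cdiff K r \<star> Id C (TUnit C))"
      by (rule comp_eq_reassoc1[OF l(2)]) (use t in simp_all)
    also have "\<dots> = cdiff K r o RUnit C (cobj K r)" using t by (simp add: runit_nat)
    finally show "(cdiff K r o cplx_runit C K r) o tin K \<one>\<^sub>c r 0 = (cplx_runit C K (r + 1) o cdiff (K \<otimes> \<one>\<^sub>c) r) o tin K \<one>\<^sub>c r 0"
      using t d l(2)[of r] by simp
  qed (use l(1)[of r] l(1)[of "r + 1"] bT K in simp_all)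
  then show ?thesis using l(1) bT K by (simp add: chm_def chain_map_iff)
qed

lemma cplx_lunit_inverse:
  assumes K: "bdd K"
  obtains g where "chm K (\<one>\<^sub>c \<otimes> K) g" "ccomp g (cplx_lunit C K) = cid (\<one>\<^sub>c \<otimes> K)"
    "ccomp (cplx_lunit C K) g = cid K"
proof -
  have b: "bdd \<one>\<^sub>c" by simp
  note l = cplx_lunit_tin[OF K]
  let ?\<beta> = "\<lambda>r. arr_inv C (LUnit C (cobj K r))"
  have \<beta>: "ar C (?\<beta> r) (cobj K r) (TUnit C \<boxtimes> cobj K r)" "?\<beta> r o LUnit C (cobj K r) = Id C (TUnit C \<boxtimes> cobj K r)"
    "LUnit C (cobj K r) o ?\<beta> r = Id C (cobj K r)" for r
    using arr_inv_simps[OF lunit_iso, of "cobj K r"] K by simp_all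
  let ?g = "\<lambda>r. tin \<one>\<^sub>c K 0 r o ?\<beta> r"
  have g: "ar C (?g r) (cobj K r) (cobj (\<one>\<^sub>c \<otimes> K) r)" for r using \<beta>(1)[of r] K b by simp
  have 1: "?g r o cplx_lunit C K r = Id C (cobj (\<one>\<^sub>c \<otimes> K) r)" for r
    by (rule lunit_tin_epi[OF K, where r = r and Z = "cobj (\<one>\<^sub>c \<otimes> K) r"]) (use \<beta>(1,2)[of r] l[of r] K b in simp_all)
  have 2: "cplx_lunit C K r o ?g r = Id C (cobj K r)" for r
    using comp_eq_reassoc1[OF l(2)[of r], of "?\<beta> r"] \<beta>(1,3)[of r] l(1)[of r] K b by simp
  show thesis by (rule that) (rule chm_inverse[OF chm_cplx_lunit[OF K] g 1 2])+
qed

lemma cplx_runit_inverse: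
  assumes K: "bdd K"
  obtains g where "chm K (K \<otimes> \<one>\<^sub>c) g" "ccomp g (cplx_runit C K) = cid (K \<otimes> \<one>\<^sub>c)"
    "ccomp (cplx_runit C K) g = cid K"
proof -
  have b: "bdd \<one>\<^sub>c" by simp
  note l = cplx_runit_tin[OF K]
  let ?\<beta> = "\<lambda>r. arr_inv C (RUnit C (cobj K r))"
  have \<beta>: "ar C (?\<beta> r) (cobj K r) (cobj K r \<boxtimes> TUnit C)" "?\<beta> r o RUnit C (cobj K r) = Id C (cobj K r \<boxtimes> TUnit C)"
    "RUnit C (cobj K r) o ?\<beta> r = Id C (cobj K r)" for r
    using arr_inv_simps[OF runit_iso, of "cobj K r"] K by simp_all
  let ?g = "\<lambda>r. tin K \<one>\<^sub>c r 0 o ?\<beta> r"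
  have g: "ar C (?g r) (cobj K r) (cobj (K \<otimes> \<one>\<^sub>c) r)" for r using \<beta>(1)[of r] K b by simp
  have 1: "?g r o cplx_runit C K r = Id C (cobj (K \<otimes> \<one>\<^sub>c) r)" for r
    by (rule runit_tin_epi[OF K, where r = r and Z = "cobj (K \<otimes> \<one>\<^sub>c) r"]) (use \<beta>(1,2)[of r] l[of r] K b in simp_all)
  have 2: "cplx_runit C K r o ?g r = Id C (cobj K r)" for r
    using comp_eq_reassoc1[OF l(2)[of r], of "?\<beta> r"] \<beta>(1,3)[of r] l(1)[of r] K b by simp
  show thesis by (rule that) (rule chm_inverse[OF chm_cplx_runit[OF K] g 1 2])+
qed

lemma cplx_lunit_natural:
  assumes f: "chm K L f"
  shows "ccomp (cplx_lunit C L) (ctens \<one>\<^sub>c K \<one>\<^sub>c L (cid \<one>\<^sub>c) f) = ccomp f (cplx_lunit C K)" (is "?L = ?R")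
proof
  fix r
  have b: "bdd \<one>\<^sub>c" by simp
  note F = chmD[OF f] and T = chain_tensor_tin[OF chm_id[OF b] f]
  note l = cplx_lunit_tin[OF F(1)] and l' = cplx_lunit_tin[OF F(2)]
  note t = b F(1,2) F(4)[of r] T(1)[of r] l(1)[of r] l'(1)[of r]
  show "?L r = ?R r"
  proof (rule lunit_tin_epi[OF F(1), where Z = "cobj L r"])
    have "cplx_lunit C L r o (ctens \<one>\<^sub>c K \<one>\<^sub>c L (cid \<one>\<^sub>c) f r o tin \<one>\<^sub>c K 0 r) =
        cplx_lunit C L r o (tin \<one>\<^sub>c L 0 r o (Id C (TUnit C) \<star> f r))"
      by (subst T(2)[of r 0 r]) (simp_all add: chain_id_def)
    also have "\<dots> = LUnit C (cobj L r) o (Id C (TUnit C) \<star> f r)"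
      by (rule comp_eq_reassoc1[OF l'(2)]) (use t in simp_all)
    also have "\<dots> = f r o LUnit C (cobj K r)" using t by (simp add: lunit_nat)
    finally show "ccomp (cplx_lunit C L) (ctens \<one>\<^sub>c K \<one>\<^sub>c L (cid \<one>\<^sub>c) f) r o tin \<one>\<^sub>c K 0 r =
      ccomp f (cplx_lunit C K) r o tin \<one>\<^sub>c K 0 r" using t l(2)[of r] by (simp add: chain_comp_def)
  qed (use t in \<open>simp_all add: chain_comp_def\<close>)
qed

lemma cplx_runit_natural:
  assumes f: "chm K L f"
  shows "ccomp (cplx_runit C L) (ctens K \<one>\<^sub>c L \<one>\<^sub>c f (cid \<one>\<^sub>c)) = ccomp f (cplx_runit C K)" (is "?L = ?R")
proof
  fix r
  have b: "bdd \<one>\<^sub>c" by simp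
  note F = chmD[OF f] and T = chain_tensor_tin[OF f chm_id[OF b]]
  note l = cplx_runit_tin[OF F(1)] and l' = cplx_runit_tin[OF F(2)]
  note t = b F(1,2) F(4)[of r] T(1)[of r] l(1)[of r] l'(1)[of r]
  show "?L r = ?R r"
  proof (rule runit_tin_epi[OF F(1), where Z = "cobj L r"])
    have "cplx_runit C L r o (ctens K \<one>\<^sub>c L \<one>\<^sub>c f (cid \<one>\<^sub>c) r o tin K \<one>\<^sub>c r 0) =
        cplx_runit C L r o (tin L \<one>\<^sub>c r 0 o (f r \<star> Id C (TUnit C)))"
      by (subst T(2)[of r r 0]) (simp_all add: chain_id_def)
    also have "\<dots> = RUnit C (cobj L r) o (f r \<star> Id C (TUnit C))"
      by (rule comp_eq_reassoc1[OF l'(2)]) (use t in simp_all)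
    also have "\<dots> = f r o RUnit C (cobj K r)" using t by (simp add: runit_nat)
    finally show "ccomp (cplx_runit C L) (ctens K \<one>\<^sub>c L \<one>\<^sub>c f (cid \<one>\<^sub>c)) r o tin K \<one>\<^sub>c r 0 =
      ccomp f (cplx_runit C K) r o tin K \<one>\<^sub>c r 0" using t l(2)[of r] by (simp add: chain_comp_def)
  qed (use t in \<open>simp_all add: chain_comp_def\<close>)
qed

text \<open>Triples whose middle degree is not 0 contribute zero objects; for middle degree 0 the
  identity is the triangle of C.\<close>

lemma cplx_triangle:
  assumes K: "bdd K" and L: "bdd L"
  shows "ccomp (ctens K (\<one>\<^sub>c \<otimes> L) K L (cid K) (cplx_lunit C L)) (cplx_assoc C K \<one>\<^sub>c L) =
    ctens (K \<otimes> \<one>\<^sub>c) L K L (cplx_runit C K) (cid L)" (is "?L = ?R")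
proof
  fix r
  have b: "bdd \<one>\<^sub>c" by simp
  note bT = bounded_tensor[OF b L] bounded_tensor[OF K b]
  note T1 = chain_tensor_tin[OF chm_id[OF K] chm_cplx_lunit[OF L]]
    and T2 = chain_tensor_tin[OF chm_cplx_runit[OF K] chm_id[OF L]]
  note A = cplx_assoc_tin[OF K b L] and l = cplx_lunit_tin[OF L] and rr = cplx_runit_tin[OF K]
  show "?L r = ?R r" (is "?lhs = ?rhs")
  proof (rule tin3_epi[OF K b L, where Z = "cobj (K \<otimes> L) r"])
    show lt: "ar C ?lhs (cobj ((K \<otimes> \<one>\<^sub>c) \<otimes> L) r) (cobj (K \<otimes> L) r)"
      using T1(1)[of r] A(1)[of r] by (simp add: chain_comp_def)
    show rt: "ar C ?rhs (cobj ((K \<otimes> \<one>\<^sub>c) \<otimes> L) r) (cobj (K \<otimes> L) r)" using T2(1) .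
    fix i j m assume r: "r = i + (j + m)"
    let ?y = "tin (K \<otimes> \<one>\<^sub>c) L (i + j) m o (tin K \<one>\<^sub>c i j \<star> Id C (cobj L m))"
    have yt: "ar C ?y ((cobj K i \<boxtimes> cobj \<one>\<^sub>c j) \<boxtimes> cobj L m) (cobj ((K \<otimes> \<one>\<^sub>c) \<otimes> L) r)"
      using K L b bT r by (simp add: add_ac)
    show "?lhs o ?y = ?rhs o ?y"
    proof (cases "j = 0")
      case False
      then have "zero_obj C (cobj K i \<boxtimes> cobj \<one>\<^sub>c j)" using K tensor_zero_obj(2)[OF zero_obj_the_zero] by simp
      then have z: "zero_obj C ((cobj K i \<boxtimes> cobj \<one>\<^sub>c j) \<boxtimes> cobj L m)" by (rule tensor_zero_obj) (use L in simp)
      show ?thesis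
        using from_zero_obj[OF z, of "?lhs o ?y" "cobj (K \<otimes> L) r"] from_zero_obj[OF z, of "?rhs o ?y" "cobj (K \<otimes> L) r"]
          yt lt rt by simp
    next
      case j: True
      have r0: "r = i + m" using r j by simp
      let ?\<alpha> = "Assoc C (cobj K i) (TUnit C) (cobj L m)"
      note t = K L b bT T1(1)[of r] T2(1)[of r] A(1)[of r] l(1)[of m] rr(1)[of i] r0 j
      have "?lhs o ?y = ctens K (\<one>\<^sub>c \<otimes> L) K L (cid K) (cplx_lunit C L) r o (cplx_assoc C K \<one>\<^sub>c L r o ?y)"
        using t yt by (simp add: chain_comp_def)
      also have "cplx_assoc C K \<one>\<^sub>c L r o ?y = tin K (\<one>\<^sub>c \<otimes> L) i m o ((Id C (cobj K i) \<star> tin \<one>\<^sub>c L 0 m) o ?\<alpha>)"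
        using A(2)[OF r] j by simp
      also have "ctens K (\<one>\<^sub>c \<otimes> L) K L (cid K) (cplx_lunit C L) r o
          (tin K (\<one>\<^sub>c \<otimes> L) i m o ((Id C (cobj K i) \<star> tin \<one>\<^sub>c L 0 m) o ?\<alpha>))
        = tin K L i m o ((cid K i \<star> cplx_lunit C L m) o ((Id C (cobj K i) \<star> tin \<one>\<^sub>c L 0 m) o ?\<alpha>))"
        by (rule chain_tensor_tin_comp[OF chm_id[OF K] chm_cplx_lunit[OF L] r0, where W = "(cobj K i \<boxtimes> TUnit C) \<boxtimes> cobj L m"])
          (use t in simp_all)
      also have "\<dots> = tin K L i m o ((Id C (cobj K i) \<star> LUnit C (cobj L m)) o ?\<alpha>)"
        using t l(2)[of m] by (simp add: chain_id_def tensor_comp_assoc)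
      also have "\<dots> = tin K L i m o (RUnit C (cobj K i) \<star> Id C (cobj L m))"
        using triangle[of "cobj K i" "cobj L m"] K L by simp
      also have "\<dots> = tin K L i m o ((cplx_runit C K i \<star> cid L m) o (tin K \<one>\<^sub>c i 0 \<star> Id C (cobj L m)))"
        using t rr(2)[of i] by (simp add: chain_id_def tensor_comp)
      also have "\<dots> = ?rhs o (tin (K \<otimes> \<one>\<^sub>c) L i m o (tin K \<one>\<^sub>c i 0 \<star> Id C (cobj L m)))"
        by (rule chain_tensor_tin_comp[OF chm_cplx_runit[OF K] chm_id[OF L] r0,
            where W = "(cobj K i \<boxtimes> TUnit C) \<boxtimes> cobj L m", symmetric]) (use t in simp_all)
      finally show ?thesis using j by simp
    qed
  qed
qed

text \<open>\<open>tin3_epi\<close> is applied with \<open>K \<otimes> L\<close> as a single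
  complex, and then only the innermost pair of degrees remains to be split, by tensoring its direct
  sum decomposition twice.\<close>

lemma tin4_epi:
  assumes K: "bdd K" and L: "bdd L" and M: "bdd M" and N: "bdd N"
    and f: "ar C f (cobj (((K \<otimes> L) \<otimes> M) \<otimes> N) r) Z" and g: "ar C g (cobj (((K \<otimes> L) \<otimes> M) \<otimes> N) r) Z"
    and eq: "\<And>i j l m. r = i + j + l + m \<Longrightarrow>
      f o (tin ((K \<otimes> L) \<otimes> M) N (i + j + l) m o ((tin (K \<otimes> L) M (i + j) l o (tin K L i j \<star> Id C (cobj M l))) \<star> Id C (cobj N m)))
      = g o (tin ((K \<otimes> L) \<otimes> M) N (i + j + l) m o ((tin (K \<otimes> L) M (i + j) l o (tin K L i j \<star> Id C (cobj M l))) \<star> Id C (cobj N m)))"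
  shows "f = g"
proof (rule tin3_epi[OF bounded_tensor[OF K L] M N f g])
  fix n l m assume r: "r = n + (l + m)"
  have b: "bdd (K \<otimes> L)" "bdd ((K \<otimes> L) \<otimes> M)" using K L M by auto
  note t = f g K L M N r b
  let ?y = "tin ((K \<otimes> L) \<otimes> M) N (n + l) m o (tin (K \<otimes> L) M n l \<star> Id C (cobj N m))"
  have y: "ar C ?y ((cobj (K \<otimes> L) n \<boxtimes> cobj M l) \<boxtimes> cobj N m) (cobj (((K \<otimes> L) \<otimes> M) \<otimes> N) r)"
    using t by (simp add: add_ac)
  show "f o ?y = g o ?y"
  proof (rule dsum_epi[OF dsum_tensor_left[OF dsum_tensor_left[OF tensor_dsum[OF K L]]], where Z = Z])
    show "cobj M l \<in> Obj C" "cobj N m \<in> Obj C" using M N by auto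
    show "ar C (f o ?y) ((cobj (K \<otimes> L) n \<boxtimes> cobj M l) \<boxtimes> cobj N m) Z"
      "ar C (g o ?y) ((cobj (K \<otimes> L) n \<boxtimes> cobj M l) \<boxtimes> cobj N m) Z" using y f g by auto
    fix a assume "a \<in> antidiag n"
    then obtain i j where a: "a = (i, j)" "n = i + j" by (auto simp: antidiag_def)
    let ?x = "(tin K L i j \<star> Id C (cobj M l)) \<star> Id C (cobj N m)"
    have y': "?y o ?x = tin ((K \<otimes> L) \<otimes> M) N (i + j + l) m o
        ((tin (K \<otimes> L) M (i + j) l o (tin K L i j \<star> Id C (cobj M l))) \<star> Id C (cobj N m))"
      unfolding a(2) using t by (simp add: tensor_comp)
    have x: "ar C ?x (((cobj K i \<boxtimes> cobj L j) \<boxtimes> cobj M l) \<boxtimes> cobj N m) ((cobj (K \<otimes> L) n \<boxtimes> cobj M l) \<boxtimes> cobj N m)"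
      using t a by simp
    have "f o (?y o ?x) = g o (?y o ?x)" unfolding y' by (rule eq) (use r a in simp)
    moreover have "(f o ?y) o ?x = f o (?y o ?x)" "(g o ?y) o ?x = g o (?y o ?x)"
      by (rule assoc_arr; use x y f g in simp)+
    ultimately show "(f o ?y) o ((dinj C (antidiag n) (tfam C K L) a \<star> Id C (cobj M l)) \<star> Id C (cobj N m)) =
      (g o ?y) o ((dinj C (antidiag n) (tfam C K L) a \<star> Id C (cobj M l)) \<star> Id C (cobj N m))"
      unfolding a tin_def[of K L i j, symmetric] by simp
  qed
qed

text \<open>Each associator of complexes passes through the inclusion of a fourfold summand and
  leaves an associator of C behind it; what remains is the pentagon for the four terms in degrees i,
  j, l, m.\<close>

lemma cplx_pentagon:
  assumes K: "bdd K" and L: "bdd L" and M: "bdd M" and N: "bdd N"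
  shows "ccomp (ctens K ((L \<otimes> M) \<otimes> N) K (L \<otimes> (M \<otimes> N)) (cid K) (cplx_assoc C L M N))
      (ccomp (cplx_assoc C K (L \<otimes> M) N)
        (ctens ((K \<otimes> L) \<otimes> M) N (K \<otimes> (L \<otimes> M)) N (cplx_assoc C K L M) (cid N))) =
    ccomp (cplx_assoc C K L (M \<otimes> N)) (cplx_assoc C (K \<otimes> L) M N)"
proof
  fix r
  have b: "bdd (K \<otimes> L)" "bdd (L \<otimes> M)" "bdd (M \<otimes> N)"
    "bdd ((K \<otimes> L) \<otimes> M)" "bdd (K \<otimes> (L \<otimes> M))"
    "bdd ((L \<otimes> M) \<otimes> N)" "bdd (L \<otimes> (M \<otimes> N))" using K L M N by auto
  let ?P = "ctens ((K \<otimes> L) \<otimes> M) N (K \<otimes> (L \<otimes> M)) N (cplx_assoc C K L M) (cid N)"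
  let ?Q = "ctens K ((L \<otimes> M) \<otimes> N) K (L \<otimes> (M \<otimes> N)) (cid K) (cplx_assoc C L M N)"
  let ?A1 = "cplx_assoc C K (L \<otimes> M) N" and ?A2 = "cplx_assoc C K L (M \<otimes> N)" and ?A3 = "cplx_assoc C (K \<otimes> L) M N"
  note P = chain_tensor_tin(1)[OF chm_cplx_assoc[OF K L M] chm_id[OF N], of r]
    and Q = chain_tensor_tin(1)[OF chm_id[OF K] chm_cplx_assoc[OF L M N], of r]
    and A1 = cplx_assoc_tin(1)[OF K b(2) N, of r] and A2 = cplx_assoc_tin(1)[OF K L b(3), of r]
    and A3 = cplx_assoc_tin(1)[OF b(1) M N, of r]
  show "ccomp ?Q (ccomp ?A1 ?P) r = ccomp ?A2 ?A3 r"
    unfolding chain_comp_def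
  proof (rule tin4_epi[OF K L M N, where Z = "cobj (K \<otimes> (L \<otimes> (M \<otimes> N))) r"])
    fix i j l m assume r: "r = i + j + l + m"
    have r1: "r = i + ((j + l) + m)" and r2: "r = i + (j + (l + m))" and r3: "r = (i + j) + (l + m)" using r by simp_all
    let ?a = "cobj K i" and ?b = "cobj L j" and ?c = "cobj M l" and ?d = "cobj N m"
    note o = bounded_complexD(1)[OF K, of i] bounded_complexD(1)[OF L, of j] bounded_complexD(1)[OF M, of l] bounded_complexD(1)[OF N, of m]
    let ?w = "tin (K \<otimes> L) M (i + j) l o (tin K L i j \<star> Id C ?c)"
    let ?y = "tin ((K \<otimes> L) \<otimes> M) N (i + j + l) m o (?w \<star> Id C ?d)"
    let ?W = "((?a \<boxtimes> ?b) \<boxtimes> ?c) \<boxtimes> ?d"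
    note t = K L M N b o
    have yt: "ar C ?y ?W (cobj (((K \<otimes> L) \<otimes> M) \<otimes> N) r)" using t r by simp
    have At: "ar C (cplx_assoc C K L M (i + j + l)) (cobj ((K \<otimes> L) \<otimes> M) (i + j + l)) (cobj (K \<otimes> (L \<otimes> M)) (i + j + l))"
      by (rule cplx_assoc_tin(1)[OF K L M])
    have A't: "ar C (cplx_assoc C L M N (j + l + m)) (cobj ((L \<otimes> M) \<otimes> N) (j + l + m)) (cobj (L \<otimes> (M \<otimes> N)) (j + l + m))"
      by (rule cplx_assoc_tin(1)[OF L M N])
    let ?u = "(Id C ?a \<star> tin L M j l) o Assoc C ?a ?b ?c"
    have Aw: "cplx_assoc C K L M (i + j + l) o ?w = tin K (L \<otimes> M) i (j + l) o ?u"
      using cplx_assoc_tin(2)[OF K L M, of "i + j + l" i j l] by simp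
    have s1: "?P r o ?y = tin (K \<otimes> (L \<otimes> M)) N (i + j + l) m o ((tin K (L \<otimes> M) i (j + l) o ?u) \<star> Id C ?d)"
    proof -
      have "?P r o ?y = tin (K \<otimes> (L \<otimes> M)) N (i + j + l) m o
          ((cplx_assoc C K L M (i + j + l) \<star> cid N m) o (?w \<star> Id C ?d))"
        by (rule chain_tensor_tin_comp[OF chm_cplx_assoc[OF K L M] chm_id[OF N] r, where W = ?W]) (use t in simp_all)
      also have "(cplx_assoc C K L M (i + j + l) \<star> cid N m) o (?w \<star> Id C ?d) = (cplx_assoc C K L M (i + j + l) o ?w) \<star> Id C ?d"
        using t At by (subst tensor_comp) (simp_all add: chain_id_def)
      finally show ?thesis unfolding Aw .
    qed
    let ?\<alpha>\<alpha> = "Assoc C ?a (?b \<boxtimes> ?c) ?d o (Assoc C ?a ?b ?c \<star> Id C ?d)"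
    let ?v = "tin (L \<otimes> M) N (j + l) m o (tin L M j l \<star> Id C ?d)"
    have s2: "?A1 r o (tin (K \<otimes> (L \<otimes> M)) N (i + j + l) m o ((tin K (L \<otimes> M) i (j + l) o ?u) \<star> Id C ?d)) =
      tin K ((L \<otimes> M) \<otimes> N) i (j + l + m) o ((Id C ?a \<star> ?v) o ?\<alpha>\<alpha>)"
    proof -
      have 1: "?A1 r o (tin (K \<otimes> (L \<otimes> M)) N (i + j + l) m o ((tin K (L \<otimes> M) i (j + l) o ?u) \<star> Id C ?d)) =
        tin K ((L \<otimes> M) \<otimes> N) i (j + l + m) o ((Id C ?a \<star> tin (L \<otimes> M) N (j + l) m) o
          (Assoc C ?a (cobj (L \<otimes> M) (j + l)) ?d o (?u \<star> Id C ?d)))"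
        by (rule cplx_assoc_comp[OF K b(2) N _ r1]) (use t in simp_all)
      have 2: "?u \<star> Id C ?d = ((Id C ?a \<star> tin L M j l) \<star> Id C ?d) o (Assoc C ?a ?b ?c \<star> Id C ?d)"
        using t by (simp add: tensor_comp)
      show ?thesis unfolding 1 2 using t by (simp add: assoc_nat_assoc tensor_comp_assoc)
    qed
    let ?z = "tin L (M \<otimes> N) j (l + m) o (Id C ?b \<star> tin M N l m)"
    have Av: "cplx_assoc C L M N (j + l + m) o ?v = ?z o Assoc C ?b ?c ?d"
      using cplx_assoc_tin(2)[OF L M N, of "j + l + m" j l m] t by simp
    have s3: "?Q r o (tin K ((L \<otimes> M) \<otimes> N) i (j + l + m) o ((Id C ?a \<star> ?v) o ?\<alpha>\<alpha>)) =
      tin K (L \<otimes> (M \<otimes> N)) i (j + l + m) o ((Id C ?a \<star> ?z) o ((Id C ?a \<star> Assoc C ?b ?c ?d) o ?\<alpha>\<alpha>))"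
    proof -
      have "?Q r o (tin K ((L \<otimes> M) \<otimes> N) i (j + l + m) o ((Id C ?a \<star> ?v) o ?\<alpha>\<alpha>)) =
        tin K (L \<otimes> (M \<otimes> N)) i (j + l + m) o ((cid K i \<star> cplx_assoc C L M N (j + l + m)) o ((Id C ?a \<star> ?v) o ?\<alpha>\<alpha>))"
        by (rule chain_tensor_tin_comp[OF chm_id[OF K] chm_cplx_assoc[OF L M N] r1, where W = ?W]) (use t in simp_all)
      also have "(cid K i \<star> cplx_assoc C L M N (j + l + m)) o ((Id C ?a \<star> ?v) o ?\<alpha>\<alpha>) =
        (Id C ?a \<star> (cplx_assoc C L M N (j + l + m) o ?v)) o ?\<alpha>\<alpha>"
        using t A't by (subst tensor_comp_assoc) (simp_all add: chain_id_def)
      also have "\<dots> = (Id C ?a \<star> ?z) o ((Id C ?a \<star> Assoc C ?b ?c ?d) o ?\<alpha>\<alpha>)"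
        unfolding Av using t by (simp add: tensor_comp_assoc)
      finally show ?thesis .
    qed
    have pent: "(Id C ?a \<star> Assoc C ?b ?c ?d) o ?\<alpha>\<alpha> = Assoc C ?a ?b (?c \<boxtimes> ?d) o Assoc C (?a \<boxtimes> ?b) ?c ?d"
      by (rule pentagon) (use o in auto)
    have s4: "?A3 r o ?y = tin (K \<otimes> L) (M \<otimes> N) (i + j) (l + m) o
        ((tin K L i j \<star> tin M N l m) o Assoc C (?a \<boxtimes> ?b) ?c ?d)"
    proof -
      have "?A3 r o ?y = tin (K \<otimes> L) (M \<otimes> N) (i + j) (l + m) o ((Id C (cobj (K \<otimes> L) (i + j)) \<star> tin M N l m) o
        (Assoc C (cobj (K \<otimes> L) (i + j)) ?c ?d o ((tin K L i j \<star> Id C ?c) \<star> Id C ?d)))"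
        by (rule cplx_assoc_comp[OF b(1) M N _ r3]) (use t in simp_all)
      then show ?thesis using t by (simp add: assoc_nat tensor_comp_assoc)
    qed
    have s5: "?A2 r o (tin (K \<otimes> L) (M \<otimes> N) (i + j) (l + m) o ((tin K L i j \<star> tin M N l m) o Assoc C (?a \<boxtimes> ?b) ?c ?d)) =
      tin K (L \<otimes> (M \<otimes> N)) i (j + (l + m)) o ((Id C ?a \<star> ?z) o (Assoc C ?a ?b (?c \<boxtimes> ?d) o Assoc C (?a \<boxtimes> ?b) ?c ?d))"
    proof -
      \<comment> \<open>The inserted identities again present the inclusion as a composite, so that
        \<open>cplx_assoc_comp\<close> applies to it.\<close>
      have 1: "?A2 r o (tin (K \<otimes> L) (M \<otimes> N) (i + j) (l + m) o ((tin K L i j o (Id C ?a \<star> Id C ?b)) \<star> tin M N l m)) =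
        tin K (L \<otimes> (M \<otimes> N)) i (j + (l + m)) o ((Id C ?a \<star> tin L (M \<otimes> N) j (l + m)) o
          (Assoc C ?a ?b (cobj (M \<otimes> N) (l + m)) o ((Id C ?a \<star> Id C ?b) \<star> tin M N l m)))"
        by (rule cplx_assoc_comp[OF K L b(3) _ r2]) (use t in simp_all)
      have 2: "Assoc C ?a ?b (cobj (M \<otimes> N) (l + m)) o ((Id C ?a \<star> Id C ?b) \<star> tin M N l m) =
        (Id C ?a \<star> (Id C ?b \<star> tin M N l m)) o Assoc C ?a ?b (?c \<boxtimes> ?d)"
        by (subst assoc_nat) (use t in simp_all)
      have 3: "?A2 r o (tin (K \<otimes> L) (M \<otimes> N) (i + j) (l + m) o (tin K L i j \<star> tin M N l m)) =
        tin K (L \<otimes> (M \<otimes> N)) i (j + (l + m)) o ((Id C ?a \<star> ?z) o Assoc C ?a ?b (?c \<boxtimes> ?d))"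
        using 1[unfolded 2] t by (simp add: tensor_comp_assoc)
      have "?A2 r o (tin (K \<otimes> L) (M \<otimes> N) (i + j) (l + m) o ((tin K L i j \<star> tin M N l m) o Assoc C (?a \<boxtimes> ?b) ?c ?d)) =
        (?A2 r o (tin (K \<otimes> L) (M \<otimes> N) (i + j) (l + m) o (tin K L i j \<star> tin M N l m))) o Assoc C (?a \<boxtimes> ?b) ?c ?d"
        using t A2 r3 by simp
      then show ?thesis unfolding 3 using t by simp
    qed
    have "?Q r o (?A1 r o (?P r o ?y)) = ?A2 r o (?A3 r o ?y)"
      unfolding s1 s2 s3 s4 s5 pent by (simp add: add.assoc)
    moreover have "(?Q r o ?A1 r o ?P r) o ?y = ?Q r o (?A1 r o (?P r o ?y))"
      "(?A2 r o ?A3 r) o ?y = ?A2 r o (?A3 r o ?y)"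
      using P Q A1 A2 A3 yt by simp_all
    ultimately show "(?Q r o ?A1 r o ?P r) o ?y = (?A2 r o ?A3 r) o ?y" by simp
  qed (use P Q A1 A2 A3 in simp_all)
qed

section \<open>The bounded derived category as a monoidal category\<close>

lemma Db_hom: "chm K L f \<Longrightarrow> chain_class C K L f \<in> homs (Db C) K L"
  by (auto simp: roof_hom_carrier chm_def)

lemma Db_ar: "chm K L f \<Longrightarrow> ar (Db C) (chain_class C K L f) K L"
  using linear_category.homs_iff[OF Db_linear_category, THEN iffD1, OF _ _ Db_hom] by (simp add: chm_def)

text \<open>Strict inverses are available for the associator, the unitors, \<open>mu\<close> and the
  unit comparison, so isomorphisms of complexes suffice here.\<close>

lemma Db_is_iso:
  assumes "chm K L f" "chm L K g" "ccomp g f = cid K" "ccomp f g = cid L"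
  shows "is_iso (Db C) (chain_class C K L f)"
proof -
  interpret D: linear_category k "Db C" by (rule Db_linear_category)
  have b: "bdd K" "bdd L" using assms by (auto simp: chm_def)
  show ?thesis
  proof (rule D.is_isoI)
    show "ar (Db C) (chain_class C K L f) K L" "ar (Db C) (chain_class C L K g) L K"
      using Db_ar assms(1,2) by blast+
  qed (use assms in \<open>simp_all add: roof_comp_chain_class\<close>)
qed

text \<open>Arrows are represented by chain maps, and composition and tensor product are computed on
  representatives; each coherence axiom therefore becomes an equality of chain maps proved
  above.\<close>

lemma Db_monoidal: "linear_monoidal_category k (Db C)"
proof (rule linear_monoidal_category.intro[OF Db_linear_category], rule linear_monoidal_category_axioms.intro)
  have b1: "bdd \<one>\<^sub>c" by simp
  note S = roof_comp_chain_class roof_tensor_chain_class chm_tensor chm_comp chm_id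
  show "TUnit (Db C) \<in> Obj (Db C)" by simp
  fix K K' L L'
  assume *: "K \<in> Obj (Db C)" "K' \<in> Obj (Db C)" "L \<in> Obj (Db C)" "L' \<in> Obj (Db C)"
  then have b: "bdd K" "bdd K'" "bdd L" "bdd L'" by auto
  fix f g assume "f \<in> homs (Db C) K K'" "g \<in> homs (Db C) L L'"
  then obtain f0 g0 where f: "chm K K' f0" "f = chain_class C K K' f0" and g: "chm L L' g0" "g = chain_class C L L' g0"
    using Db_homE b by metis
  show "f \<star>\<^bsub>Db C\<^esub> g \<in> homs (Db C) (K \<boxtimes>\<^bsub>Db C\<^esub> L) (K' \<boxtimes>\<^bsub>Db C\<^esub> L')"
    using Db_hom[OF chm_tensor[OF f(1) g(1)]] f g by (simp add: S)
  show "(f \<oplus>\<^bsub>Hom (Db C) K K'\<^esub> f') \<star>\<^bsub>Db C\<^esub> g =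
      (f \<star>\<^bsub>Db C\<^esub> g) \<oplus>\<^bsub>Hom (Db C) (K \<boxtimes>\<^bsub>Db C\<^esub> L) (K' \<boxtimes>\<^bsub>Db C\<^esub> L')\<^esub> (f' \<star>\<^bsub>Db C\<^esub> g)"
    if "f' \<in> homs (Db C) K K'" for f'
    using that f g b by (elim Db_homE) (simp_all add: S roof_hom_add chm_add chain_tensor_add_left)
  show "f \<star>\<^bsub>Db C\<^esub> (g \<oplus>\<^bsub>Hom (Db C) L L'\<^esub> g') =
      (f \<star>\<^bsub>Db C\<^esub> g) \<oplus>\<^bsub>Hom (Db C) (K \<boxtimes>\<^bsub>Db C\<^esub> L) (K' \<boxtimes>\<^bsub>Db C\<^esub> L')\<^esub> (f \<star>\<^bsub>Db C\<^esub> g')"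
    if "g' \<in> homs (Db C) L L'" for g'
    using that f g b by (elim Db_homE) (simp_all add: S roof_hom_add chm_add chain_tensor_add_right)
  show "(c \<odot>\<^bsub>Hom (Db C) K K'\<^esub> f) \<star>\<^bsub>Db C\<^esub> g =
      c \<odot>\<^bsub>Hom (Db C) (K \<boxtimes>\<^bsub>Db C\<^esub> L) (K' \<boxtimes>\<^bsub>Db C\<^esub> L')\<^esub> (f \<star>\<^bsub>Db C\<^esub> g)"
    "f \<star>\<^bsub>Db C\<^esub> (c \<odot>\<^bsub>Hom (Db C) L L'\<^esub> g) =
      c \<odot>\<^bsub>Hom (Db C) (K \<boxtimes>\<^bsub>Db C\<^esub> L) (K' \<boxtimes>\<^bsub>Db C\<^esub> L')\<^esub> (f \<star>\<^bsub>Db C\<^esub> g)" if "c \<in> carrier k" for c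
    using that f g b by (simp_all add: S roof_hom_smult chm_smult chain_tensor_smult)
  show "(f' o\<^bsub>Db C\<^esub> f) \<star>\<^bsub>Db C\<^esub> (g' o\<^bsub>Db C\<^esub> g) = (f' \<star>\<^bsub>Db C\<^esub> g') o\<^bsub>Db C\<^esub> (f \<star>\<^bsub>Db C\<^esub> g)"
    if h: "K'' \<in> Obj (Db C)" "L'' \<in> Obj (Db C)" "f' \<in> homs (Db C) K' K''" "g' \<in> homs (Db C) L' L''" for K'' L'' f' g'
  proof -
    obtain f1 g1 where "chm K' K'' f1" "f' = chain_class C K' K'' f1" "chm L' L'' g1" "g' = chain_class C L' L'' g1"
      using Db_homE h b by (metis Db_simps(1) mem_Collect_eq)
    then show ?thesis using f g by (simp add: S chain_tensor_comp)
  qed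
  show "Assoc (Db C) K' L' M' o\<^bsub>Db C\<^esub> ((f \<star>\<^bsub>Db C\<^esub> g) \<star>\<^bsub>Db C\<^esub> h) =
      (f \<star>\<^bsub>Db C\<^esub> (g \<star>\<^bsub>Db C\<^esub> h)) o\<^bsub>Db C\<^esub> Assoc (Db C) K L M"
    if h: "M \<in> Obj (Db C)" "M' \<in> Obj (Db C)" "h \<in> homs (Db C) M M'" for M M' h
  proof -
    obtain h0 where h0: "chm M M' h0" "h = chain_class C M M' h0" using Db_homE[OF h(3)] h(1,2) by auto
    have bM: "bdd M" "bdd M'" using h by auto
    show ?thesis unfolding h0(2) f(2) g(2)
      using f(1) g(1) h0(1) b bM by (simp add: S chm_cplx_assoc cplx_assoc_natural)
  qed
  show "LUnit (Db C) K' o\<^bsub>Db C\<^esub> (Id (Db C) (TUnit (Db C)) \<star>\<^bsub>Db C\<^esub> f) = f o\<^bsub>Db C\<^esub> LUnit (Db C) K"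
    "RUnit (Db C) K' o\<^bsub>Db C\<^esub> (f \<star>\<^bsub>Db C\<^esub> Id (Db C) (TUnit (Db C))) = f o\<^bsub>Db C\<^esub> RUnit (Db C) K"
    unfolding f(2) using f(1) b b1
    by (simp_all add: S chm_cplx_lunit cplx_lunit_natural chm_cplx_runit cplx_runit_natural)
next
  have b1: "bdd \<one>\<^sub>c" by simp
  note S = roof_comp_chain_class roof_tensor_chain_class chm_tensor chm_comp chm_id
  fix K L assume *: "K \<in> Obj (Db C)" "L \<in> Obj (Db C)"
  then have b: "bdd K" "bdd L" by auto
  show "K \<boxtimes>\<^bsub>Db C\<^esub> L \<in> Obj (Db C)" using b by simp
  show "Id (Db C) K \<star>\<^bsub>Db C\<^esub> Id (Db C) L = Id (Db C) (K \<boxtimes>\<^bsub>Db C\<^esub> L)"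
    using b by (simp add: S chain_tensor_id)
  show "LUnit (Db C) K \<in> homs (Db C) (TUnit (Db C) \<boxtimes>\<^bsub>Db C\<^esub> K) K" using Db_hom[OF chm_cplx_lunit[OF b(1)]] by simp
  show "RUnit (Db C) K \<in> homs (Db C) (K \<boxtimes>\<^bsub>Db C\<^esub> TUnit (Db C)) K" using Db_hom[OF chm_cplx_runit[OF b(1)]] by simp
  obtain g where g: "chm K (\<one>\<^sub>c \<otimes> K) g" "ccomp g (cplx_lunit C K) = cid (\<one>\<^sub>c \<otimes> K)"
    "ccomp (cplx_lunit C K) g = cid K" using cplx_lunit_inverse[OF b(1)] .
  show "is_iso (Db C) (LUnit (Db C) K)" using Db_is_iso[OF chm_cplx_lunit[OF b(1)] g] by simp
  obtain g where g: "chm K (K \<otimes> \<one>\<^sub>c) g" "ccomp g (cplx_runit C K) = cid (K \<otimes> \<one>\<^sub>c)"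
    "ccomp (cplx_runit C K) g = cid K" using cplx_runit_inverse[OF b(1)] .
  show "is_iso (Db C) (RUnit (Db C) K)" using Db_is_iso[OF chm_cplx_runit[OF b(1)] g] by simp
  show "(Id (Db C) K \<star>\<^bsub>Db C\<^esub> LUnit (Db C) L) o\<^bsub>Db C\<^esub> Assoc (Db C) K (TUnit (Db C)) L = RUnit (Db C) K \<star>\<^bsub>Db C\<^esub> Id (Db C) L"
    using b b1 by (simp add: S chm_cplx_lunit chm_cplx_runit chm_cplx_assoc cplx_triangle)
  fix M assume "M \<in> Obj (Db C)"
  then have bM: "bdd M" by auto
  show "Assoc (Db C) K L M \<in> homs (Db C) ((K \<boxtimes>\<^bsub>Db C\<^esub> L) \<boxtimes>\<^bsub>Db C\<^esub> M) (K \<boxtimes>\<^bsub>Db C\<^esub> (L \<boxtimes>\<^bsub>Db C\<^esub> M))"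
    using Db_hom[OF chm_cplx_assoc[OF b bM]] by simp
  obtain g where g: "chm (K \<otimes> (L \<otimes> M)) ((K \<otimes> L) \<otimes> M) g"
    "ccomp g (cplx_assoc C K L M) = cid ((K \<otimes> L) \<otimes> M)"
    "ccomp (cplx_assoc C K L M) g = cid (K \<otimes> (L \<otimes> M))" using cplx_assoc_inverse[OF b bM] .
  show "is_iso (Db C) (Assoc (Db C) K L M)" using Db_is_iso[OF chm_cplx_assoc[OF b bM] g] by simp
  fix N assume "N \<in> Obj (Db C)"
  then have bN: "bdd N" by auto
  show "(Id (Db C) K \<star>\<^bsub>Db C\<^esub> Assoc (Db C) L M N) o\<^bsub>Db C\<^esub> Assoc (Db C) K (L \<boxtimes>\<^bsub>Db C\<^esub> M) N o\<^bsub>Db C\<^esub>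
      (Assoc (Db C) K L M \<star>\<^bsub>Db C\<^esub> Id (Db C) N) = Assoc (Db C) K L (M \<boxtimes>\<^bsub>Db C\<^esub> N) o\<^bsub>Db C\<^esub> Assoc (Db C) (K \<boxtimes>\<^bsub>Db C\<^esub> L) M N"
    using b bM bN chm_comp[OF chm_tensor[OF chm_cplx_assoc[OF b bM] chm_id[OF bN]]
        chm_cplx_assoc[OF b(1) bounded_tensor[OF b(2) bM] bN]]
    by (simp add: S chm_cplx_assoc cplx_pentagon)
qed

end

section \<open>Transport of tensor categories along equivalences\<close>

context linear_category
begin

lemma is_mono_arrow: "is_mono C f \<Longrightarrow> arrow C f"
  unfolding is_mono_def by blast

lemma is_epi_arrow: "is_epi C f \<Longrightarrow> arrow C f"
  unfolding is_epi_def by blast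

lemma is_mono_comp: assumes "is_mono C f" "is_mono C g" "Dom C g = Cod C f" shows "is_mono C (g o f)"
  unfolding is_mono_iff
proof (intro conjI allI impI)
  have a: "arrow C f" "arrow C g" using assms is_mono_arrow by auto
  then show "arrow C (g o f)" using assms(3) by simp
  fix T u v assume *: "ar C u T (Dom C (g o f)) \<and> ar C v T (Dom C (g o f)) \<and> (g o f) o u = (g o f) o v"
  then have t: "ar C u T (Dom C f)" "ar C v T (Dom C f)" using a assms(3) by auto
  have "g o (f o u) = g o (f o v)" using * t a assms(3) by simp
  then have "f o u = f o v" by (rule monoD[OF assms(2), rotated 2]) (use t a assms(3) in auto)
  then show "u = v" by (rule monoD[OF assms(1), rotated 2]) (use t in auto)
qed

lemma is_epi_comp: assumes "is_epi C f" "is_epi C g" "Dom C g = Cod C f" shows "is_epi C (g o f)"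
  unfolding is_epi_iff
proof (intro conjI allI impI)
  have a: "arrow C f" "arrow C g" using assms is_epi_arrow by auto
  then show "arrow C (g o f)" using assms(3) by simp
  fix T u v assume *: "ar C u (Cod C (g o f)) T \<and> ar C v (Cod C (g o f)) T \<and> u o (g o f) = v o (g o f)"
  then have t: "ar C u (Cod C g) T" "ar C v (Cod C g) T" using a assms(3) by auto
  have "(u o g) o f = (v o g) o f" using * t a assms(3) by simp
  then have "u o g = v o g" by (rule epiD[OF assms(1), rotated 2]) (use t a assms(3) in auto)
  then show "u = v" by (rule epiD[OF assms(2), rotated 2]) (use t in auto)
qed

lemma zero_obj_iso: "\<lbrakk>iso_pair f g X Y; zero_obj C X\<rbrakk> \<Longrightarrow> zero_obj C Y"
  using zero_obj_retract[of X g Y f] iso_pairD[of f g X Y] by blast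

text \<open>An object of the heart is only isomorphic to a value of the functor, so kernels are
  moved by conjugating all three objects. A test arrow \<open>t\<close> is carried to the source of
  \<open>f\<close>, factored there, and brought back.\<close>

lemma kernel_iso:
  assumes k: "is_kernel C f m" and a: "iso_pair a a' (Dom C f) A" and b: "iso_pair b b' (Cod C f) B"
    and c: "iso_pair c c' (Dom C m) M"
  shows "is_kernel C (b o f o a') (a o m o c')"
proof -
  note K = is_kernelD[OF k] and A = iso_pairD[OF a] and B = iso_pairD[OF b] and M = iso_pairD[OF c]
  show ?thesis
  proof (rule is_kernelI)
    show 1: "arrow C (b o f o a')" "arrow C (a o m o c')" using K(1-3) A(1,2) B(1) M(2) by simp_all
    show "Cod C (a o m o c') = Dom C (b o f o a')" using K(1-3) A(1,2) B(1) M(2) by simp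
    have "f o (m o c') = zer M (Cod C f)"
      using comp_eq_reassoc1[OF K(4), of c'] K(1-3) M(2) by simp
    then show "(b o f o a') o (a o m o c') = zer (Dom C (a o m o c')) (Cod C (b o f o a'))"
      using K(1-3) A(1,2) B(1) M(2) A(8)[of "m o c'" M] by simp
    show "\<exists>u. ar C u T (Dom C (a o m o c')) \<and> (a o m o c') o u = t"
      if t: "ar C t T (Dom C (b o f o a'))" "(b o f o a') o t = zer T (Cod C (b o f o a'))" for t T
    proof -
      have t1: "ar C t T A" using t(1) K(1-3) A(1,2) B(1) by simp
      have "f o (a' o t) = b' o (b o (f o (a' o t)))" using B(8)[of "f o (a' o t)" T] t1 K(1-3) A(1,2) by simp
      also have "b o (f o (a' o t)) = zer T B" using t(2) t1 K(1-3) A(1,2) B(1) by simp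
      finally have "f o (a' o t) = zer T (Cod C f)" using B(2) t1 by simp
      then obtain u where u: "ar C u T (Dom C m)" "m o u = a' o t" using K(5)[of "a' o t" T] t1 A(2) by auto
      have "(a o m o c') o (c o u) = a o (m o u)" using u(1) K(1-3) A(1) M(1,2) M(8)[of u T] by simp
      also have "\<dots> = t" unfolding u(2) using A(9)[of t T] t1 by simp
      finally show ?thesis using u(1) M(1,2) K(1-3) A(1) by (intro exI[of _ "c o u"]) simp
    qed
    show "is_mono C (a o m o c')"
      by (intro is_mono_comp is_iso_mono A(5) M(6) K(6)) (use K(1-3) A(1) M(2) in simp_all)
  qed
qed

lemma cokernel_iso:
  assumes k: "is_cokernel C f q" and a: "iso_pair a a' (Dom C f) A" and b: "iso_pair b b' (Cod C f) B"
    and c: "iso_pair c c' (Cod C q) Q"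
  shows "is_cokernel C (b o f o a') (c o q o b')"
proof -
  note K = is_cokernelD[OF k] and A = iso_pairD[OF a] and B = iso_pairD[OF b] and Q = iso_pairD[OF c]
  show ?thesis
  proof (rule is_cokernelI)
    show 1: "arrow C (b o f o a')" "arrow C (c o q o b')" using K(1-3) A(1,2) B(1,2) Q(1) by simp_all
    show "Dom C (c o q o b') = Cod C (b o f o a')" using K(1-3) A(1,2) B(1,2) Q(1) by simp
    have "q o (f o a') = zer A (Cod C q)"
      using comp_eq_reassoc1[OF K(4), of a'] K(1-3) A(2) by simp
    then show "(c o q o b') o (b o f o a') = zer (Dom C (b o f o a')) (Cod C (c o q o b'))"
      using K(1-3) A(1,2) B(1,2) Q(1) B(8)[of "f o a'" A] by simp
    show "\<exists>u. ar C u (Cod C (c o q o b')) T \<and> u o (c o q o b') = t"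
      if t: "ar C t (Cod C (b o f o a')) T" "t o (b o f o a') = zer (Dom C (b o f o a')) T" for t T
    proof -
      have t1: "ar C t B T" using t(1) K(1-3) A(1,2) B(1) by simp
      have "(t o b) o f = (t o (b o (f o a'))) o a" using t1 K(1-3) A(1-3) B(1) by simp
      also have "t o (b o (f o a')) = zer A T" using t(2) t1 K(1-3) A(1,2) B(1) by simp
      finally have "(t o b) o f = zer (Dom C f) T" using A(1) t1 by simp
      then obtain u where u: "ar C u (Cod C q) T" "u o q = t o b" using K(5)[of "t o b" T] t1 B(1) by auto
      have "(u o c') o (c o q o b') = (u o q) o b'" using u(1) K(1-3) B(2) Q(1,2) Q(8)[of "q o b'" B] by simp
      also have "\<dots> = t" unfolding u(2) using t1 B(1,2,4) by simp
      finally show ?thesis using u(1) Q(1,2) K(1-3) B(2) by (intro exI[of _ "u o c'"]) simp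
    qed
    show "is_epi C (c o q o b')"
      by (intro is_epi_comp is_iso_epi B(6) Q(5) K(6)) (use K(1-3) B(2) Q(1) in simp_all)
  qed
qed

lemma dsum_iso:
  assumes d: "is_dsum C I X B i p" and c: "\<And>a. a \<in> I \<Longrightarrow> iso_pair (c a) (c' a) (X a) (Y a)" and b: "iso_pair b b' B A"
  shows "is_dsum C I Y A (\<lambda>a. b o i a o c' a) (\<lambda>a. c a o p a o b')"
proof -
  note D = is_dsumD[OF d] and B = iso_pairD[OF b] and E = iso_pairD[OF c]
  show ?thesis
  proof (rule is_dsumI)
    show "A \<in> Obj C" using B(1) by simp
    have "{a \<in> I. \<not> zero_obj C (Y a)} \<subseteq> {a \<in> I. \<not> zero_obj C (X a)}" using zero_obj_iso[OF c] by auto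
    then show "finite {a \<in> I. \<not> zero_obj C (Y a)}" using D(4) finite_subset by blast
    show "ar C (b o i a o c' a) (Y a) A" "ar C (c a o p a o b') A (Y a)" if "a \<in> I" for a
      using B(1,2) D(2,3)[OF that] E(1,2)[OF that] by simp_all
    have pi: "(c a' o p a' o b') o (b o i a o c' a) = c a' o (p a' o i a) o c' a" if "a \<in> I" "a' \<in> I" for a a'
      using B(1,2) D(2,3)[OF that(1)] D(2,3)[OF that(2)] E(1,2)[OF that(1)] E(1,2)[OF that(2)]
        B(8)[of "i a o c' a" "Y a"] by simp
    show "(c a o p a o b') o (b o i a o c' a) = Id C (Y a)" if "a \<in> I" for a
      unfolding pi[OF that that] D(5)[OF that] using E(1,2,4)[OF that] by simp
    show "(c a' o p a' o b') o (b o i a o c' a) = zer (Y a) (Y a')" if "a \<in> I" "a' \<in> I" "a \<noteq> a'" for a a'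
      unfolding pi[OF that(1,2)] D(6)[OF that] using E(1,2)[OF that(1)] E(1,2)[OF that(2)] by simp
    fix f g assume fg: "ar C f A A" "ar C g A A" "\<And>a. a \<in> I \<Longrightarrow> f o (b o i a o c' a) = g o (b o i a o c' a)"
    have "f o b = g o b"
    proof (rule dsum_epi[OF d])
      fix a assume a: "a \<in> I"
      have "(f o (b o i a o c' a)) o c a = (g o (b o i a o c' a)) o c a" using fg(3)[OF a] by simp
      then show "(f o b) o i a = (g o b) o i a"
        using fg(1,2) B(1) D(2)[OF a] E(1,2,3)[OF a] by simp
    qed (use fg B(1) in auto)
    then show "f = g" by (rule epiD[OF is_iso_epi[OF B(5)], rotated 2]) (use fg B(1) in auto)
  qed
qed

lemma simple_obj_iso:
  assumes S: "simple_obj C S" and p: "iso_pair f g S S'"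
  shows "simple_obj C S'"
  unfolding simple_obj_def
proof (intro conjI allI impI)
  note P = iso_pairD[OF p]
  show "S' \<in> Obj C" using P(1) by simp
  show "\<not> zero_obj C S'" using zero_obj_iso[OF P(7)] S by (auto simp: simple_obj_def)
  fix m assume m: "is_mono C m \<and> Cod C m = S'"
  have mt: "ar C m (Dom C m) S'" using m is_mono_arrow by auto
  have "is_mono C (g o m)" by (rule is_mono_comp[OF _ is_iso_mono[OF P(6)]]) (use m P(2) in auto)
  moreover have "Cod C (g o m) = S" "Dom C (g o m) = Dom C m" using mt P(2) by simp_all
  ultimately have "zero_obj C (Dom C m) \<or> is_iso C (g o m)" using S unfolding simple_obj_def by metis
  moreover have "is_iso C (f o (g o m))" if "is_iso C (g o m)"
    by (rule is_iso_comp[OF that P(5)]) (use mt P(1,2) in auto)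
  ultimately show "zero_obj C (Dom C m) \<or> is_iso C m" using P(9)[OF mt] by auto
qed

lemma iso_pair_Id: "X \<in> Obj C \<Longrightarrow> iso_pair (Id C X) (Id C X) X X"
  by (simp add: iso_pair_def)

text \<open>A case distinction replaces induction: only the last extension involves
  \<open>X\<close>, and its two arrows can be composed with the isomorphism.\<close>

lemma finite_length_iso:
  assumes "finite_length C X" "iso_pair f g X Y"
  shows "finite_length C Y"
  using assms(1)
proof (cases rule: finite_length.cases)
  case zero
  show ?thesis by (rule finite_length.zero, rule zero_obj_iso[OF assms(2) zero])
next
  case (extend u v)
  note P = iso_pairD[OF assms(2)]
  have uv: "is_kernel C v u" "is_cokernel C u v" using extend(2) by (auto simp: short_exact_def)
  note K = is_kernelD[OF uv(1)] and Q = is_cokernelD[OF uv(2)]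
  have i: "iso_pair (Id C (Dom C u)) (Id C (Dom C u)) (Dom C u) (Dom C u)"
    "iso_pair (Id C (Cod C v)) (Id C (Cod C v)) (Cod C v) (Cod C v)" using K(1,2) by (auto intro: iso_pair_Id)
  have p: "iso_pair f g (Dom C v) Y" "iso_pair f g (Cod C u) Y" using assms(2) extend(1) K(3) by auto
  have "is_kernel C (v o g) (f o u)" using kernel_iso[OF uv(1) p(1) i(2) i(1)] K(1-3) P(1,2) extend(1) by simp
  moreover have "is_cokernel C (f o u) (v o g)" using cokernel_iso[OF uv(2) i(1) p(2) i(2)] K(1-3) P(1,2) extend(1) by simp
  ultimately have "short_exact C (f o u) (v o g)" by (simp add: short_exact_def)
  then have "finite_length C (Cod C (f o u))"
    by (rule finite_length.extend) (use extend K(1-3) P(1,2) in simp_all)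
  then show ?thesis using K(1-3) P(1,2) extend(1) by simp
qed

end

section \<open>Duals\<close>

context linear_monoidal_category
begin

lemma arr_inv_assoc:
  assumes "X \<in> Obj C" "Y \<in> Obj C" "Z \<in> Obj C"
  shows "ar C (arr_inv C (Assoc C X Y Z)) (X \<boxtimes> (Y \<boxtimes> Z)) ((X \<boxtimes> Y) \<boxtimes> Z)"
    "arr_inv C (Assoc C X Y Z) o Assoc C X Y Z = Id C ((X \<boxtimes> Y) \<boxtimes> Z)"
    "Assoc C X Y Z o arr_inv C (Assoc C X Y Z) = Id C (X \<boxtimes> (Y \<boxtimes> Z))"
  using arr_inv_simps[OF assoc_iso[OF assms]] assms by simp_all

lemmas arr_inv_assoc_simps [simp] = arD[OF arr_inv_assoc(1)]

lemma arr_inv_assoc_nat: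
  assumes "ar C f X X'" "ar C g Y Y'" "ar C h Z Z'"
  shows "arr_inv C (Assoc C X' Y' Z') o (f \<star> (g \<star> h)) = ((f \<star> g) \<star> h) o arr_inv C (Assoc C X Y Z)"
proof -
  have o: "X \<in> Obj C" "Y \<in> Obj C" "Z \<in> Obj C" "X' \<in> Obj C" "Y' \<in> Obj C" "Z' \<in> Obj C" using assms by auto
  let ?a = "Assoc C X Y Z" and ?a' = "Assoc C X' Y' Z'"
  have "arr_inv C ?a' o (f \<star> (g \<star> h)) = arr_inv C ?a' o (((f \<star> (g \<star> h)) o ?a) o arr_inv C ?a)"
    using assms o arr_inv_assoc(3)[OF o(1-3)] by simp
  also have "(f \<star> (g \<star> h)) o ?a = ?a' o ((f \<star> g) \<star> h)" using assoc_nat[of f g h X' Y' Z'] assms by simp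
  also have "arr_inv C ?a' o ((?a' o ((f \<star> g) \<star> h)) o arr_inv C ?a) = ((f \<star> g) \<star> h) o arr_inv C ?a"
    using assms o comp_eq_reassoc1[OF arr_inv_assoc(2)[OF o(4-6)], of "((f \<star> g) \<star> h) o arr_inv C ?a"] by simp
  finally show ?thesis .
qed

text \<open>Inverse unitors are cancelled, so that the zigzag identities end in unitors; in this
  form naturality of the unitors and the unit coherence of a monoidal functor apply
  directly.\<close>

lemma is_left_dual_iff:
  assumes X: "X \<in> Obj C" and D: "D \<in> Obj C" and ev: "ar C ev (D \<boxtimes> X) (TUnit C)" and cv: "ar C cv (TUnit C) (X \<boxtimes> D)"
  shows "is_left_dual C X D ev cv \<longleftrightarrow>
    RUnit C X o (Id C X \<star> ev) o Assoc C X D X o (cv \<star> Id C X) = LUnit C X \<and>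
    LUnit C D o (ev \<star> Id C D) o arr_inv C (Assoc C D X D) o (Id C D \<star> cv) = RUnit C D"
proof -
  note t = X D ev cv
  note l = arr_inv_simps[OF lunit_iso[OF X]] and r = arr_inv_simps[OF runit_iso[OF D]]
  let ?z = "RUnit C X o (Id C X \<star> ev) o Assoc C X D X o (cv \<star> Id C X)"
  let ?w = "LUnit C D o (ev \<star> Id C D) o arr_inv C (Assoc C D X D) o (Id C D \<star> cv)"
  have zt: "ar C ?z (TUnit C \<boxtimes> X) X" "ar C ?w (D \<boxtimes> TUnit C) D" using t by simp_all
  have 1: "RUnit C X o (Id C X \<star> ev) o Assoc C X D X o (cv \<star> Id C X) o arr_inv C (LUnit C X) = ?z o arr_inv C (LUnit C X)"
    using t l(1) by simp
  have 2: "LUnit C D o (ev \<star> Id C D) o arr_inv C (Assoc C D X D) o (Id C D \<star> cv) o arr_inv C (RUnit C D) = ?w o arr_inv C (RUnit C D)"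
    using t r(1) by simp
  have 3: "?z o arr_inv C (LUnit C X) = Id C X \<longleftrightarrow> ?z = LUnit C X"
  proof
    assume "?z o arr_inv C (LUnit C X) = Id C X"
    then have "(?z o arr_inv C (LUnit C X)) o LUnit C X = LUnit C X" using X by simp
    moreover have "(?z o arr_inv C (LUnit C X)) o LUnit C X = ?z o (arr_inv C (LUnit C X) o LUnit C X)"
      by (rule assoc_arr) (use zt l(1) X in simp_all)
    ultimately show "?z = LUnit C X" using l(2) zt(1) X by simp
  qed (use l(3) X in simp)
  have 4: "?w o arr_inv C (RUnit C D) = Id C D \<longleftrightarrow> ?w = RUnit C D"
  proof
    assume "?w o arr_inv C (RUnit C D) = Id C D"
    then have "(?w o arr_inv C (RUnit C D)) o RUnit C D = RUnit C D" using D by simp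
    moreover have "(?w o arr_inv C (RUnit C D)) o RUnit C D = ?w o (arr_inv C (RUnit C D) o RUnit C D)"
      by (rule assoc_arr) (use zt r(1) D in simp_all)
    ultimately show "?w = RUnit C D" using r(2) zt(2) D by simp
  qed (use r(3) D in simp)
  show ?thesis unfolding is_left_dual_def 1 2 3 4 using t by (simp add: homs_iff)
qed

lemma is_left_dual_typing:
  "is_left_dual C X D ev cv \<Longrightarrow> X \<in> Obj C \<and> D \<in> Obj C \<and> ar C ev (D \<boxtimes> X) (TUnit C) \<and> ar C cv (TUnit C) (X \<boxtimes> D)"
  by (auto simp: is_left_dual_def homs_iff)

text \<open>Evaluation and coevaluation are conjugated. In each zigzag the inner isomorphisms cancel
  after naturality of the associator, and the outer pair leaves through the unitors.\<close>

lemma is_left_dual_iso: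
  assumes d: "is_left_dual C X D ev cv" and p: "iso_pair \<phi> \<phi>' X Y" and q: "iso_pair \<psi> \<psi>' D E"
  shows "is_left_dual C Y E (ev o (\<psi>' \<star> \<phi>')) ((\<phi> \<star> \<psi>) o cv)"
proof -
  note T = is_left_dual_typing[OF d] and P = iso_pairD[OF p] and Q = iso_pairD[OF q]
  have o: "X \<in> Obj C" "D \<in> Obj C" "Y \<in> Obj C" "E \<in> Obj C" using P(1) Q(1) by auto
  have ev: "ar C ev (D \<boxtimes> X) (TUnit C)" and cv: "ar C cv (TUnit C) (X \<boxtimes> D)" using T by auto
  have Z: "RUnit C X o (Id C X \<star> ev) o Assoc C X D X o (cv \<star> Id C X) = LUnit C X"
    "LUnit C D o (ev \<star> Id C D) o arr_inv C (Assoc C D X D) o (Id C D \<star> cv) = RUnit C D"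
    using d is_left_dual_iff[OF o(1,2) ev cv] by auto
  note t = o ev cv P(1-4) Q(1-4)
  have a1: "RUnit C Y o (Id C Y \<star> (ev o (\<psi>' \<star> \<phi>'))) o Assoc C Y E Y o (((\<phi> \<star> \<psi>) o cv) \<star> Id C Y) = LUnit C Y"
  proof -
    have 1: "((\<phi> \<star> \<psi>) o cv) \<star> Id C Y = ((\<phi> \<star> \<psi>) \<star> \<phi>) o (cv \<star> \<phi>')" using t by (simp add: tensor_comp)
    have 2: "Assoc C Y E Y o (((\<phi> \<star> \<psi>) \<star> \<phi>) o (cv \<star> \<phi>')) = (\<phi> \<star> (\<psi> \<star> \<phi>)) o (Assoc C X D X o (cv \<star> \<phi>'))"
      using t by (simp add: assoc_nat_assoc)
    have 3: "(Id C Y \<star> (ev o (\<psi>' \<star> \<phi>'))) o ((\<phi> \<star> (\<psi> \<star> \<phi>)) o (Assoc C X D X o (cv \<star> \<phi>'))) =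
        (\<phi> \<star> ev) o (Assoc C X D X o (cv \<star> \<phi>'))" using t by (simp add: tensor_comp tensor_comp_assoc)
    have "RUnit C Y o (\<phi> \<star> ev) = RUnit C Y o ((\<phi> \<star> Id C (TUnit C)) o (Id C X \<star> ev))" using t by (simp add: tensor_comp)
    also have "\<dots> = \<phi> o (RUnit C X o (Id C X \<star> ev))"
      by (rule comp_eq_reassoc[OF runit_nat[of \<phi> Y, unfolded conjunct1[OF conjunct2[OF P(1)]]]]) (use t in simp_all)
    finally have 4: "RUnit C Y o (\<phi> \<star> ev) = \<phi> o RUnit C X o (Id C X \<star> ev)" .
    have "RUnit C Y o ((\<phi> \<star> ev) o (Assoc C X D X o (cv \<star> \<phi>'))) = (\<phi> o RUnit C X o (Id C X \<star> ev)) o (Assoc C X D X o (cv \<star> \<phi>'))"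
      by (rule comp_eq_reassoc1[OF 4]) (use t in simp_all)
    also have 5: "cv \<star> \<phi>' = (cv \<star> Id C X) o (Id C (TUnit C) \<star> \<phi>')" using t by (simp add: tensor_comp)
    also have "(\<phi> o RUnit C X o (Id C X \<star> ev)) o (Assoc C X D X o ((cv \<star> Id C X) o (Id C (TUnit C) \<star> \<phi>'))) =
        \<phi> o ((RUnit C X o (Id C X \<star> ev) o Assoc C X D X o (cv \<star> Id C X)) o (Id C (TUnit C) \<star> \<phi>'))" using t by simp
    also have "\<dots> = \<phi> o (\<phi>' o LUnit C Y)" unfolding Z(1) using t lunit_nat[of \<phi>' X] by simp
    also have "\<dots> = LUnit C Y" using P(9)[of "LUnit C Y" "TUnit C \<boxtimes> Y"] t by simp
    finally show ?thesis unfolding 1 2 3 unfolding 5 .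
  qed
  have a2: "LUnit C E o ((ev o (\<psi>' \<star> \<phi>')) \<star> Id C E) o arr_inv C (Assoc C E Y E) o (Id C E \<star> ((\<phi> \<star> \<psi>) o cv)) = RUnit C E"
  proof -
    have 1: "Id C E \<star> ((\<phi> \<star> \<psi>) o cv) = (\<psi> \<star> (\<phi> \<star> \<psi>)) o (\<psi>' \<star> cv)" using t by (simp add: tensor_comp)
    have 2: "arr_inv C (Assoc C E Y E) o ((\<psi> \<star> (\<phi> \<star> \<psi>)) o (\<psi>' \<star> cv)) = ((\<psi> \<star> \<phi>) \<star> \<psi>) o (arr_inv C (Assoc C D X D) o (\<psi>' \<star> cv))"
      by (rule comp_eq_reassoc[OF arr_inv_assoc_nat[OF Q(1) P(1) Q(1)]]) (use t in simp_all)
    have 3: "((ev o (\<psi>' \<star> \<phi>')) \<star> Id C E) o (((\<psi> \<star> \<phi>) \<star> \<psi>) o (arr_inv C (Assoc C D X D) o (\<psi>' \<star> cv))) =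
        (ev \<star> \<psi>) o (arr_inv C (Assoc C D X D) o (\<psi>' \<star> cv))" using t by (simp add: tensor_comp tensor_comp_assoc)
    have "LUnit C E o (ev \<star> \<psi>) = LUnit C E o ((Id C (TUnit C) \<star> \<psi>) o (ev \<star> Id C D))" using t by (simp add: tensor_comp)
    also have "\<dots> = \<psi> o (LUnit C D o (ev \<star> Id C D))"
      by (rule comp_eq_reassoc[OF lunit_nat[of \<psi> E, unfolded conjunct1[OF conjunct2[OF Q(1)]]]]) (use t in simp_all)
    finally have 4: "LUnit C E o (ev \<star> \<psi>) = \<psi> o LUnit C D o (ev \<star> Id C D)" .
    have "LUnit C E o ((ev \<star> \<psi>) o (arr_inv C (Assoc C D X D) o (\<psi>' \<star> cv))) =
        (\<psi> o LUnit C D o (ev \<star> Id C D)) o (arr_inv C (Assoc C D X D) o (\<psi>' \<star> cv))"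
      by (rule comp_eq_reassoc1[OF 4]) (use t in simp_all)
    also have 5: "\<psi>' \<star> cv = (Id C D \<star> cv) o (\<psi>' \<star> Id C (TUnit C))" using t by (simp add: tensor_comp)
    also have "(\<psi> o LUnit C D o (ev \<star> Id C D)) o (arr_inv C (Assoc C D X D) o ((Id C D \<star> cv) o (\<psi>' \<star> Id C (TUnit C)))) =
        \<psi> o ((LUnit C D o (ev \<star> Id C D) o arr_inv C (Assoc C D X D) o (Id C D \<star> cv)) o (\<psi>' \<star> Id C (TUnit C)))" using t by simp
    also have "\<dots> = \<psi> o (\<psi>' o RUnit C E)" unfolding Z(2) using t runit_nat[of \<psi>' D] by simp
    also have "\<dots> = RUnit C E" using Q(9)[of "RUnit C E" "E \<boxtimes> TUnit C"] t by simp
    finally show ?thesis unfolding 1 2 3 unfolding 5 .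
  qed
  show ?thesis
    by (subst is_left_dual_iff) (use t a1 a2 in simp_all)
qed

end

lemma finite_dimensional_image:
  assumes M: "module k M" and N: "module k N" and fin: "finite_dimensional k M"
    and bij: "bij_betw \<psi> (carrier M) (carrier N)"
    and add: "\<And>x y. \<lbrakk>x \<in> carrier M; y \<in> carrier M\<rbrakk> \<Longrightarrow> \<psi> (x \<oplus>\<^bsub>M\<^esub> y) = \<psi> x \<oplus>\<^bsub>N\<^esub> \<psi> y"
    and sm: "\<And>c x. \<lbrakk>c \<in> carrier k; x \<in> carrier M\<rbrakk> \<Longrightarrow> \<psi> (c \<odot>\<^bsub>M\<^esub> x) = c \<odot>\<^bsub>N\<^esub> \<psi> x"
  shows "finite_dimensional k N"
proof -
  interpret M: module k M by fact
  interpret N: module k N by fact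
  obtain B where B: "finite B" "B \<subseteq> carrier M"
    "\<And>v. v \<in> carrier M \<Longrightarrow> \<exists>c \<in> B \<rightarrow> carrier k. v = (\<Oplus>\<^bsub>M\<^esub>b\<in>B. c b \<odot>\<^bsub>M\<^esub> b)"
    using fin unfolding finite_dimensional_def by blast
  have \<psi>c: "\<psi> \<in> carrier M \<rightarrow> carrier N" using bij by (auto simp: bij_betw_def)
  have inj: "inj_on \<psi> B" using bij B(2) by (auto simp: bij_betw_def intro: inj_on_subset)
  show ?thesis unfolding finite_dimensional_def
  proof (intro exI conjI ballI)
    show "finite (\<psi> ` B)" using B(1) by simp
    show "\<psi> ` B \<subseteq> carrier N" using \<psi>c B(2) by auto
    fix v assume "v \<in> carrier N"
    then obtain x where x: "x \<in> carrier M" "v = \<psi> x" using bij by (auto simp: bij_betw_def)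
    obtain c where c: "c \<in> B \<rightarrow> carrier k" "x = (\<Oplus>\<^bsub>M\<^esub>b\<in>B. c b \<odot>\<^bsub>M\<^esub> b)" using B(3)[OF x(1)] by blast
    \<comment> \<open>The image basis is indexed by its own elements, so the coefficients are pulled
      back along the inverse of \<open>\<psi>\<close> on \<open>B\<close>.\<close>
    let ?c = "\<lambda>y. c (the_inv_into B \<psi> y)"
    have "v = (\<Oplus>\<^bsub>N\<^esub>b\<in>B. \<psi> (c b \<odot>\<^bsub>M\<^esub> b))" unfolding x(2) c(2)
      by (rule finsum_hom[OF M.abelian_group_axioms N.abelian_group_axioms \<psi>c add B(1)])
        (use c(1) B(2) in \<open>auto intro!: M.smult_closed\<close>)
    also have "\<dots> = (\<Oplus>\<^bsub>N\<^esub>b\<in>B. ?c (\<psi> b) \<odot>\<^bsub>N\<^esub> \<psi> b)"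
      by (rule N.finsum_cong') (use c(1) B(2) \<psi>c in \<open>auto simp: the_inv_into_f_f[OF inj] sm Pi_iff subset_iff intro!: N.smult_closed\<close>)
    also have "\<dots> = (\<Oplus>\<^bsub>N\<^esub>y\<in>\<psi> ` B. ?c y \<odot>\<^bsub>N\<^esub> y)"
      by (rule N.finsum_reindex[OF _ inj, symmetric])
        (use c(1) B(2) \<psi>c in \<open>auto simp: the_inv_into_f_f[OF inj] Pi_iff subset_iff intro!: N.smult_closed\<close>)
    finally show "\<exists>c \<in> \<psi> ` B \<rightarrow> carrier k. v = (\<Oplus>\<^bsub>N\<^esub>y\<in>\<psi> ` B. c y \<odot>\<^bsub>N\<^esub> y)"
      using c(1) by (intro bexI[of _ ?c]) (auto simp: the_inv_into_f_f[OF inj])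
  qed
qed

text \<open>The target may be larger than the essential image: the locale is instantiated with
  \<open>Db C\<close> to determine the heart, and again with the heart as target.\<close>

locale full_functor =
  C: linear_category k C + D: linear_category k D
  for k :: "'k ring" and C :: "('k, 'o, 'a, 'm) cat_scheme" and D :: "('k, 'p, 'b, 'n) cat_scheme" (structure) +
  fixes F :: "('o, 'a, 'p, 'b) functr"
  assumes linear_F: "linear_functor k C D F"
    and fully_faithful: "\<lbrakk>X \<in> Obj C; Y \<in> Obj C\<rbrakk> \<Longrightarrow> bij_betw (FArr F) (homs C X Y) (homs D (FObj F X) (FObj F Y))"
begin

abbreviation FO where "FO \<equiv> FObj F"
abbreviation FA where "FA \<equiv> FArr F"

lemma FO_Obj [simp]: "X \<in> Obj C \<Longrightarrow> FO X \<in> Obj D"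
  using linear_F by (simp add: linear_functor_def)

lemma FA_Id [simp]: "X \<in> Obj C \<Longrightarrow> FA (Id C X) = Id D (FO X)"
  using linear_F by (simp add: linear_functor_def)

lemma FA_ar: "arrow C f \<Longrightarrow> ar D (FA f) (FO (Dom C f)) (FO (Cod C f))"
proof -
  assume f: "arrow C f"
  then have "FA f \<in> homs D (FO (Dom C f)) (FO (Cod C f))"
    using linear_F C.arrow_homs[OF f] C.arrow_Obj[OF f] unfolding linear_functor_def by blast
  then show ?thesis using D.homs_iff f by simp
qed

lemmas FA_simps [simp] = arD[OF FA_ar]

lemma FA_comp [simp]:
  "\<lbrakk>arrow C f; arrow C g; Dom C g = Cod C f\<rbrakk> \<Longrightarrow> FA (g o\<^bsub>C\<^esub> f) = FA g o FA f"
  using linear_F C.arrow_homs[of f] C.arrow_homs[of g] C.arrow_Obj[of f] C.arrow_Obj[of g]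
  unfolding linear_functor_def by metis

lemma FA_add: "\<lbrakk>ar C f X Y; ar C g X Y\<rbrakk> \<Longrightarrow> FA (f \<oplus>\<^bsub>Hom C X Y\<^esub> g) = FA f \<oplus>\<^bsub>Hom D (FO X) (FO Y)\<^esub> FA g"
  using linear_F C.homs_iff unfolding linear_functor_def by metis

lemma FA_smult: "\<lbrakk>c \<in> carrier k; ar C f X Y\<rbrakk> \<Longrightarrow> FA (c \<odot>\<^bsub>Hom C X Y\<^esub> f) = c \<odot>\<^bsub>Hom D (FO X) (FO Y)\<^esub> FA f"
  using linear_F C.homs_iff unfolding linear_functor_def by metis

lemma FA_zero [simp]: "\<lbrakk>X \<in> Obj C; Y \<in> Obj C\<rbrakk> \<Longrightarrow> FA (zero_arr C X Y) = zero_arr D (FO X) (FO Y)"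
  by (rule D.add_self_zero) (use FA_add[of "zero_arr C X Y" X Y "zero_arr C X Y"] in simp_all)

lemma FA_full:
  assumes "ar D \<phi> (FO X) (FO Y)" "X \<in> Obj C" "Y \<in> Obj C"
  obtains f where "ar C f X Y" "FA f = \<phi>"
proof -
  have "\<phi> \<in> FA ` homs C X Y" using fully_faithful[OF assms(2,3)] assms D.homs_iff
    by (simp add: bij_betw_def)
  then show thesis using that assms C.homs_iff by auto
qed

lemma FA_faithful: "\<lbrakk>ar C f X Y; ar C g X Y; FA f = FA g\<rbrakk> \<Longrightarrow> f = g"
  using fully_faithful[of X Y] C.homs_iff[of X Y] unfolding bij_betw_def inj_on_def by blast

lemma arrow_lift:
  assumes \<phi>: "ar D \<phi> K L" and X: "X \<in> Obj C" and Y: "Y \<in> Obj C"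
    and a: "D.iso_pair a a' (FO X) K" and b: "D.iso_pair b b' (FO Y) L"
  obtains f where "ar C f X Y" "\<phi> = b o FA f o a'" "FA f = b' o (\<phi> o a)"
proof -
  note A = D.iso_pairD[OF a] and B = D.iso_pairD[OF b]
  obtain f where f: "ar C f X Y" "FA f = b' o \<phi> o a"
    by (rule FA_full[of "b' o \<phi> o a" X Y]) (use A(1) B(2) \<phi> X Y in auto)
  have "b o FA f o a' = \<phi>"
    unfolding f(2) using A(1,2,4) B(1,2) \<phi> B(9)[of "\<phi>" K] B(9)[of "\<phi> o (a o a')" K] by simp
  then show thesis using that[OF f(1) _ f(2)] by simp
qed

lemma F_iso_pair: "C.iso_pair f g X Y \<Longrightarrow> D.iso_pair (FA f) (FA g) (FO X) (FO Y)"
  using FA_comp[of f g] FA_comp[of g f] by (auto simp: C.iso_pair_def D.iso_pair_def)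

lemma F_zero_obj: "zero_obj C X \<Longrightarrow> zero_obj D (FO X)"
  using FA_Id[of X] by (simp add: C.zero_obj_iff D.zero_obj_iff)

text \<open>\<open>is_dsumI\<close> tests joint epimorphy on endomorphisms of the sum only, and
  those of \<open>FO B\<close> lift to C by fullness.\<close>

lemma F_dsum:
  assumes d: "is_dsum C I X B i p"
  shows "is_dsum D I (\<lambda>a. FO (X a)) (FO B) (\<lambda>a. FA (i a)) (\<lambda>a. FA (p a))"
proof -
  note E = C.is_dsumD[OF d]
  show ?thesis
  proof (rule D.is_dsumI)
    show "FO B \<in> Obj D" using E(1) by simp
    show "ar D (FA (i a)) (FO (X a)) (FO B)" "ar D (FA (p a)) (FO B) (FO (X a))" if "a \<in> I" for a
      using E(2,3)[OF that] by simp_all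
    have "{a \<in> I. \<not> zero_obj D (FO (X a))} \<subseteq> {a \<in> I. \<not> zero_obj C (X a)}" using F_zero_obj by auto
    then show "finite {a \<in> I. \<not> zero_obj D (FO (X a))}" using E(4) finite_subset by blast
    show "FA (p a) o FA (i a) = Id D (FO (X a))" if "a \<in> I" for a
      using FA_comp[of "i a" "p a"] E(2,3,5)[OF that] by simp
    show "FA (p b) o FA (i a) = zero_arr D (FO (X a)) (FO (X b))" if "a \<in> I" "b \<in> I" "a \<noteq> b" for a b
      using FA_comp[of "i a" "p b"] E(2)[OF that(1)] E(3)[OF that(2)] E(2)[OF that(2)] E(6)[OF that] by simp
    fix f g assume fg: "ar D f (FO B) (FO B)" "ar D g (FO B) (FO B)" "\<And>a. a \<in> I \<Longrightarrow> f o FA (i a) = g o FA (i a)"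
    obtain f0 where f0: "ar C f0 B B" "FA f0 = f" using FA_full[OF fg(1) E(1) E(1)] .
    obtain g0 where g0: "ar C g0 B B" "FA g0 = g" using FA_full[OF fg(2) E(1) E(1)] .
    have "f0 = g0"
    proof (rule C.dsum_epi[OF d f0(1) g0(1)])
      fix a assume a: "a \<in> I"
      show "f0 o\<^bsub>C\<^esub> i a = g0 o\<^bsub>C\<^esub> i a"
        by (rule FA_faithful[of _ "X a" B]) (use f0 g0 E(2)[OF a] fg(3)[OF a] in simp_all)
    qed
    then show "f = g" using f0 g0 by simp
  qed
qed

end

text \<open>D is only linear and monoidal; abelianness, rigidity and the finiteness axioms are
  derived for it below.\<close>

locale monoidal_transport =
  C: tensor_category k C + D: linear_monoidal_category k D + full_functor k C D F
  for k :: "'k ring" and C :: "('k, 'o, 'a, 'm) tcat_scheme" and D :: "('k, 'p, 'b, 'n) tcat_scheme" (structure)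
    and F :: "('o, 'a, 'p, 'b) functr" +
  fixes \<mu> :: "'o \<Rightarrow> 'o \<Rightarrow> 'b" and \<epsilon> :: 'b
  assumes ess_surj: "K \<in> Obj D \<Longrightarrow> \<exists>X \<in> Obj C. isomorphic D (FObj F X) K"
    and monoidal_F: "strong_monoidal_structure C D F \<mu> \<epsilon>"
begin

lemma ess_surjE:
  assumes "K \<in> Obj D"
  obtains X a a' where "X \<in> Obj C" "D.iso_pair a a' (FO X) K"
  using ess_surj[OF assms] D.iso_pair_isomorphic by blast

text \<open>A test object of D is replaced by some \<open>FO X\<close> along an isomorphism; the
  test arrows then lift to C. The same replacement proves \<open>F_epi\<close>,
  \<open>F_kernel\<close> and \<open>F_cokernel\<close>.\<close>

lemma F_mono: assumes m: "is_mono C m" shows "is_mono D (FA m)"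
  unfolding D.is_mono_iff
proof (intro conjI allI impI)
  have ma: "arrow C m" using C.is_mono_arrow[OF m] .
  then show "arrow D (FA m)" by simp
  fix T u v assume *: "ar D u T (Dom D (FA m)) \<and> ar D v T (Dom D (FA m)) \<and> FA m o u = FA m o v"
  then have t: "ar D u T (FO (Dom C m))" "ar D v T (FO (Dom C m))" and eq: "FA m o u = FA m o v" using ma by auto
  have "T \<in> Obj D" using t by simp
  then obtain X a a' where X: "X \<in> Obj C" and a: "D.iso_pair a a' (FO X) T" by (rule ess_surjE)
  note A = D.iso_pairD[OF a]
  obtain u0 where u0: "ar C u0 X (Dom C m)" "FA u0 = u o a"
    by (rule FA_full[of "u o a" X "Dom C m"]) (use t A(1) X ma in auto)
  obtain v0 where v0: "ar C v0 X (Dom C m)" "FA v0 = v o a"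
    by (rule FA_full[of "v o a" X "Dom C m"]) (use t A(1) X ma in auto)
  have "FA (m o\<^bsub>C\<^esub> u0) = FA m o (u o a)" "FA (m o\<^bsub>C\<^esub> v0) = FA m o (v o a)" using u0 v0 ma by simp_all
  moreover have "FA m o (u o a) = FA m o (v o a)"
    by (rule D.comp_eq_reassoc[OF eq]) (use t A(1) ma in simp_all)
  ultimately have "m o\<^bsub>C\<^esub> u0 = m o\<^bsub>C\<^esub> v0"
    by (intro FA_faithful[of "m o\<^bsub>C\<^esub> u0" X "Cod C m" "m o\<^bsub>C\<^esub> v0"]) (use u0 v0 ma in simp_all)
  then have "u0 = v0" using C.monoD[OF m] u0(1) v0(1) by blast
  then have "u o a = v o a" using u0 v0 by simp
  then show "u = v" by (intro D.epiD[OF D.is_iso_epi[OF A(5)], of u "FO (Dom C m)" v]) (use t A(1) in simp_all)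
qed

lemma F_epi: assumes q: "is_epi C q" shows "is_epi D (FA q)"
  unfolding D.is_epi_iff
proof (intro conjI allI impI)
  have qa: "arrow C q" using C.is_epi_arrow[OF q] .
  then show "arrow D (FA q)" by simp
  fix T u v assume *: "ar D u (Cod D (FA q)) T \<and> ar D v (Cod D (FA q)) T \<and> u o FA q = v o FA q"
  then have t: "ar D u (FO (Cod C q)) T" "ar D v (FO (Cod C q)) T" and eq: "u o FA q = v o FA q" using qa by auto
  have "T \<in> Obj D" using t by simp
  then obtain X a a' where X: "X \<in> Obj C" and a: "D.iso_pair a a' (FO X) T" by (rule ess_surjE)
  note A = D.iso_pairD[OF a]
  obtain u0 where u0: "ar C u0 (Cod C q) X" "FA u0 = a' o u"
    by (rule FA_full[of "a' o u" "Cod C q" X]) (use t A(2) X qa in auto)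
  obtain v0 where v0: "ar C v0 (Cod C q) X" "FA v0 = a' o v"
    by (rule FA_full[of "a' o v" "Cod C q" X]) (use t A(2) X qa in auto)
  have "FA (u0 o\<^bsub>C\<^esub> q) = a' o (u o FA q)" "FA (v0 o\<^bsub>C\<^esub> q) = a' o (v o FA q)"
    using u0 v0 qa t A(2) by simp_all
  then have "FA (u0 o\<^bsub>C\<^esub> q) = FA (v0 o\<^bsub>C\<^esub> q)" using eq by simp
  then have "u0 o\<^bsub>C\<^esub> q = v0 o\<^bsub>C\<^esub> q"
    by (intro FA_faithful[of "u0 o\<^bsub>C\<^esub> q" "Dom C q" X "v0 o\<^bsub>C\<^esub> q"]) (use u0 v0 qa in simp_all)
  then have "u0 = v0" using C.epiD[OF q] u0(1) v0(1) by blast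
  then have "a' o u = a' o v" using u0 v0 by simp
  then show "u = v" by (intro D.monoD[OF D.is_iso_mono[OF A(6)], of u "FO (Cod C q)" v]) (use t A(2) in simp_all)
qed

lemma F_kernel: assumes k: "is_kernel C f m" shows "is_kernel D (FA f) (FA m)"
proof -
  note K = C.is_kernelD[OF k]
  show ?thesis
  proof (rule D.is_kernelI)
    show "FA f o FA m = zero_arr D (Dom D (FA m)) (Cod D (FA f))"
      using K(1-4) FA_comp[of m f, symmetric] by simp
    fix t T assume t: "ar D t T (Dom D (FA f))" "FA f o t = zero_arr D T (Cod D (FA f))"
    have "T \<in> Obj D" using t by simp
    then obtain X a a' where X: "X \<in> Obj C" and a: "D.iso_pair a a' (FO X) T" by (rule ess_surjE)
    note A = D.iso_pairD[OF a]
    obtain t0 where t0: "ar C t0 X (Dom C f)" "FA t0 = t o a"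
      by (rule FA_full[of "t o a" X "Dom C f"]) (use t A(1) X K(1) in auto)
    have "FA f o (t o a) = zero_arr D (FO X) (FO (Cod C f))"
      using D.comp_eq_reassoc1[OF t(2), of a] t(1) A(1) K(1) by simp
    then have "FA (f o\<^bsub>C\<^esub> t0) = FA (zero_arr C X (Cod C f))" using t0 K(1) X by simp
    then have "f o\<^bsub>C\<^esub> t0 = zero_arr C X (Cod C f)"
      by (intro FA_faithful[of _ X "Cod C f"]) (use t0 K(1) X in simp_all)
    then obtain u where u: "ar C u X (Dom C m)" "m o\<^bsub>C\<^esub> u = t0" using K(5) t0 by blast
    have "FA m o (FA u o a') = FA (m o\<^bsub>C\<^esub> u) o a'" using u(1) K(1-3) A(2) by simp
    also have "\<dots> = t" unfolding u(2) t0(2) using t(1) A(1,2,4) K(1) by simp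
    finally show "\<exists>u. ar D u T (Dom D (FA m)) \<and> FA m o u = t"
      using u(1) K(2) A(2) by (intro exI[of _ "FA u o a'"]) simp
  qed (use K(1-3) F_mono[OF K(6)] in simp_all)
qed

lemma F_cokernel: assumes k: "is_cokernel C f q" shows "is_cokernel D (FA f) (FA q)"
proof -
  note K = C.is_cokernelD[OF k]
  show ?thesis
  proof (rule D.is_cokernelI)
    show "FA q o FA f = zero_arr D (Dom D (FA f)) (Cod D (FA q))"
      using K(1-4) FA_comp[of f q, symmetric] by simp
    fix t T assume t: "ar D t (Cod D (FA f)) T" "t o FA f = zero_arr D (Dom D (FA f)) T"
    have "T \<in> Obj D" using t by simp
    then obtain X a a' where X: "X \<in> Obj C" and a: "D.iso_pair a a' (FO X) T" by (rule ess_surjE)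
    note A = D.iso_pairD[OF a]
    obtain t0 where t0: "ar C t0 (Cod C f) X" "FA t0 = a' o t"
      by (rule FA_full[of "a' o t" "Cod C f" X]) (use t A(2) X K(1) in auto)
    have "FA (t0 o\<^bsub>C\<^esub> f) = a' o (t o FA f)" using t0 K(1) t(1) A(2) by simp
    also have "\<dots> = FA (zero_arr C (Dom C f) X)" unfolding t(2) using A(2) K(1) X by simp
    finally have "t0 o\<^bsub>C\<^esub> f = zero_arr C (Dom C f) X"
      by (intro FA_faithful[of _ "Dom C f" X]) (use t0 K(1) X in simp_all)
    then obtain u where u: "ar C u (Cod C q) X" "u o\<^bsub>C\<^esub> q = t0" using K(5) t0 by blast
    have "(a o FA u) o FA q = a o FA (u o\<^bsub>C\<^esub> q)" using u(1) K(1-3) A(1) by simp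
    also have "\<dots> = t" unfolding u(2) t0(2) using t(1) K(1) A(9)[of t "FO (Cod C f)"] by simp
    finally show "\<exists>u. ar D u (Cod D (FA q)) T \<and> u o FA q = t"
      using u(1) K(2) A(1) by (intro exI[of _ "a o FA u"]) simp
  qed (use K(1-3) F_epi[OF K(6)] in simp_all)
qed

lemma reflect_mono: assumes m: "is_mono D (FA f)" "arrow C f" shows "is_mono C f"
  unfolding C.is_mono_iff
proof (intro conjI allI impI)
  fix T u v assume *: "ar C u T (Dom C f) \<and> ar C v T (Dom C f) \<and> f o\<^bsub>C\<^esub> u = f o\<^bsub>C\<^esub> v"
  then have t: "ar C u T (Dom C f)" "ar C v T (Dom C f)" and eq: "f o\<^bsub>C\<^esub> u = f o\<^bsub>C\<^esub> v" by auto
  have "FA (f o\<^bsub>C\<^esub> u) = FA (f o\<^bsub>C\<^esub> v)" by (simp only: eq)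
  then have e: "FA f o FA u = FA f o FA v" using t m(2) by simp
  have "FA u = FA v"
    by (rule D.monoD[OF m(1), of "FA u" "FO T" "FA v"]) (use t m(2) e in simp_all)
  then show "u = v" using FA_faithful t by blast
qed (rule m)

lemma reflect_epi: assumes q: "is_epi D (FA f)" "arrow C f" shows "is_epi C f"
  unfolding C.is_epi_iff
proof (intro conjI allI impI)
  fix T u v assume *: "ar C u (Cod C f) T \<and> ar C v (Cod C f) T \<and> u o\<^bsub>C\<^esub> f = v o\<^bsub>C\<^esub> f"
  then have t: "ar C u (Cod C f) T" "ar C v (Cod C f) T" and eq: "u o\<^bsub>C\<^esub> f = v o\<^bsub>C\<^esub> f" by auto
  have "FA (u o\<^bsub>C\<^esub> f) = FA (v o\<^bsub>C\<^esub> f)" by (simp only: eq)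
  then have e: "FA u o FA f = FA v o FA f" using t q(2) by simp
  have "FA u = FA v"
    by (rule D.epiD[OF q(1), of "FA u" "FO T" "FA v"]) (use t q(2) e in simp_all)
  then show "u = v" using FA_faithful t by blast
qed (rule q)

text \<open>An arrow of D is conjugate to the image of an arrow of C. For normality the lift has to
  be mono or epi again, which faithfulness gives; then its presentation as a kernel or cokernel in C
  is mapped back.\<close>

lemma D_abelian: "abelian_category k D"
proof (rule abelian_category.intro[OF D.linear_category_axioms], rule abelian_category_axioms.intro)
  show "\<exists>Z. zero_obj D Z" using F_zero_obj[OF C.zero_obj_the_zero] by blast
next
  fix K L assume "K \<in> Obj D" "L \<in> Obj D"
  then obtain X a a' Y b b' where X: "X \<in> Obj C" "D.iso_pair a a' (FO X) K" and Y: "Y \<in> Obj C" "D.iso_pair b b' (FO Y) L"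
    using ess_surjE by metis
  obtain B i p where d: "is_dsum C (UNIV :: bool set) (\<lambda>b. if b then X else Y) B i p"
    using C.has_dsums[OF X(1) Y(1)] by blast
  have B: "B \<in> Obj C" using C.is_dsumD(1)[OF d] .
  show "\<exists>B i p. is_dsum D (UNIV :: bool set) (\<lambda>b. if b then K else L) B i p"
    by (intro exI, rule D.dsum_iso[OF F_dsum[OF d], of "\<lambda>c. if c then a else b" "\<lambda>c. if c then a' else b'" "\<lambda>c. if c then K else L",
        OF _ D.iso_pair_Id[OF FO_Obj[OF B]]]) (use X(2) Y(2) in \<open>simp split: if_splits\<close>)
next
  fix \<phi> assume "arrow D \<phi>"
  then have \<phi>: "ar D \<phi> (Dom D \<phi>) (Cod D \<phi>)" by simp
  obtain X a a' where X: "X \<in> Obj C" "D.iso_pair a a' (FO X) (Dom D \<phi>)" using ess_surjE \<phi> by metis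
  obtain Y b b' where Y: "Y \<in> Obj C" "D.iso_pair b b' (FO Y) (Cod D \<phi>)" using ess_surjE \<phi> by metis
  obtain f where f: "ar C f X Y" "\<phi> = b o FA f o a'" using arrow_lift[OF \<phi> X(1) Y(1) X(2) Y(2)] .
  have ab: "D.iso_pair a a' (Dom D (FA f)) (Dom D \<phi>)" "D.iso_pair b b' (Cod D (FA f)) (Cod D \<phi>)" using X Y f(1) by auto
  obtain m where m: "is_kernel C f m" using C.has_kernels f(1) by blast
  obtain q where q: "is_cokernel C f q" using C.has_cokernels f(1) by blast
  have o: "Dom D (FA m) \<in> Obj D" "Cod D (FA q) \<in> Obj D" using C.is_kernelD(2)[OF m] C.is_cokernelD(2)[OF q] by auto
  show "\<exists>m. is_kernel D \<phi> m"
    using D.kernel_iso[OF F_kernel[OF m] ab D.iso_pair_Id[OF o(1)]] f(2) by metis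
  show "\<exists>q. is_cokernel D \<phi> q"
    using D.cokernel_iso[OF F_cokernel[OF q] ab D.iso_pair_Id[OF o(2)]] f(2) by metis
next
  fix m assume m: "is_mono D m"
  then have mt: "ar D m (Dom D m) (Cod D m)" using D.is_mono_arrow by simp
  obtain X a a' where X: "X \<in> Obj C" "D.iso_pair a a' (FO X) (Dom D m)" using ess_surjE mt by metis
  obtain Y b b' where Y: "Y \<in> Obj C" "D.iso_pair b b' (FO Y) (Cod D m)" using ess_surjE mt by metis
  note A = D.iso_pairD[OF X(2)] and B = D.iso_pairD[OF Y(2)]
  obtain m0 where m0: "ar C m0 X Y" "m = b o FA m0 o a'"
    and e: "FA m0 = b' o (m o a)" using arrow_lift[OF mt X(1) Y(1) X(2) Y(2)] .
  have "is_mono D (m o a)" by (rule D.is_mono_comp[OF D.is_iso_mono[OF A(5)] m]) (use A(1) in simp)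
  then have "is_mono D (FA m0)" unfolding e by (rule D.is_mono_comp[OF _ D.is_iso_mono[OF B(6)]]) (use mt A(1) B(2) in simp)
  then have "is_mono C m0" using reflect_mono m0(1) by blast
  then obtain f where f: "is_kernel C f m0" using C.mono_normal by blast
  note K = C.is_kernelD[OF f]
  have o: "Cod D (FA f) \<in> Obj D" using K(1) by simp
  have p: "D.iso_pair b b' (Dom D (FA f)) (Cod D m)" "D.iso_pair a a' (Dom D (FA m0)) (Dom D m)" using X(2) Y(2) K(1-3) m0(1) by auto
  show "\<exists>f. is_kernel D f m"
    using D.kernel_iso[OF F_kernel[OF f] p(1) D.iso_pair_Id[OF o] p(2)] m0(2) by metis
next
  fix q assume q: "is_epi D q"
  then have qt: "ar D q (Dom D q) (Cod D q)" using D.is_epi_arrow by simp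
  obtain X a a' where X: "X \<in> Obj C" "D.iso_pair a a' (FO X) (Dom D q)" using ess_surjE qt by metis
  obtain Y b b' where Y: "Y \<in> Obj C" "D.iso_pair b b' (FO Y) (Cod D q)" using ess_surjE qt by metis
  note A = D.iso_pairD[OF X(2)] and B = D.iso_pairD[OF Y(2)]
  obtain q0 where q0: "ar C q0 X Y" "q = b o FA q0 o a'"
    and e: "FA q0 = b' o (q o a)" using arrow_lift[OF qt X(1) Y(1) X(2) Y(2)] .
  have "is_epi D (q o a)" by (rule D.is_epi_comp[OF D.is_iso_epi[OF A(5)] q]) (use A(1) in simp)
  then have "is_epi D (FA q0)" unfolding e by (rule D.is_epi_comp[OF _ D.is_iso_epi[OF B(6)]]) (use qt A(1) B(2) in simp)
  then have "is_epi C q0" using reflect_epi q0(1) by blast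
  then obtain f where f: "is_cokernel C f q0" using C.epi_normal by blast
  note K = C.is_cokernelD[OF f]
  have o: "Dom D (FA f) \<in> Obj D" using K(1) by simp
  have p: "D.iso_pair a a' (Cod D (FA f)) (Dom D q)" "D.iso_pair b b' (Cod D (FA q0)) (Cod D q)" using X(2) Y(2) K(1-3) q0(1) by auto
  show "\<exists>f. is_cokernel D f q"
    using D.cokernel_iso[OF F_cokernel[OF f] D.iso_pair_Id[OF o] p] q0(2) by metis
qed

text \<open>Up to an isomorphism of its domain, a mono into \<open>FO S\<close> is the image of a
  mono into \<open>S\<close>.\<close>

lemma F_simple: assumes S: "simple_obj C S" shows "simple_obj D (FO S)"
  unfolding simple_obj_def
proof (intro conjI allI impI)
  have So: "S \<in> Obj C" and Sz: "\<not> zero_obj C S" using S by (auto simp: simple_obj_def)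
  show "FO S \<in> Obj D" using So by simp
  show "\<not> zero_obj D (FO S)"
  proof
    assume "zero_obj D (FO S)"
    then have "FA (Id C S) = FA (zero_arr C S S)" using So by (simp add: D.zero_obj_iff)
    then have "Id C S = zero_arr C S S" by (rule FA_faithful[rotated 2]) (use So in simp_all)
    then show False using Sz So by (simp add: C.zero_obj_iff)
  qed
  fix m assume m: "is_mono D m \<and> Cod D m = FO S"
  then have mt: "ar D m (Dom D m) (FO S)" using D.is_mono_arrow So by simp
  obtain X a a' where X: "X \<in> Obj C" "D.iso_pair a a' (FO X) (Dom D m)" using ess_surjE mt by metis
  note A = D.iso_pairD[OF X(2)]
  obtain m0 where m0: "ar C m0 X S" "FA m0 = m o a"
    by (rule FA_full[of "m o a" X S]) (use mt A(1) X So in auto)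
  have "is_mono D (FA m0)" unfolding m0(2) by (rule D.is_mono_comp[OF D.is_iso_mono[OF A(5)]]) (use m A(1) in auto)
  then have "is_mono C m0" using reflect_mono m0(1) by blast
  then have "zero_obj C X \<or> is_iso C m0" using S m0(1) by (auto simp: simple_obj_def)
  then show "zero_obj D (Dom D m) \<or> is_iso D m"
  proof
    assume "zero_obj C X"
    then show ?thesis using D.zero_obj_iso[OF X(2)] F_zero_obj by blast
  next
    assume "is_iso C m0"
    then have "is_iso D (FA m0)" using D.iso_pairD(5)[OF F_iso_pair[OF C.iso_pair_iso]] m0(1) by blast
    then have "is_iso D (FA m0 o a')" by (rule D.is_iso_comp[OF A(6)]) (use m0(1) A(2) in simp)
    moreover have "FA m0 o a' = m" unfolding m0(2) using mt A(1,2,4) by simp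
    ultimately show ?thesis by simp
  qed
qed

lemma F_finite_length: "finite_length C X \<Longrightarrow> finite_length D (FO X)"
proof (induction rule: finite_length.induct)
  case (zero Z)
  show ?case by (rule finite_length.zero, rule F_zero_obj[OF zero])
next
  case (extend f g)
  have fg: "is_kernel C g f" "is_cokernel C f g" using extend(1) by (auto simp: short_exact_def)
  have a: "arrow C f" "arrow C g" using C.is_kernelD(1,2)[OF fg(1)] by auto
  have "short_exact D (FA f) (FA g)" using F_kernel F_cokernel fg by (simp add: short_exact_def)
  then have "finite_length D (Cod D (FA f))"
    by (rule finite_length.extend) (use extend a F_simple in simp_all)
  then show ?case using a by simp
qed

lemma \<mu>_ar:
  assumes "X \<in> Obj C" "Y \<in> Obj C"
  shows "ar D (\<mu> X Y) (FO X \<boxtimes> FO Y) (FO (X \<boxtimes>\<^bsub>C\<^esub> Y))" "is_iso D (\<mu> X Y)"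
proof -
  have h: "\<mu> X Y \<in> homs D (FO X \<boxtimes> FO Y) (FO (X \<boxtimes>\<^bsub>C\<^esub> Y))" and "is_iso D (\<mu> X Y)"
    using monoidal_F assms unfolding strong_monoidal_structure_def by blast+
  then show "is_iso D (\<mu> X Y)" by blast
  show "ar D (\<mu> X Y) (FO X \<boxtimes> FO Y) (FO (X \<boxtimes>\<^bsub>C\<^esub> Y))"
    using h assms by (simp add: D.homs_iff)
qed

lemma \<epsilon>_ar: "ar D \<epsilon> (TUnit D) (FO (TUnit C))" "is_iso D \<epsilon>"
proof -
  have h: "\<epsilon> \<in> homs D (TUnit D) (FO (TUnit C))" and "is_iso D \<epsilon>"
    using monoidal_F unfolding strong_monoidal_structure_def by blast+
  then show "is_iso D \<epsilon>" by blast
  show "ar D \<epsilon> (TUnit D) (FO (TUnit C))" using h by (simp add: D.homs_iff)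
qed

lemma \<mu>_natural:
  "\<lbrakk>ar C f X X'; ar C g Y Y'\<rbrakk> \<Longrightarrow> \<mu> X' Y' o (FA f \<star> FA g) = FA (f \<star>\<^bsub>C\<^esub> g) o \<mu> X Y"
  using monoidal_F C.homs_iff unfolding strong_monoidal_structure_def by metis

lemma \<mu>_assoc:
  "\<lbrakk>X \<in> Obj C; Y \<in> Obj C; Z \<in> Obj C\<rbrakk> \<Longrightarrow>
      FA (Assoc C X Y Z) o \<mu> (X \<boxtimes>\<^bsub>C\<^esub> Y) Z o (\<mu> X Y \<star> Id D (FO Z))
      = \<mu> X (Y \<boxtimes>\<^bsub>C\<^esub> Z) o (Id D (FO X) \<star> \<mu> Y Z) o Assoc D (FO X) (FO Y) (FO Z)"
  using monoidal_F unfolding strong_monoidal_structure_def by blast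

lemma \<mu>_unit:
  assumes "X \<in> Obj C"
  shows "FA (LUnit C X) o \<mu> (TUnit C) X o (\<epsilon> \<star> Id D (FO X)) = LUnit D (FO X)"
    "FA (RUnit C X) o \<mu> X (TUnit C) o (Id D (FO X) \<star> \<epsilon>) = RUnit D (FO X)"
  using monoidal_F assms unfolding strong_monoidal_structure_def by blast+

lemmas \<mu>_simps [simp] = arD[OF \<mu>_ar(1)]

lemma FA_arr_inv_assoc:
  assumes "X \<in> Obj C" "Y \<in> Obj C" "Z \<in> Obj C"
  shows "FA (arr_inv C (Assoc C X Y Z)) o FA (Assoc C X Y Z) = Id D (FO ((X \<boxtimes>\<^bsub>C\<^esub> Y) \<boxtimes>\<^bsub>C\<^esub> Z))"
  using C.arr_inv_assoc(2)[OF assms] FA_comp[of "Assoc C X Y Z" "arr_inv C (Assoc C X Y Z)"] assms by simp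

text \<open>Strong monoidal functors preserve duals: naturality moves \<open>\<mu>\<close> past the
  images of \<open>ev\<close> and \<open>cv\<close>, coherence exchanges the associators, and the
  zigzag of C is left between the unit constraints.\<close>

lemma F_left_dual:
  assumes d: "is_left_dual C X E ev cv"
  shows "is_left_dual D (FO X) (FO E) (arr_inv D \<epsilon> o FA ev o \<mu> E X) (arr_inv D (\<mu> X E) o FA cv o \<epsilon>)"
proof -
  have o: "X \<in> Obj C" "E \<in> Obj C" and ev: "ar C ev (E \<boxtimes>\<^bsub>C\<^esub> X) (TUnit C)" and cv: "ar C cv (TUnit C) (X \<boxtimes>\<^bsub>C\<^esub> E)"
    using C.is_left_dual_typing[OF d] by auto
  have Z: "RUnit C X o\<^bsub>C\<^esub> (Id C X \<star>\<^bsub>C\<^esub> ev) o\<^bsub>C\<^esub> Assoc C X E X o\<^bsub>C\<^esub> (cv \<star>\<^bsub>C\<^esub> Id C X) = LUnit C X"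
    "LUnit C E o\<^bsub>C\<^esub> (ev \<star>\<^bsub>C\<^esub> Id C E) o\<^bsub>C\<^esub> arr_inv C (Assoc C E X E) o\<^bsub>C\<^esub> (Id C E \<star>\<^bsub>C\<^esub> cv) = RUnit C E"
    using d C.is_left_dual_iff[OF o ev cv] by auto
  have ep: "D.iso_pair \<epsilon> (arr_inv D \<epsilon>) (TUnit D) (FO (TUnit C))" by (rule D.iso_pair_iso[OF \<epsilon>_ar(2,1)])
  have mp: "D.iso_pair (\<mu> X E) (arr_inv D (\<mu> X E)) (FO X \<boxtimes> FO E) (FO (X \<boxtimes>\<^bsub>C\<^esub> E))"
    by (rule D.iso_pair_iso[OF \<mu>_ar(2,1)[OF o]])
  note EP = D.iso_pairD[OF ep] and MP = D.iso_pairD[OF mp]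
  let ?e = "arr_inv D \<epsilon>" and ?m = "arr_inv D (\<mu> X E)" and ?I = "Id D (FO X)" and ?J = "Id D (FO E)"
  let ?ev = "?e o FA ev o \<mu> E X" and ?cv = "?m o FA cv o \<epsilon>"
  note t = o ev cv EP(1,2) MP(1,2)
  have evt: "ar D ?ev (FO E \<boxtimes> FO X) (TUnit D)" and cvt: "ar D ?cv (TUnit D) (FO X \<boxtimes> FO E)"
    using t by simp_all
  have mcv: "\<mu> X E o ?cv = FA cv o \<epsilon>" using MP(9)[of "FA cv o \<epsilon>" "TUnit D"] t by simp
  have a1: "RUnit D (FO X) o (?I \<star> ?ev) o Assoc D (FO X) (FO E) (FO X) o (?cv \<star> ?I) = LUnit D (FO X)"
  proof -
    let ?y = "Assoc D (FO X) (FO E) (FO X) o (?cv \<star> ?I)"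
    let ?W = "TUnit D \<boxtimes> FO X"
    have y: "ar D ?y ?W (FO X \<boxtimes> (FO E \<boxtimes> FO X))" using t by simp
    have 1: "?I \<star> ?ev = (?I \<star> ?e) o ((?I \<star> FA ev) o (?I \<star> \<mu> E X))" using t by (simp add: D.tensor_comp)
    have 2: "RUnit D (FO X) o (?I \<star> ?e) = FA (RUnit C X) o \<mu> X (TUnit C)"
      unfolding \<mu>_unit(2)[OF o(1), symmetric] using t EP(4) by (simp add: D.tensor_comp)
    have 3: "\<mu> X (TUnit C) o (?I \<star> FA ev) = FA (Id C X \<star>\<^bsub>C\<^esub> ev) o \<mu> X (E \<boxtimes>\<^bsub>C\<^esub> X)"
      using \<mu>_natural[of "Id C X" X X ev "E \<boxtimes>\<^bsub>C\<^esub> X" "TUnit C"] t by simp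
    have 4: "\<mu> X (E \<boxtimes>\<^bsub>C\<^esub> X) o ((?I \<star> \<mu> E X) o ?y) =
        FA (Assoc C X E X) o (\<mu> (X \<boxtimes>\<^bsub>C\<^esub> E) X o ((\<mu> X E \<star> ?I) o (?cv \<star> ?I)))"
    proof -
      have "\<mu> X (E \<boxtimes>\<^bsub>C\<^esub> X) o ((?I \<star> \<mu> E X) o ?y) =
        (\<mu> X (E \<boxtimes>\<^bsub>C\<^esub> X) o (?I \<star> \<mu> E X) o Assoc D (FO X) (FO E) (FO X)) o (?cv \<star> ?I)"
        using t cvt by simp
      also have "\<dots> = (FA (Assoc C X E X) o \<mu> (X \<boxtimes>\<^bsub>C\<^esub> E) X o (\<mu> X E \<star> ?I)) o (?cv \<star> ?I)"
        unfolding \<mu>_assoc[OF o(1,2,1)] ..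
      finally show ?thesis using t cvt by simp
    qed
    have 5: "(\<mu> X E \<star> ?I) o (?cv \<star> ?I) = (FA cv \<star> ?I) o (\<epsilon> \<star> ?I)"
    proof -
      have "(\<mu> X E \<star> ?I) o (?cv \<star> ?I) = (\<mu> X E o ?cv) \<star> (?I o ?I)"
        by (rule D.tensor_comp) (use t cvt in simp_all)
      also have "\<dots> = (FA cv \<star> ?I) o (\<epsilon> \<star> ?I)" unfolding mcv using t by (simp add: D.tensor_comp)
      finally show ?thesis .
    qed
    have 6: "\<mu> (X \<boxtimes>\<^bsub>C\<^esub> E) X o (FA cv \<star> ?I) = FA (cv \<star>\<^bsub>C\<^esub> Id C X) o \<mu> (TUnit C) X"
      using \<mu>_natural[of cv "TUnit C" "X \<boxtimes>\<^bsub>C\<^esub> E" "Id C X" X X] t by simp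
    have "RUnit D (FO X) o ((?I \<star> ?ev) o ?y) =
        (RUnit D (FO X) o (?I \<star> ?e)) o ((?I \<star> FA ev) o ((?I \<star> \<mu> E X) o ?y))"
      unfolding 1 using t y by simp
    also have "\<dots> = FA (RUnit C X) o ((\<mu> X (TUnit C) o (?I \<star> FA ev)) o ((?I \<star> \<mu> E X) o ?y))"
      unfolding 2 using t y by simp
    also have "\<dots> = FA (RUnit C X) o (FA (Id C X \<star>\<^bsub>C\<^esub> ev) o (\<mu> X (E \<boxtimes>\<^bsub>C\<^esub> X) o ((?I \<star> \<mu> E X) o ?y)))"
      unfolding 3 using t y by simp
    also have "\<dots> = FA (RUnit C X) o (FA (Id C X \<star>\<^bsub>C\<^esub> ev) o (FA (Assoc C X E X) o
        ((\<mu> (X \<boxtimes>\<^bsub>C\<^esub> E) X o (FA cv \<star> ?I)) o (\<epsilon> \<star> ?I))))"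
      unfolding 4 5 using t by simp
    also have "\<dots> = FA (RUnit C X o\<^bsub>C\<^esub> (Id C X \<star>\<^bsub>C\<^esub> ev) o\<^bsub>C\<^esub> Assoc C X E X o\<^bsub>C\<^esub> (cv \<star>\<^bsub>C\<^esub> Id C X)) o (\<mu> (TUnit C) X o (\<epsilon> \<star> ?I))"
      unfolding 6 using t by simp
    also have "\<dots> = LUnit D (FO X)" unfolding Z(1) \<mu>_unit(1)[OF o(1), symmetric] ..
    finally show ?thesis .
  qed
  have a2: "LUnit D (FO E) o (?ev \<star> ?J) o arr_inv D (Assoc D (FO E) (FO X) (FO E)) o (?J \<star> ?cv) = RUnit D (FO E)"
  proof -
    let ?\<alpha> = "Assoc D (FO E) (FO X) (FO E)" and ?a = "Assoc C E X E"
    let ?y = "arr_inv D ?\<alpha> o (?J \<star> ?cv)"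
    let ?W = "FO E \<boxtimes> TUnit D"
    have y: "ar D ?y ?W ((FO E \<boxtimes> FO X) \<boxtimes> FO E)" using t by simp
    have 1: "?ev \<star> ?J = (?e \<star> ?J) o ((FA ev \<star> ?J) o (\<mu> E X \<star> ?J))" using t by (simp add: D.tensor_comp)
    have 2: "LUnit D (FO E) o (?e \<star> ?J) = FA (LUnit C E) o \<mu> (TUnit C) E"
      unfolding \<mu>_unit(1)[OF o(2), symmetric] using t EP(4) by (simp add: D.tensor_comp)
    have 3: "\<mu> (TUnit C) E o (FA ev \<star> ?J) = FA (ev \<star>\<^bsub>C\<^esub> Id C E) o \<mu> (E \<boxtimes>\<^bsub>C\<^esub> X) E"
      using \<mu>_natural[of ev "E \<boxtimes>\<^bsub>C\<^esub> X" "TUnit C" "Id C E" E E] t by simp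
    have 4: "\<mu> (E \<boxtimes>\<^bsub>C\<^esub> X) E o ((\<mu> E X \<star> ?J) o ?y) =
        FA (arr_inv C ?a) o (\<mu> E (X \<boxtimes>\<^bsub>C\<^esub> E) o ((?J \<star> \<mu> X E) o (?J \<star> ?cv)))"
    proof -
      \<comment> \<open>Coherence is available for the associator but the second zigzag contains its
        inverse, so the identity is proved after composing with \<open>FA ?a\<close> and then
        cancelled.\<close>
      let ?z = "\<mu> (E \<boxtimes>\<^bsub>C\<^esub> X) E o ((\<mu> E X \<star> ?J) o ?y)"
      have zt: "ar D ?z ?W (FO ((E \<boxtimes>\<^bsub>C\<^esub> X) \<boxtimes>\<^bsub>C\<^esub> E))" using t y by simp
      have "FA ?a o ?z = (FA ?a o \<mu> (E \<boxtimes>\<^bsub>C\<^esub> X) E o (\<mu> E X \<star> ?J)) o ?y" using t y by simp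
      also have "\<dots> = (\<mu> E (X \<boxtimes>\<^bsub>C\<^esub> E) o (?J \<star> \<mu> X E)) o (?\<alpha> o ?y)"
        unfolding \<mu>_assoc[OF o(2,1,2)] using t y by simp
      also have "?\<alpha> o ?y = ?J \<star> ?cv"
        using D.comp_eq_reassoc1[OF D.arr_inv_assoc(3), of "FO E" "FO X" "FO E" "?J \<star> ?cv"] t cvt by simp
      finally have *: "FA ?a o ?z = \<mu> E (X \<boxtimes>\<^bsub>C\<^esub> E) o ((?J \<star> \<mu> X E) o (?J \<star> ?cv))" using t cvt by simp
      have "?z = (FA (arr_inv C ?a) o FA ?a) o ?z" unfolding FA_arr_inv_assoc[OF o(2,1,2)] using zt by simp
      also have "\<dots> = FA (arr_inv C ?a) o (FA ?a o ?z)" by (rule D.assoc_arr) (use t zt in simp_all)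
      finally show ?thesis unfolding * .
    qed
    have 5: "(?J \<star> \<mu> X E) o (?J \<star> ?cv) = (?J \<star> FA cv) o (?J \<star> \<epsilon>)"
    proof -
      have "(?J \<star> \<mu> X E) o (?J \<star> ?cv) = (?J o ?J) \<star> (\<mu> X E o ?cv)"
        by (rule D.tensor_comp) (use t cvt in simp_all)
      also have "\<dots> = (?J \<star> FA cv) o (?J \<star> \<epsilon>)" unfolding mcv using t by (simp add: D.tensor_comp)
      finally show ?thesis .
    qed
    have 6: "\<mu> E (X \<boxtimes>\<^bsub>C\<^esub> E) o (?J \<star> FA cv) = FA (Id C E \<star>\<^bsub>C\<^esub> cv) o \<mu> E (TUnit C)"
      using \<mu>_natural[of "Id C E" E E cv "TUnit C" "X \<boxtimes>\<^bsub>C\<^esub> E"] t by simp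
    have "LUnit D (FO E) o ((?ev \<star> ?J) o ?y) =
        (LUnit D (FO E) o (?e \<star> ?J)) o ((FA ev \<star> ?J) o ((\<mu> E X \<star> ?J) o ?y))"
      unfolding 1 using t y by simp
    also have "\<dots> = FA (LUnit C E) o ((\<mu> (TUnit C) E o (FA ev \<star> ?J)) o ((\<mu> E X \<star> ?J) o ?y))"
      unfolding 2 using t y by simp
    also have "\<dots> = FA (LUnit C E) o (FA (ev \<star>\<^bsub>C\<^esub> Id C E) o (\<mu> (E \<boxtimes>\<^bsub>C\<^esub> X) E o ((\<mu> E X \<star> ?J) o ?y)))"
      unfolding 3 using t y by simp
    also have "\<dots> = FA (LUnit C E) o (FA (ev \<star>\<^bsub>C\<^esub> Id C E) o (FA (arr_inv C ?a) o
        ((\<mu> E (X \<boxtimes>\<^bsub>C\<^esub> E) o (?J \<star> FA cv)) o (?J \<star> \<epsilon>))))"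
      unfolding 4 5 using t by simp
    also have "\<dots> = FA (LUnit C E o\<^bsub>C\<^esub> (ev \<star>\<^bsub>C\<^esub> Id C E) o\<^bsub>C\<^esub> arr_inv C ?a o\<^bsub>C\<^esub> (Id C E \<star>\<^bsub>C\<^esub> cv)) o (\<mu> E (TUnit C) o (?J \<star> \<epsilon>))"
      unfolding 6 using t by simp
    also have "\<dots> = RUnit D (FO E)" unfolding Z(2) \<mu>_unit(2)[OF o(2), symmetric] ..
    finally show ?thesis .
  qed
  show ?thesis
    by (subst D.is_left_dual_iff) (use o evt cvt a1 a2 in simp_all)
qed

text \<open>Compares hom spaces of arbitrary objects of D with those of C; it transports both finite
  dimension and the description of the endomorphisms of the unit.\<close>

lemma conj_bij:
  assumes X: "X \<in> Obj C" "D.iso_pair a a' (FO X) K" and Y: "Y \<in> Obj C" "D.iso_pair b b' (FO Y) L"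
  shows "bij_betw (\<lambda>f. b o FA f o a') (homs C X Y) (homs D K L)"
proof (rule bij_betw_imageI)
  note A = D.iso_pairD[OF X(2)] and B = D.iso_pairD[OF Y(2)]
  have KL: "K \<in> Obj D" "L \<in> Obj D" using A(1) B(1) by auto
  show "inj_on (\<lambda>f. b o FA f o a') (homs C X Y)"
  proof (rule inj_onI)
    fix f g assume "f \<in> homs C X Y" "g \<in> homs C X Y" and eq: "b o FA f o a' = b o FA g o a'"
    then have fg: "ar C f X Y" "ar C g X Y" using X Y C.homs_iff by auto
    have "FA f o a' = FA g o a'" by (rule D.monoD[OF D.is_iso_mono[OF B(5)] _ _ eq]) (use fg A(2) B(1) in auto)
    then have "FA f = FA g" by (rule D.epiD[OF D.is_iso_epi[OF A(6)], rotated 2]) (use fg A(2) in auto)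
    then show "f = g" using FA_faithful fg by blast
  qed
  show "(\<lambda>f. b o FA f o a') ` homs C X Y = homs D K L"
  proof
    show "(\<lambda>f. b o FA f o a') ` homs C X Y \<subseteq> homs D K L"
      using X(1) Y(1) A(2) B(1) KL by (auto simp: C.homs_iff D.homs_iff)
    show "homs D K L \<subseteq> (\<lambda>f. b o FA f o a') ` homs C X Y"
    proof
      fix \<phi> assume "\<phi> \<in> homs D K L"
      then have "ar D \<phi> K L" using KL D.homs_iff by simp
      then obtain f where "ar C f X Y" "\<phi> = b o FA f o a'" by (rule arrow_lift[OF _ X(1) Y(1) X(2) Y(2)])
      then show "\<phi> \<in> (\<lambda>f. b o FA f o a') ` homs C X Y" using X Y C.homs_iff by auto
    qed
  qed
qed

lemma D_tensor_category: "tensor_category k D"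
proof (rule tensor_category.intro[OF D.linear_monoidal_category_axioms D_abelian], rule tensor_category_axioms.intro)
  fix K assume K: "K \<in> Obj D"
  then obtain X a a' where X: "X \<in> Obj C" "D.iso_pair a a' (FO X) K" by (rule ess_surjE)
  obtain E ev cv where "is_left_dual C X E ev cv" using C.left_rigid[OF X(1)] by blast
  then show "\<exists>E ev cv. is_left_dual D K E ev cv"
    using D.is_left_dual_iso[OF F_left_dual X(2) D.iso_pair_Id] C.is_left_dual_typing FO_Obj by blast
  obtain E ev cv where "is_left_dual C E X ev cv" using C.right_rigid[OF X(1)] by blast
  then show "\<exists>E ev cv. is_left_dual D E K ev cv"
    using D.is_left_dual_iso[OF F_left_dual D.iso_pair_Id X(2)] C.is_left_dual_typing FO_Obj by blast
  show "finite_length D K"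
    using D.finite_length_iso[OF F_finite_length[OF C.obj_finite_length[OF X(1)]] X(2)] .
  fix L assume L: "L \<in> Obj D"
  then obtain Y b b' where Y: "Y \<in> Obj C" "D.iso_pair b b' (FO Y) L" by (rule ess_surjE)
  note A = D.iso_pairD[OF X(2)] and B = D.iso_pairD[OF Y(2)]
  show "finite_dimensional k (Hom D K L)"
  proof (rule finite_dimensional_image[OF C.hom_module[OF X(1) Y(1)] D.hom_module[OF K L] C.hom_finite[OF X(1) Y(1)] conj_bij[OF X Y]])
    fix f assume "f \<in> homs C X Y"
    then have f: "ar C f X Y" using X Y C.homs_iff by simp
    show "b o FA (f \<oplus>\<^bsub>Hom C X Y\<^esub> g) o a' = (b o FA f o a') \<oplus>\<^bsub>Hom D K L\<^esub> (b o FA g o a')"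
      if "g \<in> homs C X Y" for g
      using that f X(1) Y(1) A(2) B(1) FA_add[OF f, of g] by (simp add: C.homs_iff)
    show "b o FA (c \<odot>\<^bsub>Hom C X Y\<^esub> f) o a' = c \<odot>\<^bsub>Hom D K L\<^esub> (b o FA f o a')"
      if "c \<in> carrier k" for c
      using that f A(2) B(1) FA_smult[OF that f] by simp
  qed
next
  have ep: "D.iso_pair \<epsilon> (arr_inv D \<epsilon>) (TUnit D) (FO (TUnit C))" by (rule D.iso_pair_iso[OF \<epsilon>_ar(2,1)])
  note EP = D.iso_pairD[OF ep]
  show "simple_obj D (TUnit D)" by (rule D.simple_obj_iso[OF F_simple[OF C.unit_simple] EP(7)])
  let ?e = "arr_inv D \<epsilon>"
  \<comment> \<open>Scalars parametrise the endomorphisms of the unit of C, and conjugation with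
    \<open>\<epsilon>\<close> carries these to the endomorphisms of the unit of D.\<close>
  have "bij_betw ((\<lambda>f. ?e o FA f o \<epsilon>) \<circ> (\<lambda>c. c \<odot>\<^bsub>Hom C (TUnit C) (TUnit C)\<^esub> Id C (TUnit C)))
      (carrier k) (homs D (TUnit D) (TUnit D))"
    by (rule bij_betw_trans[OF C.unit_end conj_bij[OF C.unit_Obj EP(7) C.unit_Obj EP(7)]])
  moreover have "((\<lambda>f. ?e o FA f o \<epsilon>) \<circ> (\<lambda>c. c \<odot>\<^bsub>Hom C (TUnit C) (TUnit C)\<^esub> Id C (TUnit C))) c =
      c \<odot>\<^bsub>Hom D (TUnit D) (TUnit D)\<^esub> Id D (TUnit D)" if "c \<in> carrier k" for c
    using FA_smult[OF that, of "Id C (TUnit C)" "TUnit C" "TUnit C"] that EP(1-3) by simp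
  ultimately show "bij_betw (\<lambda>c. c \<odot>\<^bsub>Hom D (TUnit D) (TUnit D)\<^esub> Id D (TUnit D)) (carrier k) (homs D (TUnit D) (TUnit D))"
    by (subst bij_betw_cong) auto
qed

text \<open>The quasi-inverse chooses a preimage \<open>G0 K\<close> with an isomorphism
  \<open>a K\<close> onto \<open>K\<close>, and lifts conjugated arrows. Its laws are checked after
  \<open>FA\<close>, by faithfulness; the chosen isomorphisms form the second natural
  isomorphism.\<close>

lemma F_linear_equivalence: "linear_equivalence k C D F"
proof -
  have "\<exists>X. \<exists>a a'. X \<in> Obj C \<and> D.iso_pair a a' (FO X) K" if "K \<in> Obj D" for K using ess_surjE[OF that] by blast
  then obtain G0 a a' where G0: "\<And>K. K \<in> Obj D \<Longrightarrow> G0 K \<in> Obj C" and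
    a: "\<And>K. K \<in> Obj D \<Longrightarrow> D.iso_pair (a K) (a' K) (FO (G0 K)) K" by metis
  note A = D.iso_pairD[OF a]
  have "\<exists>f. ar C f (G0 (Dom D \<phi>)) (G0 (Cod D \<phi>)) \<and> FA f = a' (Cod D \<phi>) o \<phi> o a (Dom D \<phi>)" if \<phi>: "arrow D \<phi>" for \<phi>
  proof -
    have o: "Dom D \<phi> \<in> Obj D" "Cod D \<phi> \<in> Obj D" using \<phi> by auto
    show ?thesis
      using FA_full[of "a' (Cod D \<phi>) o \<phi> o a (Dom D \<phi>)" "G0 (Dom D \<phi>)" "G0 (Cod D \<phi>)", OF _ G0[OF o(1)] G0[OF o(2)]]
        A(1)[OF o(1)] A(2)[OF o(2)] \<phi> by (metis (full_types) D.comp_ar)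
  qed
  then obtain G1 where G1: "\<And>\<phi>. arrow D \<phi> \<Longrightarrow> ar C (G1 \<phi>) (G0 (Dom D \<phi>)) (G0 (Cod D \<phi>))"
    "\<And>\<phi>. arrow D \<phi> \<Longrightarrow> FA (G1 \<phi>) = a' (Cod D \<phi>) o \<phi> o a (Dom D \<phi>)" by metis
  have g: "ar C (G1 \<phi>) (G0 K) (G0 L)" "FA (G1 \<phi>) = a' L o \<phi> o a K" if "ar D \<phi> K L" for \<phi> K L
    using G1[of \<phi>] that by auto
  let ?G = "\<lparr>FObj = G0, FArr = G1\<rparr>"
  have lin: "linear_functor k D C ?G" unfolding linear_functor_def functr.simps
  proof (intro conjI ballI)
    fix K assume K: "K \<in> Obj D"
    show "G0 K \<in> Obj C" by (rule G0[OF K])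
    show "G1 (Id D K) = Id C (G0 K)"
      by (rule FA_faithful[of _ "G0 K" "G0 K"]) (use g[of "Id D K" K K] K G0[OF K] A(1-3)[OF K] in simp_all)
    fix L assume L: "L \<in> Obj D"
    fix \<phi> assume "\<phi> \<in> homs D K L"
    then have \<phi>: "ar D \<phi> K L" using K L D.homs_iff by simp
    show "G1 \<phi> \<in> homs C (G0 K) (G0 L)" using g[OF \<phi>] by (simp add: C.homs_iff)
    show "G1 (\<phi> \<oplus>\<^bsub>Hom D K L\<^esub> \<psi>) = G1 \<phi> \<oplus>\<^bsub>Hom C (G0 K) (G0 L)\<^esub> G1 \<psi>" if "\<psi> \<in> homs D K L" for \<psi>
    proof -
      have \<psi>: "ar D \<psi> K L" using that K L D.homs_iff by simp
      have s: "ar D (\<phi> \<oplus>\<^bsub>Hom D K L\<^esub> \<psi>) K L" using \<phi> \<psi> by simp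
      show ?thesis
        by (rule FA_faithful[of _ "G0 K" "G0 L"])
          (use g[OF s] g[OF \<phi>] g[OF \<psi>] FA_add[OF g(1)[OF \<phi>] g(1)[OF \<psi>]] \<phi> \<psi> A(1)[OF K] A(2)[OF L] in simp_all)
    qed
    show "G1 (c \<odot>\<^bsub>Hom D K L\<^esub> \<phi>) = c \<odot>\<^bsub>Hom C (G0 K) (G0 L)\<^esub> G1 \<phi>" if c: "c \<in> carrier k" for c
    proof -
      have s: "ar D (c \<odot>\<^bsub>Hom D K L\<^esub> \<phi>) K L" using \<phi> c by simp
      show ?thesis
        by (rule FA_faithful[of _ "G0 K" "G0 L"])
          (use g[OF s] g[OF \<phi>] FA_smult[OF c g(1)[OF \<phi>]] \<phi> c A(1)[OF K] A(2)[OF L] in simp_all)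
    qed
    fix M \<psi> assume M: "M \<in> Obj D" and "\<psi> \<in> homs D L M"
    then have \<psi>: "ar D \<psi> L M" using L D.homs_iff by simp
    have s: "ar D (\<psi> o \<phi>) K M" using \<phi> \<psi> by simp
    show "G1 (\<psi> o \<phi>) = G1 \<psi> o\<^bsub>C\<^esub> G1 \<phi>"
    proof (rule FA_faithful[of _ "G0 K" "G0 M"])
      have "FA (G1 \<psi> o\<^bsub>C\<^esub> G1 \<phi>) = (a' M o \<psi> o a L) o (a' L o \<phi> o a K)"
        using g[OF \<phi>] g[OF \<psi>] by simp
      also have "\<dots> = a' M o (\<psi> o (\<phi> o a K))"
        using A(9)[OF L, of "\<phi> o a K" "FO (G0 K)"] A(1)[OF K] A(1,2)[OF L] A(2)[OF M] \<phi> \<psi> by simp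
      finally show "FA (G1 (\<psi> o \<phi>)) = FA (G1 \<psi> o\<^bsub>C\<^esub> G1 \<phi>)" using g(2)[OF s] \<phi> \<psi> A(1)[OF K] A(2)[OF M] by simp
    qed (use g[OF s] g[OF \<phi>] g[OF \<psi>] in simp_all)
  qed
  have "\<exists>\<eta>. natural_iso C C id_functor (comp_functor ?G F) \<eta>"
  proof -
    \<comment> \<open>The first natural isomorphism at \<open>X\<close> is the lift of
      \<open>a' (FO X)\<close>, with the lift of \<open>a (FO X)\<close> as inverse.\<close>
    have "\<exists>f f'. C.iso_pair f f' X (G0 (FO X)) \<and> FA f = a' (FO X)" if X: "X \<in> Obj C" for X
    proof -
      note AX = A[OF FO_Obj[OF X]] and GX = G0[OF FO_Obj[OF X]]
      obtain f where f: "ar C f X (G0 (FO X))" "FA f = a' (FO X)" using FA_full[OF AX(2) X GX] .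
      obtain f' where f': "ar C f' (G0 (FO X)) X" "FA f' = a (FO X)" using FA_full[OF AX(1) GX X] .
      have "f' o\<^bsub>C\<^esub> f = Id C X" by (rule FA_faithful[of _ X X]) (use f f' AX(4) X in simp_all)
      moreover have "f o\<^bsub>C\<^esub> f' = Id C (G0 (FO X))"
        by (rule FA_faithful[of _ "G0 (FO X)" "G0 (FO X)"]) (use f f' AX(3) GX in simp_all)
      ultimately show ?thesis using f f' by (auto simp: C.iso_pair_def)
    qed
    then obtain \<eta> \<eta>' where \<eta>: "\<And>X. X \<in> Obj C \<Longrightarrow> C.iso_pair (\<eta> X) (\<eta>' X) X (G0 (FO X))"
      "\<And>X. X \<in> Obj C \<Longrightarrow> FA (\<eta> X) = a' (FO X)" by metis
    have "natural_iso C C id_functor (comp_functor ?G F) \<eta>"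
      unfolding natural_iso_def id_functor_def comp_functor_def functr.simps
    proof (intro conjI ballI)
      fix X assume X: "X \<in> Obj C"
      note E = C.iso_pairD[OF \<eta>(1)[OF X]]
      show "\<eta> X \<in> homs C X (G0 (FO X))" using E(1) by (simp add: C.homs_iff)
      show "is_iso C (\<eta> X)" by (rule E(5))
      fix Y f assume Y: "Y \<in> Obj C" and "f \<in> homs C X Y"
      then have f: "ar C f X Y" using X C.homs_iff by simp
      have Ff: "ar D (FA f) (FO X) (FO Y)" using f by simp
      show "\<eta> Y o\<^bsub>C\<^esub> f = G1 (FA f) o\<^bsub>C\<^esub> \<eta> X"
        by (rule FA_faithful[of _ X "G0 (FO Y)"])
          (use f g[OF Ff] C.iso_pairD(1)[OF \<eta>(1)[OF X]] C.iso_pairD(1)[OF \<eta>(1)[OF Y]] \<eta>(2)[OF X] \<eta>(2)[OF Y]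
            A(1,2,4)[OF FO_Obj[OF X]] A(2)[OF FO_Obj[OF Y]] in simp_all)
    qed
    then show ?thesis by blast
  qed
  moreover have "natural_iso D D (comp_functor F ?G) id_functor a"
    unfolding natural_iso_def id_functor_def comp_functor_def functr.simps
  proof (intro conjI ballI)
    fix K assume K: "K \<in> Obj D"
    show "a K \<in> homs D (FO (G0 K)) K" using A(1)[OF K] by (simp add: D.homs_iff)
    show "is_iso D (a K)" by (rule A(5)[OF K])
    fix L \<phi> assume L: "L \<in> Obj D" and "\<phi> \<in> homs D K L"
    then have \<phi>: "ar D \<phi> K L" using K D.homs_iff by simp
    show "a L o FA (G1 \<phi>) = \<phi> o a K"
      using A(9)[OF L, of "\<phi> o a K" "FO (G0 K)"] g(2)[OF \<phi>] \<phi> A(1)[OF K] by simp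
  qed
  ultimately show ?thesis unfolding linear_equivalence_def using linear_F lin by blast
qed

theorem F_exact_tensor_equivalence: "exact_tensor_equivalence k C D F \<mu> \<epsilon>"
  unfolding exact_tensor_equivalence_def exact_functor_def short_exact_def
  using C.tensor_category_axioms D_tensor_category monoidal_F F_kernel F_cokernel F_linear_equivalence by blast

end

section \<open>The grading and the functor \<open>R\<^sub>\<chi>\<close>\<close>

lemma (in linear_category) finite_dsumsI:
  assumes d: "is_dsum C J X B i p" and J: "finite J" and S: "\<And>j. j \<in> J \<Longrightarrow> X j \<in> S"
  shows "B \<in> finite_dsums C S"
proof -
  obtain h where h: "bij_betw h {..<card J} J" using ex_bij_betw_nat_finite[OF J] by (auto simp: lessThan_atLeast0)
  then have hJ: "h a \<in> J" if "a < card J" for a using that by (auto simp: bij_betw_def)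
  have "is_dsum C {..<card J} (\<lambda>a. X (h a)) B (\<lambda>a. i (h a)) (\<lambda>a. p (h a))" by (rule dsum_reindex[OF d h]) simp_all
  moreover have "\<forall>a < card J. X (h a) \<in> S" using S hJ by blast
  ultimately show ?thesis unfolding finite_dsums_def
    by (intro CollectI exI[of _ "card J"] exI[of _ "\<lambda>a. X (h a)"] exI[of _ "\<lambda>a. i (h a)"] exI[of _ "\<lambda>a. p (h a)"] conjI)
qed

lemma (in linear_category) finite_dsums_iso:
  assumes "X \<in> finite_dsums C S" "iso_pair f g X Y"
  shows "Y \<in> finite_dsums C S"
proof -
  obtain n T i p where T: "\<forall>j < n. T j \<in> S" "is_dsum C {..<n::nat} T X i p"
    using assms(1) unfolding finite_dsums_def by blast
  have "is_dsum C {..<n} T Y (\<lambda>a. f o i a o Id C (T a)) (\<lambda>a. Id C (T a) o p a o g)"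
    by (rule dsum_iso[OF T(2) iso_pair_Id assms(2)]) (use is_dsumD(2)[OF T(2)] in blast)
  then show ?thesis using T(1) unfolding finite_dsums_def by blast
qed

locale graded_tensor_category = semisimple_tensor_category k C
  for k :: "'k ring" and C :: "('k, 'o, 'a, 'm) tcat_scheme" (structure) +
  fixes \<chi> :: "'o character"
  assumes char: "\<chi> \<in> hom (universal_grading_group C) integer_group"
begin

section \<open>Weights and the decomposition into graded components\<close>

abbreviation wt where "wt \<equiv> weight C \<chi>"
abbreviation grade where "grade \<equiv> graded_component C \<chi>"
abbreviation R where "R \<equiv> R_obj C \<chi>"

lemma weight_iso: assumes "isomorphic C X Y" shows "wt X = wt Y"
proof -
  have "iso_class C X = iso_class C Y"
    using assms isomorphic_sym isomorphic_trans unfolding iso_class_def by blast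
  then show ?thesis by (simp add: weight_def)
qed

lemma weight_tensor:
  assumes "simple_obj C X" "simple_obj C Y" "simple_obj C Z" "direct_summand C Z (X \<boxtimes> Y)"
  shows "wt Z = wt X + wt Y"
proof -
  note G = is_grading_deg[of C, unfolded is_grading_def]
  have "deg C (iso_class C X) \<in> carrier (universal_grading_group C)"
    "deg C (iso_class C Y) \<in> carrier (universal_grading_group C)"
    using G assms(1,2) by (auto simp: Irr_def Pi_iff)
  then show ?thesis using G assms hom_mult[OF char] by (simp add: weight_def)
qed

text \<open>The unit is a direct summand of its own square, so its weight w satisfies w = w +
  w.\<close>

lemma weight_unit: "wt (TUnit C) = 0"
proof -
  note l = arr_inv_simps[OF lunit_iso[OF unit_Obj]]
  have "direct_summand C (TUnit C) (TUnit C \<boxtimes> TUnit C)"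
    by (rule retract_direct_summand[of "arr_inv C (LUnit C (TUnit C))" _ _ "LUnit C (TUnit C)"]) (use l in simp_all)
  then show ?thesis using weight_tensor[OF unit_simple unit_simple unit_simple] by simp
qed

lemma simple_weight_hom_zero:
  "\<lbrakk>simple_obj C S; simple_obj C T; wt S \<noteq> wt T; ar C f S T\<rbrakk> \<Longrightarrow> f = zer S T"
  using simple_hom_zero weight_iso by blast

lemma grade_hom_zero:
  assumes "X \<in> grade n" "Y \<in> grade m" "n \<noteq> m" "ar C f X Y"
  shows "f = zer X Y"
  by (rule finite_dsums_hom_zero[OF assms(1,2)[unfolded graded_component_def] _ assms(4)])
    (use simple_weight_hom_zero assms(3) in auto)

lemma grade_Obj: "X \<in> grade n \<Longrightarrow> X \<in> Obj C"
  unfolding graded_component_def by (rule finite_dsums_Obj)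

lemma simple_grade: assumes S: "simple_obj C S" shows "S \<in> grade (wt S)"
  unfolding graded_component_def
proof (rule finite_dsumsI)
  show "is_dsum C {()} (\<lambda>_. S) S (\<lambda>_. Id C S) (\<lambda>_. Id C S)"
    by (rule is_dsumI) (use simple_Obj[OF S] in auto)
qed (use S in auto)

lemma gradeE:
  assumes "X \<in> grade n"
  obtains N :: nat and S i p where "\<And>j. j \<in> {..<N} \<Longrightarrow> simple_obj C (S j) \<and> wt (S j) = n" "is_dsum C {..<N} S X i p"
  using assms unfolding graded_component_def finite_dsums_def by blast

text \<open>Every simple summand of the tensor product has weight \<open>wt S + wt T\<close> by the
  relations of the grading group, so Schur's lemma leaves no arrow to \<open>U\<close>.\<close>

lemma simple_tensor_hom_zero:
  assumes S: "simple_obj C S" and T: "simple_obj C T" and U: "simple_obj C U"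
    and w: "wt U \<noteq> wt S + wt T" and h: "ar C h (S \<boxtimes> T) U"
  shows "h = zer (S \<boxtimes> T) U"
proof -
  have o: "S \<in> Obj C" "T \<in> Obj C" "U \<in> Obj C" using simple_Obj S T U by auto
  obtain N V v w where V: "\<And>c. c < N \<Longrightarrow> simple_obj C (V c)" "is_dsum C {..<N::nat} V (S \<boxtimes> T) v w"
    by (rule simple_dsum[OF tensor_Obj[OF o(1,2)]]) blast
  note D = is_dsumD[OF V(2)]
  show ?thesis
  proof (rule dsum_epi[OF V(2) h])
    fix c assume c: "c \<in> {..<N}"
    have "wt (V c) = wt S + wt T"
      by (rule weight_tensor[OF S T V(1)]) (use c retract_direct_summand[OF D(2,3,5)] in auto)
    then have "h o v c = zer (V c) U"
      by (intro simple_weight_hom_zero[OF V(1) U]) (use c h w D(2)[OF c] assms(4) in auto)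
    then show "h o v c = zer (S \<boxtimes> T) U o v c" using D(2)[OF c] h by simp
  qed (use o in simp)
qed

text \<open>Multiplicativity of the grading in terms of arrows: decompose \<open>X\<close>,
  \<open>Y\<close> and \<open>Z\<close> into simple objects in turn and apply the simple case to
  each entry.\<close>

lemma tensor_hom_zero:
  assumes X: "X \<in> grade n" and Y: "Y \<in> grade m" and Z: "Z \<in> grade r" and r: "r \<noteq> n + m"
    and f: "ar C f (X \<boxtimes> Y) Z"
  shows "f = zer (X \<boxtimes> Y) Z"
proof -
  obtain N S i p where S: "\<And>a. a \<in> {..<N} \<Longrightarrow> simple_obj C (S a) \<and> wt (S a) = n" and dX: "is_dsum C {..<N::nat} S X i p"
    by (rule gradeE[OF X]) blast
  obtain M T j q where T: "\<And>a. a \<in> {..<M} \<Longrightarrow> simple_obj C (T a) \<and> wt (T a) = m" and dY: "is_dsum C {..<M::nat} T Y j q"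
    by (rule gradeE[OF Y]) blast
  obtain L U l s where U: "\<And>a. a \<in> {..<L} \<Longrightarrow> simple_obj C (U a) \<and> wt (U a) = r" and dZ: "is_dsum C {..<L::nat} U Z l s"
    by (rule gradeE[OF Z]) blast
  have o: "X \<in> Obj C" "Y \<in> Obj C" "Z \<in> Obj C" using X Y Z grade_Obj by auto
  note DX = is_dsumD[OF dX] and DY = is_dsumD[OF dY] and DZ = is_dsumD[OF dZ]
  show ?thesis
  proof (rule dsum_epi[OF dsum_tensor_left[OF dX o(2)] f])
    fix a assume a: "a \<in> {..<N}"
    note ia = DX(2)[OF a]
    let ?f = "f o (i a \<star> Id C Y)"
    have ft: "ar C ?f (S a \<boxtimes> Y) Z" using f ia o by simp
    have "?f = zer (S a \<boxtimes> Y) Z"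
    proof (rule dsum_epi[OF dsum_tensor_right[OF dY] ft])
      show "S a \<in> Obj C" using ia by simp
      fix b assume b: "b \<in> {..<M}"
      note jb = DY(2)[OF b]
      let ?g = "?f o (Id C (S a) \<star> j b)"
      have gt: "ar C ?g (S a \<boxtimes> T b) Z" using ft ia jb by simp
      have "?g = zer (S a \<boxtimes> T b) Z"
      proof (rule dsum_mono[OF dZ gt])
        fix c assume c: "c \<in> {..<L}"
        have "s c o ?g = zer (S a \<boxtimes> T b) (U c)"
          by (rule simple_tensor_hom_zero) (use S[OF a] T[OF b] U[OF c] r gt DZ(3)[OF c] in simp_all)
        then show "s c o ?g = s c o zer (S a \<boxtimes> T b) Z" using gt DZ(3)[OF c] by simp
      qed (use gt in simp)
      then show "?g = zer (S a \<boxtimes> Y) Z o (Id C (S a) \<star> j b)" using ia jb o by simp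
    qed (use ft in simp)
    then show "?f = zer (X \<boxtimes> Y) Z o (i a \<star> Id C Y)" using ia o by simp
  qed (use o in simp)
qed

text \<open>The simple summands of \<open>X\<close> are collected by weight into sets
  \<open>J n\<close>. Only the finitely many weights that occur give components that may be
  non-zero.\<close>

lemma grading_exists:
  assumes X: "X \<in> Obj C"
  shows "\<exists>Y i p. is_dsum C (UNIV :: int set) Y X i p \<and> (\<forall>n. Y n \<in> grade n)"
proof -
  obtain N S \<iota> \<pi> where S: "\<And>j. j < N \<Longrightarrow> simple_obj C (S j)" and d: "is_dsum C {..<N::nat} S X \<iota> \<pi>"
    by (rule simple_dsum[OF X]) blast
  note D = is_dsumD[OF d]
  define J where "J n = {j. j < N \<and> wt (S j) = n}" for n
  have J: "finite (J n)" "\<And>j. j \<in> J n \<Longrightarrow> j < N" for n by (auto simp: J_def)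
  have "\<exists>B i p. is_dsum C (J n) S B i p" for n
    by (rule dsum_exists[OF J(1)]) (use J(2) S simple_Obj in auto)
  then obtain B i p where B: "\<And>n. is_dsum C (J n) S (B n) (i n) (p n)" by metis
  note E = is_dsumD[OF B]
  have Bg: "B n \<in> grade n" for n
    unfolding graded_component_def by (rule finite_dsumsI[OF B J(1)]) (use S in \<open>auto simp: J_def\<close>)
  \<comment> \<open>The inclusion of the weight n part and, dually, the projection onto it; both are
    fixed by matching the summands of \<open>B n\<close> with those of \<open>X\<close>.\<close>
  define I where "I n = arr_sum C (B n) X (J n) (\<lambda>j. \<iota> j o p n j)" for n
  define P where "P n = arr_sum C X (B n) (J n) (\<lambda>j. i n j o \<pi> j)" for n
  have I: "ar C (I n) (B n) X" "j \<in> J n \<Longrightarrow> I n o i n j = \<iota> j" for n j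
    using dsum_induced(1)[OF B, of n \<iota> X] dsum_induced(2)[OF B, of n \<iota> X j] D(2) J(2) X unfolding I_def by auto
  have P: "ar C (P n) X (B n)" "j \<in> J n \<Longrightarrow> p n j o P n = \<pi> j" for n j
    using dsum_coinduced(1)[OF B, of n \<pi> X] dsum_coinduced(2)[OF B, of n \<pi> X j] D(3) J(2) X unfolding P_def by auto
  have "is_dsum C UNIV B X I P"
  proof (rule is_dsumI)
    have "n \<in> (\<lambda>j. wt (S j)) ` {..<N}" if "\<not> zero_obj C (B n)" for n
      using that empty_dsum_zero[OF B, of n] by (auto simp: J_def)
    then show "finite {a \<in> UNIV. \<not> zero_obj C (B a)}"
      by (rule_tac finite_subset[of _ "(\<lambda>j. wt (S j)) ` {..<N}"]) auto
    show "P n o I n = Id C (B n)" for n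
    proof (rule dsum_epi[OF B])
      fix j assume j: "j \<in> J n"
      show "(P n o I n) o i n j = Id C (B n) o i n j"
      proof (rule dsum_mono[OF B])
        fix l assume l: "l \<in> J n"
        have "p n l o ((P n o I n) o i n j) = (p n l o P n) o (I n o i n j)"
          using P(1) I(1) E(2)[OF j] E(3)[OF l] by simp
        also have "\<dots> = p n l o i n j" unfolding P(2)[OF l] I(2)[OF j]
          using D(5,6) E(5,6) J(2) j l by (cases "j = l") simp_all
        finally show "p n l o ((P n o I n) o i n j) = p n l o (Id C (B n) o i n j)" using E(2)[OF j] by simp
      qed (use P(1) I(1) E(2)[OF j] in auto)
    qed (use P(1) I(1) in auto)
    \<comment> \<open>Different components are orthogonal because there are no arrows between
      different weights.\<close>
    show "P m o I n = zer (B n) (B m)" if "n \<noteq> m" for n m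
      by (rule grade_hom_zero[OF Bg Bg that]) (use P(1) I(1) in simp)
    fix f g assume fg: "ar C f X X" "ar C g X X" "\<And>a. a \<in> UNIV \<Longrightarrow> f o I a = g o I a"
    show "f = g"
    proof (rule dsum_epi[OF d fg(1,2)])
      fix j assume "j \<in> {..<N}"
      then have j: "j \<in> J (wt (S j))" by (simp add: J_def)
      show "f o \<iota> j = g o \<iota> j"
        unfolding I(2)[OF j, symmetric] by (rule comp_eq_reassoc) (use fg I(1) E(2)[OF j] in auto)
    qed
  qed (use X I(1) P(1) in auto)
  then show ?thesis using Bg by blast
qed

section \<open>The complexes R X and the maps between them\<close>

definition gin where "gin X n = fst (snd (grading_data C \<chi> X)) n"
definition gpr where "gpr X n = snd (snd (grading_data C \<chi> X)) n"

lemma grading_dsum: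
  assumes "X \<in> Obj C"
  shows "is_dsum C UNIV (component C \<chi> X) X (gin X) (gpr X)" "component C \<chi> X n \<in> grade n"
proof -
  have "\<exists>t. case t of (Y, i, p) \<Rightarrow> is_dsum C UNIV Y X i p \<and> (\<forall>n. Y n \<in> grade n)"
    using grading_exists[OF assms] by auto
  from someI_ex[OF this] have "case grading_data C \<chi> X of (Y, i, p) \<Rightarrow> is_dsum C UNIV Y X i p \<and> (\<forall>n. Y n \<in> grade n)"
    unfolding grading_data_def .
  then show "is_dsum C UNIV (component C \<chi> X) X (gin X) (gpr X)" "component C \<chi> X n \<in> grade n"
    by (auto simp: component_def[abs_def] gin_def[abs_def] gpr_def[abs_def] split: prod.splits)
qed

text \<open>The family summed in degree i of \<open>R X\<close>. The stalk shifted by n is non-zero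
  at most in degree -n, so only n = -i can contribute.\<close>

abbreviation rfam where "rfam X i \<equiv> (\<lambda>n. if i + n = 0 then component C \<chi> X n else the_zero C)"

lemma R_cobj: "cobj (R X) i = dsum C UNIV (rfam X i)"
  by (simp add: R_obj_def cplx_dsum_def Let_def shift_def)

lemma R_cobj_dsum:
  assumes X: "X \<in> Obj C"
  shows "is_dsum C UNIV (rfam X i) (cobj (R X) i) (dinj C UNIV (rfam X i)) (dprj C UNIV (rfam X i))"
  unfolding R_cobj
proof (rule is_dsum_dsum)
  show "finite {a \<in> UNIV. \<not> zero_obj C (rfam X i a)}" by (rule finite_subset[of _ "{-i}"]) auto
qed (use grading_dsum(2)[OF X] grade_Obj in auto)

text \<open>The inclusion of the degree i term of \<open>R X\<close> into \<open>X\<close>; the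
  index -i is the weight that sits in degree i. It makes the terms of \<open>R X\<close> summands of
  \<open>X\<close> itself, where calculations take place.\<close>

definition ein where "ein X i = gin X (-i) o dprj C UNIV (rfam X i) (-i)"
definition qpr where "qpr X i = dinj C UNIV (rfam X i) (-i) o gpr X (-i)"

text \<open>All other members of \<open>rfam X i\<close> are zero objects, but the direct sum is a
  chosen one, so the term is isomorphic to the component without being equal to it.\<close>

lemma R_component_iso:
  assumes X: "X \<in> Obj C"
  shows "iso_pair (dprj C UNIV (rfam X i) (-i)) (dinj C UNIV (rfam X i) (-i)) (cobj (R X) i) (component C \<chi> X (-i))"
proof -
  note D = is_dsumD[OF R_cobj_dsum[OF X, of i]]
  let ?i = "dinj C UNIV (rfam X i)" and ?p = "dprj C UNIV (rfam X i)"
  have a: "ar C (?i (-i)) (component C \<chi> X (-i)) (cobj (R X) i)" "ar C (?p (-i)) (cobj (R X) i) (component C \<chi> X (-i))"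
    using D(2)[of "-i"] D(3)[of "-i"] by auto
  have "?i (-i) o ?p (-i) = Id C (cobj (R X) i)"
  proof (rule dsum_epi[OF R_cobj_dsum[OF X]])
    fix n :: int
    show "(?i (-i) o ?p (-i)) o ?i n = Id C (cobj (R X) i) o ?i n"
    proof (cases "n = -i")
      case True
      then show ?thesis using a D(5)[of "-i"] by simp
    next
      case False
      then have z: "zero_obj C (rfam X i n)" by auto
      show ?thesis
        by (rule HOL.trans[OF zero_summand_comp[OF R_cobj_dsum[OF X] _ z] zero_summand_comp[OF R_cobj_dsum[OF X] _ z, symmetric]])
          (use a D(1) in auto)
    qed
  qed (use a in auto)
  then show ?thesis using a D(5)[of "-i"] by (simp add: iso_pair_def)
qed

lemma R_dsum:
  assumes X: "X \<in> Obj C"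
  shows "is_dsum C UNIV (cobj (R X)) X (ein X) (qpr X)"
proof -
  note G = is_dsumD[OF grading_dsum(1)[OF X]] and B = iso_pairD[OF R_component_iso[OF X]]
  let ?i = "\<lambda>i. dinj C UNIV (rfam X i) (-i)" and ?p = "\<lambda>i. dprj C UNIV (rfam X i) (-i)"
  have e: "ar C (ein X i) (cobj (R X) i) X" and q: "ar C (qpr X i) X (cobj (R X) i)" for i
    using G(2)[of "-i"] G(3)[of "-i"] B(1,2)[of i] by (auto simp: ein_def qpr_def)
  show ?thesis
  proof (rule is_dsumI)
    have "- i \<in> {n. \<not> zero_obj C (component C \<chi> X n)}" if "\<not> zero_obj C (cobj (R X) i)" for i
      using zero_obj_iso[OF B(7), of i] that by auto
    then have "{i \<in> UNIV. \<not> zero_obj C (cobj (R X) i)} \<subseteq> uminus ` {n \<in> UNIV. \<not> zero_obj C (component C \<chi> X n)}"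
      by (auto simp: image_iff) (metis minus_minus)
    then show "finite {i \<in> UNIV. \<not> zero_obj C (cobj (R X) i)}" using G(4) finite_surj by blast
    show "qpr X i o ein X i = Id C (cobj (R X) i)" for i
    proof -
      have "qpr X i o ein X i = ?i i o ((gpr X (-i) o gin X (-i)) o ?p i)"
        using G(2)[of "-i"] G(3)[of "-i"] B(1,2)[of i] by (simp add: ein_def qpr_def)
      also have "\<dots> = Id C (cobj (R X) i)" unfolding G(5)[OF UNIV_I] using B(1,2,3)[of i] by simp
      finally show ?thesis .
    qed
    show "qpr X j o ein X i = zer (cobj (R X) i) (cobj (R X) j)" if "i \<noteq> j" for i j
    proof -
      have "qpr X j o ein X i = ?i j o ((gpr X (-j) o gin X (-i)) o ?p i)"
        using G(2)[of "-i"] G(3)[of "-j"] B(1,2)[of i] B(1,2)[of j] by (simp add: ein_def qpr_def)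
      also have "gpr X (-j) o gin X (-i) = zer (component C \<chi> X (-i)) (component C \<chi> X (-j))"
        using G(6)[of "-i" "-j"] that by simp
      finally show ?thesis using B(1,2)[of i] B(1,2)[of j] by simp
    qed
    fix f g assume fg: "ar C f X X" "ar C g X X" "\<And>a. a \<in> UNIV \<Longrightarrow> f o ein X a = g o ein X a"
    show "f = g"
    proof (rule dsum_epi[OF grading_dsum(1)[OF X] fg(1,2)])
      fix n :: int
      have "gin X n = ein X (-n) o ?i (-n)" using G(2)[of n] B(1,2,4)[of "-n"] by (simp add: ein_def)
      then show "f o gin X n = g o gin X n"
        using comp_eq_reassoc[OF fg(3)[of "-n"], of "?i (-n)"] fg(1,2) e[of "-n"] B(2)[of "-n"] by simp
    qed
  qed (use X e q in auto)
qed

lemma R_grade: "X \<in> Obj C \<Longrightarrow> cobj (R X) i \<in> grade (-i)"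
  using finite_dsums_iso[OF _ iso_pairD(7)[OF R_component_iso]] grading_dsum(2) unfolding graded_component_def by blast

lemma shift_stalk_cdiff:
  "X \<in> Obj C \<Longrightarrow> cdiff (shift C n (stalk C X)) i =
    zer (cobj (shift C n (stalk C X)) i) (cobj (shift C n (stalk C X)) (i + 1))"
  by (simp add: shift_def stalk_cdiff add_ac)

lemma R_cdiff:
  assumes X: "X \<in> Obj C"
  shows "cdiff (R X) i = zer (cobj (R X) i) (cobj (R X) (i + 1))" (is "_ = ?R")
proof -
  note D = is_dsumD[OF R_cobj_dsum[OF X]]
  let ?K = "\<lambda>n. shift C n (stalk C (component C \<chi> X n))"
  have K: "cobj (?K n) i = rfam X i n" for i n by (simp add: shift_def)
  have o: "component C \<chi> X n \<in> Obj C" for n using grading_dsum(2)[OF X] grade_Obj by blast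
  have "cdiff (R X) i = arr_sum C (cobj (R X) i) (cobj (R X) (i + 1)) UNIV
      (\<lambda>n. dinj C UNIV (rfam X (i + 1)) n o cdiff (?K n) i o dprj C UNIV (rfam X i) n)"
    unfolding R_cobj by (simp add: R_obj_def cplx_dsum_def Let_def K)
  also have "\<dots> = ?R"
  proof (rule arr_sum_zero)
    fix n :: int
    show "dinj C UNIV (rfam X (i + 1)) n o cdiff (?K n) i o dprj C UNIV (rfam X i) n = ?R"
      unfolding shift_stalk_cdiff[OF o] K using D(2)[of n "i + 1"] D(3)[of n i] by simp
  qed (use D(1) in auto)
  finally show ?thesis .
qed

definition zdiff where
  "zdiff K \<longleftrightarrow> bdd K \<and> (\<forall>i. cdiff K i = zer (cobj K i) (cobj K (i + 1)))"

lemma zdiffD: assumes "zdiff K" shows "bdd K" "cdiff K i = zer (cobj K i) (cobj K (i + 1))"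
  using assms by (auto simp: zdiff_def)

lemma chm_zdiff:
  assumes K: "zdiff K" and L: "zdiff L" and f: "\<And>i. ar C (f i) (cobj K i) (cobj L i)"
  shows "chm K L f"
  unfolding chm_def chain_map_iff[OF zdiffD(1)[OF K] zdiffD(1)[OF L]]
  using zdiffD(1)[OF K] zdiffD(1)[OF L] f by (simp add: zdiffD(2)[OF K] zdiffD(2)[OF L])

text \<open>With zero differentials every boundary d h + h d vanishes, so homotopic maps
  coincide.\<close>

lemma htpc_zdiff:
  assumes K: "zdiff K" and L: "zdiff L" and h: "htpc K L f g"
  shows "f = g"
proof
  fix i
  note f = chmD[OF htpc_chm(1)[OF h]] and g = chmD[OF htpc_chm(2)[OF h]]
  obtain s where s: "\<And>i. ar C (s i) (cobj K i) (cobj L (i - 1))"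
    "\<And>i. f i = g i +[cobj K i, cobj L i] boundary K L s i"
    by (rule homotopicE[of K L f g]) (use h f(1,2,4) g(4) in \<open>auto simp: htpc_def\<close>)
  have "boundary K L s i = zer (cobj K i) (cobj L i)"
    using s(1)[of i] s(1)[of "i + 1"] f(1,2) zdiffD(2)[OF L, of "i - 1"] by (simp add: boundary_def zdiffD(2)[OF K])
  then show "f i = g i" using s(2)[of i] g(4)[of i] by simp
qed

lemma zdiff_tensor: assumes K: "zdiff K" and L: "zdiff L" shows "zdiff (K \<otimes> L)"
  unfolding zdiff_def
proof (intro conjI allI)
  note b = zdiffD(1)[OF K] zdiffD(1)[OF L]
  show "bdd (K \<otimes> L)" using b by simp
  fix r show "cdiff (K \<otimes> L) r = zer (cobj (K \<otimes> L) r) (cobj (K \<otimes> L) (r + 1))"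
  proof (rule tin_epi[OF b, where Z = "cobj (K \<otimes> L) (r + 1)"])
    fix i j assume r: "r = i + j"
    have t: "Cod C (tin K L (i + 1) j) = cobj (K \<otimes> L) (r + 1)" "Cod C (tin K L i (j + 1)) = cobj (K \<otimes> L) (r + 1)"
      using b by (simp_all add: r add_ac)
    show "cdiff (K \<otimes> L) r o tin K L i j = zer (cobj (K \<otimes> L) r) (cobj (K \<otimes> L) (r + 1)) o tin K L i j"
      unfolding cdiff_tensor(2)[OF b r] zdiffD(2)[OF K] zdiffD(2)[OF L] using b t by (simp add: r)
  qed (use b in auto)
qed

lemma zdiff_R: assumes X: "X \<in> Obj C" shows "zdiff (R X)"
  unfolding zdiff_def using R_cdiff[OF X] is_dsumD(2,4)[OF R_dsum[OF X]]
  by (intro conjI allI bounded_zero_diff) auto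

lemma bounded_R [simp]: "X \<in> Obj C \<Longrightarrow> bdd (R X)"
  using zdiff_R zdiffD by blast

lemma ein_simps [simp]:
  assumes "X \<in> Obj C"
  shows "arrow C (ein X i)" "Dom C (ein X i) = cobj (R X) i" "Cod C (ein X i) = X"
    "arrow C (qpr X i)" "Dom C (qpr X i) = X" "Cod C (qpr X i) = cobj (R X) i"
    "qpr X i o ein X i = Id C (cobj (R X) i)"
  using is_dsumD(2,3,5)[OF R_dsum[OF assms], of i] by auto

lemma ein_cancel:
  assumes "X \<in> Obj C" "ar C u W (cobj (R X) i)" "ar C v W (cobj (R X) i)" "ein X i o u = ein X i o v"
  shows "u = v"
  by (rule monoD[OF split_mono[of "ein X i" "cobj (R X) i" X "qpr X i"], of u W v]) (use assms in simp_all)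

text \<open>If all other components of an arrow into \<open>X\<close> vanish, it factors through the
  degree i term; \<open>qpr X i o f\<close> is the factorisation. The vanishing is always supplied
  by weights.\<close>

lemma ein_qpr:
  assumes X: "X \<in> Obj C" and f: "ar C f W X" and 0: "\<And>j. j \<noteq> i \<Longrightarrow> qpr X j o f = zer W (cobj (R X) j)"
  shows "ein X i o (qpr X i o f) = f"
proof (rule dsum_mono[OF R_dsum[OF X]])
  fix j :: int
  show "qpr X j o (ein X i o (qpr X i o f)) = qpr X j o f"
  proof (cases "j = i")
    case True
    then show ?thesis
      using comp_eq_reassoc1[OF ein_simps(7)[OF X, of i], of "qpr X i o f"] X f by simp
  next
    case False
    have "qpr X j o ein X i = zer (cobj (R X) i) (cobj (R X) j)"
      using is_dsumD(6)[OF R_dsum[OF X], of i j] False by simp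
    then show ?thesis using comp_eq_reassoc1[of "qpr X j" "ein X i" _ "qpr X i o f"] X f 0[OF False] by simp
  qed
qed (use X f in auto)

text \<open>The block of \<open>f\<close> in degree i. It is the concrete form of the action of the
  functor on arrows, as \<open>R_FArr\<close> shows.\<close>

definition rmap where "rmap X Y f i = qpr Y i o f o ein X i"

lemma rmap_simps [simp]:
  "ar C f X Y \<Longrightarrow> arrow C (rmap X Y f i)" "ar C f X Y \<Longrightarrow> Dom C (rmap X Y f i) = cobj (R X) i"
  "ar C f X Y \<Longrightarrow> Cod C (rmap X Y f i) = cobj (R Y) i"
  by (auto simp: rmap_def)

text \<open>Arrows cannot change weight, so \<open>f\<close> maps the degree i term into the degree
  i term and its diagonal block loses nothing.\<close>

lemma ein_rmap:
  assumes f: "ar C f X Y"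
  shows "ein Y i o rmap X Y f i = f o ein X i"
  unfolding rmap_def
proof (rule ein_qpr)
  fix j assume "j \<noteq> i"
  then show "qpr Y j o (f o ein X i) = zer (cobj (R X) i) (cobj (R Y) j)"
    by (intro grade_hom_zero[OF R_grade R_grade]) (use f in auto)
qed (use f in auto)

lemma chm_rmap: "ar C f X Y \<Longrightarrow> chm (R X) (R Y) (rmap X Y f)"
  by (intro chm_zdiff zdiff_R) auto

lemma rmap_id: "X \<in> Obj C \<Longrightarrow> rmap X X (Id C X) = cid (R X)"
  by (auto simp: rmap_def chain_id_def)

lemma rmap_comp:
  assumes f: "ar C f X Y" and g: "ar C g Y Z"
  shows "rmap X Z (g o f) = ccomp (rmap Y Z g) (rmap X Y f)" (is "_ = ?R")
proof
  fix i
  have "rmap Y Z g i o rmap X Y f i = qpr Z i o (g o (ein Y i o rmap X Y f i))"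
    unfolding rmap_def[of Y Z] using f g by simp
  then show "rmap X Z (g o f) i = ?R i"
    unfolding ein_rmap[OF f] using f g by (simp add: rmap_def chain_comp_def)
qed

lemma rmap_add: "\<lbrakk>ar C f X Y; ar C g X Y\<rbrakk> \<Longrightarrow> rmap X Y (f +[X, Y] g) = chain_add (R X) (R Y) (rmap X Y f) (rmap X Y g)"
  by (rule ext) (simp add: rmap_def chain_add_def)

lemma rmap_smult: "\<lbrakk>c \<in> carrier k; ar C f X Y\<rbrakk> \<Longrightarrow> rmap X Y (c \<odot>\<^bsub>Hom C X Y\<^esub> f) = chain_smult (R X) (R Y) c (rmap X Y f)"
  by (rule ext) (simp add: rmap_def chain_smult_def)

lemma rmap_inj: assumes f: "ar C f X Y" and g: "ar C g X Y" and eq: "rmap X Y f = rmap X Y g" shows "f = g"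
proof (rule dsum_epi[OF R_dsum f g])
  show "f o ein X a = g o ein X a" for a
    unfolding ein_rmap[OF f, symmetric] ein_rmap[OF g, symmetric] eq ..
qed (use f in simp)

text \<open>Arrows in the separate degrees assemble to an arrow out of the direct sum
  \<open>X\<close>.\<close>

lemma rmap_surj:
  assumes \<phi>: "chm (R X) (R Y) \<phi>" and X: "X \<in> Obj C" and Y: "Y \<in> Obj C"
  obtains f where "ar C f X Y" "rmap X Y f = \<phi>"
proof
  note p = chmD(4)[OF \<phi>]
  let ?f = "arr_sum C X Y UNIV (\<lambda>a. (ein Y a o \<phi> a) o qpr X a)"
  have t: "ar C (ein Y a o \<phi> a) (cobj (R X) a) Y" for a using p[of a] Y by simp
  note I = dsum_induced[OF R_dsum[OF X] t Y]
  show f: "ar C ?f X Y" by (rule I(1))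
  show "rmap X Y ?f = \<phi>"
  proof
    fix i
    show "rmap X Y ?f i = \<phi> i"
      by (rule ein_cancel[OF Y, of _ "cobj (R X) i" i])
        (use I(2)[of i] ein_rmap[OF f, of i] f p[of i] in simp_all)
  qed
qed

lemma R_FObj [simp]: "FObj (R_functor C \<chi>) = R"
  by (simp add: R_functor_def)

text \<open>In degree i the sum that defines the induced map of direct sums has the single
  contribution n = -i, which is \<open>rmap\<close> once \<open>ein\<close> and \<open>qpr\<close>
  are unfolded.\<close>

lemma R_FArr:
  assumes f: "ar C f X Y"
  shows "FArr (R_functor C \<chi>) f = chain_class C (R X) (R Y) (rmap X Y f)"
proof -
  have o: "X \<in> Obj C" "Y \<in> Obj C" using f by auto
  let ?K = "\<lambda>X n. shift C n (stalk C (component C \<chi> X n))"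
  have K: "cobj (?K X n) i = rfam X i n" for X i n by (simp add: shift_def)
  have "cplx_dsum_map C UNIV (?K X) (?K Y) (\<lambda>n. shift_map n (stalk_map C (component_arr C \<chi> f n))) i = rmap X Y f i" for i
  proof -
    note DX = is_dsumD[OF R_cobj_dsum[OF o(1), of i]] and DY = is_dsumD[OF R_cobj_dsum[OF o(2), of i]]
    note GX = is_dsumD(2)[OF grading_dsum(1)[OF o(1)], of "-i"] and GY = is_dsumD(3)[OF grading_dsum(1)[OF o(2)], of "-i"]
    let ?g = "\<lambda>n. dinj C UNIV (rfam Y i) n o shift_map n (stalk_map C (component_arr C \<chi> f n)) i o dprj C UNIV (rfam X i) n"
    have g: "?g (-i) = rmap X Y f i"
      using f GX GY DX(3)[of "-i"] DY(2)[of "-i"] by (simp add: shift_map_def stalk_map_def component_arr_def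
        rmap_def ein_def qpr_def gin_def[symmetric] gpr_def[symmetric])
    have "cplx_dsum_map C UNIV (?K X) (?K Y) (\<lambda>n. shift_map n (stalk_map C (component_arr C \<chi> f n))) i =
        arr_sum C (cobj (R X) i) (cobj (R Y) i) UNIV ?g"
      unfolding R_cobj by (simp add: cplx_dsum_map_def Let_def K)
    also have "\<dots> = ?g (-i)"
    proof (rule arr_sum_single)
      fix n :: int assume "n \<noteq> -i"
      then have n: "i + n \<noteq> 0" by auto
      then show "?g n = zer (cobj (R X) i) (cobj (R Y) i)"
        using DX(3)[of n] DY(2)[of n] by (simp add: shift_map_def stalk_map_def add.commute[of n i])
    qed (use f g in simp_all)
    finally show ?thesis using g by simp
  qed
  then have "cplx_dsum_map C UNIV (?K X) (?K Y) (\<lambda>n. shift_map n (stalk_map C (component_arr C \<chi> f n))) = rmap X Y f" by (rule ext)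
  then show ?thesis using f by (simp add: R_functor_def)
qed

text \<open>Stated with target \<open>Db C\<close>, because the description of the objects of the
  heart already lifts idempotents along this functor.\<close>

lemma R_full_functor: "full_functor k C (Db C) (R_functor C \<chi>)"
proof (rule full_functor.intro[OF linear_category_axioms Db_linear_category], rule full_functor_axioms.intro)
  show "linear_functor k C (Db C) (R_functor C \<chi>)"
    unfolding linear_functor_def
  proof (intro conjI ballI)
    fix X assume X: "X \<in> Obj C"
    show "FObj (R_functor C \<chi>) X \<in> Obj (Db C)" using X by simp
    show "FArr (R_functor C \<chi>) (Id C X) = Id (Db C) (FObj (R_functor C \<chi>) X)"
      using R_FArr[of "Id C X" X X] X by (simp add: rmap_id)
    fix Y f assume Y: "Y \<in> Obj C" and "f \<in> homs C X Y"
    then have f: "ar C f X Y" using X homs_iff by blast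
    show "FArr (R_functor C \<chi>) f \<in> homs (Db C) (FObj (R_functor C \<chi>) X) (FObj (R_functor C \<chi>) Y)"
      using Db_hom[OF chm_rmap[OF f]] by (simp add: R_FArr[OF f])
    show "FArr (R_functor C \<chi>) (g o f) = FArr (R_functor C \<chi>) g o\<^bsub>Db C\<^esub> FArr (R_functor C \<chi>) f"
      if Z: "Z \<in> Obj C" "g \<in> homs C Y Z" for Z g
    proof -
      have g: "ar C g Y Z" using Y Z homs_iff by blast
      have gf: "ar C (g o f) X Z" using f g by simp
      show ?thesis unfolding R_FArr[OF f] R_FArr[OF g] R_FArr[OF gf]
        using roof_comp_chain_class[OF chm_rmap[OF f] chm_rmap[OF g]] by (simp add: rmap_comp[OF f g])
    qed
    show "FArr (R_functor C \<chi>) (f +[X, Y] g) = FArr (R_functor C \<chi>) f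
        \<oplus>\<^bsub>Hom (Db C) (FObj (R_functor C \<chi>) X) (FObj (R_functor C \<chi>) Y)\<^esub> FArr (R_functor C \<chi>) g"
      if "g \<in> homs C X Y" for g
    proof -
      have g: "ar C g X Y" using X Y that homs_iff by blast
      have fg: "ar C (f +[X, Y] g) X Y" using f g by simp
      show ?thesis unfolding R_FArr[OF f] R_FArr[OF g] R_FArr[OF fg]
        using roof_hom_add[OF chm_rmap[OF f] chm_rmap[OF g]] by (simp add: rmap_add[OF f g])
    qed
    show "FArr (R_functor C \<chi>) (c \<odot>\<^bsub>Hom C X Y\<^esub> f) =
        c \<odot>\<^bsub>Hom (Db C) (FObj (R_functor C \<chi>) X) (FObj (R_functor C \<chi>) Y)\<^esub> FArr (R_functor C \<chi>) f"
      if c: "c \<in> carrier k" for c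
    proof -
      have cf: "ar C (c \<odot>\<^bsub>Hom C X Y\<^esub> f) X Y" using f c by simp
      show ?thesis unfolding R_FArr[OF f] R_FArr[OF cf]
        using roof_hom_smult[OF chm_rmap[OF f] c] by (simp add: rmap_smult[OF c f])
    qed
  qed
  fix X Y assume o: "X \<in> Obj C" "Y \<in> Obj C"
  show "bij_betw (FArr (R_functor C \<chi>)) (homs C X Y) (homs (Db C) (FObj (R_functor C \<chi>) X) (FObj (R_functor C \<chi>) Y))"
  proof (rule bij_betw_imageI)
    show "inj_on (FArr (R_functor C \<chi>)) (homs C X Y)"
    proof (rule inj_onI)
      fix f g assume "f \<in> homs C X Y" "g \<in> homs C X Y" and eq: "FArr (R_functor C \<chi>) f = FArr (R_functor C \<chi>) g"
      then have fg: "ar C f X Y" "ar C g X Y" using o homs_iff by blast+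
      have "htpc (R X) (R Y) (rmap X Y f) (rmap X Y g)"
        using eq unfolding R_FArr[OF fg(1)] R_FArr[OF fg(2)] chain_class_eq_iff[OF chm_rmap[OF fg(1)] chm_rmap[OF fg(2)]] .
      then show "f = g" using htpc_zdiff[OF zdiff_R zdiff_R] rmap_inj[OF fg] o by blast
    qed
    show "FArr (R_functor C \<chi>) ` homs C X Y = homs (Db C) (FObj (R_functor C \<chi>) X) (FObj (R_functor C \<chi>) Y)"
    proof (intro equalityI subsetI)
      fix \<phi> assume "\<phi> \<in> FArr (R_functor C \<chi>) ` homs C X Y"
      then obtain f where "ar C f X Y" "\<phi> = FArr (R_functor C \<chi>) f" using o homs_iff by blast
      then show "\<phi> \<in> homs (Db C) (FObj (R_functor C \<chi>) X) (FObj (R_functor C \<chi>) Y)"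
        using Db_hom[OF chm_rmap[of f X Y]] R_FArr[of f X Y] by simp
    next
      fix \<phi> assume "\<phi> \<in> homs (Db C) (FObj (R_functor C \<chi>) X) (FObj (R_functor C \<chi>) Y)"
      then have "\<phi> \<in> homs (Db C) (R X) (R Y)" by simp
      then obtain h where h: "chm (R X) (R Y) h" "\<phi> = chain_class C (R X) (R Y) h"
        by (rule Db_homE) (use o in auto)
      obtain f where f: "ar C f X Y" "rmap X Y f = h" by (rule rmap_surj[OF h(1) o])
      then show "\<phi> \<in> FArr (R_functor C \<chi>) ` homs C X Y" using R_FArr[OF f(1)] h(2) o homs_iff by (intro image_eqI[of _ _ f]) simp_all
    qed
  qed
qed

section \<open>The monoidal structure on the functor\<close>

lemma ein_tensor_epi:
  assumes X: "X \<in> Obj C" and Y: "Y \<in> Obj C" and f: "ar C f (X \<boxtimes> Y) Z" and g: "ar C g (X \<boxtimes> Y) Z"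
    and eq: "\<And>i j. f o (ein X i \<star> ein Y j) = g o (ein X i \<star> ein Y j)"
  shows "f = g"
proof (rule dsum_epi[OF dsum_tensor_left[OF R_dsum[OF X] Y] f g])
  fix i :: int
  show "f o (ein X i \<star> Id C Y) = g o (ein X i \<star> Id C Y)"
  proof (rule dsum_epi[OF dsum_tensor_right[OF R_dsum[OF Y]]])
    fix j :: int
    have "(f o (ein X i \<star> Id C Y)) o (Id C (cobj (R X) i) \<star> ein Y j) = f o (ein X i \<star> ein Y j)"
      "(g o (ein X i \<star> Id C Y)) o (Id C (cobj (R X) i) \<star> ein Y j) = g o (ein X i \<star> ein Y j)"
      using X Y f g by (simp_all add: tensor_comp)
    then show "(f o (ein X i \<star> Id C Y)) o (Id C (cobj (R X) i) \<star> ein Y j) = (g o (ein X i \<star> Id C Y)) o (Id C (cobj (R X) i) \<star> ein Y j)"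
      using eq by simp
  qed (use X Y f g in auto)
qed

lemma qpr_tensor_zero:
  assumes X: "X \<in> Obj C" and Y: "Y \<in> Obj C" and r: "r \<noteq> i + j"
  shows "qpr (X \<boxtimes> Y) r o (ein X i \<star> ein Y j) = zer (cobj (R X) i \<boxtimes> cobj (R Y) j) (cobj (R (X \<boxtimes> Y)) r)"
  by (rule tensor_hom_zero[OF R_grade[OF X] R_grade[OF Y] R_grade[OF tensor_Obj[OF X Y]]]) (use X Y r in auto)

text \<open>The summand of degrees (i, j) is included into the tensor product of \<open>X\<close>
  and \<open>Y\<close> and then projected to the term of degree r = i + j.\<close>

definition mu where
  "mu X Y r = arr_sum C (cobj (R X \<otimes> R Y) r) (cobj (R (X \<boxtimes> Y)) r) (antidiag r)
    (\<lambda>(i, j). (qpr (X \<boxtimes> Y) r o (ein X i \<star> ein Y j)) o tpr (R X) (R Y) i j)"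

lemma mu_tin:
  assumes X: "X \<in> Obj C" and Y: "Y \<in> Obj C"
  shows "ar C (mu X Y r) (cobj (R X \<otimes> R Y) r) (cobj (R (X \<boxtimes> Y)) r)"
    "r = i + j \<Longrightarrow> mu X Y r o tin (R X) (R Y) i j = qpr (X \<boxtimes> Y) r o (ein X i \<star> ein Y j)"
proof -
  have t: "ar C (qpr (X \<boxtimes> Y) r o (ein X i \<star> ein Y j)) (cobj (R X) i \<boxtimes> cobj (R Y) j) (cobj (R (X \<boxtimes> Y)) r)" for i j
    using X Y by simp
  have o: "cobj (R (X \<boxtimes> Y)) r \<in> Obj C" using X Y by simp
  note I = tensor_induced[OF bounded_R[OF X] bounded_R[OF Y] t o mu_def]
  show "ar C (mu X Y r) (cobj (R X \<otimes> R Y) r) (cobj (R (X \<boxtimes> Y)) r)"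
    "r = i + j \<Longrightarrow> mu X Y r o tin (R X) (R Y) i j = qpr (X \<boxtimes> Y) r o (ein X i \<star> ein Y j)"
    using I by blast+
qed

lemma mu_simps [simp]:
  assumes "X \<in> Obj C" "Y \<in> Obj C"
  shows "arrow C (mu X Y r)" "Dom C (mu X Y r) = cobj (R X \<otimes> R Y) r" "Cod C (mu X Y r) = cobj (R (X \<boxtimes> Y)) r"
  using mu_tin(1)[OF assms] by auto

text \<open>Inside the tensor product of \<open>X\<close> and \<open>Y\<close> the map
  \<open>mu\<close> is the inclusion of summands, since weights leave no other component. As
  \<open>ein\<close> is mono, this lemma turns each coherence identity for \<open>mu\<close> into
  one in C.\<close>

lemma ein_mu:
  assumes X: "X \<in> Obj C" and Y: "Y \<in> Obj C" and r: "r = i + j" and u: "ar C u W (cobj (R X) i \<boxtimes> cobj (R Y) j)"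
  shows "ein (X \<boxtimes> Y) r o (mu X Y r o (tin (R X) (R Y) i j o u)) = (ein X i \<star> ein Y j) o u" (is "?L = _")
proof -
  have e: "ein (X \<boxtimes> Y) r o (qpr (X \<boxtimes> Y) r o (ein X i \<star> ein Y j)) = ein X i \<star> ein Y j"
    by (rule ein_qpr[where W = "cobj (R X) i \<boxtimes> cobj (R Y) j"]) (use X Y qpr_tensor_zero[OF X Y] r in auto)
  have "?L = ein (X \<boxtimes> Y) r o ((mu X Y r o tin (R X) (R Y) i j) o u)"
    using X Y u r by simp
  also have "\<dots> = (ein (X \<boxtimes> Y) r o (qpr (X \<boxtimes> Y) r o (ein X i \<star> ein Y j))) o u"
    unfolding mu_tin(2)[OF X Y r] using X Y u by simp
  finally show ?thesis unfolding e .
qed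

lemma chm_mu: "\<lbrakk>X \<in> Obj C; Y \<in> Obj C\<rbrakk> \<Longrightarrow> chm (R X \<otimes> R Y) (R (X \<boxtimes> Y)) (mu X Y)"
  by (intro chm_zdiff zdiff_tensor zdiff_R mu_tin) auto

text \<open>Equality of weights makes the two decompositions of the degree r part agree: by pairs
  (i, j) with i + j = r, and by the grading of the tensor product.\<close>

lemma mu_inverse:
  assumes X: "X \<in> Obj C" and Y: "Y \<in> Obj C"
  shows "\<exists>g. ar C g (cobj (R (X \<boxtimes> Y)) r) (cobj (R X \<otimes> R Y) r) \<and> g o mu X Y r = Id C (cobj (R X \<otimes> R Y) r) \<and>
    mu X Y r o g = Id C (cobj (R (X \<boxtimes> Y)) r)"
proof -
  let ?T = "cobj (R X \<otimes> R Y) r" and ?W = "cobj (R (X \<boxtimes> Y)) r" and ?m = "mu X Y r"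
  note b = bounded_R[OF X] bounded_R[OF Y]
  note d = tensor_dsum[OF b, of r]
  \<comment> \<open>The components of the candidate inverse: include the degree r term into the
    tensor product, then project in both factors.\<close>
  let ?f = "\<lambda>(i, j). (qpr X i \<star> qpr Y j) o ein (X \<boxtimes> Y) r"
  have f: "ar C (?f a) ?W (tfam C (R X) (R Y) a)" for a using X Y by (cases a) (simp add: tfam_def)
  have W: "?W \<in> Obj C" using X Y by simp
  obtain g where g: "ar C g ?W ?T" "\<And>a. a \<in> antidiag r \<Longrightarrow> dprj C (antidiag r) (tfam C (R X) (R Y)) a o g = ?f a"
    using dsum_coinduced[OF d f W] by blast
  have gm: "g o ?m = Id C ?T"
  proof (rule tin_epi[OF b, where Z = ?T])
    fix i j assume r: "r = i + j"
    have "(g o ?m) o tin (R X) (R Y) i j = Id C ?T o tin (R X) (R Y) i j"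
    proof (rule dsum_mono[OF d])
      fix a assume a: "a \<in> antidiag r"
      obtain i' j' where ij: "a = (i', j')" "r = i' + j'" using a by (cases a) (auto simp: antidiag_def)
      let ?p = "dprj C (antidiag r) (tfam C (R X) (R Y)) a"
      have p: "?p = tpr (R X) (R Y) i' j'" by (simp add: tpr_def ij)
      have pg: "?p o g = (qpr X i' \<star> qpr Y j') o ein (X \<boxtimes> Y) r" using g(2)[OF a] ij by simp
      have "?p o ((g o ?m) o tin (R X) (R Y) i j) = (?p o g) o (?m o (tin (R X) (R Y) i j o Id C (cobj (R X) i \<boxtimes> cobj (R Y) j)))"
        unfolding p using X Y g(1) b ij r by simp
      also have "\<dots> = (qpr X i' \<star> qpr Y j') o (ein (X \<boxtimes> Y) r o (?m o (tin (R X) (R Y) i j o Id C (cobj (R X) i \<boxtimes> cobj (R Y) j))))"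
        unfolding pg using X Y b r by simp
      also have "\<dots> = (qpr X i' \<star> qpr Y j') o (ein X i \<star> ein Y j)"
        by (subst ein_mu[OF X Y r]) (use X Y in auto)
      also have "\<dots> = (qpr X i' o ein X i) \<star> (qpr Y j' o ein Y j)" using X Y by (simp add: tensor_comp)
      also have "\<dots> = ?p o tin (R X) (R Y) i j"
      proof (cases "i = i'")
        case True
        then show ?thesis unfolding p using tpr_tin(1)[OF b, of i j] X Y ij r by simp
      next
        case False
        have "qpr X i' o ein X i = zer (cobj (R X) i) (cobj (R X) i')"
          using is_dsumD(6)[OF R_dsum[OF X], of i i'] False by simp
        then show ?thesis unfolding p using tpr_tin(2)[OF b, of i j i' j'] X Y ij r False by simp
      qed
      finally show "?p o ((g o ?m) o tin (R X) (R Y) i j) = ?p o (Id C ?T o tin (R X) (R Y) i j)" using b r by simp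
    qed (use X Y g(1) b r in auto)
    then show "(g o ?m) o tin (R X) (R Y) i j = Id C ?T o tin (R X) (R Y) i j" .
  qed (use g(1) X Y in auto)
  have "?m o g = Id C ?W"
  proof -
    \<comment> \<open>The projection \<open>qpr\<close> is a split epimorphism, so the identity may
      be tested after it and then on all pairs (i, j); for i + j different from r both sides
      vanish.\<close>
    have e: "((?m o g) o qpr (X \<boxtimes> Y) r) = qpr (X \<boxtimes> Y) r"
    proof (rule ein_tensor_epi[OF X Y])
      fix i j
      show "((?m o g) o qpr (X \<boxtimes> Y) r) o (ein X i \<star> ein Y j) = qpr (X \<boxtimes> Y) r o (ein X i \<star> ein Y j)"
      proof (cases "r = i + j")
        case True
        have "((?m o g) o qpr (X \<boxtimes> Y) r) o (ein X i \<star> ein Y j) = ?m o (g o (?m o tin (R X) (R Y) i j))"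
          unfolding mu_tin(2)[OF X Y True] using X Y g(1) by simp
        also have "\<dots> = ?m o ((g o ?m) o tin (R X) (R Y) i j)" using X Y g(1) b True by simp
        also have "\<dots> = qpr (X \<boxtimes> Y) r o (ein X i \<star> ein Y j)"
          unfolding gm using b True mu_tin(2)[OF X Y True] by simp
        finally show ?thesis .
      next
        case False
        then show ?thesis using qpr_tensor_zero[OF X Y False] X Y g(1) by simp
      qed
    qed (use X Y g(1) in auto)
    have "?m o g = ((?m o g) o qpr (X \<boxtimes> Y) r) o ein (X \<boxtimes> Y) r" using X Y g(1) by simp
    then show ?thesis unfolding e using X Y by simp
  qed
  then show ?thesis using g(1) gm by blast
qed

lemma mu_iso:
  assumes X: "X \<in> Obj C" and Y: "Y \<in> Obj C"
  shows "is_iso (Db C) (chain_class C (R X \<otimes> R Y) (R (X \<boxtimes> Y)) (mu X Y))"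
proof -
  obtain g where g: "\<And>r. ar C (g r) (cobj (R (X \<boxtimes> Y)) r) (cobj (R X \<otimes> R Y) r)"
    "\<And>r. g r o mu X Y r = Id C (cobj (R X \<otimes> R Y) r)" "\<And>r. mu X Y r o g r = Id C (cobj (R (X \<boxtimes> Y)) r)"
    using mu_inverse[OF X Y] by metis
  note I = chm_inverse[OF chm_mu[OF X Y], of g, OF g]
  show ?thesis by (rule Db_is_iso[OF chm_mu[OF X Y] I])
qed

text \<open>After \<open>ein\<close> on the left and \<open>tin\<close> on the right both sides
  become the tensor product of \<open>f\<close> and \<open>g\<close> applied to the included
  summand.\<close>

lemma mu_natural:
  assumes f: "ar C f X X'" and g: "ar C g Y Y'"
  shows "ccomp (mu X' Y') (ctens (R X) (R Y) (R X') (R Y') (rmap X X' f) (rmap Y Y' g)) =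
    ccomp (rmap (X \<boxtimes> Y) (X' \<boxtimes> Y') (f \<star> g)) (mu X Y)" (is "?L = ?R")
proof
  fix r
  have o: "X \<in> Obj C" "Y \<in> Obj C" "X' \<in> Obj C" "Y' \<in> Obj C" using f g by auto
  have fg: "ar C (f \<star> g) (X \<boxtimes> Y) (X' \<boxtimes> Y')" using f g by simp
  note b = bounded_R[OF o(1)] bounded_R[OF o(2)]
  note cf = chm_rmap[OF f] and cg = chm_rmap[OF g]
  let ?ct = "ctens (R X) (R Y) (R X') (R Y') (rmap X X' f) (rmap Y Y' g) r"
  note ct = chain_tensor_tin[OF cf cg, of r]
  have "mu X' Y' r o ?ct = rmap (X \<boxtimes> Y) (X' \<boxtimes> Y') (f \<star> g) r o mu X Y r"
  proof (rule tin_epi[OF b, where Z = "cobj (R (X' \<boxtimes> Y')) r"])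
    fix i j assume r: "r = i + j"
    let ?t = "tin (R X) (R Y) i j"
    let ?W = "cobj (R X) i \<boxtimes> cobj (R Y) j"
    have tt: "Cod C ?t = cobj (R X \<otimes> R Y) r" using b r by simp
    show "(mu X' Y' r o ?ct) o ?t = (rmap (X \<boxtimes> Y) (X' \<boxtimes> Y') (f \<star> g) r o mu X Y r) o ?t"
    proof (rule ein_cancel[of "X' \<boxtimes> Y'" _ ?W r])
      have "ein (X' \<boxtimes> Y') r o ((mu X' Y' r o ?ct) o ?t) = ein (X' \<boxtimes> Y') r o (mu X' Y' r o (?ct o ?t))"
        using o ct(1) tt b by simp
      also have "\<dots> = (ein X' i \<star> ein Y' j) o (rmap X X' f i \<star> rmap Y Y' g j)"
        unfolding ct(2)[OF r] by (rule ein_mu[OF o(3,4) r]) (use f g o in auto)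
      also have "\<dots> = (ein X' i o rmap X X' f i) \<star> (ein Y' j o rmap Y Y' g j)" using f g o by (simp add: tensor_comp)
      also have "\<dots> = (f \<star> g) o (ein X i \<star> ein Y j)" unfolding ein_rmap[OF f] ein_rmap[OF g] using f g o by (simp add: tensor_comp)
      also have "\<dots> = (f \<star> g) o (ein (X \<boxtimes> Y) r o (mu X Y r o ?t))"
        using ein_mu[OF o(1,2) r, of "Id C ?W" ?W] o b by simp
      also have "\<dots> = (ein (X' \<boxtimes> Y') r o rmap (X \<boxtimes> Y) (X' \<boxtimes> Y') (f \<star> g) r) o (mu X Y r o ?t)"
        unfolding ein_rmap[OF fg] using f g o tt b by simp
      finally show "ein (X' \<boxtimes> Y') r o ((mu X' Y' r o ?ct) o ?t) =
          ein (X' \<boxtimes> Y') r o ((rmap (X \<boxtimes> Y) (X' \<boxtimes> Y') (f \<star> g) r o mu X Y r) o ?t)"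
        using fg o tt b by simp
    qed (use o fg ct(1) tt b in auto)
  qed (use o fg ct(1) b in auto)
  then show "?L r = ?R r" by (simp add: chain_comp_def)
qed

text \<open>Included into the threefold tensor product, both sides become the associator of C on the
  terms in degrees i, j, l, and they agree by its naturality for \<open>ein\<close>.\<close>

lemma mu_assoc:
  assumes X: "X \<in> Obj C" and Y: "Y \<in> Obj C" and Z: "Z \<in> Obj C"
  shows "ccomp (rmap ((X \<boxtimes> Y) \<boxtimes> Z) (X \<boxtimes> (Y \<boxtimes> Z)) (Assoc C X Y Z)) (ccomp (mu (X \<boxtimes> Y) Z)
      (ctens (R X \<otimes> R Y) (R Z) (R (X \<boxtimes> Y)) (R Z) (mu X Y) (cid (R Z)))) =
    ccomp (mu X (Y \<boxtimes> Z)) (chain_comp C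
      (ctens (R X) (R Y \<otimes> R Z) (R X) (R (Y \<boxtimes> Z)) (cid (R X)) (mu Y Z)) (cplx_assoc C (R X) (R Y) (R Z)))"
proof
  fix r
  note b = bounded_R[OF X] bounded_R[OF Y] bounded_R[OF Z]
  let ?K = "R X" and ?L = "R Y" and ?M = "R Z" and ?V = "(X \<boxtimes> Y) \<boxtimes> Z" and ?W = "X \<boxtimes> (Y \<boxtimes> Z)" and ?a = "Assoc C X Y Z"
  have a: "ar C ?a ?V ?W" using X Y Z by simp
  note XY = tensor_Obj[OF X Y] and YZ = tensor_Obj[OF Y Z]
  let ?c = "ctens (?K \<otimes> ?L) ?M (R (X \<boxtimes> Y)) ?M (mu X Y) (cid ?M) r"
  let ?d = "ctens ?K (?L \<otimes> ?M) ?K (R (Y \<boxtimes> Z)) (cid ?K) (mu Y Z) r"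
  let ?A = "cplx_assoc C ?K ?L ?M r"
  note C1 = chain_tensor_tin(1)[OF chm_mu[OF X Y] chm_id[OF b(3)], of r]
    and C2 = chain_tensor_tin_comp[OF chm_mu[OF X Y] chm_id[OF b(3)]]
  note D1 = chain_tensor_tin(1)[OF chm_id[OF b(1)] chm_mu[OF Y Z], of r]
    and D2 = chain_tensor_tin_comp[OF chm_id[OF b(1)] chm_mu[OF Y Z]]
  note A = cplx_assoc_tin[OF b]
  have "rmap ?V ?W ?a r o (mu (X \<boxtimes> Y) Z r o ?c) = mu X (Y \<boxtimes> Z) r o (?d o ?A)"
  proof (rule tin3_epi[OF b, where Z = "cobj (R ?W) r"])
    fix i j l assume r: "r = i + (j + l)"
    have r': "r = (i + j) + l" using r by simp
    let ?t = "tin (?K \<otimes> ?L) ?M (i + j) l" and ?s = "tin ?K ?L i j \<star> Id C (cobj ?M l)"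
    let ?S = "(cobj ?K i \<boxtimes> cobj ?L j) \<boxtimes> cobj ?M l"
    have t: "ar C ?t (cobj (?K \<otimes> ?L) (i + j) \<boxtimes> cobj ?M l) (cobj ((?K \<otimes> ?L) \<otimes> ?M) r)" using b r' by simp
    have s: "ar C ?s ?S (cobj (?K \<otimes> ?L) (i + j) \<boxtimes> cobj ?M l)" using b by simp
    have 1: "?c o (?t o ?s) = tin (R (X \<boxtimes> Y)) ?M (i + j) l o ((mu X Y (i + j) \<star> Id C (cobj ?M l)) o ?s)"
      using C2[OF r' s] by (simp add: chain_id_def)
    have "ein ?W r o (rmap ?V ?W ?a r o (mu (X \<boxtimes> Y) Z r o (?c o (?t o ?s)))) =
        (ein ?W r o rmap ?V ?W ?a r) o (mu (X \<boxtimes> Y) Z r o (?c o (?t o ?s)))"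
      using X Y Z a C1 t s by simp
    also have "\<dots> = ?a o (ein ?V r o (mu (X \<boxtimes> Y) Z r o (?c o (?t o ?s))))"
      unfolding ein_rmap[OF a] using X Y Z a C1 t s by simp
    also have "\<dots> = ?a o ((ein (X \<boxtimes> Y) (i + j) \<star> ein Z l) o ((mu X Y (i + j) \<star> Id C (cobj ?M l)) o ?s))"
      unfolding 1 by (subst ein_mu[OF XY Z r']) (use X Y Z s in auto)
    also have "\<dots> = ?a o ((ein (X \<boxtimes> Y) (i + j) o (mu X Y (i + j) o (tin ?K ?L i j o Id C (cobj ?K i \<boxtimes> cobj ?L j)))) \<star> ein Z l)"
      using X Y Z b by (simp add: tensor_comp)
    also have "\<dots> = ?a o ((ein X i \<star> ein Y j) \<star> ein Z l)"
      by (subst ein_mu[OF X Y HOL.refl]) (use X Y in auto)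
    also have "\<dots> = (ein X i \<star> (ein Y j \<star> ein Z l)) o Assoc C (cobj ?K i) (cobj ?L j) (cobj ?M l)"
      using assoc_nat[of "ein X i" "ein Y j" "ein Z l" X Y Z] X Y Z by simp
    finally have L: "ein ?W r o (rmap ?V ?W ?a r o (mu (X \<boxtimes> Y) Z r o (?c o (?t o ?s)))) =
      (ein X i \<star> (ein Y j \<star> ein Z l)) o Assoc C (cobj ?K i) (cobj ?L j) (cobj ?M l)" .
    let ?b = "Assoc C (cobj ?K i) (cobj ?L j) (cobj ?M l)" and ?u = "Id C (cobj ?K i) \<star> tin ?L ?M j l"
    have ub: "ar C (?u o ?b) ?S (cobj ?K i \<boxtimes> cobj (?L \<otimes> ?M) (j + l))" using b by simp
    have 2: "?d o (?A o (?t o ?s)) = tin ?K (R (Y \<boxtimes> Z)) i (j + l) o ((Id C (cobj ?K i) \<star> mu Y Z (j + l)) o (?u o ?b))"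
      unfolding A(2)[OF r] using D2[OF r ub] by (simp add: chain_id_def)
    have "ein ?W r o (mu X (Y \<boxtimes> Z) r o (?d o (?A o (?t o ?s)))) =
        (ein X i \<star> ein (Y \<boxtimes> Z) (j + l)) o ((Id C (cobj ?K i) \<star> mu Y Z (j + l)) o (?u o ?b))"
      unfolding 2 by (subst ein_mu[OF X YZ r]) (use X Y Z b in auto)
    also have "\<dots> = (ein X i \<star> (ein (Y \<boxtimes> Z) (j + l) o (mu Y Z (j + l) o (tin ?L ?M j l o Id C (cobj ?L j \<boxtimes> cobj ?M l))))) o ?b"
      using X Y Z b by (simp add: tensor_comp tensor_comp_assoc)
    also have "\<dots> = (ein X i \<star> (ein Y j \<star> ein Z l)) o ?b"
      by (subst ein_mu[OF Y Z HOL.refl]) (use Y Z in auto)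
    finally have "ein ?W r o (mu X (Y \<boxtimes> Z) r o (?d o (?A o (?t o ?s)))) = (ein X i \<star> (ein Y j \<star> ein Z l)) o ?b" .
    note E = HOL.trans[OF L this[symmetric]]
    have "rmap ?V ?W ?a r o (mu (X \<boxtimes> Y) Z r o (?c o (?t o ?s))) = mu X (Y \<boxtimes> Z) r o (?d o (?A o (?t o ?s)))"
      by (rule ein_cancel[of ?W _ ?S r, OF _ _ _ E]) (use X Y Z a C1 D1 A(1)[of r] t s in simp_all)
    then show "(rmap ?V ?W ?a r o (mu (X \<boxtimes> Y) Z r o ?c)) o ?t o ?s = (mu X (Y \<boxtimes> Z) r o (?d o ?A)) o ?t o ?s"
      using X Y Z a C1 D1 A(1)[of r] t s by simp
  qed (use X Y Z a C1 D1 A(1)[of r] in auto)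
  then show "ccomp (rmap ?V ?W ?a) (ccomp (mu (X \<boxtimes> Y) Z)
      (ctens (?K \<otimes> ?L) ?M (R (X \<boxtimes> Y)) ?M (mu X Y) (cid ?M))) r =
    ccomp (mu X (Y \<boxtimes> Z)) (chain_comp C
      (ctens ?K (?L \<otimes> ?M) ?K (R (Y \<boxtimes> Z)) (cid ?K) (mu Y Z)) (cplx_assoc C ?K ?L ?M)) r"
    by (simp add: chain_comp_def)
qed

end

lemma (in linear_category) direct_summand_self:
  assumes Z: "zero_obj C Z" and K: "K \<in> Obj C"
  shows "direct_summand C K K"
proof -
  have Zo: "Z \<in> Obj C" "Id C Z = zer Z Z" using Z zero_obj_iff by auto
  let ?i = "\<lambda>b. if b then Id C K else zer Z K" and ?p = "\<lambda>b. if b then Id C K else zer K Z"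
  have "is_dsum C UNIV (\<lambda>b. if b then K else Z) K ?i ?p"
  proof (rule is_dsumI)
    fix f g assume fg: "ar C f K K" "ar C g K K" "\<And>a. a \<in> UNIV \<Longrightarrow> f o ?i a = g o ?i a"
    show "f = g" using fg(3)[of True] fg(1,2) by simp
  qed (use K Zo in auto)
  then show ?thesis unfolding direct_summand_def by blast
qed

lemma (in linear_monoidal_category) iso_pair_tensor:
  assumes "iso_pair f g X Y" "iso_pair f' g' X' Y'"
  shows "iso_pair (f \<star> f') (g \<star> g') (X \<boxtimes> X') (Y \<boxtimes> Y')"
  using iso_pairD(1-4)[OF assms(1)] iso_pairD(1-4)[OF assms(2)] by (simp add: iso_pair_def tensor_comp)

lemma full_subcategory_is_iso:
  assumes "is_iso D f" "Dom D f \<in> A" "Cod D f \<in> A"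
  shows "is_iso (D\<lparr>Obj := A\<rparr>) f"
proof -
  obtain g where g: "inverse_arrows D f g" using assms(1) unfolding is_iso_def by blast
  have "inverse_arrows (D\<lparr>Obj := A\<rparr>) f g"
    using g assms(2,3) unfolding inverse_arrows_def arrow_def by auto
  then show ?thesis unfolding is_iso_def by blast
qed

text \<open>The axioms are statements about given objects and restrict to \<open>A\<close>. Only
  \<open>is_iso\<close> depends on the class of objects, and an inverse stays available because its
  end points are those of the arrow.\<close>

lemma full_subcategory_monoidal:
  assumes "linear_monoidal_category k D" and sub: "A \<subseteq> Obj D" and unit: "TUnit D \<in> A"
    and tensor: "\<And>X Y. \<lbrakk>X \<in> A; Y \<in> A\<rbrakk> \<Longrightarrow> X \<boxtimes>\<^bsub>D\<^esub> Y \<in> A"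
  shows "linear_monoidal_category k (D\<lparr>Obj := A\<rparr>)"
proof -
  interpret D: linear_monoidal_category k D by fact
  have sub: "X \<in> A \<Longrightarrow> X \<in> Obj D" for X using sub by blast
  have i: "is_iso (D\<lparr>Obj := A\<rparr>) f" if "is_iso D f" "f \<in> homs D X Y" "X \<in> A" "Y \<in> A" for f X Y
    by (rule full_subcategory_is_iso) (use that D.dom_cod[of X Y f] sub in auto)
  note rules = D.dom_cod D.hom_module D.id_hom D.comp_hom D.id_left D.id_right D.comp_assoc D.comp_add_left
    D.comp_add_right D.comp_smult_left D.comp_smult_right D.tarr D.tarr_id D.tarr_comp D.tarr_add_left D.tarr_add_right
    D.tarr_smult_left D.tarr_smult_right D.assoc_hom D.assoc_natural D.lunit_hom D.lunit_natural D.runit_hom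
    D.runit_natural D.pentagon D.triangle
  show ?thesis
    by (intro linear_monoidal_category.intro linear_category.intro linear_monoidal_category_axioms.intro;
        simp add: D.field_k;
        ((rule rules; blast intro: sub) | (rule i[OF D.assoc_iso D.assoc_hom]; blast intro: sub unit tensor)
          | (rule i[OF D.lunit_iso D.lunit_hom]; blast intro: sub unit tensor)
          | (rule i[OF D.runit_iso D.runit_hom]; blast intro: sub unit tensor) | (rule unit) | (rule tensor; assumption)))
qed

section \<open>The unit comparison and the heart\<close>

context graded_tensor_category
begin

abbreviation scplx where "scplx S \<equiv> shift C (wt S) (stalk C S)"

lemma zdiff_scplx: assumes S: "S \<in> Obj C" shows "zdiff (scplx S)"
proof -
  have "{i. \<not> zero_obj C (cobj (scplx S) i)} \<subseteq> {- wt S}" by (auto simp: shift_def)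
  then have "finite {i. \<not> zero_obj C (cobj (scplx S) i)}" using finite_subset by blast
  then show ?thesis unfolding zdiff_def using shift_stalk_cdiff[OF S] S
    by (intro conjI allI bounded_zero_diff) (auto simp: shift_def)
qed

text \<open>A simple object has a single weight, so \<open>R S\<close> is concentrated in degree
  \<open>- wt S\<close>, where its term is all of \<open>S\<close>.\<close>

lemma simple_ein:
  assumes S: "simple_obj C S"
  shows "i \<noteq> - wt S \<Longrightarrow> ein S i = zer (cobj (R S) i) S"
    "i \<noteq> - wt S \<Longrightarrow> zero_obj C (cobj (R S) i)"
    "ein S (- wt S) o qpr S (- wt S) = Id C S"
proof -
  have o: "S \<in> Obj C" using simple_Obj[OF S] .
  show z: "ein S i = zer (cobj (R S) i) S" if "i \<noteq> - wt S" for i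
    by (rule grade_hom_zero[OF R_grade[OF o] simple_grade[OF S]]) (use o that in auto)
  show "zero_obj C (cobj (R S) i)" if "i \<noteq> - wt S"
    using ein_simps(7)[OF o, of i] z[OF that] o by (intro zero_objI) simp_all
  let ?w = "- wt S"
  show "ein S ?w o qpr S ?w = Id C S"
  proof (rule dsum_epi[OF R_dsum[OF o]])
    fix i show "(ein S ?w o qpr S ?w) o ein S i = Id C S o ein S i"
      using z[of i] o by (cases "i = ?w") simp_all
  qed (use o in simp_all)
qed

text \<open>Compares a generator of the heart with the corresponding value of the functor; the two
  have isomorphic but differently chosen terms.\<close>

definition stalk_in where
  "stalk_in S i = (if i = - wt S then qpr S i else zer (the_zero C) (cobj (R S) i))"

lemma stalk_in_iso:
  assumes S: "simple_obj C S"
  shows "chm (scplx S) (R S) (stalk_in S)" "is_iso (Db C) (chain_class C (scplx S) (R S) (stalk_in S))"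
proof -
  have o: "S \<in> Obj C" using simple_Obj[OF S] .
  let ?g = "\<lambda>i. if i = - wt S then ein S i else zer (cobj (R S) i) (the_zero C)"
  have K: "cobj (scplx S) i = (if i = - wt S then S else the_zero C)" for i by (auto simp: shift_def)
  show c: "chm (scplx S) (R S) (stalk_in S)"
    by (rule chm_zdiff[OF zdiff_scplx[OF o] zdiff_R[OF o]]) (use o in \<open>auto simp: K stalk_in_def\<close>)
  have z: "Id C (the_zero C) = zer (the_zero C) (the_zero C)" using zero_obj_the_zero zero_obj_iff by blast
  have zR: "Id C (cobj (R S) i) = zer (cobj (R S) i) (cobj (R S) i)" if "i \<noteq> - wt S" for i
    using simple_ein(2)[OF S that] zero_obj_iff by blast
  have "chm (R S) (scplx S) ?g" "ccomp ?g (stalk_in S) = cid (scplx S)"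
    "ccomp (stalk_in S) ?g = cid (R S)"
    by (rule chm_inverse[OF c]; use o simple_ein(3)[OF S] zR in \<open>auto simp: K stalk_in_def z\<close>)+
  then show "is_iso (Db C) (chain_class C (scplx S) (R S) (stalk_in S))" using Db_is_iso[OF c] by blast
qed

text \<open>Weight 0 makes both the shift and its sign trivial, so the complexes are equal as
  records and \<open>stalk_in\<close> at the unit can serve as the unit comparison.\<close>

lemma scplx_unit: "scplx (TUnit C) = \<one>\<^sub>c"
  by (rule cplx.equality) (simp_all add: weight_unit shift_def sgn_arr_def fun_eq_iff)

abbreviation eps where "eps \<equiv> stalk_in (TUnit C)"

lemmas eps_iso = stalk_in_iso[OF unit_simple, unfolded scplx_unit]

lemma eps_0: "eps 0 = qpr (TUnit C) 0" "ein (TUnit C) 0 o qpr (TUnit C) 0 = Id C (TUnit C)"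
  using simple_ein(3)[OF unit_simple] by (simp_all add: stalk_in_def weight_unit)

text \<open>After \<open>ein\<close>, the degree 0 inclusion of the unit cancels against
  \<open>eps\<close> by \<open>eps_0\<close>, and naturality of the left unitor for
  \<open>ein X r\<close> remains.\<close>

lemma mu_lunit:
  assumes X: "X \<in> Obj C"
  shows "ccomp (rmap (TUnit C \<boxtimes> X) X (LUnit C X)) (ccomp (mu (TUnit C) X)
    (ctens \<one>\<^sub>c (R X) (R (TUnit C)) (R X) eps (cid (R X)))) = cplx_lunit C (R X)"
proof
  fix r
  note b = bounded_R[OF X]
  let ?I = "TUnit C"
  let ?c = "ctens \<one>\<^sub>c (R X) (R ?I) (R X) eps (cid (R X)) r"
  note ct = chain_tensor_tin[OF eps_iso(1) chm_id[OF b], of r]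
  have l: "ar C (LUnit C X) (?I \<boxtimes> X) X" using X by simp
  let ?u = "qpr ?I 0 \<star> Id C (cobj (R X) r)"
  have u: "ar C ?u (?I \<boxtimes> cobj (R X) r) (cobj (R ?I) 0 \<boxtimes> cobj (R X) r)" using X by simp
  have t: "ar C (tin \<one>\<^sub>c (R X) 0 r) (?I \<boxtimes> cobj (R X) r) (cobj (\<one>\<^sub>c \<otimes> R X) r)"
    using tin_ar(1)[of "\<one>\<^sub>c" "R X" 0 r] b by simp
  have 1: "?c o tin \<one>\<^sub>c (R X) 0 r = tin (R ?I) (R X) 0 r o ?u" using ct(2)[of 0 r] by (simp add: chain_id_def eps_0)
  note L = cplx_lunit_tin[OF b, of r]
  have "rmap (?I \<boxtimes> X) X (LUnit C X) r o (mu ?I X r o ?c) = cplx_lunit C (R X) r"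
  proof (rule lunit_tin_epi[OF b, where Z = "cobj (R X) r"])
    have "ein X r o (rmap (?I \<boxtimes> X) X (LUnit C X) r o (mu ?I X r o (?c o tin \<one>\<^sub>c (R X) 0 r))) =
      (ein X r o rmap (?I \<boxtimes> X) X (LUnit C X) r) o (mu ?I X r o (?c o tin \<one>\<^sub>c (R X) 0 r))"
      using X l ct(1) t by simp
    also have "\<dots> = LUnit C X o (ein (?I \<boxtimes> X) r o (mu ?I X r o (?c o tin \<one>\<^sub>c (R X) 0 r)))"
      unfolding ein_rmap[OF l] using X ct(1) t by simp
    also have "\<dots> = LUnit C X o ((ein ?I 0 \<star> ein X r) o ?u)"
      unfolding 1 by (subst ein_mu[OF unit_Obj X _ u]) simp_all
    also have "\<dots> = ein X r o LUnit C (cobj (R X) r)"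
      using X lunit_nat[of "ein X r" X] by (simp add: tensor_comp eps_0)
    finally have "ein X r o (rmap (?I \<boxtimes> X) X (LUnit C X) r o (mu ?I X r o (?c o tin \<one>\<^sub>c (R X) 0 r))) =
      ein X r o LUnit C (cobj (R X) r)" .
    note E = this
    have "rmap (?I \<boxtimes> X) X (LUnit C X) r o (mu ?I X r o (?c o tin \<one>\<^sub>c (R X) 0 r)) = LUnit C (cobj (R X) r)"
      by (rule ein_cancel[OF X _ _ E, where W = "?I \<boxtimes> cobj (R X) r"]) (use X l ct(1) t in simp_all)
    then show "(rmap (?I \<boxtimes> X) X (LUnit C X) r o (mu ?I X r o ?c)) o tin \<one>\<^sub>c (R X) 0 r = cplx_lunit C (R X) r o tin \<one>\<^sub>c (R X) 0 r"
      unfolding L(2) using X l ct(1) t by simp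
  qed (use X l ct(1) L(1) in simp_all)
  then show "ccomp (rmap (?I \<boxtimes> X) X (LUnit C X)) (ccomp (mu ?I X)
    (ctens \<one>\<^sub>c (R X) (R ?I) (R X) eps (cid (R X)))) r = cplx_lunit C (R X) r" by (simp add: chain_comp_def)
qed

lemma mu_runit:
  assumes X: "X \<in> Obj C"
  shows "ccomp (rmap (X \<boxtimes> TUnit C) X (RUnit C X)) (ccomp (mu X (TUnit C))
    (ctens (R X) \<one>\<^sub>c (R X) (R (TUnit C)) (cid (R X)) eps)) = cplx_runit C (R X)"
proof
  fix r
  note b = bounded_R[OF X]
  let ?I = "TUnit C"
  let ?c = "ctens (R X) \<one>\<^sub>c (R X) (R ?I) (cid (R X)) eps r"
  note ct = chain_tensor_tin[OF chm_id[OF b] eps_iso(1), of r]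
  have l: "ar C (RUnit C X) (X \<boxtimes> ?I) X" using X by simp
  let ?u = "Id C (cobj (R X) r) \<star> qpr ?I 0"
  have u: "ar C ?u (cobj (R X) r \<boxtimes> ?I) (cobj (R X) r \<boxtimes> cobj (R ?I) 0)" using X by simp
  have t: "ar C (tin (R X) \<one>\<^sub>c r 0) (cobj (R X) r \<boxtimes> ?I) (cobj (R X \<otimes> \<one>\<^sub>c) r)"
    using tin_ar(1)[of "R X" "\<one>\<^sub>c" r 0] b by simp
  have 1: "?c o tin (R X) \<one>\<^sub>c r 0 = tin (R X) (R ?I) r 0 o ?u" using ct(2)[of r 0] by (simp add: chain_id_def eps_0)
  note L = cplx_runit_tin[OF b, of r]
  have "rmap (X \<boxtimes> ?I) X (RUnit C X) r o (mu X ?I r o ?c) = cplx_runit C (R X) r"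
  proof (rule runit_tin_epi[OF b, where Z = "cobj (R X) r"])
    have "ein X r o (rmap (X \<boxtimes> ?I) X (RUnit C X) r o (mu X ?I r o (?c o tin (R X) \<one>\<^sub>c r 0))) =
      (ein X r o rmap (X \<boxtimes> ?I) X (RUnit C X) r) o (mu X ?I r o (?c o tin (R X) \<one>\<^sub>c r 0))"
      using X l ct(1) t by simp
    also have "\<dots> = RUnit C X o (ein (X \<boxtimes> ?I) r o (mu X ?I r o (?c o tin (R X) \<one>\<^sub>c r 0)))"
      unfolding ein_rmap[OF l] using X ct(1) t by simp
    also have "\<dots> = RUnit C X o ((ein X r \<star> ein ?I 0) o ?u)"
      unfolding 1 by (subst ein_mu[OF X unit_Obj _ u]) simp_all
    also have "\<dots> = ein X r o RUnit C (cobj (R X) r)"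
      using X runit_nat[of "ein X r" X] by (simp add: tensor_comp eps_0)
    finally have "ein X r o (rmap (X \<boxtimes> ?I) X (RUnit C X) r o (mu X ?I r o (?c o tin (R X) \<one>\<^sub>c r 0))) =
      ein X r o RUnit C (cobj (R X) r)" .
    note E = this
    have "rmap (X \<boxtimes> ?I) X (RUnit C X) r o (mu X ?I r o (?c o tin (R X) \<one>\<^sub>c r 0)) = RUnit C (cobj (R X) r)"
      by (rule ein_cancel[OF X _ _ E, where W = "cobj (R X) r \<boxtimes> ?I"]) (use X l ct(1) t in simp_all)
    then show "(rmap (X \<boxtimes> ?I) X (RUnit C X) r o (mu X ?I r o ?c)) o tin (R X) \<one>\<^sub>c r 0 = cplx_runit C (R X) r o tin (R X) \<one>\<^sub>c r 0"
      unfolding L(2) using X l ct(1) t by simp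
  qed (use X l ct(1) L(1) in simp_all)
  then show "ccomp (rmap (X \<boxtimes> ?I) X (RUnit C X)) (ccomp (mu X ?I)
    (ctens (R X) \<one>\<^sub>c (R X) (R ?I) (cid (R X)) eps)) r = cplx_runit C (R X) r" by (simp add: chain_comp_def)
qed

abbreviation muD where "muD X Y \<equiv> chain_class C (R X \<otimes> R Y) (R (X \<boxtimes> Y)) (mu X Y)"
abbreviation epsD where "epsD \<equiv> chain_class C \<one>\<^sub>c (R (TUnit C)) eps"

lemma R_monoidal: "strong_monoidal_structure C (Db C) (R_functor C \<chi>) muD epsD"
  unfolding strong_monoidal_structure_def R_FObj
proof (intro conjI ballI)
  show "epsD \<in> homs (Db C) (TUnit (Db C)) (R (TUnit C))" using Db_hom[OF eps_iso(1)] by simp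
  show "is_iso (Db C) epsD" by (rule eps_iso(2))
  fix X assume X: "X \<in> Obj C"
  note b = bounded_R[OF X] and u = bounded_R[OF unit_Obj]
  have l: "ar C (LUnit C X) (TUnit C \<boxtimes> X) X" and r: "ar C (RUnit C X) (X \<boxtimes> TUnit C) X" using X by simp_all
  note cl = chm_tensor[OF eps_iso(1) chm_id[OF b]] and cr = chm_tensor[OF chm_id[OF b] eps_iso(1)]
  note ml = chm_mu[OF unit_Obj X] and mr = chm_mu[OF X unit_Obj]
  show "FArr (R_functor C \<chi>) (LUnit C X) o\<^bsub>Db C\<^esub> muD (TUnit C) X o\<^bsub>Db C\<^esub> (epsD \<star>\<^bsub>Db C\<^esub> Id (Db C) (R X)) = LUnit (Db C) (R X)"
    unfolding R_FArr[OF l] Db_simps roof_tensor_chain_class[OF eps_iso(1) chm_id[OF b]] roof_comp_chain_class[OF cl ml]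
      roof_comp_chain_class[OF chm_comp[OF cl ml] chm_rmap[OF l]] mu_lunit[OF X] ..
  show "FArr (R_functor C \<chi>) (RUnit C X) o\<^bsub>Db C\<^esub> muD X (TUnit C) o\<^bsub>Db C\<^esub> (Id (Db C) (R X) \<star>\<^bsub>Db C\<^esub> epsD) = RUnit (Db C) (R X)"
    unfolding R_FArr[OF r] Db_simps roof_tensor_chain_class[OF chm_id[OF b] eps_iso(1)] roof_comp_chain_class[OF cr mr]
      roof_comp_chain_class[OF chm_comp[OF cr mr] chm_rmap[OF r]] mu_runit[OF X] ..
  fix Y assume Y: "Y \<in> Obj C"
  show "muD X Y \<in> homs (Db C) (R X \<boxtimes>\<^bsub>Db C\<^esub> R Y) (R (X \<boxtimes> Y))" using Db_hom[OF chm_mu[OF X Y]] by simp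
  show "is_iso (Db C) (muD X Y)" by (rule mu_iso[OF X Y])
  fix Z assume Z: "Z \<in> Obj C"
  have a: "ar C (Assoc C X Y Z) ((X \<boxtimes> Y) \<boxtimes> Z) (X \<boxtimes> (Y \<boxtimes> Z))" using X Y Z by simp
  note bb = bounded_R[OF X] bounded_R[OF Y] bounded_R[OF Z]
  note m = chm_mu[OF X Y] chm_mu[OF Y Z] chm_mu[OF tensor_Obj[OF X Y] Z] chm_mu[OF X tensor_Obj[OF Y Z]]
  note t1 = chm_tensor[OF m(1) chm_id[OF bb(3)]] and t2 = chm_tensor[OF chm_id[OF bb(1)] m(2)] and A = chm_cplx_assoc[OF bb]
  show "FArr (R_functor C \<chi>) (Assoc C X Y Z) o\<^bsub>Db C\<^esub> muD (X \<boxtimes> Y) Z o\<^bsub>Db C\<^esub> (muD X Y \<star>\<^bsub>Db C\<^esub> Id (Db C) (R Z)) =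
      muD X (Y \<boxtimes> Z) o\<^bsub>Db C\<^esub> (Id (Db C) (R X) \<star>\<^bsub>Db C\<^esub> muD Y Z) o\<^bsub>Db C\<^esub> Assoc (Db C) (R X) (R Y) (R Z)"
    unfolding R_FArr[OF a] Db_simps roof_tensor_chain_class[OF m(1) chm_id[OF bb(3)]] roof_tensor_chain_class[OF chm_id[OF bb(1)] m(2)]
      roof_comp_chain_class[OF t1 m(3)] roof_comp_chain_class[OF chm_comp[OF t1 m(3)] chm_rmap[OF a]]
      roof_comp_chain_class[OF A t2] roof_comp_chain_class[OF chm_comp[OF A t2] m(4)] mu_assoc[OF X Y Z] ..
next
  fix X X' Y Y' f g assume "X \<in> Obj C" "X' \<in> Obj C" "Y \<in> Obj C" "Y' \<in> Obj C" "f \<in> homs C X X'" "g \<in> homs C Y Y'"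
  then have f: "ar C f X X'" and g: "ar C g Y Y'" using homs_iff by blast+
  then have o: "X \<in> Obj C" "X' \<in> Obj C" "Y \<in> Obj C" "Y' \<in> Obj C" and fg: "ar C (f \<star> g) (X \<boxtimes> Y) (X' \<boxtimes> Y')" by simp_all
  note c = chm_rmap[OF f] chm_rmap[OF g]
  show "muD X' Y' o\<^bsub>Db C\<^esub> (FArr (R_functor C \<chi>) f \<star>\<^bsub>Db C\<^esub> FArr (R_functor C \<chi>) g) =
      FArr (R_functor C \<chi>) (f \<star> g) o\<^bsub>Db C\<^esub> muD X Y"
    unfolding R_FArr[OF f] R_FArr[OF g] R_FArr[OF fg] Db_simps roof_tensor_chain_class[OF c]
      roof_comp_chain_class[OF chm_tensor[OF c] chm_mu[OF o(2,4)]] roof_comp_chain_class[OF chm_mu[OF o(1,3)] chm_rmap[OF fg]]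
      mu_natural[OF f g] ..
qed

text \<open>Objects of the heart are direct summands of sums of shifted stalks, hence retracts of
  some \<open>R Y\<close>; the idempotent that cuts out such a retract already splits in C.
  Conversely, a decomposition of \<open>X\<close> into simple objects decomposes \<open>R X\<close>
  into generators.\<close>

lemma heart_Obj: "Obj (heart C \<chi>) = {K. bdd K \<and> (\<exists>X \<in> Obj C. isomorphic (Db C) (R X) K)}"
proof -
  interpret F: full_functor k C "Db C" "R_functor C \<chi>" by (rule R_full_functor)
  have stalk_pair: "\<exists>c c'. F.D.iso_pair c c' (scplx S) (R S)" if S: "simple_obj C S" for S
    using F.D.iso_pair_iso[OF stalk_in_iso(2)[OF S] Db_ar[OF stalk_in_iso(1)[OF S]]] by blast
  let ?S = "{scplx S | S. simple_obj C S}"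
  have obj: "Obj (heart C \<chi>) = add_closure (Db C) ?S" by (simp add: heart_def)
  show ?thesis unfolding obj
  proof (intro equalityI subsetI CollectI conjI)
    fix K assume "K \<in> add_closure (Db C) ?S"
    then obtain B where K: "K \<in> Obj (Db C)" "direct_summand (Db C) K B" and "B \<in> finite_dsums (Db C) ?S"
      unfolding add_closure_def by blast
    then obtain n T i p where T: "\<forall>j < n. T j \<in> ?S" and dB: "is_dsum (Db C) {..<n::nat} T B i p"
      unfolding finite_dsums_def by blast
    show "bdd K" using K(1) by simp
    have "\<forall>j. \<exists>S. j < n \<longrightarrow> simple_obj C S \<and> T j = scplx S" using T by blast
    then obtain S where S: "\<And>j. j < n \<Longrightarrow> simple_obj C (S j) \<and> T j = scplx (S j)" by metis
    have "\<forall>j. \<exists>c c'. j < n \<longrightarrow> F.D.iso_pair c c' (T j) (R (S j))" using S stalk_pair by metis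
    then obtain c c' where c: "\<And>j. j \<in> {..<n} \<Longrightarrow> F.D.iso_pair (c j) (c' j) (T j) (R (S j))" by (metis lessThan_iff)
    obtain Y \<iota> \<pi> where dY: "is_dsum C {..<n} S Y \<iota> \<pi>"
      using dsum_exists[of "{..<n}" "{..<n}" S] S simple_Obj by auto
    have Y: "Y \<in> Obj C" using is_dsumD(1)[OF dY] .
    obtain f g where fg: "F.D.iso_pair f g B (R Y)"
      by (rule F.D.dsum_isomorphic[OF dB F.F_dsum[OF dY]]) (use c in auto)
    note P = F.D.iso_pairD[OF fg]
    obtain Z' i' p' where dK: "is_dsum (Db C) (UNIV :: bool set) (\<lambda>b. if b then K else Z') B i' p'"
      using K(2) unfolding direct_summand_def by blast
    let ?u = "i' True" and ?v = "p' True"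
    have uv: "ar (Db C) ?u K B" "ar (Db C) ?v B K" "?v o\<^bsub>Db C\<^esub> ?u = Id (Db C) K"
      using F.D.is_dsumD(2,3,5)[OF dK, of True] by (simp_all del: Db_simps)
    \<comment> \<open>Section and retraction that present \<open>K\<close> as a retract of
      \<open>R Y\<close>, obtained from those for \<open>B\<close> by the isomorphism of
      \<open>B\<close> with \<open>R Y\<close>.\<close>
    define a where "a = f o\<^bsub>Db C\<^esub> ?u"
    define b where "b = ?v o\<^bsub>Db C\<^esub> g"
    have a: "ar (Db C) a K (R Y)" and b: "ar (Db C) b (R Y) K" using P(1,2) uv by (simp_all add: a_def b_def del: Db_simps)
    have ba: "b o\<^bsub>Db C\<^esub> a = Id (Db C) K"
      unfolding a_def b_def using P(1,2) P(8)[OF uv(1)] uv by (simp del: Db_simps)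
    have baa: "b o\<^bsub>Db C\<^esub> (a o\<^bsub>Db C\<^esub> x) = x" if "ar (Db C) x W K" for x W
      using F.D.comp_eq_reassoc1[OF ba, of x] a b that by (simp del: Db_simps)
    \<comment> \<open>The idempotent a b of \<open>R Y\<close> lifts by fullness, and its lift is
      idempotent by faithfulness, so that it can be split in C.\<close>
    obtain e where e: "ar C e Y Y" "F.FA e = a o\<^bsub>Db C\<^esub> b"
      by (rule F.FA_full[of "a o\<^bsub>Db C\<^esub> b" Y Y]) (use a b Y in \<open>simp_all del: Db_simps\<close>)
    have "F.FA (e o e) = F.FA e"
      using F.FA_comp[of e e] e a b baa[OF b] by (simp del: Db_simps)
    then have "e o e = e" by (intro F.FA_faithful[of "e o e" Y Y e]) (use e in simp_all)
    then obtain X m u where X: "ar C m X Y" "ar C u Y X" "u o m = Id C X" "m o u = e"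
      by (rule idempotent_split[OF e(1)])
    have Fu: "F.FA u o\<^bsub>Db C\<^esub> F.FA m = Id (Db C) (R X)" "F.FA m o\<^bsub>Db C\<^esub> F.FA u = a o\<^bsub>Db C\<^esub> b"
      using F.FA_comp[of m u] F.FA_comp[of u m] X e by (simp_all del: Db_simps F.FA_comp)
    have Fa: "ar (Db C) (F.FA m) (R X) (R Y)" "ar (Db C) (F.FA u) (R Y) (R X)"
      using F.FA_ar[of m] F.FA_ar[of u] X(1,2) by (simp_all del: Db_simps)
    have um: "F.FA u o\<^bsub>Db C\<^esub> (F.FA m o\<^bsub>Db C\<^esub> x) = x" if "ar (Db C) x W (R X)" for x W
      using F.D.comp_eq_reassoc1[OF Fu(1), of x] Fa that by (simp del: Db_simps)
    \<comment> \<open>\<open>K\<close> and \<open>R X\<close> split the same idempotent of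
      \<open>R Y\<close>; the section of one followed by the retraction of the other gives mutually
      inverse arrows.\<close>
    have "F.D.iso_pair (b o\<^bsub>Db C\<^esub> F.FA m) (F.FA u o\<^bsub>Db C\<^esub> a) (R X) K"
      unfolding F.D.iso_pair_def
    proof (intro conjI)
      have "(F.FA u o\<^bsub>Db C\<^esub> a) o\<^bsub>Db C\<^esub> (b o\<^bsub>Db C\<^esub> F.FA m) = F.FA u o\<^bsub>Db C\<^esub> ((a o\<^bsub>Db C\<^esub> b) o\<^bsub>Db C\<^esub> F.FA m)"
        using Fa a b by (simp del: Db_simps)
      also have "\<dots> = Id (Db C) (R X)"
        unfolding Fu(2)[symmetric] using Fa um[of "F.FA u o\<^bsub>Db C\<^esub> F.FA m" "R X"] Fu(1) by (simp del: Db_simps)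
      finally show "(F.FA u o\<^bsub>Db C\<^esub> a) o\<^bsub>Db C\<^esub> (b o\<^bsub>Db C\<^esub> F.FA m) = Id (Db C) (R X)" .
      have "(b o\<^bsub>Db C\<^esub> F.FA m) o\<^bsub>Db C\<^esub> (F.FA u o\<^bsub>Db C\<^esub> a) = b o\<^bsub>Db C\<^esub> ((F.FA m o\<^bsub>Db C\<^esub> F.FA u) o\<^bsub>Db C\<^esub> a)"
        using Fa a b by (simp del: Db_simps)
      also have "\<dots> = Id (Db C) K" unfolding Fu(2) using a b ba baa[of "b o\<^bsub>Db C\<^esub> a" K] by (simp del: Db_simps)
      finally show "(b o\<^bsub>Db C\<^esub> F.FA m) o\<^bsub>Db C\<^esub> (F.FA u o\<^bsub>Db C\<^esub> a) = Id (Db C) K" .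
    qed (use Fa a b in \<open>simp_all del: Db_simps\<close>)
    then have "isomorphic (Db C) (R X) K" using F.D.isomorphicI F.D.iso_pairD(1,5) by blast
    then show "\<exists>X \<in> Obj C. isomorphic (Db C) (R X) K" using X(1) by blast
  next
    fix K assume "K \<in> {K. bdd K \<and> (\<exists>X \<in> Obj C. isomorphic (Db C) (R X) K)}"
    then obtain X a a' where X: "X \<in> Obj C" and a: "F.D.iso_pair a a' (R X) K" using F.D.iso_pair_isomorphic by blast
    obtain n S i p where S: "\<And>j. j < n \<Longrightarrow> simple_obj C (S j)" and d: "is_dsum C {..<n::nat} S X i p"
      by (rule simple_dsum[OF X]) blast
    have "\<forall>j. \<exists>c c'. j < n \<longrightarrow> F.D.iso_pair c c' (scplx (S j)) (R (S j))" using S stalk_pair by metis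
    then obtain c c' where c: "\<And>j. j < n \<Longrightarrow> F.D.iso_pair (c j) (c' j) (scplx (S j)) (R (S j))" by metis
    \<comment> \<open>The functor preserves the decomposition of \<open>X\<close>, and
      \<open>dsum_iso\<close> exchanges each value at a simple object for the isomorphic shifted
      stalk and \<open>R X\<close> for \<open>K\<close>.\<close>
    have "K \<in> finite_dsums (Db C) ?S"
    proof (rule F.D.finite_dsumsI)
      show "is_dsum (Db C) {..<n} (\<lambda>j. scplx (S j)) K (\<lambda>j. a o\<^bsub>Db C\<^esub> F.FA (i j) o\<^bsub>Db C\<^esub> c j) (\<lambda>j. c' j o\<^bsub>Db C\<^esub> F.FA (p j) o\<^bsub>Db C\<^esub> a')"
      by (rule F.D.dsum_iso[OF F.F_dsum[OF d], of c' c], rule F.D.iso_pairD(7)) (use c a in auto)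
    qed (use S in auto)
    moreover have "K \<in> Obj (Db C)" using F.D.iso_pairD(1)[OF a] by blast
    moreover have "direct_summand (Db C) K K"
      by (rule F.D.direct_summand_self[OF F.F_zero_obj[OF zero_obj_the_zero] \<open>K \<in> Obj (Db C)\<close>])
    ultimately show "K \<in> add_closure (Db C) ?S" unfolding add_closure_def by blast
  qed
qed

lemma heart_eq: "heart C \<chi> = Db C\<lparr>Obj := Obj (heart C \<chi>)\<rparr>"
  by (simp add: heart_def)

lemma R_heart: assumes "X \<in> Obj C" shows "R X \<in> Obj (heart C \<chi>)"
proof -
  interpret D: linear_category k "Db C" by (rule Db_linear_category)
  have "isomorphic (Db C) (R X) (R X)"
    using assms D.isomorphicI[OF D.Id_ar D.is_iso_Id, of "R X"] by (simp del: Db_simps(5))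
  then show ?thesis using assms by (auto simp: heart_Obj)
qed

text \<open>Closure under the tensor product comes from \<open>mu\<close>: up to isomorphism
  \<open>K\<close> and \<open>L\<close> are values of the functor, and so is their product. Closure
  under the unit comes from the unit comparison.\<close>

lemma heart_monoidal: "linear_monoidal_category k (heart C \<chi>)"
proof (subst heart_eq, rule full_subcategory_monoidal[OF Db_monoidal])
  interpret D: linear_monoidal_category k "Db C" by (rule Db_monoidal)
  show "Obj (heart C \<chi>) \<subseteq> Obj (Db C)" by (auto simp: heart_Obj)
  have "isomorphic (Db C) (R (TUnit C)) \<one>\<^sub>c"
    using D.isomorphic_sym[OF D.isomorphicI[OF Db_ar[OF eps_iso(1)] eps_iso(2)]] .
  then show "TUnit (Db C) \<in> Obj (heart C \<chi>)" using unit_Obj by (auto simp: heart_Obj)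
  fix K L assume "K \<in> Obj (heart C \<chi>)" "L \<in> Obj (heart C \<chi>)"
  then obtain X Y where X: "X \<in> Obj C" "isomorphic (Db C) (R X) K" and Y: "Y \<in> Obj C" "isomorphic (Db C) (R Y) L"
    and b: "bdd K" "bdd L" by (auto simp: heart_Obj)
  obtain f f' where f: "D.iso_pair f f' (R X) K" using D.iso_pair_isomorphic X(2) by blast
  obtain g g' where g: "D.iso_pair g g' (R Y) L" using D.iso_pair_isomorphic Y(2) by blast
  have 1: "isomorphic (Db C) (R X \<otimes> R Y) (K \<otimes> L)"
    using D.iso_pairD(1,5)[OF D.iso_pair_tensor[OF f g]] D.isomorphicI by (metis Db_simps(7))
  have 2: "isomorphic (Db C) (R X \<otimes> R Y) (R (X \<boxtimes> Y))"
    using D.isomorphicI[OF Db_ar[OF chm_mu[OF X(1) Y(1)]] mu_iso[OF X(1) Y(1)]] .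
  have "isomorphic (Db C) (R (X \<boxtimes> Y)) (K \<otimes> L)" by (rule D.isomorphic_trans[OF D.isomorphic_sym[OF 2] 1])
  then show "K \<boxtimes>\<^bsub>Db C\<^esub> L \<in> Obj (heart C \<chi>)" using X(1) Y(1) b by (auto simp: heart_Obj)
qed

lemma heart_simps:
  "Hom (heart C \<chi>) = Hom (Db C)" "Dom (heart C \<chi>) = Dom (Db C)" "Cod (heart C \<chi>) = Cod (Db C)"
  "Id (heart C \<chi>) = Id (Db C)" "Comp (heart C \<chi>) = Comp (Db C)" "TObj (heart C \<chi>) = TObj (Db C)"
  "TArr (heart C \<chi>) = TArr (Db C)" "TUnit (heart C \<chi>) = TUnit (Db C)" "Assoc (heart C \<chi>) = Assoc (Db C)"
  "LUnit (heart C \<chi>) = LUnit (Db C)" "RUnit (heart C \<chi>) = RUnit (Db C)"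
  by (simp_all add: heart_def del: Db_simps)

lemma heart_is_iso:
  assumes "is_iso (Db C) f" "Dom (Db C) f \<in> Obj (heart C \<chi>)" "Cod (Db C) f \<in> Obj (heart C \<chi>)"
  shows "is_iso (heart C \<chi>) f"
  by (subst heart_eq, rule full_subcategory_is_iso[OF assms])

lemma R_exact_tensor_equivalence: "exact_tensor_equivalence k C (heart C \<chi>) (R_functor C \<chi>) muD epsD"
proof (rule monoidal_transport.F_exact_tensor_equivalence, rule monoidal_transport.intro)
  interpret H: linear_monoidal_category k "heart C \<chi>" by (rule heart_monoidal)
  interpret F: full_functor k C "Db C" "R_functor C \<chi>" by (rule R_full_functor)
  show "tensor_category k C" by (rule tensor_category_axioms)
  show "linear_monoidal_category k (heart C \<chi>)" by (rule heart_monoidal)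
  show "full_functor k C (heart C \<chi>) (R_functor C \<chi>)"
  proof (rule full_functor.intro[OF linear_category_axioms H.linear_category_axioms], rule full_functor_axioms.intro)
    show "linear_functor k C (heart C \<chi>) (R_functor C \<chi>)"
      using F.linear_F R_heart unfolding linear_functor_def heart_simps R_FObj by blast
    show "bij_betw (FArr (R_functor C \<chi>)) (homs C X Y) (homs (heart C \<chi>) (FObj (R_functor C \<chi>) X) (FObj (R_functor C \<chi>) Y))"
      if "X \<in> Obj C" "Y \<in> Obj C" for X Y
      unfolding heart_simps by (rule F.fully_faithful[OF that])
  qed
  show "monoidal_transport_axioms C (heart C \<chi>) (R_functor C \<chi>) muD epsD"
  proof (rule monoidal_transport_axioms.intro)
    fix K assume K: "K \<in> Obj (heart C \<chi>)"
    then obtain X f where X: "X \<in> Obj C" "f \<in> homs (Db C) (R X) K" "is_iso (Db C) f"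
      unfolding heart_Obj isomorphic_def by blast
    have "ar (Db C) f (R X) K" using F.D.homs_iff[of "R X" K f] X(1,2) K by (simp add: heart_Obj)
    then have "is_iso (heart C \<chi>) f" using heart_is_iso X R_heart K by metis
    then have "isomorphic (heart C \<chi>) (R X) K" using X(1,2) R_heart K unfolding isomorphic_def heart_simps by blast
    then show "\<exists>X \<in> Obj C. isomorphic (heart C \<chi>) (FObj (R_functor C \<chi>) X) K" using X(1) by auto
  next
    \<comment> \<open>The equations and typings of the monoidal structure are literally those in
      \<open>Db C\<close>; only the invertibility conditions refer to the smaller class of
      objects.\<close>
    have "is_iso (heart C \<chi>) (muD X Y)" if o: "X \<in> Obj C" "Y \<in> Obj C" for X Y
      using heart_is_iso[OF mu_iso[OF o]] Db_ar[OF chm_mu[OF o]] H.tensor_Obj[of "R X" "R Y"] R_heart o tensor_Obj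
      by (simp add: heart_simps)
    moreover have "is_iso (heart C \<chi>) epsD"
      using heart_is_iso[OF eps_iso(2)] Db_ar[OF eps_iso(1)] H.unit_Obj R_heart[OF unit_Obj] by (simp add: heart_simps)
    ultimately show "strong_monoidal_structure C (heart C \<chi>) (R_functor C \<chi>) muD epsD"
      using R_monoidal unfolding strong_monoidal_structure_def heart_simps by blast
  qed
qed

end

theorem theorem4p2:
  fixes k :: "'k ring" and C :: "('k, 'o, 'a) tcat" and \<chi> :: "'o character"
  assumes "algebraically_closed k"
    and "tensor_category k C"
    and "semisimple C"
    and "\<chi> \<in> hom (universal_grading_group C) integer_group"
  shows "\<exists>\<mu> \<epsilon>. exact_tensor_equivalence k C (heart C \<chi>) (R_functor C \<chi>) \<mu> \<epsilon>"
proof -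
  interpret tensor_category k C by fact
  interpret graded_tensor_category k C \<chi>
    by unfold_locales (use assms in auto)
  show ?thesis using R_exact_tensor_equivalence by blast
qed

end
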